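(* Stable intersection is associative: for any three tropical cycles $X$, $Y$ and $Z$ in $N_{\mathbb R}$, $$(X\cdot Y)\cdot Z=X\cdot(Y\cdot Z)$$ as tropical cycles (with multiplicities).
   Context: Let $N\cong\mathbb Z^n$ be a lattice and $N_{\mathbb R}=N\otimes_{\mathbb Z}\mathbb R$. Polyhedral complexes are finite and rational (each polyhedron is a finite intersection of half-spaces $\{x:\langle u,x\rangle\le c\}$ with $u\in\operatorname{Hom}(N,\mathbb Z)$, $c\in\mathbb R$). For a polyhedron $\sigma$, $N_\sigma$ is the maximal sublattice of $N$ parallel to the affine span of $\sigma$. A tropical $k$-cycle $X$ is a pure $k$-dimensional polyhedral complex in which every facet $\sigma$ carries a multiplicity $\operatorname{mult}_X(\sigma)\in\mathbb Q$ and which is balanced: for each ridge (codimension-one face) $\tau$, $\sum_{\sigma\supset\tau}\operatorname{mult}_X(\sigma)v_{\sigma/\tau}\in\operatorname{span}_{\mathbb Q}(N_\tau)$, the sum being over facets $\sigma\supset\tau$, where $v_{\sigma/\tau}\in N$ points from $\tau$ into $\sigma$ and generates $N_\sigma$ together with $N_\tau$. Facets of multiplicity $0$ are ignored (if none remain, the cycle is the zero cycle), and cycles with a common refinement carrying equal multiplicities are identified. $\operatorname{supp}(X)$ is the union of the closed facets of nonzero multiplicity. "Positive multiplicities" means all facet multiplicities are $>0$. The cycle sum $X\oplus Y$ of cycles of equal dimension is the union with multiplicities added on overlaps. Links: for a polyhedron $\sigma\ni\omega$, $\operatorname{link}_\omega(\sigma)=\{u:\omega+\varepsilon u\in\sigma\text{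 for all sufficiently small }\varepsilon>0\}$; $\operatorname{link}_\omega(X)=\{\operatorname{link}_\omega(\sigma):\omega\in\sigma\in X\}$ with inherited multiplicities; $\operatorname{link}_\gamma$ for a polyhedron $\gamma$ means the link at a relative interior point of $\gamma$. Stable intersection: for tropical cycles $X,Y$ with positive multiplicities, $\operatorname{supp}(X\cdot Y)=\{\omega\in N_{\mathbb R}:\operatorname{supp}(\operatorname{link}_\omega X)-\operatorname{supp}(\operatorname{link}_\omega Y)=N_{\mathbb R}\}$, where $S-T=\{s-t\}$; it is a subcomplex of the common refinement $\{\sigma_1\cap\sigma_2:\sigma_1\in X,\sigma_2\in Y\}$. A cell $\gamma$ of it with $\operatorname{codim}(\gamma)=\operatorname{codim}(X)+\operatorname{codim}(Y)$ has multiplicity $\operatorname{mult}_{X\cdot Y}(\gamma)=\sum_{\sigma,\tau}\operatorname{mult}_X(\sigma)\operatorname{mult}_Y(\tau)[N:N_\sigma+N_\tau]$, the sum being over pairs of facets $\sigma\in\operatorname{link}_\gamma(X)$, $\tau\in\operatorname{link}_\gamma(Y)$ with $v\in\sigma-\tau$, for a fixed generic $v\in N_{\mathbb R}$ (the value is independent of generic $v$). Every tropical cycle is a $\mathbb Q$-linear combination (with respect to $\oplus$) of cycles with positive multiplicities, and the product is extended to arbitrary cycles by bilinearity. The product of two tropical cycles is again a tropical cycle (possibly zero) of codimension equal to the sum of the codimensions. *)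

theory Defs
  imports "HOL-Analysis.Analysis"
begin

text \<open>
  The lattice is \<open>N = \<int>\<^sup>n\<close> inside \<open>real ^ 'n\<close>. The dual lattice \<open>Hom(N, \<int>)\<close> is identified with
  \<open>N\<close> via the standard inner product.
\<close>

definition int_lattice :: "(real ^ 'n) set"
  where "int_lattice = {x. \<forall>i. x $ i \<in> \<int>}"

definition int_span :: "'a::real_vector set \<Rightarrow> 'a set"
  where "int_span = module.span (\<lambda>(k::int) x. of_int k *\<^sub>R x)"

definition rat_span :: "'a::real_vector set \<Rightarrow> 'a set"
  where "rat_span = module.span (\<lambda>(q::rat) x. of_rat q *\<^sub>R x)"

definition rational_polyhedron :: "(real ^ 'n) set \<Rightarrow> bool"
  where "rational_polyhedron \<sigma> \<longleftrightarrow>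
    (\<exists>F. finite F \<and> F \<subseteq> int_lattice \<times> UNIV \<and> \<sigma> = {x. \<forall>(u, c)\<in>F. u \<bullet> x \<le> c})"

definition polyhedron_lattice :: "(real ^ 'n) set \<Rightarrow> (real ^ 'n) set"
  where "polyhedron_lattice \<sigma> =
    {v \<in> int_lattice. \<forall>x \<in> affine hull \<sigma>. x + v \<in> affine hull \<sigma>}"

definition lattice_index :: "(real ^ 'n) set \<Rightarrow> nat"
  where "lattice_index L =
    card (int_lattice // {(x, y). x \<in> int_lattice \<and> y \<in> int_lattice \<and> x - y \<in> L})"

definition minkowski_diff :: "'a::minus set \<Rightarrow> 'a set \<Rightarrow> 'a set"
  where "minkowski_diff S T = {s - t |s t. s \<in> S \<and> t \<in> T}"

definition link :: "'a::real_vector \<Rightarrow> 'a set \<Rightarrow> 'a set"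
  where "link \<omega> \<sigma> = {u. eventually (\<lambda>\<epsilon>::real. \<omega> + \<epsilon> *\<^sub>R u \<in> \<sigma>) (at_right 0)}"

definition relint_point :: "'a::euclidean_space set \<Rightarrow> 'a"
  where "relint_point \<gamma> = (SOME \<omega>. \<omega> \<in> rel_interior \<gamma>)"

text \<open>The empty set is not a cell, although \<^const>\<open>face_of\<close> regards it as a face of every set.\<close>

definition polyhedral_complex :: "(real ^ 'n) set set \<Rightarrow> bool"
  where "polyhedral_complex C \<longleftrightarrow>
    finite C \<and>
    (\<forall>\<sigma>\<in>C. rational_polyhedron \<sigma> \<and> \<sigma> \<noteq> {}) \<and>
    (\<forall>\<sigma>\<in>C. \<forall>F. F face_of \<sigma> \<and> F \<noteq> {} \<longrightarrow> F \<in> C) \<and>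
    (\<forall>\<sigma>\<in>C. \<forall>\<tau>\<in>C. \<sigma> \<inter> \<tau> face_of \<sigma> \<and> \<sigma> \<inter> \<tau> face_of \<tau>)"

text \<open>
  Complexes are graded by codimension, so that a stable intersection whose expected codimension
  exceeds \<open>n\<close> is simply an empty complex. The function \<open>mult\<close> is only relevant on facets.
\<close>

record 'a weighted_complex =
  codim :: nat
  cells :: "'a set set"
  mult :: "'a set \<Rightarrow> rat"

definition facets :: "(real ^ 'n) weighted_complex \<Rightarrow> (real ^ 'n) set set"
  where "facets X = {\<sigma> \<in> cells X. aff_dim \<sigma> = int CARD('n) - int (codim X)}"

definition ridges :: "(real ^ 'n) weighted_complex \<Rightarrow> (real ^ 'n) set set"
  where "ridges X = {\<tau> \<in> cells X. aff_dim \<tau> = int CARD('n) - int (codim X) - 1}"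

definition pure_complex :: "(real ^ 'n) weighted_complex \<Rightarrow> bool"
  where "pure_complex X \<longleftrightarrow>
    polyhedral_complex (cells X) \<and> (\<forall>\<tau>\<in>cells X. \<exists>\<sigma>\<in>facets X. \<tau> \<subseteq> \<sigma>)"

text \<open>The vector \<open>v\<^bsub>\<sigma>/\<tau>\<^esub>\<close>; it is determined only up to adding elements of \<open>N\<^sub>\<tau>\<close>.\<close>

definition lattice_normal :: "(real ^ 'n) set \<Rightarrow> (real ^ 'n) set \<Rightarrow> real ^ 'n"
  where "lattice_normal \<sigma> \<tau> = (SOME v. v \<in> int_lattice \<and>
    v \<in> link (relint_point \<tau>) \<sigma> \<and>
    int_span (insert v (polyhedron_lattice \<tau>)) = polyhedron_lattice \<sigma>)"

definition balanced :: "(real ^ 'n) weighted_complex \<Rightarrow> bool"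
  where "balanced X \<longleftrightarrow> (\<forall>\<tau>\<in>ridges X.
    (\<Sum>\<sigma> | \<sigma> \<in> facets X \<and> \<tau> \<subseteq> \<sigma>. of_rat (mult X \<sigma>) *\<^sub>R lattice_normal \<sigma> \<tau>)
      \<in> rat_span (polyhedron_lattice \<tau>))"

text \<open>A representative of a tropical cycle; facets of multiplicity \<open>0\<close> are permitted here.\<close>

definition tropical_cycle :: "(real ^ 'n) weighted_complex \<Rightarrow> bool"
  where "tropical_cycle X \<longleftrightarrow> pure_complex X \<and> balanced X"

definition positive_cycle :: "(real ^ 'n) weighted_complex \<Rightarrow> bool"
  where "positive_cycle X \<longleftrightarrow> tropical_cycle X \<and> (\<forall>\<sigma>\<in>facets X. mult X \<sigma> > 0)"

definition supp :: "(real ^ 'n) weighted_complex \<Rightarrow> (real ^ 'n) set"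
  where "supp X = \<Union>{\<sigma> \<in> facets X. mult X \<sigma> \<noteq> 0}"

definition drop_zero :: "(real ^ 'n) weighted_complex \<Rightarrow> (real ^ 'n) weighted_complex"
  where "drop_zero X =
    X\<lparr>cells := {\<tau> \<in> cells X. \<exists>\<sigma>\<in>facets X. mult X \<sigma> \<noteq> 0 \<and> \<tau> \<subseteq> \<sigma>}\<rparr>"

definition refines :: "(real ^ 'n) weighted_complex \<Rightarrow> (real ^ 'n) weighted_complex \<Rightarrow> bool"
  where "refines W X \<longleftrightarrow>
    pure_complex W \<and> codim W = codim X \<and>
    \<Union>(cells W) = \<Union>(cells X) \<and>
    (\<forall>\<sigma>\<in>cells W. \<exists>\<tau>\<in>cells X. \<sigma> \<subseteq> \<tau>) \<and>
    (\<forall>\<sigma>\<in>facets W. \<forall>\<tau>\<in>facets X. \<sigma> \<subseteq> \<tau> \<longrightarrow> mult W \<sigma> = mult X \<tau>)"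

text \<open>Equality of tropical cycles; it entails that both sides are tropical cycles.\<close>

definition cycle_eq ::
    "(real ^ 'n) weighted_complex \<Rightarrow> (real ^ 'n) weighted_complex \<Rightarrow> bool"  (infix "\<approx>" 50)
  where "X \<approx> Y \<longleftrightarrow> tropical_cycle X \<and> tropical_cycle Y \<and>
    (\<exists>W. refines W (drop_zero X) \<and> refines W (drop_zero Y))"

text \<open>
  \<open>W = \<Oplus>\<^sub>i a\<^sub>i X\<^sub>i\<close>: all the cycles are represented on one complex \<open>C\<close>, with multiplicity \<open>0\<close>
  on the facets outside the respective support, and the multiplicities are combined facet by facet.
\<close>

definition lin_comb :: "'i set \<Rightarrow> ('i \<Rightarrow> rat) \<Rightarrow> ('i \<Rightarrow> (real ^ 'n) weighted_complex) \<Rightarrow>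
    (real ^ 'n) weighted_complex \<Rightarrow> bool"
  where "lin_comb I a Xs W \<longleftrightarrow> (\<exists>C m.
    (\<forall>i\<in>I. Xs i \<approx> \<lparr>codim = codim W, cells = C, mult = m i\<rparr>) \<and>
    W \<approx> \<lparr>codim = codim W, cells = C, mult = (\<lambda>\<sigma>. \<Sum>i\<in>I. a i * m i \<sigma>)\<rparr>)"

text \<open>The inherited multiplicities make sense since \<open>link \<omega>\<close> is injective on the cells at \<open>\<omega>\<close>.\<close>

definition link_complex ::
    "real ^ 'n \<Rightarrow> (real ^ 'n) weighted_complex \<Rightarrow> (real ^ 'n) weighted_complex"
  where "link_complex \<omega> X =
    \<lparr>codim = codim X,
     cells = link \<omega> ` {\<sigma> \<in> cells X. \<omega> \<in> \<sigma>},
     mult = (\<lambda>\<rho>. mult X (the_inv_into {\<sigma> \<in> cells X. \<omega> \<in> \<sigma>} (link \<omega>) \<rho>))\<rparr>"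

definition common_refinement :: "(real ^ 'n) weighted_complex \<Rightarrow>
    (real ^ 'n) weighted_complex \<Rightarrow> (real ^ 'n) set set"
  where "common_refinement X Y = {\<sigma> \<inter> \<tau> |\<sigma> \<tau>. \<sigma> \<in> cells X \<and> \<tau> \<in> cells Y \<and> \<sigma> \<inter> \<tau> \<noteq> {}}"

definition stable_supp :: "(real ^ 'n) weighted_complex \<Rightarrow>
    (real ^ 'n) weighted_complex \<Rightarrow> (real ^ 'n) set"
  where "stable_supp X Y =
    {\<omega>. minkowski_diff (supp (link_complex \<omega> X)) (supp (link_complex \<omega> Y)) = UNIV}"

definition displaced_mult :: "(real ^ 'n) weighted_complex \<Rightarrow> (real ^ 'n) weighted_complex \<Rightarrow>
    (real ^ 'n) set \<Rightarrow> real ^ 'n \<Rightarrow> rat"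
  where "displaced_mult X Y \<gamma> v =
    (let LX = link_complex (relint_point \<gamma>) X; LY = link_complex (relint_point \<gamma>) Y in
      \<Sum>(\<sigma>, \<tau>) | \<sigma> \<in> facets LX \<and> \<tau> \<in> facets LY \<and> v \<in> minkowski_diff \<sigma> \<tau>.
        mult LX \<sigma> * mult LY \<tau> *
        of_nat (lattice_index
          {a + b |a b. a \<in> polyhedron_lattice \<sigma> \<and> b \<in> polyhedron_lattice \<tau>}))"

text \<open>``Generic \<open>v\<close>'' means \<open>v\<close> outside some finite union of proper linear subspaces.\<close>

definition stable_mult :: "(real ^ 'n) weighted_complex \<Rightarrow> (real ^ 'n) weighted_complex \<Rightarrow>
    (real ^ 'n) set \<Rightarrow> rat"
  where "stable_mult X Y \<gamma> = (THE m. \<exists>H. finite H \<and> (\<forall>V\<in>H. subspace V \<and> V \<noteq> UNIV) \<and>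
    (\<forall>v. v \<notin> \<Union>H \<longrightarrow> displaced_mult X Y \<gamma> v = m))"

definition stable_prod_pos :: "(real ^ 'n) weighted_complex \<Rightarrow> (real ^ 'n) weighted_complex \<Rightarrow>
    (real ^ 'n) weighted_complex"
  where "stable_prod_pos X Y =
    \<lparr>codim = codim X + codim Y,
     cells = {\<gamma> \<in> common_refinement X Y. \<gamma> \<subseteq> stable_supp X Y},
     mult = stable_mult X Y\<rparr>"

text \<open>Bilinear extension of \<^const>\<open>stable_prod_pos\<close> to arbitrary tropical cycles.\<close>

definition is_stable_prod :: "(real ^ 'n) weighted_complex \<Rightarrow> (real ^ 'n) weighted_complex \<Rightarrow>
    (real ^ 'n) weighted_complex \<Rightarrow> bool"
  where "is_stable_prod X Y W \<longleftrightarrow>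
    codim W = codim X + codim Y \<and>
    (\<exists>(p::nat) (q::nat) a b Xs Ys.
      (\<forall>i<p. positive_cycle (Xs i)) \<and> lin_comb {..<p} a Xs X \<and>
      (\<forall>j<q. positive_cycle (Ys j)) \<and> lin_comb {..<q} b Ys Y \<and>
      lin_comb ({..<p} \<times> {..<q}) (\<lambda>(i, j). a i * b j)
        (\<lambda>(i, j). stable_prod_pos (Xs i) (Ys j)) W)"

text \<open>A representative of \<open>X \<cdot> Y\<close>, which is unique only up to \<open>\<approx>\<close>.\<close>

definition stable_prod :: "(real ^ 'n) weighted_complex \<Rightarrow> (real ^ 'n) weighted_complex \<Rightarrow>
    (real ^ 'n) weighted_complex"  (infixl "\<odot>" 70)
  where "X \<odot> Y = (SOME W. is_stable_prod X Y W)"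

end

theory Submission
 imports Defs
begin

text \<open>
  A tropical cycle is encoded by its weight function on a rational hyperplane arrangement that cuts out its cells.
  Two cycles are equal iff their weights on a common arrangement are equal, and a complex is balanced iff its
  weight is. The weight of a stable product at a point is a degree: the number of preimages, counted with lattice
  indices, of a generic vector under \<open>(x, y) \<mapsto> x - y\<close> on the product of the two local fans. Crossing a wall changes
  such a degree of a linear projection by an instance of the balancing condition, so that it is constant.
  For three local fans the degree of \<open>(x, y, z) \<mapsto> (x - y, x - z)\<close> at \<open>(u, w)\<close> is constant as well. For \<open>u\<close> small compared with
  \<open>w\<close> it counts \<open>(X \<cdot> Y) \<cdot> Z\<close>, and permuting the factors it also counts \<open>X \<cdot> (Y \<cdot> Z)\<close>.
\<close>

text \<open>Two features of the definitions shape the argument. \<open>stable_prod_pos\<close> is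
  described through supports, which is adequate for positive multiplicities, and
  \<open>\<odot>\<close> is picked by \<open>SOME\<close> after an existential choice of
  decompositions. Both are absorbed by a pointwise product \<open>prod_weight\<close>, which is
  available for all balanced weights and is bilinear: every admissible choice has this weight on
  fine enough arrangements. The degree argument must allow fans with a lineality space, since the
  local fan at a point of a positive-dimensional cell is invariant under the directions of that
  cell; dimensions are therefore counted modulo a space of common directions. The three-factor
  degree serves more than once: with a hyperplane as third factor it gives balancing of the product,
  and with a complementary linear space it shows that a product of nonnegative fans with transversal
  cells does not vanish, on which purity of the stable intersection rests. Lattice indices match
  because the index of a triple of lattices factors into two indices of pairs.\<close>

notation scaleR (infixr "*R" 75)

type_synonym 'n wcomplex = "(real ^ 'n) weighted_complex"

abbreviation near0 :: "(real => bool) => bool"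
 where "near0 P \<equiv> eventually P (at_right 0)"

abbreviation msum :: "'a::plus set => 'a set => 'a set"
 where "msum D E \<equiv> {a + b |a b. a \<in> D \<and> b \<in> E}"

abbreviation "mdiff \<equiv> minkowski_diff"

subsection \<open>Indices of subgroups\<close>

definition subgrp :: "'a::ab_group_add set => bool"
 where "subgrp A \<longleftrightarrow> 0 \<in> A \<and> (\<forall>a\<in>A. \<forall>b\<in>A. a - b \<in> A)"

text \<open>The ambient group is a set \<open>A\<close>, since images and kernels of lattices take
  its place in \<open>grp_ix_exact\<close>. An infinite index is 0, the value of
  \<open>card\<close>.\<close>

definition grp_ix :: "'a::ab_group_add set => 'a set => nat"
 where "grp_ix A G = card (A // {(x, y). x \<in> A \<and> y \<in> A \<and> x - y \<in> G})"

definition coset_in :: "'a::ab_group_add set => 'a set => 'a => 'a set"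
 where "coset_in A G a = {y \<in> A. a - y \<in> G}"

lemma grp_ix_coset: "grp_ix A G = card (coset_in A G ` A)"
proof -
 have "A // {(x, y). x \<in> A \<and> y \<in> A \<and> x - y \<in> G} = coset_in A G ` A"
  unfolding quotient_def coset_in_def by auto
 then show ?thesis by (simp add: grp_ix_def)
qed

lemma subgrp_0: "subgrp A ==> 0 \<in> A"
 and subgrp_diff: "subgrp A ==> a \<in> A ==> b \<in> A ==> a - b \<in> A"
 by (auto simp: subgrp_def)

lemma subgrp_uminus: "subgrp A ==> a \<in> A ==> - a \<in> A"
 by (metis subgrp_def diff_0)

lemma subgrp_add: "subgrp A ==> a \<in> A ==> b \<in> A ==> a + b \<in> A"
 by (metis subgrp_diff subgrp_uminus diff_minus_eq_add)

lemma subgrp_of_int: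
 fixes A :: "'a::real_vector set"
 assumes "subgrp A" "a \<in> A"
 shows "of_int k *R a \<in> A"
proof -
 have nat: "of_nat n *R a \<in> A" for n
  by (induction n) (auto simp: subgrp_0 assms scaleR_left_distrib subgrp_add)
 show ?thesis
 proof (cases "k \<ge> 0")
  case True
  then show ?thesis using nat[of "nat k"] by simp
 next
  case False
  then have "of_int k *R a = - (of_nat (nat (-k)) *R a)" by simp
  then show ?thesis using nat subgrp_uminus assms(1) by metis
 qed
qed

lemma subgrp_Int: "subgrp A ==> subgrp B ==> subgrp (A \<inter> B)"
 by (auto simp: subgrp_def)

lemma subgrp_subspace: "subspace A ==> subgrp A"
 by (auto simp: subgrp_def subspace_0 subspace_diff)

lemma coset_in_eq_iff:
 assumes "subgrp A" "subgrp G" "a \<in> A" "b \<in> A"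
 shows "coset_in A G a = coset_in A G b \<longleftrightarrow> a - b \<in> G"
proof
 assume "coset_in A G a = coset_in A G b"
 moreover have "b \<in> coset_in A G b"
  using assms by (simp add: coset_in_def subgrp_0)
 ultimately have "b \<in> coset_in A G a" by simp
 then show "a - b \<in> G" by (simp add: coset_in_def)
next
 assume ab: "a - b \<in> G"
 have "a - y \<in> G \<longleftrightarrow> b - y \<in> G" for y
 proof
  assume "a - y \<in> G"
  then have "(a - y) - (a - b) \<in> G" by (rule subgrp_diff[OF assms(2) _ ab])
  then show "b - y \<in> G" by simp
 next
  assume "b - y \<in> G"
  then have "(a - b) + (b - y) \<in> G" by (rule subgrp_add[OF assms(2) ab])
  then show "a - y \<in> G" by simp
 qed
 then show "coset_in A G a = coset_in A G b" unfolding coset_in_def by (simp only:)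
qed

text \<open>Infinite indices are \<open>0\<close>, and the formula remains correct for them because \<open>card\<close> of a
  product is always the product of the cards.\<close>

lemma grp_ix_exact:
 fixes f :: "'a::ab_group_add => 'b::ab_group_add"
 assumes A: "subgrp A" and G: "subgrp G" and GA: "G \<subseteq> A"
  and f: "\<And>a b. a \<in> A ==> b \<in> A ==> f (a - b) = f a - f b"
 shows "grp_ix A G =
  grp_ix (f ` A) (f ` G) * grp_ix {a \<in> A. f a = 0} {a \<in> G. f a = 0}"
proof -
 define K where "K = {a \<in> A. f a = 0}"
 define L where "L = {a \<in> G. f a = 0}"
 have f0: "f 0 = 0" using f[of 0 0] A by (simp add: subgrp_0)
 have K: "subgrp K" using A f f0 by (auto simp: subgrp_def K_def)
 have L: "subgrp L" using G GA f f0 by (auto simp: subgrp_def L_def subset_iff)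
 have im: "subgrp (f ` S)" if S: "subgrp S" "S \<subseteq> A" for S
  unfolding subgrp_def
 proof (intro conjI ballI)
  show "0 \<in> f ` S" using S f0 by (metis subgrp_0 image_eqI)
  fix a b assume "a \<in> f ` S" "b \<in> f ` S"
  then obtain x y where "x \<in> S" "y \<in> S" "a = f x" "b = f y" by auto
  then have "a - b = f (x - y)" "x - y \<in> S" using S f by (auto simp: subgrp_def subset_iff)
  then show "a - b \<in> f ` S" by auto
 qed
 note imA = im[OF A order_refl] and imG = im[OF G GA]
 define QB where "QB = coset_in (f ` A) (f ` G) ` f ` A"
 define QK where "QK = coset_in K L ` K"
 \<comment> \<open>Representatives are chosen for the cosets in the image and in the kernel. A coset
   of \<open>G\<close> in \<open>A\<close> then corresponds to its image coset together with the
   kernel coset of a correction term.\<close>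
 define lift where "lift Q = (SOME a. a \<in> A \<and> coset_in (f ` A) (f ` G) (f a) = Q)" for Q
 define sr where "sr R = (SOME k. k \<in> K \<and> coset_in K L k = R)" for R
 have lift: "lift Q \<in> A \<and> coset_in (f ` A) (f ` G) (f (lift Q)) = Q" if "Q \<in> QB" for Q
  unfolding lift_def by (rule someI_ex) (use that in \<open>auto simp: QB_def\<close>)
 have sr: "sr R \<in> K \<and> coset_in K L (sr R) = R" if "R \<in> QK" for R
  unfolding sr_def by (rule someI_ex) (use that in \<open>auto simp: QK_def\<close>)
 define h where "h = (\<lambda>(Q, R). coset_in A G (lift Q + sr R))"
 have KA: "K \<subseteq> A" by (auto simp: K_def)
 have "bij_betw h (QB \<times> QK) (coset_in A G ` A)"
  unfolding bij_betw_def
 proof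
  show "inj_on h (QB \<times> QK)"
  proof (rule inj_onI, clarify)
   fix Q R Q' R'
   assume Q: "Q \<in> QB" and R: "R \<in> QK" and Q': "Q' \<in> QB" and R': "R' \<in> QK"
    and h: "h (Q, R) = h (Q', R')"
   have lA: "lift Q \<in> A" "lift Q' \<in> A" and srK: "sr R \<in> K" "sr R' \<in> K"
    using lift sr Q Q' R R' by auto
   have srA: "sr R \<in> A" "sr R' \<in> A" using srK KA by auto
   have sA: "lift Q + sr R \<in> A" "lift Q' + sr R' \<in> A"
    using lA srA A subgrp_add by blast+
   have d: "(lift Q + sr R) - (lift Q' + sr R') \<in> G"
    using h coset_in_eq_iff[OF A G sA] by (simp add: h_def)
   have add: "f (a + k) = f a" if "a \<in> A" "k \<in> K" for a k
   proof -
    have "f (a + k - k) = f (a + k) - f k"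
     using that KA A subgrp_add by (intro f) auto
    then show ?thesis using that by (simp add: K_def)
   qed
   have "f ((lift Q + sr R) - (lift Q' + sr R')) = f (lift Q) - f (lift Q')"
    using f[OF sA] add lA srK by simp
   then have "f (lift Q) - f (lift Q') \<in> f ` G" using d by (metis image_eqI)
   then have QQ: "Q = Q'"
    using coset_in_eq_iff[OF imA imG, of "f (lift Q)" "f (lift Q')"] lift Q Q' lA by auto
   have "sr R - sr R' \<in> G" using d QQ by simp
   moreover have "sr R - sr R' \<in> K" using K srK by (simp add: subgrp_diff)
   ultimately have "sr R - sr R' \<in> L" by (auto simp: K_def L_def)
   then have "R = R'" using coset_in_eq_iff[OF K L srK] sr R R' by auto
   then show "Q = Q' \<and> R = R'" using QQ by simp
  qed
  show "h ` (QB \<times> QK) = coset_in A G ` A"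
  proof
   show "h ` (QB \<times> QK) \<subseteq> coset_in A G ` A"
    using lift sr A KA subgrp_add by (force simp: h_def)
   show "coset_in A G ` A \<subseteq> h ` (QB \<times> QK)"
   proof
    fix W assume "W \<in> coset_in A G ` A"
    then obtain b where b: "b \<in> A" "W = coset_in A G b" by auto
    define Q where "Q = coset_in (f ` A) (f ` G) (f b)"
    have Q: "Q \<in> QB" using b by (auto simp: QB_def Q_def)
    have aA: "lift Q \<in> A" using lift Q by auto
    have "f (lift Q) - f b \<in> f ` G"
     using coset_in_eq_iff[OF imA imG, of "f (lift Q)" "f b"] lift Q b aA Q_def by auto
    then obtain g where g: "g \<in> G" "f (lift Q) - f b = f g" by auto
    \<comment> \<open>Adding to \<open>b - lift Q\<close> an element \<open>g\<close> of
      \<open>G\<close> that compensates its image moves it into the kernel without changing its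
      coset.\<close>
    define b' where "b' = (b - lift Q) - (0 - g)"
    have gA: "g \<in> A" "0 - g \<in> A" using g GA subgrp_diff[OF A subgrp_0[OF A]] by auto
    have "f b' = (f b - f (lift Q)) - (f 0 - f g)"
     unfolding b'_def using b aA gA A f by (simp add: subgrp_0 subgrp_diff del: diff_0)
    also have "\<dots> = 0" using g f0 by (simp add: algebra_simps)
    finally have b'0: "f b' = 0" .
    have "b' \<in> A" unfolding b'_def using subgrp_diff[OF A subgrp_diff[OF A b(1) aA] gA(2)] .
    then have b'K: "b' \<in> K" using b'0 by (simp add: K_def)
    define R where "R = coset_in K L b'"
    have R: "R \<in> QK" using b'K by (auto simp: R_def QK_def)
    have "b' - sr R \<in> L" using coset_in_eq_iff[OF K L b'K] sr[OF R] R_def by auto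
    then have "b' - sr R \<in> G" by (simp add: L_def)
    then have "(b' - sr R) - g \<in> G" using G g subgrp_diff by blast
    moreover have "(b' - sr R) - g = b - (lift Q + sr R)" by (simp add: b'_def)
    ultimately have "b - (lift Q + sr R) \<in> G" by simp
    moreover have "lift Q + sr R \<in> A" using aA sr[OF R] KA A subgrp_add by blast
    ultimately have "W = h (Q, R)" using coset_in_eq_iff[OF A G b(1)] b by (auto simp: h_def)
    then show "W \<in> h ` (QB \<times> QK)" using Q R by auto
   qed
  qed
 qed
 then have "card (coset_in A G ` A) = card QB * card QK"
  using bij_betw_same_card card_cartesian_product by metis
 then show ?thesis by (simp add: grp_ix_coset QB_def QK_def K_def L_def)
qed

lemma grp_ix_self:
 assumes "subgrp A"
 shows "grp_ix A A = 1"
proof -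
 have "coset_in A A a = A" if "a \<in> A" for a
  using that subgrp_diff[OF assms] by (auto simp: coset_in_def)
 then have "coset_in A A ` A = {A}" using subgrp_0[OF assms] by auto
 then show ?thesis by (simp add: grp_ix_coset)
qed

lemma grp_ix_inj_image:
 assumes A: "subgrp A" and G: "subgrp G" and GA: "G \<subseteq> A"
  and f: "\<And>a b. a \<in> A ==> b \<in> A ==> f (a - b) = f a - f b"
  and inj: "\<And>a. a \<in> A ==> f a = 0 ==> a = 0"
 shows "grp_ix (f ` A) (f ` G) = grp_ix A G"
proof -
 have "f 0 = 0" using f[of 0 0] A by (simp add: subgrp_0)
 then have "{a \<in> A. f a = 0} = {0}" "{a \<in> G. f a = 0} = {0}"
  using inj GA A G by (auto simp: subgrp_0)
 then show ?thesis
  using grp_ix_exact[OF A G GA f] grp_ix_self[of "{0::'a}"]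
  by (simp add: subgrp_def)
qed

text \<open>Division with remainder by the least positive element. The integers appear as reals
  because the subgroup will be the set of values of a lattice functional.\<close>

lemma int_subgroup_principal:
 fixes A :: "real set"
 assumes A: "subgrp A" and AZ: "A \<subseteq> \<int>" and A0: "A \<noteq> {0}"
 obtains d where "d > 0" "A = range (\<lambda>k::int. d * of_int k)"
proof -
 have "\<exists>n::nat. n > 0 \<and> of_nat n \<in> A"
 proof -
  obtain a where a: "a \<in> A" "a \<noteq> 0" using A0 A subgrp_0 by blast
  then obtain k where k: "a = of_int k" using AZ by (auto elim: Ints_cases)
  have "\<bar>a\<bar> \<in> A" using a A subgrp_uminus by (auto simp: abs_if)
  then show ?thesis using a k by (intro exI[of _ "nat \<bar>k\<bar>"]) auto
 qed
 define n where "n = (LEAST n::nat. n > 0 \<and> of_nat n \<in> A)"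
 have n: "n > 0" "of_nat n \<in> A"
  using LeastI_ex[OF \<open>\<exists>n::nat. n > 0 \<and> of_nat n \<in> A\<close>] by (auto simp: n_def)
 have least: "n \<le> m" if "m > 0" "of_nat m \<in> A" for m :: nat
  unfolding n_def using that by (intro Least_le) auto
 have "A = range (\<lambda>k::int. real n * of_int k)"
 proof
  show "range (\<lambda>k::int. real n * of_int k) \<subseteq> A"
   using subgrp_of_int[OF A n(2)] by (auto simp: mult.commute)
  show "A \<subseteq> range (\<lambda>k::int. real n * of_int k)"
  proof
   fix a assume a: "a \<in> A"
   then obtain k where k: "a = of_int k" using AZ by (auto elim: Ints_cases)
   define r where "r = k mod int n"
   have kr: "k = int n * (k div int n) + r" by (simp add: r_def)
   have "of_int k - of_int (k div int n) *R real n \<in> A"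
    using a k subgrp_of_int[OF A n(2)] A subgrp_diff by blast
   moreover have "of_int k - of_int (k div int n) *R real n = of_int r"
    by (subst kr) simp
   ultimately have rA: "of_int r \<in> A" by simp
   have r: "0 \<le> r" "r < int n" using n by (auto simp: r_def)
   have "r = 0"
   proof (rule ccontr)
    assume "r \<noteq> 0"
    then have "nat r > 0" "of_nat (nat r) \<in> A" using r rA by auto
    then show False using least[of "nat r"] r by linarith
   qed
   then show "a \<in> range (\<lambda>k::int. real n * of_int k)"
    using k kr by (intro range_eqI[of _ _ "k div int n"]) (metis add.right_neutral of_int_mult of_int_of_nat_eq)
  qed
 qed
 then show thesis using that[of "real n"] n by simp
qed

text \<open>The formula has no exception: for \<open>m = 0\<close> there are infinitely many cosets,
  which \<open>card\<close> counts as 0.\<close>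

lemma grp_ix_cyclic:
 fixes d :: real
 assumes d: "d > 0"
 shows "grp_ix (range (\<lambda>k::int. d * of_int k)) (range (\<lambda>k::int. d * of_int m * of_int k)) = nat \<bar>m\<bar>"
proof -
 let ?A = "range (\<lambda>k::int. d * of_int k)" and ?G = "range (\<lambda>k::int. d * of_int m * of_int k)"
 have A: "subgrp (range (\<lambda>k::int. e * of_int k))" for e :: real
  unfolding subgrp_def
  by (auto simp: image_iff intro: exI[of _ "0::int"]) (metis of_int_diff right_diff_distrib)
 define c where "c j = coset_in ?A ?G (d * of_int j)" for j :: int
 have eq: "c i = c j \<longleftrightarrow> m dvd i - j" for i j
 proof -
  have "c i = c j \<longleftrightarrow> d * of_int i - d * of_int j \<in> ?G"
   unfolding c_def by (rule coset_in_eq_iff[OF A]) (use A[of "d * of_int m"] in auto)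
  also have "\<dots> \<longleftrightarrow> (\<exists>k::int. d * of_int (i - j) = d * of_int (m * k))"
   by (auto simp: image_iff algebra_simps)
  also have "\<dots> \<longleftrightarrow> (\<exists>k. i - j = m * k)" using d by (metis less_irrefl mult_cancel_left of_int_eq_iff)
  finally show ?thesis by (simp add: dvd_def)
 qed
 have im: "coset_in ?A ?G ` ?A = range c" by (auto simp: c_def image_iff)
 show ?thesis
 proof (cases "m = 0")
  case True
  then have "inj c" by (auto simp: inj_def eq)
  then have "infinite (range c)" using finite_imageD infinite_UNIV_int by blast
  then show ?thesis using True im by (simp add: grp_ix_coset)
 next
  case False
  have "range c = c ` {0..<\<bar>m\<bar>}"
  proof -
   have "c j = c (j mod \<bar>m\<bar>)" for j by (simp add: eq minus_mod_eq_mult_div)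
   then show ?thesis using False by (auto simp: image_iff) (metis abs_of_nonneg abs_mod_less abs_ge_zero pos_mod_sign pos_mod_bound atLeastLessThan_iff zero_less_abs_iff)
  qed
  moreover have "inj_on c {0..<\<bar>m\<bar>}"
  proof (rule inj_onI)
   fix i j assume ij: "i \<in> {0..<\<bar>m\<bar>}" "j \<in> {0..<\<bar>m\<bar>}" "c i = c j"
   then have "m dvd i - j" by (simp add: eq)
   moreover have "\<bar>i - j\<bar> < \<bar>m\<bar>" using ij by auto
   ultimately show "i = j" using zdvd_not_zless by (metis abs_dvd_iff dvd_abs_iff eq_iff_diff_eq_0 zdvd_imp_le zero_less_abs_iff not_le)
  qed
  ultimately have "card (range c) = nat \<bar>m\<bar>" by (simp add: card_image)
  then show ?thesis using im by (simp add: grp_ix_coset)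
 qed
qed

subsection \<open>Finite unions of affine sets\<close>

lemma affine_contains_line:
 assumes "affine B" "p + t1 *R d \<in> B" "p + t2 *R d \<in> B" "t1 \<noteq> t2"
 shows "p + s *R d \<in> B"
proof -
 define l where "l = (s - t2) / (t1 - t2)"
 have "l *R (p + t1 *R d) + (1 - l) *R (p + t2 *R d) \<in> B"
  using assms by (intro mem_affine) auto
 moreover have "l * (t1 - t2) = s - t2" using assms by (simp add: l_def)
 then have "l * t1 + (1 - l) * t2 = s" by (simp add: algebra_simps)
 then have "l *R (p + t1 *R d) + (1 - l) *R (p + t2 *R d) = p + s *R d"
 proof -
  have "l *R (p + t1 *R d) + (1 - l) *R (p + t2 *R d) = p + (l * t1 + (1 - l) * t2) *R d"
   by (simp add: algebra_simps)
  then show ?thesis using \<open>l * t1 + (1 - l) * t2 = s\<close> by simp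
 qed
 ultimately show ?thesis by simp
qed

text \<open>A line not contained in an affine set meets it at most once. Joining a point outside
  \<open>\<Union>F\<close> to a point outside \<open>A\<close> gives a segment of which only
  finitely many points lie in the finitely many sets.\<close>

lemma convex_subset_Union_affine:
 fixes C :: "'a::real_vector set"
 assumes "finite F" "convex C" "C \<noteq> {}" "\<And>A. A \<in> F ==> affine A" "C \<subseteq> \<Union>F"
 shows "\<exists>A\<in>F. C \<subseteq> A"
proof -
 have "finite F ==> (\<forall>A\<in>F. affine A \<and> \<not> C \<subseteq> A) ==> \<exists>z\<in>C. z \<notin> \<Union>F"
 proof (induction F rule: finite_induct)
  case empty
  then show ?case using assms by auto
 next
  case (insert A F)
  obtain z where z: "z \<in> C" "z \<notin> \<Union>F" using insert by auto
  obtain y where y: "y \<in> C" "y \<notin> A" using insert by auto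
  define d where "d = y - z"
  have fin: "finite {t. z + t *R d \<in> B}" if B: "B \<in> insert A F" for B
  proof (rule ccontr)
   assume inf: "infinite {t. z + t *R d \<in> B}"
   then obtain t1 where t1: "z + t1 *R d \<in> B" using not_finite_existsD by auto
   from inf have "infinite ({t. z + t *R d \<in> B} - {t1})" by simp
   then obtain t2 where t2: "z + t2 *R d \<in> B" "t2 \<noteq> t1"
    by (metis (no_types, lifting) Diff_iff ex_in_conv finite.emptyI insertI1 mem_Collect_eq)
   have "affine B" using insert B by auto
   then have line: "z + s *R d \<in> B" for s using affine_contains_line t1 t2 by metis
   show False using line[of 0] line[of 1] z y B by (auto simp: d_def)
  qed
  have "finite (\<Union>B\<in>insert A F. {t. z + t *R d \<in> B})" using fin insert by auto
  moreover have "infinite {0..(1::real)}" by simp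
  ultimately have "\<not> {0..1} \<subseteq> (\<Union>B\<in>insert A F. {t. z + t *R d \<in> B})"
   using finite_subset by blast
  then obtain t where t: "t \<in> {0..1}" "\<forall>B\<in>insert A F. z + t *R d \<notin> B" by blast
  have "z + t *R d = (1 - t) *R z + t *R y" by (simp add: d_def algebra_simps)
  also have "\<dots> \<in> C" using assms z y t by (auto simp: convex_alt)
  finally show ?case using t by auto
 qed
 then show ?thesis using assms by blast
qed

text \<open>Exceptional sets are finite unions of linear subspaces, exactly as in
  \<open>stable_mult\<close>, which thereby becomes a \<open>generic_value\<close>.\<close>

definition generic :: "('a::real_vector => bool) => bool"
 where "generic P \<longleftrightarrow> (\<exists>H. finite H \<and> (\<forall>V\<in>H. subspace V \<and> V \<noteq> UNIV) \<and> (\<forall>v. v \<notin> \<Union>H --> P v))"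

lemma genericI:
 "finite H ==> (\<And>V. V \<in> H ==> subspace V \<and> V \<noteq> UNIV) ==> (\<And>v. v \<notin> \<Union>H ==> P v) ==> generic P"
 unfolding generic_def by blast

lemma generic_mono: "generic P ==> (\<And>v. P v ==> Q v) ==> generic Q"
 unfolding generic_def by metis

lemma generic_conj:
 assumes "generic P" "generic Q"
 shows "generic (\<lambda>v. P v \<and> Q v)"
proof -
 obtain H where "finite H" "\<And>V. V \<in> H ==> subspace V \<and> V \<noteq> UNIV" "\<And>v. v \<notin> \<Union>H ==> P v"
  using assms(1) by (auto simp: generic_def)
 moreover obtain H' where "finite H'" "\<And>V. V \<in> H' ==> subspace V \<and> V \<noteq> UNIV" "\<And>v. v \<notin> \<Union>H' ==> Q v"
  using assms(2) by (auto simp: generic_def)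
 ultimately show ?thesis by (intro genericI[of "H \<union> H'"]) auto
qed

lemma generic_True: "(\<And>v. P v) ==> generic P"
 by (rule genericI[of "{}"]) auto

lemma generic_ball:
 assumes "finite I" "\<And>i. i \<in> I ==> generic (P i)"
 shows "generic (\<lambda>v. \<forall>i\<in>I. P i v)"
 using assms
proof (induction I rule: finite_induct)
 case empty
 then show ?case by (auto intro: generic_True)
next
 case (insert i I)
 then show ?case using generic_conj[of "P i" "\<lambda>v. \<forall>i\<in>I. P i v"] by simp
qed

lemma generic_not_mem:
 assumes "subspace V" "V \<noteq> UNIV"
 shows "generic (\<lambda>v. v \<notin> V)"
 by (rule genericI[of "{V}"]) (use assms in auto)

text \<open>A convex set covered by finitely many proper subspaces would lie in one of them. This
  provides generic points inside prescribed cones.\<close>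

lemma generic_convex:
 assumes P: "generic P" and C: "convex C" "C \<noteq> {}" "span C = UNIV"
 shows "\<exists>v\<in>C. P v"
proof -
 obtain H where H: "finite H" "\<And>V. V \<in> H ==> subspace V \<and> V \<noteq> UNIV" "\<And>v. v \<notin> \<Union>H ==> P v"
  using P by (auto simp: generic_def)
 have "\<not> C \<subseteq> \<Union>H"
 proof
  assume "C \<subseteq> \<Union>H"
  then obtain V where "V \<in> H" "C \<subseteq> V"
   using convex_subset_Union_affine[of H C] H C subspace_imp_affine by blast
  then show False using H(2) C(3) by (metis span_minimal top.extremum_uniqueI)
 qed
 then show ?thesis using H by blast
qed

lemma generic_ex: "generic P ==> \<exists>v. P v"
 using generic_convex[of P UNIV] by auto

text \<open>A ball spans the whole space, so a nonempty open complement of \<open>S\<close> would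
  contain generic points.\<close>

lemma generic_dense:
 fixes S :: "'a::real_normed_vector set"
 assumes P: "generic (\<lambda>v. v \<in> S)" and S: "closed S"
 shows "S = UNIV"
proof (rule ccontr)
 assume "S \<noteq> UNIV"
 then obtain x where "x \<in> - S" by auto
 then obtain e where e: "e > 0" "ball x e \<subseteq> - S" using S open_contains_ball open_Compl by blast
 have "span (ball x e) = UNIV"
 proof -
  have "y \<in> span (ball x e)" for y :: 'a
  proof (cases "y = 0")
   case False
   define z where "z = x + (e / (2 * norm y)) *R y"
   have xz: "x \<in> ball x e" "z \<in> ball x e" using e False by (auto simp: z_def dist_norm)
   then have "((2 * norm y) / e) *R (z - x) \<in> span (ball x e)"
    by (intro span_mul span_diff span_base)
   then show ?thesis using e False by (simp add: z_def)
  qed (simp add: span_zero)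
  then show ?thesis by auto
 qed
 then obtain v where "v \<in> ball x e" "v \<in> S"
  using generic_convex[OF P, of "ball x e"] e by auto
 then show False using e by auto
qed

text \<open>Unambiguous as soon as a generic value exists, since two generic conditions hold
  together at some point.\<close>

definition generic_value :: "('a::real_vector => 'b) => 'b"
 where "generic_value F = (THE m. generic (\<lambda>v. F v = m))"

lemma generic_value_eq:
 assumes "generic (\<lambda>v. F v = m)"
 shows "generic_value F = m"
 unfolding generic_value_def
proof (rule the_equality)
 fix m' assume "generic (\<lambda>v. F v = m')"
 then obtain v where "F v = m \<and> F v = m'" using generic_conj[OF assms] generic_ex by blast
 then show "m' = m" by blast
qed (rule assms)

subsection \<open>Lattices\<close>

text \<open>The integer lattice of every Euclidean space and not just of \<open>real ^ 'n\<close>,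
  because degrees live on products such as \<open>'a \<times> 'a \<times> 'a\<close>.\<close>

definition lat :: "'a::euclidean_space set"
 where "lat = {x. \<forall>b\<in>Basis. x \<bullet> b \<in> \<int>}"

lemma lat_subgroup: "subgrp lat"
 by (auto simp: subgrp_def lat_def inner_diff_left)

lemma Basis_subset_lat: "Basis \<subseteq> lat"
 by (auto simp: lat_def inner_Basis)

lemma span_lat: "span lat = (UNIV :: 'a::euclidean_space set)"
 by (metis Basis_subset_lat span_Basis span_mono top.extremum_uniqueI)

lemma lat_inner_Ints: "x \<in> lat ==> y \<in> lat ==> x \<bullet> y \<in> \<int>"
 by (subst euclidean_inner) (auto simp: lat_def intro!: Ints_sum Ints_mult)

lemma lat_scale: "x \<in> lat ==> q \<in> \<int> ==> q *R x \<in> lat"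
 by (auto simp: lat_def)

lemma lat_vec: "(lat :: (real ^ 'n) set) = int_lattice"
 by (auto simp: lat_def int_lattice_def Basis_vec_def inner_axis)

lemma lat_Times: "(lat :: ('a::euclidean_space \<times> 'b::euclidean_space) set) = lat \<times> lat"
 by (auto simp: lat_def Basis_prod_def ball_Un)

lemma lattice_index_eq: "lattice_index L = grp_ix lat L"
 by (simp add: lattice_index_def grp_ix_def lat_vec)

lemma finite_lat_bounded: "finite {x \<in> (lat :: 'a::euclidean_space set). norm x \<le> M}"
proof -
 let ?I = "{k \<in> \<int>. -M \<le> k \<and> k \<le> M} :: real set"
 let ?f = "\<lambda>x::'a. \<lambda>b\<in>Basis. x \<bullet> b"
 have "finite (PiE (Basis::'a set) (\<lambda>_. ?I))" by (intro finite_PiE) (auto intro: finite_int_segment)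
 moreover have "?f ` {x \<in> lat. norm x \<le> M} \<subseteq> PiE (Basis::'a set) (\<lambda>_. ?I)"
 proof -
  have "\<bar>x \<bullet> b\<bar> \<le> M" if "b \<in> Basis" "norm x \<le> M" for b x :: 'a
   using Basis_le_norm[OF that(1), of x] that by linarith
  then show ?thesis by (fastforce simp: lat_def abs_le_iff)
 qed
 moreover have "inj_on ?f {x \<in> lat. norm x \<le> M}"
  by (rule inj_onI, rule euclidean_eqI) (metis restrict_apply')
 ultimately show ?thesis using finite_imageD finite_subset by blast
qed

text \<open>A nonzero functional vanishing on \<open>L\<close> maps the lattice onto an infinite
  group and \<open>L\<close> to 0. By this convention pairs of cells that are not transversal
  contribute nothing to a degree.\<close>

lemma grp_ix_lat_eq_0:
 fixes L :: "'a::euclidean_space set"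
 assumes L: "subgrp L" "L \<subseteq> lat" "span L \<noteq> UNIV"
 shows "grp_ix lat L = 0"
proof -
 have "dim L < DIM('a)" using L by (metis dim_eq_full dim_subset_UNIV le_neq_implies_less)
 then obtain u where u: "u \<noteq> 0" "\<And>y. y \<in> span L ==> orthogonal u y"
  using orthogonal_to_subspace_exists by blast
 have "\<exists>b\<in>Basis. u \<bullet> b \<noteq> 0" using u euclidean_all_zero_iff by blast
 then obtain b where b: "b \<in> Basis" "u \<bullet> b \<noteq> 0" by blast
 have "grp_ix lat L = grp_ix ((\<bullet>) u ` lat) ((\<bullet>) u ` L) *
   grp_ix {a \<in> lat. u \<bullet> a = 0} {a \<in> L. u \<bullet> a = 0}"
  using L lat_subgroup by (intro grp_ix_exact) (auto simp: inner_diff_right)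
 moreover have "(\<bullet>) u ` L = {0}"
 proof -
  have "u \<bullet> y = 0" if "y \<in> L" for y using u(2)[OF span_base[OF that]] by (simp add: orthogonal_def)
  moreover have "0 \<in> L" using L(1) subgrp_0 by blast
  ultimately show ?thesis by (auto simp: image_iff)
 qed
 moreover have "grp_ix ((\<bullet>) u ` lat) {0} = 0"
 proof -
  have "coset_in ((\<bullet>) u ` lat) {0} ` (\<bullet>) u ` lat = (\<lambda>x. {x}) ` (\<bullet>) u ` lat"
  proof (rule image_cong)
   fix x assume "x \<in> (\<bullet>) u ` (lat::'a set)"
   then show "coset_in ((\<bullet>) u ` lat) {0} x = {x}" by (auto simp: coset_in_def)
  qed simp
  moreover have "infinite ((\<lambda>x. {x}) ` (\<bullet>) u ` (lat::'a set))"
  proof -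
   have "(\<lambda>k::int. of_int k * (u \<bullet> b)) ` UNIV \<subseteq> (\<bullet>) u ` lat"
   proof clarify
    fix k :: int
    have "of_int k *R b \<in> lat" using lat_scale[OF subsetD[OF Basis_subset_lat b(1)]] by simp
    then show "of_int k * (u \<bullet> b) \<in> (\<bullet>) u ` lat" by (metis image_eqI inner_scaleR_right)
   qed
   moreover have "infinite ((\<lambda>k::int. of_int k * (u \<bullet> b)) ` UNIV)"
    using b infinite_UNIV_int by (subst finite_image_iff) (auto simp: inj_def)
   ultimately have "infinite ((\<bullet>) u ` (lat::'a set))" using finite_subset by blast
   then show ?thesis using finite_imageD[of "\<lambda>x. {x}"] by (auto simp: inj_on_def)
  qed
  ultimately show ?thesis by (simp add: grp_ix_coset)
 qed
 ultimately show ?thesis by simp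
qed

text \<open>In a basis taken from \<open>L\<close>, subtracting the integer parts of the coordinates
  moves every lattice point into a bounded set without changing its coset.\<close>

lemma grp_ix_lat_pos:
 fixes L :: "'a::euclidean_space set"
 assumes L: "subgrp L" "L \<subseteq> lat" "span L = UNIV"
 shows "grp_ix lat L > 0"
proof -
 obtain B where B: "B \<subseteq> L" "independent B" "L \<subseteq> span B"
  using maximal_independent_subset by blast
 have finB: "finite B" using B independent_imp_finite by blast
 have spanB: "span B = UNIV" using B L by (metis span_minimal subspace_span top.extremum_uniqueI)
 define M where "M = (\<Sum>b\<in>B. norm b)"
 have "coset_in lat L ` lat \<subseteq> coset_in lat L ` {x \<in> lat. norm x \<le> M}"
 proof (rule image_subsetI)
  fix x :: 'a assume x: "x \<in> lat"
  obtain t where t: "x = (\<Sum>b\<in>B. t b *R b)"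
   using spanB span_finite[OF finB] by (metis (no_types, lifting) UNIV_I imageE)
  define z where "z = (\<Sum>b\<in>B. of_int \<lfloor>t b\<rfloor> *R b)"
  have sumL: "sum g B' \<in> L" if "finite B'" "\<And>b. b \<in> B' ==> g b \<in> L" for g B'
   using that by (induction B' rule: finite_induct) (auto simp: L subgrp_0 subgrp_add)
  have zL: "z \<in> L"
   unfolding z_def by (intro sumL finB) (use subgrp_of_int[OF L(1)] B(1) in blast)
  have y: "x - z \<in> lat" using x zL L lat_subgroup subgrp_diff by blast
  have "x - z = (\<Sum>b\<in>B. frac (t b) *R b)"
   by (simp add: t z_def sum_subtractf[symmetric] frac_def scaleR_left_diff_distrib)
  also have "norm \<dots> \<le> (\<Sum>b\<in>B. norm (frac (t b) *R b))" by (rule norm_sum)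
  also have "\<dots> \<le> M" unfolding M_def
   by (intro sum_mono) (simp add: mult_left_le_one_le frac_ge_0 frac_lt_1 less_imp_le)
  finally have "norm (x - z) \<le> M" .
  moreover have "coset_in lat L x = coset_in lat L (x - z)"
   using coset_in_eq_iff[OF lat_subgroup L(1) x y] zL by simp
  ultimately show "coset_in lat L x \<in> coset_in lat L ` {x \<in> lat. norm x \<le> M}" using y by blast
 qed
 then have "finite (coset_in lat L ` (lat::'a set))"
  using finite_lat_bounded finite_subset by blast
 moreover have "coset_in lat L ` (lat::'a set) \<noteq> {}" using lat_subgroup subgrp_0 by blast
 ultimately show ?thesis by (simp add: grp_ix_coset card_gt_0_iff)
qed

definition rational_subspace :: "'a::euclidean_space set => bool"
 where "rational_subspace K \<longleftrightarrow> (\<exists>S. finite S \<and> S \<subseteq> lat \<and> K = {x. \<forall>s\<in>S. s \<bullet> x = 0})"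

lemma subspace_orth: "subspace {x. \<forall>s\<in>S. s \<bullet> x = 0}"
 by (auto simp: subspace_def inner_add_right)

lemma rational_subspace_imp_subspace: "rational_subspace K ==> subspace K"
 using subspace_orth by (auto simp: rational_subspace_def)

lemma rational_subspace_Int:
 assumes "rational_subspace K" "rational_subspace L"
 shows "rational_subspace (K \<inter> L)"
proof -
 obtain S where "finite S" "S \<subseteq> lat" "K = {x. \<forall>s\<in>S. s \<bullet> x = 0}"
  using assms by (auto simp: rational_subspace_def)
 moreover obtain S' where "finite S'" "S' \<subseteq> lat" "L = {x. \<forall>s\<in>S'. s \<bullet> x = 0}"
  using assms by (auto simp: rational_subspace_def)
 ultimately show ?thesis unfolding rational_subspace_def by (intro exI[of _ "S \<union> S'"]) auto
qed

text \<open>Induction on the equations. If a lattice vector \<open>b\<close> of the previous space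
  violates the new equation \<open>s\<close>, then
  \<open>x \<mapsto> (s \<bullet> b) x - (s \<bullet> x) b\<close> sends lattice vectors of that
  space to lattice vectors of the smaller one, on which it is a nonzero multiple of the
  identity.\<close>

lemma rational_subspace_span_lat:
 fixes K :: "'a::euclidean_space set"
 assumes "rational_subspace K"
 shows "span (K \<inter> lat) = K"
proof -
 have main: "{x. \<forall>s\<in>S. s \<bullet> x = 0} \<subseteq> span ({x. \<forall>s\<in>S. s \<bullet> x = 0} \<inter> lat)"
  if "finite S" "S \<subseteq> lat" for S :: "'a set"
  using that
 proof (induction S rule: finite_induct)
  case empty
  then show ?case by (simp add: span_lat)
 next
  case (insert s S)
  define L where "L = {x. \<forall>s\<in>S. s \<bullet> x = 0} \<inter> lat"
  define M where "M = {x. \<forall>s\<in>insert s S. s \<bullet> x = 0} \<inter> lat"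
  have KL: "{x. \<forall>s\<in>S. s \<bullet> x = 0} \<subseteq> span L" using insert by (simp add: L_def)
  show ?case
  proof (cases "\<forall>l\<in>L. s \<bullet> l = 0")
   case True
   then have "L = M" by (auto simp: L_def M_def)
   then show ?thesis using KL unfolding M_def by auto
  next
   case False
   then obtain b where b: "b \<in> L" "s \<bullet> b \<noteq> 0" by auto
   have sb: "s \<bullet> b \<in> \<int>" using b insert by (auto simp: L_def intro: lat_inner_Ints)
   have *: "(s \<bullet> b) *R x - (s \<bullet> x) *R b \<in> span M" if "x \<in> span L" for x
    using that
   proof (induction rule: span_induct)
    case base
    have "subspace {x. (s \<bullet> b) *R x - (s \<bullet> x) *R b \<in> span M}"
    proof -
     have "linear (\<lambda>x. (s \<bullet> b) *R x - (s \<bullet> x) *R b)"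
      by (rule linearI) (simp_all add: algebra_simps inner_add_right)
     then show ?thesis using linear_subspace_vimage[of _ "span M"] by (simp add: vimage_def)
    qed
    then show ?case .
   next
    case (step x)
    have "s \<bullet> x \<in> \<int>" using step insert by (auto simp: L_def intro: lat_inner_Ints)
    then have "(s \<bullet> b) *R x - (s \<bullet> x) *R b \<in> lat"
     using step b sb by (auto simp: L_def intro!: subgrp_diff[OF lat_subgroup] lat_scale)
    then have "(s \<bullet> b) *R x - (s \<bullet> x) *R b \<in> M"
     using step b by (auto simp: M_def L_def inner_diff_right)
    then show ?case by (rule span_base)
   qed
   show ?thesis
   proof
    fix x assume x: "x \<in> {x. \<forall>s\<in>insert s S. s \<bullet> x = 0}"
    then have "(s \<bullet> b) *R x \<in> span M" using *[of x] KL by auto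
    then have "(1 / (s \<bullet> b)) *R ((s \<bullet> b) *R x) \<in> span M" by (rule span_mul)
    then show "x \<in> span ({x. \<forall>s\<in>insert s S. s \<bullet> x = 0} \<inter> lat)" using b by (simp add: M_def)
   qed
  qed
 qed
 have sub: "subspace K" using assms rational_subspace_imp_subspace by blast
 have "K \<subseteq> span (K \<inter> lat)" using assms main unfolding rational_subspace_def by force
 moreover have "span (K \<inter> lat) \<subseteq> K" using sub by (simp add: span_minimal)
 ultimately show ?thesis by auto
qed

text \<open>For \<open>T\<close> of corank 1 the index of \<open>T + \<int> w\<close> is, up to
  sign, linear in \<open>w\<close>. This linearity is what allows a sum of indices over the cells
  around a ridge to be compared with the balancing condition.\<close>

lemma grp_ix_adjoin:
 fixes T :: "'a::euclidean_space set"
 assumes T: "subgrp T" "T \<subseteq> lat" and dimT: "dim T + 1 = DIM('a)"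
 obtains a where "\<And>t. t \<in> T ==> a \<bullet> t = 0"
  "\<And>w. w \<in> lat ==> grp_ix lat {t + of_int k *R w |t k. t \<in> T} = \<bar>a \<bullet> w\<bar>"
proof -
 obtain B where B: "B \<subseteq> T" "independent B" "T \<subseteq> span B" "card B = dim T"
  using basis_exists by blast
 have finB: "finite B" using B independent_imp_finite by blast
 define W where "W = {x. \<forall>s\<in>B. s \<bullet> x = 0}"
 have ratW: "rational_subspace W" unfolding rational_subspace_def W_def using finB B T by blast
 have "dim {y \<in> (UNIV::'a set). \<forall>x\<in>span B. orthogonal x y} + dim (span B) = dim (UNIV::'a set)"
  by (rule dim_subspace_orthogonal_to_vectors) auto
 moreover have "{y \<in> (UNIV::'a set). \<forall>x\<in>span B. orthogonal x y} = W"
 proof -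
  have "(\<forall>x\<in>span B. orthogonal x y) \<longleftrightarrow> (\<forall>x\<in>B. x \<bullet> y = 0)" for y
  proof
   assume *: "\<forall>x\<in>B. x \<bullet> y = 0"
   have "orthogonal y x" if "x \<in> span B" for x
    using orthogonal_to_span[OF that, of y] * by (auto simp: orthogonal_def inner_commute)
   then show "\<forall>x\<in>span B. orthogonal x y" by (auto simp: orthogonal_commute)
  qed (auto simp: orthogonal_def span_base)
  then show ?thesis by (auto simp: W_def)
 qed
 moreover have "dim (span B) = dim T" using B by (simp add: dim_eq_card_independent)
 ultimately have "dim W = 1" using dimT by simp
 then have "W \<noteq> {0}" by auto
 \<comment> \<open>The normal line of \<open>T\<close> is cut out by vectors of \<open>T\<close>,
   hence rational, and so it contains a nonzero lattice vector.\<close>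
 then have "\<exists>u\<in>W \<inter> lat. u \<noteq> 0"
  using rational_subspace_span_lat[OF ratW]
  by (metis (no_types, lifting) all_not_in_conv insertI1 singletonI span_empty span_insert_0 subset_singletonD
    singletonD subsetI insert_absorb)
 then obtain u where u: "u \<in> W" "u \<in> lat" "u \<noteq> 0" by auto
 have uT: "u \<bullet> t = 0" if "t \<in> T" for t
 proof -
  have "orthogonal u t" using that B u
   by (intro orthogonal_to_span[of t B]) (auto simp: orthogonal_def inner_commute W_def)
  then show ?thesis by (simp add: orthogonal_def)
 qed
 let ?A = "(\<bullet>) u ` (lat :: 'a set)"
 have Asub: "subgrp ?A"
  unfolding subgrp_def
 proof (intro conjI ballI)
  show "0 \<in> ?A" using lat_subgroup subgrp_0 by (metis image_eqI inner_zero_right)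
  fix x y assume "x \<in> ?A" "y \<in> ?A"
  then obtain x' y' where "x = u \<bullet> x'" "y = u \<bullet> y'" "x' \<in> lat" "y' \<in> lat" by auto
  then have "x - y = u \<bullet> (x' - y')" "x' - y' \<in> lat"
   using lat_subgroup subgrp_diff by (auto simp: inner_diff_right)
  then show "x - y \<in> ?A" by auto
 qed
 have "?A \<subseteq> \<int>" using u by (auto intro: lat_inner_Ints)
 moreover have "?A \<noteq> {0}"
 proof -
  obtain b where "b \<in> Basis" "u \<bullet> b \<noteq> 0" using u euclidean_all_zero_iff by blast
  then have "u \<bullet> b \<in> ?A" using Basis_subset_lat by auto
  then show ?thesis using \<open>u \<bullet> b \<noteq> 0\<close> by auto
 qed
 ultimately obtain d where d: "d > 0" "?A = range (\<lambda>k::int. d * of_int k)"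
  using int_subgroup_principal[OF Asub] by blast
 \<comment> \<open>\<open>d\<close> generates the values of \<open>u\<close> on the lattice, and
   \<open>J\<close> is the index of \<open>T\<close> in the lattice of the kernel of
   \<open>u\<close>. If \<open>u \<bullet> w = d m\<close>, the exact sequence of \<open>u\<close>
   gives the index \<open>\<bar>m\<bar> J\<close>.\<close>
 define J where "J = real (grp_ix {a \<in> lat. u \<bullet> a = 0} T)"
 show thesis
 proof (rule that[of "(J / d) *R u"])
  fix t assume "t \<in> T" then show "((J / d) *R u) \<bullet> t = 0" using uT by simp
 next
  fix w :: 'a assume w: "w \<in> lat"
  define G where "G = {t + of_int k *R w |t k. t \<in> T}"
  have Gsub: "subgrp G"
   unfolding subgrp_def
  proof (intro conjI ballI)
   show "0 \<in> G" unfolding G_def using T by (auto simp: subgrp_0 intro!: exI[of _ 0])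
   fix a b assume "a \<in> G" "b \<in> G"
   then obtain t k t' k' where "a = t + of_int k *R w" "b = t' + of_int k' *R w" "t \<in> T" "t' \<in> T"
    unfolding G_def by auto
   then have "a - b = (t - t') + of_int (k - k') *R w" "t - t' \<in> T"
    using T by (auto simp: subgrp_diff algebra_simps)
   then show "a - b \<in> G" unfolding G_def by blast
  qed
  have GA: "G \<subseteq> lat" unfolding G_def using T w lat_subgroup
   by (auto intro!: subgrp_add[OF lat_subgroup] subgrp_of_int[OF lat_subgroup])
  obtain m where m: "u \<bullet> w = d * of_int m" using d w by (metis (mono_tags) image_iff)
  have "grp_ix lat G = grp_ix ?A ((\<bullet>) u ` G) * grp_ix {a \<in> lat. u \<bullet> a = 0} {a \<in> G. u \<bullet> a = 0}"
   using GA Gsub lat_subgroup by (intro grp_ix_exact) (auto simp: inner_diff_right)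
  moreover have "(\<bullet>) u ` G = range (\<lambda>k::int. d * of_int m * of_int k)"
  proof -
   have "(\<bullet>) u ` G = range (\<lambda>k::int. of_int k * (u \<bullet> w))"
    unfolding G_def using uT T
    by (auto simp: inner_add_right image_iff) (metis subgrp_0 add_0 inner_scaleR_right)
   then show ?thesis by (simp add: m mult_ac)
  qed
  ultimately have gi: "grp_ix lat G = nat \<bar>m\<bar> * grp_ix {a \<in> lat. u \<bullet> a = 0} {a \<in> G. u \<bullet> a = 0}"
   using grp_ix_cyclic[OF d(1), of m] d(2) by simp
  have "real (grp_ix lat G) = \<bar>real_of_int m\<bar> * J"
  \<comment> \<open>For \<open>m = 0\<close> both sides vanish, the index being infinite; otherwise
    the kernel of \<open>u\<close> on \<open>G\<close> is exactly \<open>T\<close>.\<close>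
  proof (cases "m = 0")
   case False
   have "{a \<in> G. u \<bullet> a = 0} = T"
   proof
    show "{a \<in> G. u \<bullet> a = 0} \<subseteq> T" using uT m False d(1)
     by (auto simp: G_def inner_add_right)
    show "T \<subseteq> {a \<in> G. u \<bullet> a = 0}" using uT
     by (auto simp: G_def intro!: exI[of _ "0::int"])
   qed
   then show ?thesis using gi by (simp add: J_def)
  qed (use gi in simp)
  also have "\<dots> = \<bar>((J / d) *R u) \<bullet> w\<bar>"
   using d(1) by (simp add: m abs_mult J_def)
  finally show "real (grp_ix lat {t + of_int k *R w |t k. t \<in> T}) = \<bar>((J / d) *R u) \<bullet> w\<bar>"
   by (simp add: G_def)
 qed
qed

subsection \<open>Primitive normal vectors\<close>

text \<open>\<open>r\<close> is the orthogonal projection to \<open>K\<^sup>\<bottom>\<close> of a lattice vector generating, together with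
  \<open>N\<^sub>K\<close>, the lattice of \<open>K + \<real> r\<close>. In contrast to the lattice vector, \<open>r\<close> is unique.\<close>

definition prim_mod :: "'a::euclidean_space set => 'a => bool"
 where "prim_mod K r \<longleftrightarrow> (\<forall>k\<in>K. r \<bullet> k = 0) \<and> r \<noteq> 0 \<and>
  (\<forall>q::real. (\<exists>v\<in>lat. v - q *R r \<in> K) \<longleftrightarrow> q \<in> \<int>)"

text \<open>Primitivity of either vector makes both \<open>c\<close> and \<open>1 / c\<close>
  integers.\<close>

lemma prim_mod_unique:
 assumes "prim_mod K r" "prim_mod K (c *R r)" "c > 0"
 shows "c = 1"
proof -
 obtain v where "v \<in> lat" "v - 1 *R (c *R r) \<in> K"
  using assms(2) Ints_1 unfolding prim_mod_def by blast
 then have c: "c \<in> \<int>" using assms(1) unfolding prim_mod_def by (metis scaleR_one)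
 obtain w where "w \<in> lat" "w - 1 *R r \<in> K"
  using assms(1) Ints_1 unfolding prim_mod_def by blast
 moreover have "1 *R r = (1 / c) *R (c *R r)" using assms(3) by simp
 ultimately have "1 / c \<in> \<int>" using assms(2) unfolding prim_mod_def by metis
 then obtain m where m: "1 / c = of_int m" by (auto elim: Ints_cases)
 obtain k where k: "c = of_int k" using c by (auto elim: Ints_cases)
 have "real_of_int (m * k) = 1" using m k assms(3) by (simp add: field_simps)
 then have "m * k = 1" by linarith
 then show ?thesis using k assms(3) by (metis of_int_1 of_int_0_less_iff zmult_eq_1_iff not_one_less_zero
    of_int_minus neg_0_less_iff_less zero_less_one less_asym' of_int_less_0_iff)
qed

lemma prim_mod_uminus: "subspace K ==> prim_mod K r ==> prim_mod K (- r)"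
proof -
 assume K: "subspace K" and r: "prim_mod K r"
 have "(\<exists>v\<in>lat. v - q *R (- r) \<in> K) \<longleftrightarrow> q \<in> \<int>" for q
 proof -
  have "(\<exists>v\<in>lat. v - q *R (- r) \<in> K) \<longleftrightarrow> (\<exists>v\<in>lat. v - (- q) *R r \<in> K)" by simp
  also have "\<dots> \<longleftrightarrow> - q \<in> \<int>" using r unfolding prim_mod_def by blast
  finally show ?thesis by simp
 qed
 then show ?thesis using r unfolding prim_mod_def by simp
qed

lemma prim_mod_notin: "prim_mod K r ==> r \<notin> K"
 unfolding prim_mod_def by auto

lemma prim_mod_rep:
 assumes "prim_mod K r"
 obtains v where "v \<in> lat" "v - r \<in> K"
 using assms Ints_1 unfolding prim_mod_def by (metis scaleR_one)

text \<open>\<open>r\<close> need not be a lattice point; the generator is a lattice vector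
  \<open>v\<close> congruent to it modulo \<open>K\<close>.\<close>

lemma prim_mod_lattice:
 assumes r: "prim_mod K r" and K: "subspace K" and v: "v \<in> lat" "v - r \<in> K"
 shows "lat \<inter> {k + q *R r |k q. k \<in> K} = {k + of_int j *R v |k j. k \<in> lat \<inter> K}"
proof
 show "lat \<inter> {k + q *R r |k q. k \<in> K} \<subseteq> {k + of_int j *R v |k j. k \<in> lat \<inter> K}"
 proof
  fix x assume x: "x \<in> lat \<inter> {k + q *R r |k q. k \<in> K}"
  then obtain k q where kq: "x = k + q *R r" "k \<in> K" by auto
  then have "x - q *R r \<in> K" by simp
  then have "q \<in> \<int>" using x r unfolding prim_mod_def by blast
  then obtain j where j: "q = of_int j" by (auto elim: Ints_cases)
  have "x - of_int j *R v \<in> lat"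
   using x v subgrp_diff[OF lat_subgroup] subgrp_of_int[OF lat_subgroup] by auto
  moreover have "x - of_int j *R v \<in> K"
  proof -
   have "x - of_int j *R v = k - q *R (v - r)" by (simp add: kq j algebra_simps)
   moreover have "k - q *R (v - r) \<in> K" using kq v K by (simp add: subspace_diff subspace_scale)
   ultimately show ?thesis by metis
  qed
  moreover have "x = (x - of_int j *R v) + of_int j *R v" by simp
  ultimately show "x \<in> {k + of_int j *R v |k j. k \<in> lat \<inter> K}" by blast
 qed
 show "{k + of_int j *R v |k j. k \<in> lat \<inter> K} \<subseteq> lat \<inter> {k + q *R r |k q. k \<in> K}"
 proof clarify
  fix k j assume k: "k \<in> lat" "k \<in> K"
  have "k + of_int j *R v \<in> lat" using k v by (intro subgrp_add[OF lat_subgroup] subgrp_of_int[OF lat_subgroup])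
  moreover have "k + of_int j *R v = (k + of_int j *R (v - r)) + of_int j *R r" by (simp add: algebra_simps)
  moreover have "k + of_int j *R (v - r) \<in> K" using k v K by (simp add: subspace_add subspace_scale)
  ultimately show "k + of_int j *R v \<in> lat \<inter> {k + q *R r |k q. k \<in> K}" by blast
 qed
qed

lemma subspace_adjoin_eq:
 fixes D :: "'a::euclidean_space set"
 assumes D: "subspace D" and K: "subspace K" "K \<subseteq> D" and x: "x \<in> D" "x \<notin> K" and dim: "dim D = dim K + 1"
 shows "D = {k + q *R x |k q. k \<in> K}"
proof -
 have spanK: "span K = K" using K by (simp add: span_eq_iff)
 have "dim (span (insert x K)) = dim D" using x spanK dim by (metis dim_insert dim_span Suc_eq_plus1 add.commute)
 moreover have "span (insert x K) \<subseteq> D" using D K x by (intro span_minimal) auto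
 ultimately have "D = span (insert x K)" using D subspace_dim_equal subspace_span by (metis order_refl)
 also have "\<dots> = {k + q *R x |k q. k \<in> K}"
 proof (intro equalityI subsetI)
  fix y assume "y \<in> span (insert x K)"
  then obtain q where "y - q *R x \<in> K" using spanK span_breakdown_eq by blast
  then show "y \<in> {k + q *R x |k q. k \<in> K}" by (force intro: exI[of _ "y - q *R x"])
 next
  fix y assume "y \<in> {k + q *R x |k q. k \<in> K}"
  then show "y \<in> span (insert x K)" by (auto intro!: span_add span_scale intro: span_base)
 qed
 finally show ?thesis .
qed

text \<open>Some equation of \<open>K\<close>, given by a lattice vector \<open>a\<close>, is
  nonzero at \<open>x\<close>. A lattice vector of \<open>D\<close> at which \<open>a\<close> takes
  its least positive value generates the lattice of \<open>D\<close> modulo that of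
  \<open>K\<close>, and \<open>r\<close> is its component orthogonal to \<open>K\<close>. The sign
  of \<open>a\<close> keeps \<open>r\<close> on the side of \<open>x\<close>.\<close>

lemma ex_prim_mod:
 fixes K D :: "'a::euclidean_space set"
 assumes K: "rational_subspace K" and D: "subspace D" "span (D \<inter> lat) = D"
  and KD: "K \<subseteq> D" "dim D = dim K + 1" and x: "x \<in> D" "x \<notin> K"
 obtains r c where "prim_mod K r" "c > 0" "x - c *R r \<in> K"
proof -
 have Ksub: "subspace K" using K rational_subspace_imp_subspace by blast
 obtain S where S: "finite S" "S \<subseteq> lat" "K = {x. \<forall>s\<in>S. s \<bullet> x = 0}"
  using K by (auto simp: rational_subspace_def)
 then obtain s where s: "s \<in> lat" "s \<bullet> x \<noteq> 0" "\<And>k. k \<in> K ==> s \<bullet> k = 0" using x by auto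
 define a where "a = sgn (s \<bullet> x) *R s"
 have ax: "a \<bullet> x > 0" using s by (simp add: a_def sgn_mult_abs abs_sgn[symmetric] mult.commute)
 have alat: "a \<in> lat" unfolding a_def using s by (intro lat_scale) (auto simp: sgn_if)
 have aK: "a \<bullet> k = 0" if "k \<in> K" for k using s that by (simp add: a_def)
 have Dx: "D = {k + q *R x |k q. k \<in> K}" using subspace_adjoin_eq D Ksub KD x by blast
 have kerK: "y \<in> K" if "y \<in> D" "a \<bullet> y = 0" for y
 proof -
  have "y \<in> {k + q *R x |k q. k \<in> K}" using that(1) Dx by simp
  then obtain k q where y: "y = k + q *R x" "k \<in> K" by blast
  then have "q = 0" using that ax aK by (simp add: inner_add_right)
  then show ?thesis using y by simp
 qed
 let ?A = "(\<bullet>) a ` (D \<inter> lat)"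
 have DL: "subgrp (D \<inter> lat)" using D lat_subgroup subgrp_Int subgrp_subspace by blast
 have Asub: "subgrp ?A"
  unfolding subgrp_def
 proof (intro conjI ballI)
  show "0 \<in> ?A" using DL subgrp_0 by (metis image_eqI inner_zero_right)
  fix u v assume "u \<in> ?A" "v \<in> ?A"
  then obtain y z where "y \<in> D \<inter> lat" "z \<in> D \<inter> lat" "u = a \<bullet> y" "v = a \<bullet> z" by auto
  then have "u - v = a \<bullet> (y - z)" "y - z \<in> D \<inter> lat" using DL subgrp_diff by (auto simp: inner_diff_right)
  then show "u - v \<in> ?A" by auto
 qed
 have "?A \<subseteq> \<int>" using alat by (auto intro: lat_inner_Ints)
 moreover have "?A \<noteq> {0}"
 proof
  assume A0: "?A = {0}"
  have "orthogonal a x"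
   by (rule orthogonal_to_span[of x "D \<inter> lat"]) (use A0 x D in \<open>auto simp: orthogonal_def\<close>)
  then show False using ax by (simp add: orthogonal_def)
 qed
 ultimately obtain d where d: "d > 0" "?A = range (\<lambda>k::int. d * of_int k)"
  using int_subgroup_principal[OF Asub] by blast
 have "d \<in> ?A" unfolding d(2) by (rule range_eqI[of _ _ 1]) simp
 then obtain v where v: "v \<in> D" "v \<in> lat" "a \<bullet> v = d" by auto
 obtain k r where kr: "k \<in> span K" "\<And>w. w \<in> span K ==> orthogonal r w" "v = k + r"
  using orthogonal_subspace_decomp_exists by blast
 have spanK: "span K = K" using Ksub by (simp add: span_eq_iff)
 have kK: "k \<in> K" using kr spanK by simp
 have ar: "a \<bullet> r = d" using kr v aK[OF kK] by (simp add: inner_add_right)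
 have rD: "r \<in> D" using kr(3) v kK KD D by (metis add_diff_cancel_left' subspace_diff subsetD)
 have prim: "prim_mod K r"
  unfolding prim_mod_def
 proof (intro conjI ballI allI iffI)
  fix w assume "w \<in> K" then show "r \<bullet> w = 0" using kr spanK by (simp add: orthogonal_def)
 next
  show "r \<noteq> 0" using ar d by auto
 next
  fix q :: real assume "\<exists>v\<in>lat. v - q *R r \<in> K"
  then obtain w where w: "w \<in> lat" "w - q *R r \<in> K" by auto
  have "w = (w - q *R r) + q *R r" by simp
  then have "w \<in> D" using w KD rD D by (metis subspace_add subspace_scale subsetD)
  then have "a \<bullet> w \<in> ?A" using w by auto
  then obtain j where j: "a \<bullet> w = d * of_int j" using d by auto
  have "a \<bullet> w = q * d" using aK[OF w(2)] ar by (simp add: inner_diff_right)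
  then have "q = of_int j" using j d by auto
  then show "q \<in> \<int>" by simp
 next
  fix q :: real assume q: "q \<in> \<int>"
  have "q *R v - q *R r = q *R k" by (simp add: kr algebra_simps)
  then have "q *R v - q *R r \<in> K" using kK Ksub subspace_scale by metis
  then show "\<exists>v\<in>lat. v - q *R r \<in> K" using q v lat_scale by blast
 qed
 show thesis
 proof (rule that[OF prim])
  show "(a \<bullet> x) / d > 0" using ax d by simp
  show "x - ((a \<bullet> x) / d) *R r \<in> K"
   by (rule kerK) (use x rD D ar d in \<open>auto simp: subspace_diff subspace_scale inner_diff_right\<close>)
 qed
qed


subsection \<open>Hyperplane arrangements\<close>

definition arrg :: "('a::euclidean_space \<times> real) set => bool"
 where "arrg H \<longleftrightarrow> finite H \<and> (\<forall>(u, c)\<in>H. u \<in> lat)"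

definition central :: "('a::euclidean_space \<times> real) set => bool"
 where "central H \<longleftrightarrow> (\<forall>(u, c)\<in>H. c = 0)"

text \<open>The relatively open cell through \<open>x\<close>. Cells are addressed by their points
  instead of by sign vectors, so that weights and tangent spaces become functions of a
  point.\<close>

definition cell :: "('a::euclidean_space \<times> real) set => 'a => 'a set"
 where "cell H x = {y. \<forall>(u, c)\<in>H. sgn (u \<bullet> y - c) = sgn (u \<bullet> x - c)}"

text \<open>The closure of \<open>cell H x\<close>; where \<open>u \<bullet> x = c\<close> both
  implications apply and force equality.\<close>

definition ccell :: "('a::euclidean_space \<times> real) set => 'a => 'a set"
 where "ccell H x = {y. \<forall>(u, c)\<in>H. (u \<bullet> x \<le> c --> u \<bullet> y \<le> c) \<and> (u \<bullet> x \<ge> c --> u \<bullet> y \<ge> c)}"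

definition tang :: "('a::euclidean_space \<times> real) set => 'a => 'a set"
 where "tang H x = {y. \<forall>(u, c)\<in>H. u \<bullet> x = c --> u \<bullet> y = 0}"

definition ocells :: "('a::euclidean_space \<times> real) set => 'a set set"
 where "ocells H = range (cell H)"

text \<open>The central arrangement whose cells are the nonempty links at \<open>x\<close> of the
  cells of \<open>H\<close>.\<close>

definition larr :: "('a::euclidean_space \<times> real) set => 'a => ('a \<times> real) set"
 where "larr H x = {(u, 0) |u. (u, u \<bullet> x) \<in> H}"

definition cell_const :: "('a::euclidean_space \<times> real) set => ('a => 'b) => bool"
 where "cell_const H f \<longleftrightarrow> (\<forall>x y. y \<in> cell H x --> f y = f x)"

text \<open>The weight of the local fan at \<open>x\<close>, that is, the value on the cell entered
  from \<open>x\<close> in direction \<open>s\<close>. For cell-constant \<open>f\<close> it exists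
  because a short segment stays in one cell.\<close>

definition germ :: "('a::real_vector => 'b) => 'a => 'a => 'b"
 where "germ f x s = (THE c. near0 (\<lambda>e. f (x + e *R s) = c))"

definition dirs :: "'a::real_vector set => 'a set"
 where "dirs C = span {a - b |a b. a \<in> C \<and> b \<in> C}"

definition on_cell :: "('a => 'b) => 'a set => 'b"
 where "on_cell f C = f (SOME x. x \<in> C)"

lemma arrg_finite: "arrg H ==> finite H"
 by (simp add: arrg_def)

lemma cell_refl [simp]: "x \<in> cell H x"
 by (simp add: cell_def)

lemma cell_eq_iff: "cell H y = cell H x \<longleftrightarrow> y \<in> cell H x"
proof
 show "y \<in> cell H x ==> cell H y = cell H x"
  by (fastforce simp: cell_def)
qed (metis cell_refl)

lemma cell_tang: "y \<in> cell H x ==> tang H y = tang H x"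
 by (fastforce simp: cell_def tang_def sgn_0_0)

lemma cell_zero_iff: "y \<in> cell H x ==> (u, c) \<in> H ==> u \<bullet> y = c \<longleftrightarrow> u \<bullet> x = c"
 unfolding cell_def by (smt (verit, best) case_prodD mem_Collect_eq sgn_0_0)

lemma sub_tang: "subspace (tang H x)"
 unfolding tang_def subspace_def by (fastforce simp: inner_add_right)

lemma rational_tang:
 assumes "arrg H"
 shows "rational_subspace (tang H x)"
 unfolding rational_subspace_def
proof (intro exI conjI)
 let ?S = "fst ` {(u, c) \<in> H. u \<bullet> x = c}"
 show "finite ?S" using assms by (auto simp: arrg_def intro: rev_finite_subset[of "fst ` H"])
 show "?S \<subseteq> lat" using assms by (auto simp: arrg_def)
 show "tang H x = {y. \<forall>s\<in>?S. s \<bullet> y = 0}" by (auto simp: tang_def)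
qed

lemma tang_span_lat: "arrg H ==> span (tang H x \<inter> lat) = tang H x"
 by (rule rational_subspace_span_lat[OF rational_tang])

lemma convex_cell: "convex (cell H x)"
proof -
 have *: "convex {y. sgn (u \<bullet> y - c) = sgn (u \<bullet> x - c)}" for u :: 'a and c
 proof -
  consider "u \<bullet> x = c" | "u \<bullet> x < c" | "u \<bullet> x > c" by linarith
  then show ?thesis
  proof cases
   case 1
   then have "{y. sgn (u \<bullet> y - c) = sgn (u \<bullet> x - c)} = {y. u \<bullet> y = c}" by (auto simp: sgn_0_0)
   then show ?thesis by (simp add: convex_hyperplane)
  next
   case 2
   then have "{y. sgn (u \<bullet> y - c) = sgn (u \<bullet> x - c)} = {y. u \<bullet> y < c}"
    by (auto simp: sgn_if split: if_splits)
   then show ?thesis by (simp add: convex_halfspace_lt)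
  next
   case 3
   then have "{y. sgn (u \<bullet> y - c) = sgn (u \<bullet> x - c)} = {y. u \<bullet> y > c}"
    by (auto simp: sgn_if split: if_splits)
   then show ?thesis by (simp add: convex_halfspace_gt)
  qed
 qed
 have "cell H x = (\<Inter>(u, c)\<in>H. {y. sgn (u \<bullet> y - c) = sgn (u \<bullet> x - c)})"
  by (auto simp: cell_def)
 moreover have "convex (\<Inter>(u, c)\<in>H. {y. sgn (u \<bullet> y - c) = sgn (u \<bullet> x - c)})"
  by (rule convex_INT) (use * in auto)
 ultimately show ?thesis by simp
qed

lemma finite_ocells:
 assumes "finite H"
 shows "finite (ocells H)"
proof -
 let ?F = "PiE H (\<lambda>_. {-1, 0, 1 :: real})"
 have "ocells H \<subseteq> (\<lambda>g. {y. \<forall>(u, c)\<in>H. sgn (u \<bullet> y - c) = g (u, c)}) ` ?F"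
  unfolding ocells_def
 proof (rule image_subsetI)
  fix x
  let ?g = "\<lambda>p\<in>H. sgn (fst p \<bullet> x - snd p)"
  have "?g \<in> ?F" by (auto simp: sgn_if)
  moreover have "cell H x = {y. \<forall>(u, c)\<in>H. sgn (u \<bullet> y - c) = ?g (u, c)}" by (auto simp: cell_def)
  ultimately show "cell H x \<in> (\<lambda>g. {y. \<forall>(u, c)\<in>H. sgn (u \<bullet> y - c) = g (u, c)}) ` ?F" by blast
 qed
 moreover have "finite ?F" using assms by (intro finite_PiE) auto
 ultimately show ?thesis using finite_subset by blast
qed

lemma on_cell_cell: "cell_const H f ==> on_cell f (cell H x) = f x"
 unfolding on_cell_def cell_const_def by (metis cell_refl someI)

lemma on_cell_tang: "on_cell (tang H) (cell H x) = tang H x"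
 unfolding on_cell_def by (metis cell_refl someI cell_tang)

lemma finite_range_tang:
 assumes "finite H"
 shows "finite (range (tang H))"
proof -
 have "range (tang H) = on_cell (tang H) ` ocells H"
  by (auto simp: ocells_def on_cell_tang image_image)
 then show ?thesis using finite_ocells[OF assms] by simp
qed

section \<open>Short steps from a point and the cell that they enter\<close>

lemma sgn_step:
 fixes a b :: real
 shows "near0 (\<lambda>e. sgn (a + e * b) = (if a = 0 then sgn b else sgn a))"
proof (cases "a = 0")
 case True
 then show ?thesis
  by (auto simp: eventually_at_filter sgn_mult)
next
 case False
 have lim: "((\<lambda>e. a + e * b) \<longlongrightarrow> a + 0 * b) (at_right 0)" by (intro tendsto_intros)
 consider "a > 0" | "a < 0" using False by linarith
 then show ?thesis
 proof cases
  case 1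
  then have "near0 (\<lambda>e. 0 < a + e * b)" using order_tendstoD(1)[OF lim, of 0] by simp
  then show ?thesis by eventually_elim (use 1 in auto)
 next
  case 2
  then have "near0 (\<lambda>e. a + e * b < 0)" using order_tendstoD(2)[OF lim, of 0] by simp
  then show ?thesis by eventually_elim (use 2 in auto)
 qed
qed

text \<open>The sign of \<open>u \<bullet> y - c\<close> at \<open>y = x + e s\<close> for all small
  \<open>e > 0\<close>: it is decided by \<open>s\<close> on hyperplanes through \<open>x\<close>
  and inherited from \<open>x\<close> on the others.\<close>

definition step_sgn :: "'a::real_inner => real => 'a => 'a => real"
 where "step_sgn u c x s = (if u \<bullet> x = c then sgn (u \<bullet> s) else sgn (u \<bullet> x - c))"

lemma near0_step:
 assumes "finite H"
 shows "near0 (\<lambda>e. \<forall>(u, c)\<in>H. sgn (u \<bullet> (x + e *R s) - c) = step_sgn u c x s)"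
proof -
 have "near0 (\<lambda>e. sgn (u \<bullet> (x + e *R s) - c) = step_sgn u c x s)" for u c
  using sgn_step[of "u \<bullet> x - c" "u \<bullet> s"]
  by (simp add: step_sgn_def inner_add_right algebra_simps)
 then show ?thesis using assms by (intro eventually_ball_finite) auto
qed

lemma near0_ex: "eventually P (at_right (0::real)) ==> \<exists>e>0. P e"
 using eventually_happens'[of "at_right (0::real)" "\<lambda>e. P e \<and> e > 0"]
 by (auto simp: eventually_conj_iff eventually_at_right_less)

lemma cell_iff_step:
 assumes "\<forall>(u, c)\<in>H. sgn (u \<bullet> y - c) = step_sgn u c x s"
  "\<forall>(u, c)\<in>H. sgn (u \<bullet> z - c) = step_sgn u c x s"
 shows "z \<in> cell H y"
 using assms unfolding cell_def by fastforce

lemma cell_step: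
 assumes "finite H"
 obtains y where "near0 (\<lambda>r. x + r *R s \<in> cell H y)"
  "\<forall>(u, c)\<in>H. sgn (u \<bullet> y - c) = step_sgn u c x s"
proof -
 obtain r where e: "\<forall>(u, c)\<in>H. sgn (u \<bullet> (x + r *R s) - c) = step_sgn u c x s"
  using near0_ex[OF near0_step[OF assms, of x s]] by blast
 have "near0 (\<lambda>d. x + d *R s \<in> cell H (x + r *R s))"
  using near0_step[OF assms, of x s] by eventually_elim (rule cell_iff_step[OF e])
 then show thesis using that e by blast
qed

lemma eventually_cell_decided:
 assumes "finite H"
 shows "near0 (\<lambda>e. x + e *R s \<in> cell H z) \<or>
  near0 (\<lambda>e. x + e *R s \<notin> cell H z)"
proof -
 obtain y where y: "near0 (\<lambda>e. x + e *R s \<in> cell H y)"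
  using cell_step[OF assms] by metis
 show ?thesis
 proof (cases "cell H y = cell H z")
  case True
  then show ?thesis using y by simp
 next
  case False
  then have "w \<notin> cell H z" if "w \<in> cell H y" for w using that cell_eq_iff by metis
  then have "near0 (\<lambda>e. x + e *R s \<notin> cell H z)" using y by (rule eventually_mono[rotated])
  then show ?thesis ..
 qed
qed

lemma ex_step:
 fixes x s :: "'a::euclidean_space"
 assumes "finite H"
 shows "\<exists>y. \<forall>(u, c)\<in>H. sgn (u \<bullet> y - c) = step_sgn u c x s"
 by (rule cell_step[OF assms]) blast

lemma step_sgn_eq_0_iff: "step_sgn u c x s = 0 \<longleftrightarrow> u \<bullet> x = c \<and> u \<bullet> s = 0"
 by (auto simp: step_sgn_def sgn_0_0)

lemma step_sgn_zero_iff: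
 assumes "\<forall>(u, c)\<in>H. sgn (u \<bullet> y - c) = step_sgn u c x s" "(u, c) \<in> H"
 shows "u \<bullet> y = c \<longleftrightarrow> u \<bullet> x = c \<and> u \<bullet> s = 0"
proof -
 have "sgn (u \<bullet> y - c) = step_sgn u c x s" using assms by auto
 moreover have "sgn (u \<bullet> y - c) = 0 \<longleftrightarrow> u \<bullet> y = c" by (simp add: sgn_0_0)
 ultimately show ?thesis using step_sgn_eq_0_iff[of u c x s] by metis
qed

lemma tang_step_sgn:
 assumes "\<forall>(u, c)\<in>H. sgn (u \<bullet> y - c) = step_sgn u c x s"
 shows "tang H y = tang (larr H x) s"
proof -
 have "u \<bullet> y = c \<longleftrightarrow> u \<bullet> x = c \<and> u \<bullet> s = 0" if "(u, c) \<in> H" for u c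
  using step_sgn_zero_iff[OF assms that] .
 then show ?thesis by (fastforce simp: tang_def larr_def)
qed

lemma near0_tang:
 assumes "finite H"
 shows "near0 (\<lambda>e. tang H (x + e *R s) = tang (larr H x) s)"
 using near0_step[OF assms, of x s] by eventually_elim (rule tang_step_sgn)

lemma tang_subset_link: "tang H x \<subseteq> tang (larr H x) s"
 by (auto simp: tang_def larr_def)

lemma mem_tang_link: "s \<in> tang (larr H x) s"
 by (auto simp: tang_def larr_def)

lemma link_cell_step:
 assumes "s' \<in> cell (larr H x) s" "(u, c) \<in> H"
 shows "step_sgn u c x s' = step_sgn u c x s"
 using assms by (fastforce simp: step_sgn_def cell_def larr_def)

lemma link_cell_stepD:
 assumes "\<And>u c. (u, c) \<in> H ==> step_sgn u c x s' = step_sgn u c x s"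
 shows "s' \<in> cell (larr H x) s"
 using assms by (fastforce simp: step_sgn_def cell_def larr_def)

lemma finite_larr: "finite H ==> finite (larr H x)"
 unfolding larr_def by (rule rev_finite_subset[of "(\<lambda>(u, c). (u, 0)) ` H"]) auto

lemma arrg_larr: "arrg H ==> arrg (larr H x)"
 unfolding arrg_def using finite_larr by (auto simp: larr_def)

lemma central_larr: "central (larr H x)"
 by (auto simp: central_def larr_def)

lemma larr_central: "central H ==> larr H 0 = H"
 by (fastforce simp: central_def larr_def)

lemma tang_link_0: "tang (larr H x) 0 = tang H x"
 by (auto simp: tang_def larr_def)

lemma step_tang:
 assumes "finite H" "s \<in> tang H x"
 shows "near0 (\<lambda>e. x + e *R s \<in> cell H x)"
proof -
 have "step_sgn u c x s = sgn (u \<bullet> x - c)" if "(u, c) \<in> H" for u c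
  using assms(2) that by (auto simp: step_sgn_def tang_def)
 then show ?thesis using near0_step[OF assms(1), of x s]
  by (auto elim!: eventually_mono simp: cell_def)
qed

lemma cell_tan_add:
 assumes "y \<in> cell H x" "\<And>u c. (u, c) \<in> H ==> u \<bullet> k = 0"
 shows "y + k \<in> cell H x"
 using assms by (auto simp: cell_def inner_add_right)

lemma into_ccell:
 assumes "finite H" "near0 (\<lambda>r. x + r *R s \<in> cell H y)"
 shows "x \<in> ccell H y"
proof -
 obtain r where e: "x + r *R s \<in> cell H y" "\<forall>(u, c)\<in>H. sgn (u \<bullet> (x + r *R s) - c) = step_sgn u c x s"
  using near0_ex[OF eventually_conj[OF assms(2) near0_step[OF assms(1), of x s]]] by blast
 have "(u \<bullet> y \<le> c --> u \<bullet> x \<le> c) \<and> (u \<bullet> y \<ge> c --> u \<bullet> x \<ge> c)" if "(u, c) \<in> H" for u c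
 proof -
  have "step_sgn u c x s = sgn (u \<bullet> y - c)" using e that by (fastforce simp: cell_def)
  then show ?thesis by (auto simp: step_sgn_def sgn_if split: if_splits)
 qed
 then show ?thesis by (auto simp: ccell_def)
qed

lemma cell_subset_ccell: "cell H x \<subseteq> ccell H x"
proof -
 have "(a \<le> 0 --> b \<le> 0) \<and> (a \<ge> 0 --> b \<ge> 0)" if "sgn b = sgn a" for a b :: real
  using that by (auto simp: sgn_if split: if_splits)
 from this[of "u \<bullet> y - c" "u \<bullet> x - c" for u y c] show ?thesis by (fastforce simp: cell_def ccell_def)
qed

lemma ccell_zero: "x \<in> ccell H y ==> (u, c) \<in> H ==> u \<bullet> y = c ==> u \<bullet> x = c"
 by (fastforce simp: ccell_def)

lemma ccell_tang: "x \<in> ccell H y ==> tang H x \<subseteq> tang H y"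
 by (auto simp: tang_def dest: ccell_zero)

lemma ccell_diff_tan: "x \<in> ccell H y ==> x - y \<in> tang H y"
 by (auto simp: tang_def inner_diff_right dest: ccell_zero)

text \<open>\<open>x - y\<close> is tangent at \<open>x\<close>, so a hyperplane through
  \<open>x\<close> contains \<open>y\<close> as well. Thus no weak inequality becomes an equality on
  passing from \<open>y\<close> to \<open>x\<close>.\<close>

lemma ccell_tang_eq:
 assumes x: "x \<in> ccell H y" and t: "tang H y \<subseteq> tang H x"
 shows "x \<in> cell H y"
proof -
 have d: "x - y \<in> tang H x" using ccell_diff_tan[OF x] t by auto
 have "sgn (u \<bullet> x - c) = sgn (u \<bullet> y - c)" if uc: "(u, c) \<in> H" for u c
 proof -
  have "u \<bullet> x = c ==> u \<bullet> y = c" using d uc by (auto simp: tang_def inner_diff_right)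
  moreover have "(u \<bullet> y \<le> c --> u \<bullet> x \<le> c) \<and> (u \<bullet> y \<ge> c --> u \<bullet> x \<ge> c)"
   using x uc by (auto simp: ccell_def)
  ultimately show ?thesis by (auto simp: sgn_if)
 qed
 then show ?thesis by (auto simp: cell_def)
qed

lemma ccell_dim_eq:
 assumes "x \<in> ccell H y" "dim (tang H y) \<le> dim (tang H x)"
 shows "x \<in> cell H y"
proof -
 have "tang H x = tang H y"
  using subspace_dim_equal[OF sub_tang sub_tang ccell_tang[OF assms(1)]] assms by simp
 then show ?thesis using ccell_tang_eq assms by blast
qed

lemma sub_dirs: "subspace (dirs C)"
 by (simp add: dirs_def)

lemma dirs_diff: "a \<in> C ==> b \<in> C ==> a - b \<in> dirs C"
 unfolding dirs_def by (rule span_base) auto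

lemma dirs_mono: "C \<subseteq> D ==> dirs C \<subseteq> dirs D"
 unfolding dirs_def by (rule span_mono) auto

lemma dirs_cell:
 assumes "finite H"
 shows "dirs (cell H x) = tang H x"
proof
 show "dirs (cell H x) \<subseteq> tang H x"
  unfolding dirs_def
 proof (rule span_minimal)
  have "u \<bullet> (a - b) = 0" if "a \<in> cell H x" "b \<in> cell H x" "(u, c) \<in> H" "u \<bullet> x = c" for u c a b
   using cell_zero_iff[OF that(1,3)] cell_zero_iff[OF that(2,3)] that(4) by (simp add: inner_diff_right)
  then have "a - b \<in> tang H x" if "a \<in> cell H x" "b \<in> cell H x" for a b
   using that unfolding tang_def by blast
  then show "{a - b |a b. a \<in> cell H x \<and> b \<in> cell H x} \<subseteq> tang H x" by blast
 qed (rule sub_tang)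
 show "tang H x \<subseteq> dirs (cell H x)"
 proof
  fix s assume "s \<in> tang H x"
  then obtain r where e: "r > 0" "x + r *R s \<in> cell H x"
   using near0_ex[OF step_tang[OF assms]] by blast
  have "(1 / r) *R ((x + r *R s) - x) \<in> dirs (cell H x)"
   by (intro subspace_scale sub_dirs dirs_diff e cell_refl)
  then show "s \<in> dirs (cell H x)" using e by simp
 qed
qed

lemma germ_eqI:
 assumes "near0 (\<lambda>e. f (x + e *R s) = c)"
 shows "germ f x s = c"
 unfolding germ_def
proof (rule the_equality)
 fix d assume "near0 (\<lambda>e. f (x + e *R s) = d)"
 then have "near0 (\<lambda>e. f (x + e *R s) = c \<and> f (x + e *R s) = d)"
  using assms eventually_conj by blast
 then show "d = c" using near0_ex by blast
qed (rule assms)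

lemma eventually_germ:
 assumes "finite H" "cell_const H f"
 shows "near0 (\<lambda>e. f (x + e *R s) = germ f x s)"
proof -
 obtain y where "near0 (\<lambda>e. x + e *R s \<in> cell H y)"
  using cell_step[OF assms(1)] by metis
 then have "near0 (\<lambda>e. f (x + e *R s) = f y)"
  by eventually_elim (use assms(2) in \<open>auto simp: cell_const_def\<close>)
 then show ?thesis using germ_eqI[of f x s "f y"] by simp
qed

lemma germ_step:
 assumes "finite H" "cell_const H f" "\<forall>(u, c)\<in>H. sgn (u \<bullet> y - c) = step_sgn u c x s"
 shows "germ f x s = f y"
proof (rule germ_eqI)
 show "near0 (\<lambda>e. f (x + e *R s) = f y)"
  using near0_step[OF assms(1), of x s]
  by eventually_elim (use assms(2) cell_iff_step[OF assms(3)] in \<open>auto simp: cell_const_def\<close>)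
qed

lemma germ_0: "germ f x 0 = f x"
 by (rule germ_eqI) simp

lemma cell_const_germ:
 assumes "finite H" "cell_const H f"
 shows "cell_const (larr H x) (germ f x)"
 unfolding cell_const_def
proof (intro allI impI)
 fix s s' assume s: "s' \<in> cell (larr H x) s"
 obtain y where "\<forall>(u, c)\<in>H. sgn (u \<bullet> y - c) = step_sgn u c x s" using ex_step[OF assms(1)] by blast
 moreover from this have "\<forall>(u, c)\<in>H. sgn (u \<bullet> y - c) = step_sgn u c x s'"
  using link_cell_step[OF s] by auto
 ultimately show "germ f x s' = germ f x s" using germ_step[OF assms] by simp
qed

lemma germ_cell_cong:
 assumes "finite H" "cell_const H f" "y \<in> cell H x"
 shows "germ f y = germ f x"
proof
 fix s
 obtain z where z: "\<forall>(u, c)\<in>H. sgn (u \<bullet> z - c) = step_sgn u c x s" using ex_step[OF assms(1)] by blast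
 have "step_sgn u c y s = step_sgn u c x s" if "(u, c) \<in> H" for u c
  using assms(3) that cell_zero_iff[OF assms(3) that] by (auto simp: step_sgn_def cell_def)
 then have "\<forall>(u, c)\<in>H. sgn (u \<bullet> z - c) = step_sgn u c y s" using z by auto
 then show "germ f y s = germ f x s" using germ_step[OF assms(1,2) z] germ_step[OF assms(1,2)] by simp
qed

lemma larr_cell_cong: "y \<in> cell H x ==> larr H y = larr H x"
proof -
 assume y: "y \<in> cell H x"
 have "(u, u \<bullet> y) \<in> H \<longleftrightarrow> (u, u \<bullet> x) \<in> H" for u
  using cell_zero_iff[OF y, of u "u \<bullet> y"] cell_zero_iff[OF y, of u "u \<bullet> x"] by metis
 then show ?thesis unfolding larr_def by simp
qed

lemma scale_cell:
 assumes "central H" "e > 0"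
 shows "e *R s \<in> cell H s"
 using assms by (auto simp: cell_def central_def sgn_mult)

lemma germ_central:
 assumes "central H" "cell_const H f"
 shows "germ f 0 s = f s"
proof (rule germ_eqI)
 show "near0 (\<lambda>e. f (0 + e *R s) = f s)"
  using eventually_at_right_less[of "0::real"]
  by eventually_elim (use assms scale_cell[OF assms(1)] in \<open>auto simp: cell_const_def\<close>)
qed

lemma eventually_link_link:
 assumes "finite H"
 shows "near0 (\<lambda>d. larr (larr H x) t = larr H (x + d *R t))"
 using near0_step[OF assms, of x t]
proof eventually_elim
 case (elim d)
 have "u \<bullet> (x + d *R t) = c \<longleftrightarrow> u \<bullet> x = c \<and> u \<bullet> t = 0" if "(u, c) \<in> H" for u c
  using step_sgn_zero_iff[OF elim that] .
 then show ?case unfolding larr_def by fastforce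
qed

text \<open>The local fan at \<open>t\<close> of the local fan at \<open>x\<close> is the local fan
  of the original weight at \<open>x + d t\<close>. Conditions imposed at all points therefore pass
  to local fans.\<close>

lemma eventually_germ_germ:
 assumes "finite H" "cell_const H f"
 shows "near0 (\<lambda>d. germ (germ f x) t = germ f (x + d *R t))"
 using near0_step[OF assms(1), of x t]
proof eventually_elim
 case (elim d)
 show ?case
 proof
  fix s
  let ?L = "larr H x"
  obtain y where y: "\<forall>(u, c)\<in>?L. sgn (u \<bullet> y - c) = step_sgn u c t s"
   using ex_step[OF finite_larr[OF assms(1)]] by blast
  have 1: "germ (germ f x) t s = germ f x y"
   by (rule germ_step[OF finite_larr[OF assms(1)] cell_const_germ[OF assms] y])
  obtain z where z: "\<forall>(u, c)\<in>H. sgn (u \<bullet> z - c) = step_sgn u c x y"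
   using ex_step[OF assms(1)] by blast
  have 2: "germ f x y = f z" by (rule germ_step[OF assms z])
  have "step_sgn u c x y = step_sgn u c (x + d *R t) s" if uc: "(u, c) \<in> H" for u c
  proof -
   have e: "sgn (u \<bullet> (x + d *R t) - c) = step_sgn u c x t" using elim uc by auto
   show ?thesis
   proof (cases "u \<bullet> x = c")
    case True
    then have "(u, 0) \<in> ?L" using uc by (auto simp: larr_def)
    then have "sgn (u \<bullet> y) = step_sgn u 0 t s" using y by auto
    then show ?thesis using True e
     by (auto simp: step_sgn_def sgn_0_0 split: if_splits)
   next
    case False
    then have "u \<bullet> (x + d *R t) \<noteq> c" "step_sgn u c x t = sgn (u \<bullet> x - c)"
     using e by (auto simp: step_sgn_def sgn_0_0 simp flip: eq_iff_diff_eq_0)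
    then show ?thesis using False e by (simp add: step_sgn_def)
   qed
  qed
  then have "\<forall>(u, c)\<in>H. sgn (u \<bullet> z - c) = step_sgn u c (x + d *R t) s" using z by auto
  then have "germ f (x + d *R t) s = f z" by (rule germ_step[OF assms])
  then show "germ (germ f x) t s = germ f (x + d *R t) s" using 1 2 by simp
 qed
qed

subsection \<open>Balanced weight functions\<close>

text \<open>A weighted complex of codimension \<open>c\<close> on an arrangement, given as a function on points
  which is constant on the open cells and supported on those of codimension \<open>c\<close>.\<close>

definition pure_weight :: "('a::euclidean_space \<times> real) set => nat => ('a => real) => bool"
 where "pure_weight H c f \<longleftrightarrow> arrg H \<and> cell_const H f \<and>
  (\<forall>x. f x \<noteq> 0 --> dim (tang H x) + c = DIM('a))"

text \<open>The vectors \<open>r\<close> are orthogonal to the ridge, so the balancing sum has to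
  vanish instead of lying in the span of the ridge. Restricting to nonzero germs makes the index set
  finite at ridges, see \<open>finite_primitive_germ\<close>.\<close>

definition balanced_at :: "('a::euclidean_space \<times> real) set => ('a => real) => 'a => bool"
 where "balanced_at H f t \<longleftrightarrow>
  (\<Sum>r | prim_mod (tang H t) r \<and> germ f t r \<noteq> 0. germ f t r *R r) = 0"

definition bal_weight :: "('a::euclidean_space \<times> real) set => nat => ('a => real) => bool"
 where "bal_weight H c f \<longleftrightarrow> pure_weight H c f \<and>
  (\<forall>t. dim (tang H t) + 1 + c = DIM('a) --> balanced_at H f t)"

lemma pureD:
 assumes "pure_weight H c (f :: 'a::euclidean_space => real)"
 shows "arrg H" "finite H" "cell_const H f" "f x \<noteq> 0 ==> dim (tang H x) + c = DIM('a)"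
 using assms by (auto simp: pure_weight_def arrg_def)

lemma bal_pure: "bal_weight H c f ==> pure_weight H c f"
 by (simp add: bal_weight_def)

lemma germ_dim:
 assumes "pure_weight H c (f :: 'a::euclidean_space => real)" "germ f t s \<noteq> 0"
 shows "dim (tang (larr H t) s) + c = DIM('a)"
proof -
 obtain y where y: "\<forall>(u, c)\<in>H. sgn (u \<bullet> y - c) = step_sgn u c t s"
  using ex_step[OF pureD(2)[OF assms(1)]] by blast
 have "f y \<noteq> 0" using germ_step[OF pureD(2,3)[OF assms(1)] y] assms(2) by simp
 then show ?thesis using pureD(4)[OF assms(1), of y] tang_step_sgn[OF y] by simp
qed

lemma pure_weight_germ:
 assumes "pure_weight H c f"
 shows "pure_weight (larr H x) c (germ f x)"
 using germ_dim[OF assms] arrg_larr[OF pureD(1)[OF assms]]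
  cell_const_germ[OF pureD(2,3)[OF assms]]
 by (auto simp: pure_weight_def)

lemma bal_weight_germ:
 assumes "bal_weight H c f"
 shows "bal_weight (larr H x) c (germ f x)"
 unfolding bal_weight_def
proof (intro conjI allI impI)
 note p = bal_pure[OF assms]
 show "pure_weight (larr H x) c (germ f x)" using pure_weight_germ p by blast
 fix t assume t: "dim (tang (larr H x) t) + 1 + c = DIM('a)"
 have "near0 (\<lambda>b. germ (germ f x) t = germ f (x + b *R t) \<and>
   tang H (x + b *R t) = tang (larr H x) t)"
  using eventually_conj[OF eventually_germ_germ[OF pureD(2,3)[OF p]] near0_tang[OF pureD(2)[OF p]]] .
 then obtain b where d: "germ (germ f x) t = germ f (x + b *R t)"
   "tang H (x + b *R t) = tang (larr H x) t" using near0_ex by blast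
 have "balanced_at H f (x + b *R t)" using assms d t by (auto simp: bal_weight_def)
 then show "balanced_at (larr H x) (germ f x) t" using d by (simp add: balanced_at_def)
qed

text \<open>In the span of the cell \<open>r' = k + q r\<close>. Orthogonality to \<open>K\<close>
  gives \<open>k = 0\<close>, the common cell gives \<open>q > 0\<close>, and primitivity gives
  \<open>q = 1\<close>.\<close>

lemma prim_mod_cell_unique:
 assumes K: "K = tang H t" and dim: "dim (tang (larr H t) r) = dim K + 1"
  and r: "prim_mod K r" "prim_mod K r'" and c: "r' \<in> cell (larr H t) r"
 shows "r' = r"
proof -
 let ?D = "tang (larr H t) r"
 have sub: "subspace K" "subspace ?D" using K sub_tang by auto
 have KD: "K \<subseteq> ?D" using K tang_subset_link by simp
 have rD: "r \<in> ?D" "r' \<in> ?D" using mem_tang_link[of r H t] mem_tang_link[of r' H t] cell_tang[OF c] by auto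
 have rK: "r \<notin> K" using r(1) prim_mod_notin by blast
 have "r' \<in> {k + q *R r |k q. k \<in> K}"
  using subspace_adjoin_eq[OF sub(2,1) KD rD(1) rK dim] rD by simp
 then obtain k q where kq: "r' = k + q *R r" "k \<in> K" by blast
 have "k \<bullet> k = 0"
 proof -
  have "r' \<bullet> k = 0" "r \<bullet> k = 0" using r kq(2) by (auto simp: prim_mod_def)
  then show ?thesis by (simp add: kq(1) inner_add_left)
 qed
 then have r': "r' = q *R r" using kq by simp
 obtain u where u: "(u, u \<bullet> t) \<in> H" "u \<bullet> r \<noteq> 0" using rK K by (auto simp: tang_def)
 then have "(u, 0) \<in> larr H t" by (auto simp: larr_def)
 then have "sgn (u \<bullet> r') = sgn (u \<bullet> r)" using c by (fastforce simp: cell_def)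
 then have "sgn q * sgn (u \<bullet> r) = sgn (u \<bullet> r)" by (simp add: r' sgn_mult)
 then have "sgn q = 1" using u by (simp add: sgn_0_0)
 then have "q > 0" by (simp add: sgn_1_pos)
 then have "q = 1" using prim_mod_unique[OF r(1)] r(2) r' by blast
 then show ?thesis using r' by simp
qed

lemma finite_primitive_germ:
 assumes p: "pure_weight H c f" and dim: "dim (tang H t) + 1 + c = DIM('a)"
 shows "finite {r::'a::euclidean_space. prim_mod (tang H t) r \<and> germ f t r \<noteq> 0}" (is "finite ?R")
proof -
 have "inj_on (cell (larr H t)) ?R"
 proof (rule inj_onI)
  fix r r' assume r: "r \<in> ?R" "r' \<in> ?R" "cell (larr H t) r = cell (larr H t) r'"
  have "dim (tang (larr H t) r') = dim (tang H t) + 1"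
   using germ_dim[OF p, of t r'] r dim by simp
  then show "r = r'" using prim_mod_cell_unique[OF refl] r by (metis (mono_tags) mem_Collect_eq cell_eq_iff)
 qed
 moreover have "finite (cell (larr H t) ` ?R)"
  using finite_ocells[OF finite_larr[OF pureD(2)[OF p]]]
  by (rule rev_finite_subset) (auto simp: ocells_def)
 ultimately show ?thesis using finite_imageD by blast
qed

text \<open>Together with \<open>prim_mod_cell_unique\<close> this matches primitive vectors with
  the cells of the local fan that have one dimension more than its lineality space.\<close>

lemma ex_prim_mod_tan:
 assumes H: "arrg H" and dim: "dim (tang (larr H t) s) = dim (tang H t) + 1"
 obtains r q where "prim_mod (tang H t) r" "q > 0" "s - q *R r \<in> tang H t"
  "r \<in> cell (larr H t) s"
proof -
 let ?K = "tang H t" and ?D = "tang (larr H t) s"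
 have sK: "s \<notin> ?K"
 proof
  assume "s \<in> ?K"
  then have "?D = ?K" by (auto simp: tang_def larr_def)
  then show False using dim by simp
 qed
 obtain r q where rq: "prim_mod ?K r" "q > 0" "s - q *R r \<in> ?K"
  using ex_prim_mod[OF rational_tang[OF H] sub_tang tang_span_lat[OF arrg_larr[OF H]]
    tang_subset_link dim mem_tang_link sK] by metis
 have "r \<in> cell (larr H t) s"
 proof -
  have "sgn (u \<bullet> r) = sgn (u \<bullet> s)" if "(u, u \<bullet> t) \<in> H" for u
  proof -
   have "u \<bullet> (s - q *R r) = 0" using rq(3) that by (auto simp: tang_def)
   then have "u \<bullet> s = q * (u \<bullet> r)" by (simp add: inner_diff_right)
   then show ?thesis using rq(2) by (simp add: sgn_mult)
  qed
  then show ?thesis by (auto simp: cell_def larr_def)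
 qed
 then show thesis using that rq by blast
qed


subsection \<open>Degrees of projections of balanced weights\<close>

lemma dim_image_kernel:
 fixes P :: "'a::euclidean_space => 'b::euclidean_space"
 assumes lin: "linear P" and D: "subspace D"
 shows "dim D = dim (P ` D) + dim {x \<in> D. P x = 0}"
proof -
 define N where "N = {x \<in> D. P x = 0}"
 define M where "M = {y \<in> D. \<forall>x\<in>N. orthogonal x y}"
 have N: "subspace N" using D lin
  by (auto simp: N_def subspace_def linear_add linear_scale linear_0)
 have M: "subspace M" using D
  by (auto simp: M_def subspace_def orthogonal_def inner_add_right)
 have dims: "dim M + dim N = dim D"
  unfolding M_def by (rule dim_subspace_orthogonal_to_vectors[OF N D]) (auto simp: N_def)
 have "inj_on P M"
 proof (rule inj_onI)
  fix x y assume xy: "x \<in> M" "y \<in> M" "P x = P y"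
  then have m: "x - y \<in> M" using M subspace_diff by blast
  moreover have "x - y \<in> N" using xy D lin by (auto simp: N_def M_def subspace_diff linear_diff)
  ultimately have "orthogonal (x - y) (x - y)" by (auto simp: M_def)
  then show "x = y" by (simp add: orthogonal_def)
 qed
 moreover have "span M = M" using M by (simp add: span_eq_iff)
 ultimately have "inj_on P (span M)" by metis
 then have "dim (P ` M) = dim M" using lin dim_image_eq by blast
 moreover have "P ` M = P ` D"
 proof
  show "P ` M \<subseteq> P ` D" by (auto simp: M_def)
  show "P ` D \<subseteq> P ` M"
  proof (rule image_subsetI)
   fix x assume x: "x \<in> D"
   obtain y z where yz: "y \<in> span N" "\<And>w. w \<in> span N ==> orthogonal z w" "x = y + z"
    using orthogonal_subspace_decomp_exists by blast
   have yN: "y \<in> N" using yz(1) N by (metis span_eq_iff)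
   have "z = x - y" using yz by simp
   then have "z \<in> D" using x yN D by (auto simp: N_def subspace_diff)
   then have "z \<in> M" using yz by (auto simp: M_def orthogonal_commute span_base)
   moreover have "P x = P z" using yz yN lin by (simp add: linear_add N_def)
   ultimately show "P x \<in> P ` M" by auto
  qed
 qed
 ultimately show ?thesis using dims by (simp add: N_def)
qed

text \<open>\<open>g\<close> may jump at isolated points. The values \<open>G s\<close> that it
  takes on punctured neighbourhoods form a locally constant function, and connectedness of the line
  makes it constant.\<close>

lemma punctured_locally_const_imp_eq:
 fixes g :: "real => 'c"
 assumes "\<And>s. \<exists>c. eventually (\<lambda>s'. g s' = c) (at s) \<and> (s = a \<or> s = b --> g s = c)"
 shows "g a = g b"
proof -
 obtain G where G: "\<And>s. eventually (\<lambda>s'. g s' = G s) (at s)" "\<And>s. s = a \<or> s = b ==> g s = G s"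
  using assms by metis
 have "eventually (\<lambda>s'. G s = G s') (at s within UNIV)" for s
 proof -
  obtain S where S: "open S" "s \<in> S" "\<And>y. y \<in> S ==> y \<noteq> s ==> g y = G s"
   using G(1)[of s] unfolding eventually_at_topological by blast
  have "G s = G s'" if s': "s' \<in> S" "s' \<noteq> s" for s'
  proof -
   have "open (S - {s})" using S by auto
   then have "eventually (\<lambda>y. y \<in> S - {s}) (at s')" using s' eventually_at_topological by blast
   then have "eventually (\<lambda>y. G s = G s') (at s')" using G(1)[of s']
    by eventually_elim (use S in auto)
   then show ?thesis by simp
  qed
  then show ?thesis using S unfolding eventually_at_topological by blast
 qed
 then have "G a = G b"
  by (intro connected_local_const[of UNIV a b G]) auto
 then show ?thesis using G(2) by simp
qed

lemma eventually_at_two_sided: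
 fixes s :: real
 assumes "near0 (\<lambda>e. P (s + e) \<and> P (s - e))"
 shows "eventually P (at s)"
proof -
 obtain b where b: "b > 0" "\<And>y. y > 0 ==> y < b ==> P (s + y) \<and> P (s - y)"
  using assms unfolding eventually_at_right[OF zero_less_one] by auto
 have "P y" if "y \<noteq> s" "dist y s < b" for y
  using b(2)[of "\<bar>y - s\<bar>"] that by (cases "y > s") (auto simp: dist_real_def)
 then show ?thesis using b(1) unfolding eventually_at by blast
qed

text \<open>By the dimension count a cell of codimension \<open>c\<close> has dimension
  \<open>dim K + DIM('b)\<close>. If its span maps onto the target, the kernel there is exactly
  \<open>K\<close>, a space of directions under which every cell is invariant; a nonempty fibre in
  the cell is then a single translate of \<open>K\<close>.\<close>

locale proj_deg =
 fixes H :: "('a::euclidean_space \<times> real) set" and c :: nat and f :: "'a => real"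
  and \<pi> :: "'a => 'b::euclidean_space" and K :: "'a set"
 assumes bal: "bal_weight H c f" and cen: "central H"
  and lin: "linear \<pi>" and lat: "\<pi> ` lat \<subseteq> lat"
  and K: "subspace K" and K_ker: "\<And>k. k \<in> K ==> \<pi> k = 0" and K_lin: "K \<subseteq> tang H 0"
  and dimK: "dim K + DIM('b) + c = DIM('a)"
begin

definition ix :: "'a set => nat"
 where "ix C = grp_ix lat (\<pi> ` (lat \<inter> dirs C))"

definition deg :: "'b => real"
 where "deg v = (\<Sum>C | C \<in> ocells H \<and> v \<in> \<pi> ` C. on_cell f C * ix C)"

text \<open>A nonzero \<open>ix C\<close> means that \<open>\<pi>\<close> maps the span of
  \<open>C\<close> onto the target, by the convention for infinite indices.\<close>

definition active :: "'a set set"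
 where "active = {C \<in> ocells H. on_cell f C \<noteq> 0 \<and> ix C \<noteq> 0}"

lemmas pure = bal_pure[OF bal]
lemmas arr = pureD(1)[OF pure]
lemmas fin = pureD(2)[OF pure]
lemmas cconst = pureD(3)[OF pure]

lemma K_orth: "k \<in> K ==> (u, d) \<in> H ==> u \<bullet> k = 0"
 using K_lin cen unfolding tang_def central_def by fastforce

lemma K_tan: "K \<subseteq> tang H x"
 using K_orth by (auto simp: tang_def)

lemma cell_subset_tan: "cell H x \<subseteq> tang H x"
proof
 fix z assume z: "z \<in> cell H x"
 have "z \<in> tang H z" using cen by (auto simp: tang_def central_def)
 then show "z \<in> tang H x" using cell_tang[OF z] by simp
qed

lemma mem_tan_self: "x \<in> tang H x"
 using cell_subset_tan cell_refl by blast

lemma cell_K: "z \<in> C ==> C \<in> ocells H ==> k \<in> K ==> z + k \<in> C"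
 unfolding ocells_def by (auto intro!: cell_tan_add K_orth)

lemma finite_active: "finite active"
 unfolding active_def using finite_ocells[OF fin] by simp

lemma deg_active: "deg v = (\<Sum>C | C \<in> active \<and> v \<in> \<pi> ` C. on_cell f C * ix C)"
 unfolding deg_def active_def
 by (rule sum.mono_neutral_right) (use finite_ocells[OF fin] in auto)

lemma sub_subgroup: "subspace D ==> subgrp (\<pi> ` (lat \<inter> D))"
 unfolding subgrp_def
proof (intro conjI ballI)
 assume D: "subspace D"
 then have L: "subgrp (lat \<inter> D)" using subgrp_Int lat_subgroup subgrp_subspace by blast
 show "0 \<in> \<pi> ` (lat \<inter> D)" using subgrp_0[OF L] lin linear_0 by force
 fix x y assume "x \<in> \<pi> ` (lat \<inter> D)" "y \<in> \<pi> ` (lat \<inter> D)"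
 then obtain x' y' where xy: "x' \<in> lat \<inter> D" "y' \<in> lat \<inter> D" "x = \<pi> x'" "y = \<pi> y'" by blast
 then have "x - y = \<pi> (x' - y')" using lin linear_diff by metis
 moreover have "x' - y' \<in> lat \<inter> D" using xy L subgrp_diff by blast
 ultimately show "x - y \<in> \<pi> ` (lat \<inter> D)" by blast
qed

lemma span_sub: "span (\<pi> ` (lat \<inter> tang H x)) = \<pi> ` tang H x"
 using tang_span_lat[OF arr, of x] lin by (metis linear_span_image Int_commute)

lemma active_cell:
 assumes "C \<in> active"
 obtains y where "C = cell H y" "dirs C = tang H y" "f y \<noteq> 0" "on_cell f C = f y"
  "dim (tang H y) + c = DIM('a)" "\<pi> ` tang H y = UNIV"
proof -
 obtain y where y: "C = cell H y" using assms by (auto simp: active_def ocells_def)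
 have d: "dirs C = tang H y" using y dirs_cell[OF fin] by simp
 have o: "on_cell f C = f y" using on_cell_cell[OF cconst] y by simp
 have f0: "f y \<noteq> 0" using assms o by (simp add: active_def)
 have "\<pi> ` tang H y = UNIV"
 proof (rule ccontr)
  assume "\<pi> ` tang H y \<noteq> UNIV"
  then have "grp_ix lat (\<pi> ` (lat \<inter> tang H y)) = 0"
   using grp_ix_lat_eq_0[OF sub_subgroup[OF sub_tang]] span_sub lat by blast
  then show False using assms d by (simp add: active_def ix_def)
 qed
 then show thesis using that y d o f0 pureD(4)[OF pure f0] by blast
qed

lemma active_kernel:
 assumes "C \<in> active" "x \<in> dirs C" "\<pi> x = 0"
 shows "x \<in> K"
proof -
 obtain y where y: "dirs C = tang H y" "dim (tang H y) + c = DIM('a)" "\<pi> ` tang H y = UNIV"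
  using active_cell[OF assms(1)] by metis
 let ?N = "{x \<in> tang H y. \<pi> x = 0}"
 have N: "subspace ?N" using sub_tang[of H y] lin
  by (auto simp: subspace_def linear_add linear_scale linear_0)
 have "dim ?N = dim K" using dim_image_kernel[OF lin sub_tang, of H y] y dimK by simp
 moreover have "K \<subseteq> ?N" using K_tan K_ker by auto
 ultimately have "K = ?N" using subspace_dim_equal[OF K N] by simp
 then show ?thesis using assms y by auto
qed

lemma active_subset_dirs: "C \<in> active ==> C \<subseteq> dirs C"
 using cell_subset_tan active_cell by metis

text \<open>The kernel of \<open>\<pi>\<close> on \<open>dirs C\<close> is \<open>K\<close>, and
  \<open>C\<close> is invariant under \<open>K\<close>, so membership in the image can be tested on
  any single lift.\<close>

lemma mem_image_active:
 assumes C: "C \<in> active" and p: "p \<in> dirs C"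
 shows "\<pi> p \<in> \<pi> ` C \<longleftrightarrow> p \<in> C"
proof
 assume "\<pi> p \<in> \<pi> ` C"
 then obtain z where z: "z \<in> C" "\<pi> p = \<pi> z" by auto
 have "p - z \<in> dirs C" using p z active_subset_dirs[OF C] sub_dirs subspace_diff by blast
 then have "p - z \<in> K" using active_kernel[OF C] z lin by (simp add: linear_diff)
 moreover have "C \<in> ocells H" using C by (simp add: active_def)
 ultimately have "z + (p - z) \<in> C" using cell_K[OF z(1)] by blast
 then show "p \<in> C" by simp
qed auto

definition plus :: "'b => 'b => 'a set => bool"
 where "plus v u C \<longleftrightarrow> near0 (\<lambda>e. v + e *R u \<in> \<pi> ` C)"

lemma plus_iff:
 assumes C: "C \<in> active" and p: "p \<in> dirs C" and q: "q \<in> dirs C"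
 shows "plus (\<pi> p) (\<pi> q) C \<longleftrightarrow> near0 (\<lambda>e. p + e *R q \<in> C)"
proof -
 have "\<pi> p + e *R \<pi> q \<in> \<pi> ` C \<longleftrightarrow> p + e *R q \<in> C" for e
 proof -
  have "p + e *R q \<in> dirs C" using p q by (simp add: subspace_add subspace_scale sub_dirs)
  from mem_image_active[OF C this] show ?thesis using lin by (simp add: linear_add linear_scale)
 qed
 then show ?thesis by (simp add: plus_def)
qed

lemma active_lift:
 assumes "C \<in> active"
 obtains p where "p \<in> dirs C" "\<pi> p = v"
 using active_cell[OF assms] by (metis UNIV_I imageE)

lemma plus_decided:
 assumes C: "C \<in> active"
 shows "near0 (\<lambda>r. v + r *R u \<in> \<pi> ` C \<longleftrightarrow> plus v u C)"
proof -
 obtain p where p: "p \<in> dirs C" "\<pi> p = v" using active_lift[OF C] by metis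
 obtain q where q: "q \<in> dirs C" "\<pi> q = u" using active_lift[OF C] by metis
 obtain z where z: "C = cell H z" using C by (auto simp: active_def ocells_def)
 have e: "v + r *R u \<in> \<pi> ` C \<longleftrightarrow> p + r *R q \<in> C" for r
 proof -
  have "p + r *R q \<in> dirs C" using p q by (simp add: subspace_add subspace_scale sub_dirs)
  from mem_image_active[OF C this] show ?thesis using lin p q by (simp add: linear_add linear_scale)
 qed
 show ?thesis using eventually_cell_decided[OF fin, of p q z]
 proof
  assume *: "near0 (\<lambda>r. p + r *R q \<in> cell H z)"
  then have "plus v u C" unfolding plus_def e unfolding z .
  then show ?thesis using * unfolding e unfolding z by simp
 next
  assume *: "near0 (\<lambda>r. p + r *R q \<notin> cell H z)"
  have "\<not> plus v u C"
  proof
   assume "plus v u C"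
   then have "near0 (\<lambda>r. p + r *R q \<in> cell H z)" unfolding plus_def e unfolding z .
   then have "near0 (\<lambda>_::real. False)" using * by eventually_elim simp
   then show False by simp
  qed
  then show ?thesis using * unfolding e unfolding z by simp
 qed
qed

lemma deg_plus:
 "near0 (\<lambda>e. deg (v + e *R u) = (\<Sum>C | C \<in> active \<and> plus v u C. on_cell f C * ix C))"
proof -
 have "near0 (\<lambda>e. \<forall>C\<in>active. v + e *R u \<in> \<pi> ` C \<longleftrightarrow> plus v u C)"
  using finite_active plus_decided by (intro eventually_ball_finite) auto
 then show ?thesis
 proof eventually_elim
  case (elim e)
  then show ?case unfolding deg_active by (intro sum.cong) auto
 qed
qed

text \<open>The lift \<open>p\<close> lies in the closure of \<open>C\<close>. If the tangent space
  at \<open>p\<close> still maps onto the target, dimensions force \<open>p \<in> C\<close>, and a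
  step backwards stays in \<open>C\<close> too. Otherwise \<open>reg\<close> makes the cell of
  \<open>p\<close> a ridge. So only ridges can change the degree at \<open>\<pi> p\<close>.\<close>

lemma plus_cases:
 assumes C: "C \<in> active" and p: "p \<in> dirs C" and q: "q \<in> dirs C"
  and reg: "\<And>x. \<pi> p \<in> \<pi> ` tang H x ==> \<pi> ` tang H x \<noteq> UNIV ==>
   dim (\<pi> ` tang H x) + 1 = DIM('b)"
  and plus: "plus (\<pi> p) (\<pi> q) C"
 shows "(p \<in> C \<and> plus (\<pi> p) (- \<pi> q) C) \<or>
  (p \<notin> C \<and> \<pi> ` tang H p \<noteq> UNIV \<and> dim (tang H p) + 1 + c = DIM('a))"
proof -
 obtain y where y: "C = cell H y" "dirs C = tang H y" "dim (tang H y) + c = DIM('a)"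
  using active_cell[OF C] by metis
 have pc: "p \<in> ccell H y" using into_ccell[OF fin] plus plus_iff[OF C p q] y by blast
 note sub = ccell_tang[OF pc]
 let ?N = "{x \<in> tang H p. \<pi> x = 0}"
 have "?N = K" using K_tan[of p] K_ker active_kernel[OF C] sub y by auto
 then have dimp: "dim (tang H p) = dim (\<pi> ` tang H p) + dim K"
  using dim_image_kernel[OF lin sub_tang, of H p] by simp
 show ?thesis
 proof (cases "\<pi> ` tang H p = UNIV")
  case True
  then have "dim (tang H y) \<le> dim (tang H p)" using dimp y dimK by simp
  then have pC: "p \<in> cell H y" using ccell_dim_eq[OF pc] by simp
  then have "- q \<in> tang H p" using q y cell_tang[OF pC] sub_tang subspace_neg by metis
  then have "near0 (\<lambda>e. p + e *R (- q) \<in> C)"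
   using step_tang[OF fin] y pC cell_eq_iff by metis
  moreover have "- q \<in> dirs C" using q sub_dirs subspace_neg by blast
  ultimately have "plus (\<pi> p) (\<pi> (- q)) C" using plus_iff[OF C p] by blast
  then show ?thesis using pC y lin by (simp add: linear_neg)
 next
  case False
  have "\<pi> p \<in> \<pi> ` tang H p" using mem_tan_self by auto
  then have "dim (\<pi> ` tang H p) + 1 = DIM('b)" using reg False by blast
  then have d: "dim (tang H p) + 1 + c = DIM('a)" using dimp dimK by simp
  have "p \<notin> C"
  proof
   assume "p \<in> C"
   then have "tang H p = tang H y" using y cell_tang by blast
   then show False using d y by simp
  qed
  then show ?thesis using False d by blast
 qed
qed

section \<open>Wall crossing and constancy of the degree\<close>

definition jump :: "'b => 'b => 'a set => real"
 where "jump v u C = on_cell f C * ix C * (of_bool (plus v u C) - of_bool (plus v (- u) C))"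

text \<open>The lattice of the cell behind \<open>r\<close> is that of the ridge plus the multiples
  of a lattice vector congruent to \<open>r\<close>, so that the functional of
  \<open>grp_ix_adjoin\<close> evaluates its index.\<close>

lemma ridge_cell:
 assumes t: "dim (tang H t) + 1 + c = DIM('a)"
  and a: "\<And>x. x \<in> \<pi> ` (lat \<inter> tang H t) ==> a \<bullet> x = 0"
   "\<And>w. w \<in> lat ==> grp_ix lat {x + of_int k *R w |x k. x \<in> \<pi> ` (lat \<inter> tang H t)} = \<bar>a \<bullet> w\<bar>"
  and r: "prim_mod (tang H t) r" "germ f t r \<noteq> 0"
  and C: "C \<in> ocells H" "near0 (\<lambda>d. t + d *R r \<in> C)"
 shows "on_cell f C = germ f t r" "dirs C = {k + q *R r |k q. k \<in> tang H t}" "ix C = \<bar>a \<bullet> \<pi> r\<bar>"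
proof -
 let ?K = "tang H t"
 obtain z where z: "C = cell H z" using C by (auto simp: ocells_def)
 have "near0 (\<lambda>d. t + d *R r \<in> C \<and> f (t + d *R r) = germ f t r \<and>
   tang H (t + d *R r) = tang (larr H t) r)"
  using C(2) eventually_germ[OF fin cconst] near0_tang[OF fin]
  by (intro eventually_conj) auto
 then obtain d where e: "t + d *R r \<in> C" "f (t + d *R r) = germ f t r"
   "tang H (t + d *R r) = tang (larr H t) r" using near0_ex by blast
 have Ce: "C = cell H (t + d *R r)" using e(1) z cell_eq_iff by metis
 show "on_cell f C = germ f t r" unfolding Ce using on_cell_cell[OF cconst] e(2) by simp
 have dC: "dirs C = tang (larr H t) r" unfolding Ce dirs_cell[OF fin] e(3) ..
 have "dim (tang (larr H t) r) = dim ?K + 1" using germ_dim[OF pure r(2)] t by simp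
 then have D: "dirs C = {k + q *R r |k q. k \<in> ?K}"
  unfolding dC
  by (intro subspace_adjoin_eq sub_tang tang_subset_link mem_tang_link prim_mod_notin r)
 then show "dirs C = {k + q *R r |k q. k \<in> ?K}" .
 obtain v where v: "v \<in> lat" "v - r \<in> ?K" using prim_mod_rep[OF r(1)] by metis
 have "\<pi> ` (lat \<inter> dirs C) = {x + of_int k *R \<pi> v |x k. x \<in> \<pi> ` (lat \<inter> ?K)}"
  unfolding D prim_mod_lattice[OF r(1) sub_tang v]
  using lin by (fastforce simp: linear_add linear_scale image_iff)
 moreover have "\<pi> v \<in> lat" using v lat by auto
 ultimately have "ix C = \<bar>a \<bullet> \<pi> v\<bar>" using a(2) by (simp add: ix_def)
 also have "a \<bullet> \<pi> v = a \<bullet> \<pi> r"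
 proof -
  have "\<pi> (v - r) \<in> span (\<pi> ` (lat \<inter> ?K))" using v span_sub by auto
  moreover have "orthogonal a x" if "x \<in> \<pi> ` (lat \<inter> ?K)" for x using a(1) that by (simp add: orthogonal_def)
  ultimately have "orthogonal a (\<pi> (v - r))" using orthogonal_to_span by blast
  then show ?thesis using lin by (simp add: orthogonal_def linear_diff inner_diff_right)
 qed
 finally show "ix C = \<bar>a \<bullet> \<pi> r\<bar>" .
qed

text \<open>Cells with nonzero jump are grouped by the ridge that contains the lift of
  \<open>v\<close>. In one group the jumps are
  \<open>germ f t r * (a \<bullet> \<pi> r) * sgn (a \<bullet> u)\<close>, the signs recording the
  side of the wall, and their sum over \<open>r\<close> is a multiple of
  \<open>a \<bullet> \<pi> s\<close> for the balancing sum \<open>s\<close>.\<close>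

lemma jump_sum_zero:
 assumes reg: "\<And>x. v \<in> \<pi> ` tang H x ==> \<pi> ` tang H x \<noteq> UNIV ==>
   dim (\<pi> ` tang H x) + 1 = DIM('b) \<and> u \<notin> \<pi> ` tang H x"
 shows "(\<Sum>C\<in>active. jump v u C) = 0"
proof -
 define P where "P C = (SOME p. p \<in> dirs C \<and> \<pi> p = v)" for C
 define Q where "Q C = (SOME q. q \<in> dirs C \<and> \<pi> q = u)" for C
 have P: "P C \<in> dirs C" "\<pi> (P C) = v" if "C \<in> active" for C
  using someI_ex[of "\<lambda>p. p \<in> dirs C \<and> \<pi> p = v"] active_lift[OF that] unfolding P_def by metis+
 have Q: "Q C \<in> dirs C" "\<pi> (Q C) = u" if "C \<in> active" for C
  using someI_ex[of "\<lambda>p. p \<in> dirs C \<and> \<pi> p = u"] active_lift[OF that] unfolding Q_def by metis+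
 have reg': "dim (\<pi> ` tang H x) + 1 = DIM('b)"
  if "v \<in> \<pi> ` tang H x" "\<pi> ` tang H x \<noteq> UNIV" for x using reg that by blast
 have ridge: "P C \<notin> C \<and> \<pi> ` tang H (P C) \<noteq> UNIV \<and> dim (tang H (P C)) + 1 + c = DIM('a)"
  if C: "C \<in> active" and j: "jump v u C \<noteq> 0" for C
 proof -
  have "plus v u C \<noteq> plus v (- u) C" using j by (auto simp: jump_def)
  then consider "plus v u C" "\<not> plus v (- u) C" | "plus v (- u) C" "\<not> plus v u C" by blast
  then show ?thesis
  proof cases
   case 1
   then show ?thesis using plus_cases[OF C P(1)[OF C] Q(1)[OF C]] P[OF C] Q[OF C] reg' by simp
  next
   case 2
   have "- Q C \<in> dirs C" using Q[OF C] sub_dirs subspace_neg by blast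
   then show ?thesis using plus_cases[OF C P(1)[OF C], of "- Q C"] P[OF C] Q[OF C] reg' 2 lin
    by (simp add: linear_neg)
  qed
 qed
 \<comment> \<open>Lifts of \<open>v\<close> to different cells may differ, but within a group they
   lie in the same cell \<open>B\<close>, along which links and germs do not change.\<close>
 have group0: "(\<Sum>C | C \<in> active \<and> cell H (P C) = B. jump v u C) = 0" for B
 proof (cases "\<exists>C0\<in>active. cell H (P C0) = B \<and> jump v u C0 \<noteq> 0")
  case False
  then show ?thesis by (intro sum.neutral) auto
 next
  case True
  then obtain C0 where C0: "C0 \<in> active" "cell H (P C0) = B" "jump v u C0 \<noteq> 0" by blast
  define t where "t = P C0"
  let ?K = "tang H t"
  have B: "B = cell H t" using C0 t_def by simp
  have t: "\<pi> ` ?K \<noteq> UNIV" "dim ?K + 1 + c = DIM('a)" "\<pi> t = v" using ridge[OF C0(1,3)] P[OF C0(1)] by (auto simp: t_def)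
  have vK: "v \<in> \<pi> ` ?K" using t mem_tan_self by blast
  have uK: "u \<notin> \<pi> ` ?K" and dimpK: "dim (\<pi> ` ?K) + 1 = DIM('b)" using reg[OF vK t(1)] by auto
  let ?T = "\<pi> ` (lat \<inter> ?K)"
  have "dim ?T = dim (\<pi> ` ?K)" using span_sub[of t] by (metis dim_span)
  then have "dim ?T + 1 = DIM('b)" using dimpK by simp
  then obtain a where a: "\<And>x. x \<in> ?T ==> a \<bullet> x = 0"
   "\<And>w. w \<in> lat ==> grp_ix lat {x + of_int k *R w |x k. x \<in> ?T} = \<bar>a \<bullet> w\<bar>"
   using grp_ix_adjoin[OF sub_subgroup[OF sub_tang]] lat by blast
  have aK: "a \<bullet> \<pi> k = 0" if "k \<in> ?K" for k
  proof -
   have "\<pi> k \<in> span ?T" using that span_sub by auto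
   moreover have "orthogonal a x" if "x \<in> ?T" for x using a(1) that by (simp add: orthogonal_def)
   ultimately have "orthogonal a (\<pi> k)" using orthogonal_to_span by blast
   then show ?thesis by (simp add: orthogonal_def)
  qed
  let ?L = "larr H t"
  define R where "R = {r. prim_mod ?K r \<and> germ f t r \<noteq> 0}"
  \<comment> \<open>For \<open>a \<bullet> \<pi> r = 0\<close> the cell behind \<open>r\<close> has
    index 0 and is not active.\<close>
  define R' where "R' = {r \<in> R. a \<bullet> \<pi> r \<noteq> 0}"
  have finR: "finite R" unfolding R_def by (rule finite_primitive_germ[OF pure t(2)])
  have Rsum: "(\<Sum>r\<in>R. germ f t r *R r) = 0"
   using bal t(2) unfolding bal_weight_def balanced_at_def R_def by blast
  define Cr where "Cr r = (SOME C. C \<in> ocells H \<and> near0 (\<lambda>h. t + h *R r \<in> C))" for r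
  have exCr: "\<exists>C. C \<in> ocells H \<and> near0 (\<lambda>h. t + h *R r \<in> C)" for r
   by (rule cell_step[OF fin, of t r]) (auto simp: ocells_def)
  have Cr: "Cr r \<in> ocells H" "near0 (\<lambda>h. t + h *R r \<in> Cr r)" for r
   using someI_ex[OF exCr[of r]] unfolding Cr_def by auto
  have Cr_unique: "C = Cr r" if CO: "C \<in> ocells H" and ev: "near0 (\<lambda>h. t + h *R r \<in> C)" for C r
  proof -
   obtain h where "t + h *R r \<in> C" "t + h *R r \<in> Cr r"
    using near0_ex[OF eventually_conj[OF ev Cr(2)[of r]]] by blast
   then show ?thesis using CO Cr(1)[of r] cell_eq_iff unfolding ocells_def by (metis imageE)
  qed
  have Crc: "near0 (\<lambda>h. t + h *R s \<in> Cr r)" if "s \<in> cell ?L r" for s r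
  proof -
   obtain y where y: "Cr r = cell H y" using Cr(1)[of r] by (auto simp: ocells_def)
   have "\<forall>(w, d)\<in>H. step_sgn w d t s = step_sgn w d t r" using link_cell_step[OF that] by blast
   then show ?thesis
    using eventually_conj[OF Cr(2)[of r] eventually_conj[OF near0_step[OF fin, of t r] near0_step[OF fin, of t s]]]
    by (elim eventually_mono) (fastforce simp: y cell_def)
  qed
  have R'Cr: "Cr r \<in> active \<and> cell H (P (Cr r)) = B \<and>
    jump v u (Cr r) = germ f t r * (a \<bullet> \<pi> r) * sgn (a \<bullet> u)" if r: "r \<in> R'" for r
  proof -
   have rR: "prim_mod ?K r" "germ f t r \<noteq> 0" "a \<bullet> \<pi> r \<noteq> 0" using r by (auto simp: R_def R'_def)
   let ?C = "Cr r"
   note rc = ridge_cell[OF t(2) a rR(1,2) Cr]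
   have act: "?C \<in> active" using Cr(1) rc rR by (simp add: active_def)
   have KC: "?K \<subseteq> dirs ?C"
   proof
    fix k assume "k \<in> ?K"
    then have "k \<in> {k + q *R r |k q. k \<in> ?K}" by (intro CollectI exI[of _ k] exI[of _ 0]) simp
    then show "k \<in> dirs ?C" using rc(2) by simp
   qed
   have tC: "t \<in> dirs ?C" using KC mem_tan_self by blast
   have "P ?C - t \<in> dirs ?C" using P[OF act] tC sub_dirs subspace_diff by blast
   then have "P ?C - t \<in> K" using active_kernel[OF act] P[OF act] t lin by (simp add: linear_diff)
   then have "t + (P ?C - t) \<in> cell H t" using cell_K[OF cell_refl] unfolding ocells_def by blast
   then have PB: "cell H (P ?C) = B" using B by (simp add: cell_eq_iff)
   \<comment> \<open>\<open>z\<close> is the coordinate of the lift of \<open>u\<close> transversal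
     to the ridge; its sign decides whether the step along \<open>u\<close> or the step along
     \<open>- u\<close> enters the cell.\<close>
   obtain k z where Qk: "Q ?C = k + z *R r" "k \<in> ?K" using Q[OF act] rc(2) by blast
   have au: "a \<bullet> u = z * (a \<bullet> \<pi> r)"
    using Q[OF act] Qk aK lin by (metis (no_types, opaque_lifting) add_0 inner_add_right inner_scaleR_right linear_add linear_scale)
   have th0: "z \<noteq> 0"
   proof
    assume "z = 0"
    then have "u = \<pi> k" using Q[OF act] Qk by simp
    then show False using uK Qk by blast
   qed
   have tnC: "t \<notin> ?C"
   proof
    assume "t \<in> ?C"
    then have "?C = cell H t" using Cr(1) cell_eq_iff unfolding ocells_def by (metis imageE)
    then have "dirs ?C = ?K" using dirs_cell[OF fin] by simp
    moreover have "r \<in> dirs ?C"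
    proof -
     have "r \<in> {k + q *R r |k q. k \<in> ?K}"
      using subspace_0[OF sub_tang] by (intro CollectI exI[of _ 0] exI[of _ 1]) simp
     then show ?thesis using rc(2) by simp
    qed
    ultimately show False using prim_mod_notin[OF rR(1)] by simp
   qed
   have pos: "near0 (\<lambda>h. t + h *R (S *R Q ?C) \<in> ?C)" if "S * z > 0" for S
   proof (rule Crc)
    show "S *R Q ?C \<in> cell ?L r"
    proof -
     have "w \<bullet> (S *R Q ?C) = (S * z) * (w \<bullet> r)" if "(w, w \<bullet> t) \<in> H" for w
      using Qk that by (auto simp: tang_def inner_add_right)
     then have "sgn (w \<bullet> (S *R Q ?C)) = sgn (w \<bullet> r)" if "(w, w \<bullet> t) \<in> H" for w
      by (metis that \<open>S * z > 0\<close> sgn_mult sgn_pos mult_1)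
     then show ?thesis by (auto simp: cell_def larr_def simp del: inner_scaleR_right)
    qed
   qed
   have Q': "S *R Q ?C \<in> dirs ?C" for S using Q[OF act] sub_dirs subspace_scale by blast
   have plus_pos: "plus v (S *R u) ?C" if "S * z > 0" for S
    using pos[OF that] plus_iff[OF act tC Q'] t Q[OF act] lin by (simp add: linear_scale)
   have plus_neg: "\<not> plus v (S *R u) ?C" if s: "S * z < 0" for S
   proof
    assume "plus v (S *R u) ?C"
    then have 1: "near0 (\<lambda>h. t + h *R (S *R Q ?C) \<in> ?C)"
     using plus_iff[OF act tC Q'] t Q[OF act] lin by (simp add: linear_scale)
    have 2: "near0 (\<lambda>h. t + h *R ((- S) *R Q ?C) \<in> ?C)" using pos[of "- S"] s by simp
    obtain h where e: "t + h *R (S *R Q ?C) \<in> ?C" "t + h *R ((- S) *R Q ?C) \<in> ?C"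
     using near0_ex[OF eventually_conj[OF 1 2]] by blast
    \<comment> \<open>\<open>t\<close> is the midpoint of a forward and a backward point, so
      convexity would put it into the cell.\<close>
    have "convex ?C" using Cr(1)[of r] convex_cell by (auto simp: ocells_def)
    then have "(1/2) *R (t + h *R (S *R Q ?C)) + (1/2) *R (t + h *R ((- S) *R Q ?C)) \<in> ?C"
     using e by (intro convexD) auto
    moreover have "(1/2) *R (t + h *R (S *R Q ?C)) + (1/2) *R (t + h *R ((- S) *R Q ?C)) = t"
    proof -
     have "(1/2) *R (t + x) + (1/2) *R (t + - x) = t" for x
     proof -
      have "(1/2) *R (t + x) + (1/2) *R (t + - x) = (1/2) *R t + (1/2) *R t"
       by (simp add: algebra_simps)
      also have "\<dots> = t" by (metis field_sum_of_halves scaleR_left_distrib scaleR_one)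
      finally show ?thesis .
     qed
     from this[of "h *R (S *R Q ?C)"] show ?thesis by simp
    qed
    ultimately show False using tnC by simp
   qed
   have ixr: "ix ?C = \<bar>a \<bullet> \<pi> r\<bar>" using rc(3) .
   have "of_bool (plus v u ?C) - of_bool (plus v (- u) ?C) = sgn z"
   proof (cases "z > 0")
    case True
    then show ?thesis using plus_pos[of 1] plus_neg[of "-1"] by simp
   next
    case False
    then have "z < 0" using th0 by simp
    then show ?thesis using plus_neg[of 1] plus_pos[of "-1"] by simp
   qed
   then have "jump v u ?C = germ f t r * \<bar>a \<bullet> \<pi> r\<bar> * sgn z" using rc(1) by (simp add: jump_def ixr)
   also have "\<dots> = germ f t r * (a \<bullet> \<pi> r) * sgn (a \<bullet> u)"
    unfolding au sgn_mult abs_sgn[of "a \<bullet> \<pi> r"] by simp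
   finally show ?thesis using act PB by blast
  qed
  have inj: "inj_on Cr R'"
  proof (rule inj_onI)
   fix r r' assume r: "r \<in> R'" "r' \<in> R'" "Cr r = Cr r'"
   have dim: "dim (tang ?L r) = dim ?K + 1" using germ_dim[OF pure, of t r] r t by (simp add: R'_def R_def)
   obtain y where y: "Cr r = cell H y" using Cr(1)[of r] by (auto simp: ocells_def)
   have ev: "near0 (\<lambda>h. t + h *R r' \<in> cell H y)" "near0 (\<lambda>h. t + h *R r \<in> cell H y)"
    using Cr(2)[of r'] Cr(2)[of r] r(3) y by auto
   obtain h where e: "t + h *R r' \<in> cell H y" "t + h *R r \<in> cell H y"
     "\<forall>(u, c)\<in>H. sgn (u \<bullet> (t + h *R r') - c) = step_sgn u c t r'"
     "\<forall>(u, c)\<in>H. sgn (u \<bullet> (t + h *R r) - c) = step_sgn u c t r"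
    using near0_ex[OF eventually_conj[OF ev(1) eventually_conj[OF ev(2)
      eventually_conj[OF near0_step[OF fin, of t r'] near0_step[OF fin, of t r]]]]] by blast
   have "r' \<in> cell ?L r"
   proof (rule link_cell_stepD)
    fix w d assume "(w, d) \<in> H"
    then show "step_sgn w d t r' = step_sgn w d t r" using e by (fastforce simp: cell_def)
   qed
   then show "r = r'" using prim_mod_cell_unique[OF refl dim] r by (auto simp: R'_def R_def)
  qed
  \<comment> \<open>A cell with nonzero jump is entered from its lift in some direction
    \<open>s\<close>. Links and germs at the lift agree with those at \<open>t\<close>, and the
    primitive vector in the local cell of \<open>s\<close> accounts for the cell.\<close>
  have onto: "C \<in> Cr ` R'" if C: "C \<in> active" "cell H (P C) = B" "jump v u C \<noteq> 0" for C
  proof -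
   let ?p = "P C"
   have "plus v u C \<noteq> plus v (- u) C" using C(3) by (auto simp: jump_def)
   then obtain s where s: "near0 (\<lambda>h. ?p + h *R s \<in> C)"
   proof (cases "plus v u C")
    case True
    then have "plus (\<pi> ?p) (\<pi> (Q C)) C" using P[OF C(1)] Q[OF C(1)] by simp
    then show thesis using that plus_iff[OF C(1) P(1)[OF C(1)] Q(1)[OF C(1)]] by blast
   next
    case False
    have q: "- Q C \<in> dirs C" using Q[OF C(1)] sub_dirs subspace_neg by blast
    have "plus (\<pi> ?p) (\<pi> (- Q C)) C"
     using P[OF C(1)] Q[OF C(1)] lin False \<open>plus v u C \<noteq> plus v (- u) C\<close> by (simp add: linear_neg)
    then show thesis using that plus_iff[OF C(1) P(1)[OF C(1)] q] by blast
   qed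
   have pt: "?p \<in> cell H t" using C(2) B by (simp add: cell_eq_iff)
   note congs = cell_tang[OF pt] larr_cell_cong[OF pt] germ_cell_cong[OF fin cconst pt]
   obtain y where y: "C = cell H y" "on_cell f C = f y" "f y \<noteq> 0" using active_cell[OF C(1)] by metis
   have "near0 (\<lambda>h. f (?p + h *R s) = f y)"
    using s by eventually_elim (use cconst y in \<open>auto simp: cell_const_def\<close>)
   then have "germ f ?p s = f y" by (rule germ_eqI)
   then have gs: "germ f t s = f y" using congs by simp
   then have "dim (tang ?L s) = dim ?K + 1" using germ_dim[OF pure, of t s] y t by simp
   then obtain r where r: "prim_mod ?K r" "r \<in> cell ?L s" using ex_prim_mod_tan[OF arr] by metis
   have "cell_const ?L (germ f t)" using cell_const_germ[OF fin cconst] .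
   then have gr: "germ f t r = f y" using r(2) gs by (auto simp: cell_const_def)
   have stp: "step_sgn w d ?p s' = step_sgn w d t s'" if "(w, d) \<in> H" for w d s'
    using pt that cell_zero_iff[OF pt that] by (auto simp: step_sgn_def cell_def)
   have "near0 (\<lambda>h. t + h *R r \<in> C)"
    using eventually_conj[OF s eventually_conj[OF near0_step[OF fin, of ?p s] near0_step[OF fin, of t r]]]
   proof eventually_elim
    case (elim h)
    have "sgn (w \<bullet> (t + h *R r) - d) = sgn (w \<bullet> y - d)" if wd: "(w, d) \<in> H" for w d
    proof -
     have "sgn (w \<bullet> (t + h *R r) - d) = step_sgn w d t r" using elim wd by auto
     also have "\<dots> = step_sgn w d t s" using link_cell_step[OF r(2) wd] .
     also have "\<dots> = step_sgn w d ?p s" using stp[OF wd] by simp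
     also have "\<dots> = sgn (w \<bullet> (?p + h *R s) - d)" using elim wd by auto
     also have "\<dots> = sgn (w \<bullet> y - d)" using elim wd y(1) by (fastforce simp: cell_def)
     finally show ?thesis .
    qed
    then show ?case unfolding y(1) cell_def by blast
   qed
   then have CC: "C = Cr r" using Cr_unique C(1) by (auto simp: active_def)
   have g0: "germ f t r \<noteq> 0" using gr y by simp
   have "ix C = \<bar>a \<bullet> \<pi> r\<bar>" unfolding CC by (rule ridge_cell(3)[OF t(2) a r(1) g0 Cr])
   then have "a \<bullet> \<pi> r \<noteq> 0" using C(1) by (auto simp: active_def)
   then have "r \<in> R'" using r(1) g0 by (simp add: R'_def R_def)
   then show ?thesis using CC by simp
  qed
  have "(\<Sum>C | C \<in> active \<and> cell H (P C) = B. jump v u C) = (\<Sum>C\<in>Cr ` R'. jump v u C)"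
   using finite_active R'Cr onto by (intro sum.mono_neutral_right) auto
  also have "\<dots> = (\<Sum>r\<in>R'. germ f t r * (a \<bullet> \<pi> r) * sgn (a \<bullet> u))"
   using inj R'Cr by (simp add: sum.reindex)
  also have "\<dots> = (\<Sum>r\<in>R. germ f t r * (a \<bullet> \<pi> r) * sgn (a \<bullet> u))"
   using finR by (intro sum.mono_neutral_left) (auto simp: R'_def)
  also have "\<dots> = (a \<bullet> \<pi> (\<Sum>r\<in>R. germ f t r *R r)) * sgn (a \<bullet> u)"
   using lin by (simp add: linear_sum linear_scale inner_sum_right sum_distrib_right)
  also have "\<dots> = 0" using Rsum lin by (simp add: linear_0)
  finally show ?thesis .
 qed
 have "(\<Sum>C\<in>active. jump v u C) = (\<Sum>B\<in>ocells H. \<Sum>C | C \<in> active \<and> cell H (P C) = B. jump v u C)"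
  using finite_active finite_ocells[OF fin]
  by (subst sum.group) (auto simp: ocells_def)
 also have "\<dots> = 0" using group0 by simp
 finally show ?thesis .
qed

text \<open>The value on both sides is the sum over the cells entered from \<open>v\<close>, equal
  for \<open>u\<close> and \<open>- u\<close> by \<open>jump_sum_zero\<close>. If \<open>v\<close>
  lies on no wall, the image of an active cell is entered from \<open>v\<close> exactly when it
  contains \<open>v\<close>, so the value is attained at \<open>v\<close> itself.\<close>

lemma deg_local:
 assumes reg: "\<And>x. v \<in> \<pi> ` tang H x ==> \<pi> ` tang H x \<noteq> UNIV ==>
   dim (\<pi> ` tang H x) + 1 = DIM('b) \<and> u \<notin> \<pi> ` tang H x"
 shows "\<exists>m. near0 (\<lambda>e. deg (v + e *R u) = m \<and> deg (v - e *R u) = m) \<and>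
  ((\<forall>x. \<pi> ` tang H x \<noteq> UNIV --> v \<notin> \<pi> ` tang H x) --> deg v = m)"
proof (intro exI conjI impI)
 define m where "m = (\<Sum>C | C \<in> active \<and> plus v u C. on_cell f C * ix C)"
 have if_sum: "(\<Sum>C | C \<in> active \<and> plus v u' C. on_cell f C * ix C) =
   (\<Sum>C\<in>active. on_cell f C * ix C * of_bool (plus v u' C))" for u'
  using finite_active by (simp add: sum.inter_filter if_distrib of_bool_def cong: if_cong)
 have "m - (\<Sum>C | C \<in> active \<and> plus v (- u) C. on_cell f C * ix C) = (\<Sum>C\<in>active. jump v u C)"
  unfolding m_def if_sum jump_def by (simp add: sum_subtractf right_diff_distrib)
 then have m2: "(\<Sum>C | C \<in> active \<and> plus v (- u) C. on_cell f C * ix C) = m"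
  using jump_sum_zero[OF reg] by simp
 show "near0 (\<lambda>e. deg (v + e *R u) = m \<and> deg (v - e *R u) = m)"
  using deg_plus[of v u] deg_plus[of v "- u"] by eventually_elim (simp add: m_def m2[unfolded m_def])
 assume good: "\<forall>x. \<pi> ` tang H x \<noteq> UNIV --> v \<notin> \<pi> ` tang H x"
 have "v \<in> \<pi> ` C \<longleftrightarrow> plus v u C" if C: "C \<in> active" for C
 proof -
  obtain p where p: "p \<in> dirs C" "\<pi> p = v" using active_lift[OF C] by metis
  obtain q where q: "q \<in> dirs C" "\<pi> q = u" using active_lift[OF C] by metis
  obtain y where y: "C = cell H y" "dirs C = tang H y" using active_cell[OF C] by metis
  show ?thesis
  proof
   assume "v \<in> \<pi> ` C"
   then have pC: "p \<in> C" using mem_image_active[OF C p(1)] p by simp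
   then have "p \<in> cell H y" using y by simp
   then have "p \<in> cell H y" "q \<in> tang H p" using y(2) q(1) cell_tang[of p H y] by auto
   then have "near0 (\<lambda>e. p + e *R q \<in> C)"
    using step_tang[OF fin] y cell_eq_iff by metis
   then show "plus v u C" using plus_iff[OF C p(1) q(1)] p q by simp
  next
   assume "plus v u C"
   then have "plus (\<pi> p) (\<pi> q) C" using p q by simp
   from plus_cases[OF C p(1) q(1) _ this] have "p \<in> C \<or> \<pi> ` tang H p \<noteq> UNIV" using good p by blast
   moreover have "\<pi> p \<in> \<pi> ` tang H p" using mem_tan_self by blast
   ultimately show "v \<in> \<pi> ` C" using good p by blast
  qed
 qed
 then show "deg v = m" unfolding deg_active m_def by (intro sum.cong) auto
qed

lemma image_tan_subspace: "subspace (\<pi> ` tang H x)"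
 using lin sub_tang linear_subspace_image by blast

text \<open>Two points off all walls whose connecting segment avoids the walls of codimension at
  least 2 have the same degree, since along it the degree is constant on punctured neighbourhoods.
  Other pairs are linked through a third point in general position to both.\<close>

theorem deg_constant: "\<exists>m. generic (\<lambda>v. deg v = m)"
proof -
 define S1 where "S1 = {V \<in> (\<lambda>x. \<pi> ` tang H x) ` UNIV. V \<noteq> UNIV}"
 define S2 where "S2 = {V \<in> S1. dim V + 1 < DIM('b)}"
 have fin1: "finite S1"
 proof -
  have "(\<lambda>x. \<pi> ` tang H x) ` UNIV = (\<lambda>T. \<pi> ` T) ` range (tang H)" by auto
  then show ?thesis using finite_range_tang[OF fin] by (simp add: S1_def)
 qed
 have sub1: "subspace V \<and> V \<noteq> UNIV" if "V \<in> S1" for V using that image_tan_subspace by (auto simp: S1_def)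
 have fin2: "finite S2" using fin1 by (simp add: S2_def)
 have line: "deg v = deg w" if v: "v \<notin> \<Union>S1" and w: "w \<notin> \<Union>S1" and wS: "\<forall>V\<in>S2. w \<notin> span (insert v V)" for v w
 proof -
  define g where "g s = deg (v + s *R (w - v))" for s :: real
  have "\<exists>m. eventually (\<lambda>s'. g s' = m) (at s) \<and> (s = 0 \<or> s = 1 --> g s = m)" for s
  proof -
   let ?v = "v + s *R (w - v)" and ?u = "w - v"
   have reg: "dim (\<pi> ` tang H x) + 1 = DIM('b) \<and> ?u \<notin> \<pi> ` tang H x"
    if x: "?v \<in> \<pi> ` tang H x" "\<pi> ` tang H x \<noteq> UNIV" for x
   proof -
    let ?V = "\<pi> ` tang H x"
    have V1: "?V \<in> S1" using x by (auto simp: S1_def)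
    have subV: "subspace ?V" by (rule image_tan_subspace)
    have "?V \<notin> S2"
    proof
     assume V2: "?V \<in> S2"
     have s0: "s \<noteq> 0" using x(1) v V1 by auto
     \<comment> \<open>A point of the line in the wall at a parameter \<open>s \<noteq> 0\<close>
       would express \<open>w\<close> through \<open>v\<close> and the wall.\<close>
     have "?v - (1 - s) *R v \<in> span (insert v ?V)"
      using x(1) by (intro span_diff span_scale) (auto intro: span_base)
     then have "(1 / s) *R (?v - (1 - s) *R v) \<in> span (insert v ?V)" by (rule span_scale)
     moreover have "(1 / s) *R (?v - (1 - s) *R v) = w" using s0 by (simp add: algebra_simps)
     ultimately show False using wS V2 by auto
    qed
    then have "dim ?V + 1 \<ge> DIM('b)" using V1 by (auto simp: S2_def)
    moreover have "dim ?V < DIM('b)"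
    proof -
     have "dim ?V \<noteq> DIM('b)" using x(2) dim_eq_full[of ?V] subV by (metis span_eq_iff)
     then show ?thesis using dim_subset_UNIV[of ?V] by linarith
    qed
    moreover have "?u \<notin> ?V"
    proof
     assume "?u \<in> ?V"
     then have "?v - s *R ?u \<in> ?V" using x(1) subV subspace_diff subspace_scale by blast
     then show False using v V1 by auto
    qed
    ultimately show ?thesis by linarith
   qed
   obtain m where m: "near0 (\<lambda>e. deg (?v + e *R ?u) = m \<and> deg (?v - e *R ?u) = m)"
    "(\<forall>x. \<pi> ` tang H x \<noteq> UNIV --> ?v \<notin> \<pi> ` tang H x) --> deg ?v = m"
    using deg_local[OF reg] by blast
   have "near0 (\<lambda>e. g (s + e) = m \<and> g (s - e) = m)"
    using m(1) by eventually_elim (simp add: g_def algebra_simps)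
   then have "eventually (\<lambda>s'. g s' = m) (at s)" by (rule eventually_at_two_sided)
   moreover have "s = 0 \<or> s = 1 --> g s = m"
   proof
    assume "s = 0 \<or> s = 1"
    then have "?v = v \<or> ?v = w" by auto
    then have "?v \<notin> \<Union>S1" using v w by metis
    then show "g s = m" using m(2) by (auto simp: g_def S1_def)
   qed
   ultimately show ?thesis by blast
  qed
  then have "g 0 = g 1" by (rule punctured_locally_const_imp_eq)
  then show ?thesis by (simp add: g_def)
 qed
 have eq: "deg v = deg v'" if v: "v \<notin> \<Union>S1" and v': "v' \<notin> \<Union>S1" for v v'
 proof -
  have gen: "generic (\<lambda>w. \<forall>V\<in>S2. w \<notin> span (insert x V))" for x
  proof (rule generic_ball[OF fin2])
   fix V assume V: "V \<in> S2"
   \<comment> \<open>Codimension at least 2 leaves room: after adjoining one vector the subspace is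
     still proper.\<close>
   have "dim (span (insert x V)) < DIM('b)" using V by (auto simp: S2_def dim_insert)
   then have "span (insert x V) \<noteq> UNIV" by (metis dim_UNIV less_irrefl)
   then show "generic (\<lambda>w. w \<notin> span (insert x V))" by (intro generic_not_mem) auto
  qed
  have gen1: "generic (\<lambda>w. w \<notin> \<Union>S1)" by (rule genericI[OF fin1]) (use sub1 in auto)
  obtain w where "w \<notin> \<Union>S1" "\<forall>V\<in>S2. w \<notin> span (insert v V)" "\<forall>V\<in>S2. w \<notin> span (insert v' V)"
   using generic_ex[OF generic_conj[OF gen1 generic_conj[OF gen[of v] gen[of v']]]] by blast
  then show ?thesis using line v v' by metis
 qed
 have gen1: "generic (\<lambda>w. w \<notin> \<Union>S1)" by (rule genericI[OF fin1]) (use sub1 in auto)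
 then obtain v where v: "v \<notin> \<Union>S1" using generic_ex by blast
 have "generic (\<lambda>w. deg w = deg v)" by (rule generic_mono[OF gen1]) (rule eq[OF _ v])
 then show ?thesis by blast
qed

end


subsection \<open>Products of weights\<close>

lemma zero_in_lat [simp]: "0 \<in> lat"
 by (rule subgrp_0[OF lat_subgroup])

lemma Collect_image_pred: "{C \<in> F ` X. P C} = F ` {x \<in> X. P (F x)}"
 by auto

definition prod_arr :: "('a::euclidean_space \<times> real) set => ('b::euclidean_space \<times> real) set => (('a \<times> 'b) \<times> real) set"
 where "prod_arr H H' = (\<lambda>(u, c). ((u, 0), c)) ` H \<union> (\<lambda>(u, c). ((0, u), c)) ` H'"

definition tensor :: "('a => real) => ('b => real) => 'a \<times> 'b => real"
 where "tensor f g = (\<lambda>(x, y). f x * g y)"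

lemma ball_prod_arr:
 "(\<forall>(u, c)\<in>prod_arr H H'. P u c) \<longleftrightarrow> (\<forall>(u, c)\<in>H. P (u, 0) c) \<and> (\<forall>(u, c)\<in>H'. P (0, u) c)"
 by (auto simp: prod_arr_def ball_Un split: prod.splits)

lemma cell_prod_arr: "cell (prod_arr H H') (x, y) = cell H x \<times> cell H' y"
 by (auto simp: cell_def ball_prod_arr inner_Pair)

lemma tang_prod_arr: "tang (prod_arr H H') (x, y) = tang H x \<times> tang H' y"
 by (auto simp: tang_def ball_prod_arr inner_Pair)

lemma arrg_prod_arr: "arrg H ==> arrg H' ==> arrg (prod_arr H H')"
 unfolding arrg_def ball_prod_arr by (auto simp: prod_arr_def lat_Times)

lemma central_prod_arr: "central H ==> central H' ==> central (prod_arr H H')"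
 unfolding central_def ball_prod_arr by simp

lemma ocells_prod_arr:
 "ocells (prod_arr H H') = (\<lambda>(A, B). A \<times> B) ` (ocells H \<times> ocells H')"
proof (intro equalityI subsetI)
 fix C assume "C \<in> ocells (prod_arr H H')"
 then obtain x y where "C = cell (prod_arr H H') (x, y)" by (auto simp: ocells_def)
 then have "C = (\<lambda>(A, B). A \<times> B) (cell H x, cell H' y)" by (simp add: cell_prod_arr)
 then show "C \<in> (\<lambda>(A, B). A \<times> B) ` (ocells H \<times> ocells H')"
  unfolding ocells_def by blast
next
 fix C assume "C \<in> (\<lambda>(A, B). A \<times> B) ` (ocells H \<times> ocells H')"
 then obtain x y where "C = cell H x \<times> cell H' y" by (auto simp: ocells_def)
 then show "C \<in> ocells (prod_arr H H')" by (simp add: ocells_def flip: cell_prod_arr)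
qed

lemma ocells_nonempty: "A \<in> ocells H ==> A \<noteq> {}"
 by (auto simp: ocells_def intro: cell_refl)

lemma inj_on_prod_cells: "inj_on (\<lambda>(A, B). A \<times> B) (ocells H \<times> ocells H')"
proof (rule inj_onI, clarify)
 fix A B A' B' assume "A \<in> ocells H" "B \<in> ocells H'" "A' \<in> ocells H" "B' \<in> ocells H'"
  "A \<times> B = A' \<times> B'"
 then show "A = A' \<and> B = B'" using ocells_nonempty[of _ H] ocells_nonempty[of _ H'] by (metis times_eq_iff)
qed

lemma cell_const_tensor:
 assumes "cell_const H f" "cell_const H' g"
 shows "cell_const (prod_arr H H') (tensor f g)"
 using assms by (auto simp: cell_const_def cell_prod_arr tensor_def)

lemma on_cell_tensor:
 assumes "cell_const H f" "cell_const H' g" "A \<in> ocells H" "B \<in> ocells H'"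
 shows "on_cell (tensor f g) (A \<times> B) = on_cell f A * on_cell g B"
proof -
 obtain x y where xy: "A = cell H x" "B = cell H' y" using assms by (auto simp: ocells_def)
 have "on_cell (tensor f g) (cell (prod_arr H H') (x, y)) = tensor f g (x, y)"
  by (rule on_cell_cell[OF cell_const_tensor[OF assms(1,2)]])
 then show ?thesis using xy assms by (simp add: on_cell_cell cell_prod_arr tensor_def)
qed

lemma dirs_Times_cells:
 assumes "finite H" "finite H'" "A \<in> ocells H" "B \<in> ocells H'"
 shows "dirs (A \<times> B) = dirs A \<times> dirs B"
proof -
 obtain x y where xy: "A = cell H x" "B = cell H' y" using assms by (auto simp: ocells_def)
 have "finite (prod_arr H H')" using assms by (simp add: prod_arr_def)
 then have "dirs (cell (prod_arr H H') (x, y)) = tang (prod_arr H H') (x, y)" by (rule dirs_cell)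
 then show ?thesis using xy assms by (simp add: cell_prod_arr tang_prod_arr dirs_cell)
qed

lemma germ_tensor:
 assumes "finite H" "finite H'" "cell_const H f" "cell_const H' g"
 shows "germ (tensor f g) (x, y) (r, s) = germ f x r * germ g y s"
 by (rule germ_eqI) (use eventually_conj[OF eventually_germ[OF assms(1,3), of x r] eventually_germ[OF assms(2,4), of y s]]
   in \<open>auto elim: eventually_mono simp: tensor_def\<close>)

lemma pure_weight_tensor:
 assumes "pure_weight H c f" "pure_weight H' d g"
 shows "pure_weight (prod_arr H H') (c + d) (tensor f g)"
proof -
 have "dim (tang (prod_arr H H') (x, y)) + (c + d) = DIM('a \<times> 'b)" if "tensor f g (x, y) \<noteq> 0" for x :: 'a and y :: 'b
 proof -
  have "f x \<noteq> 0" "g y \<noteq> 0" using that by (auto simp: tensor_def)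
  then show ?thesis using pureD(4)[OF assms(1)] pureD(4)[OF assms(2)]
   by (fastforce simp: tang_prod_arr dim_Times sub_tang)
 qed
 then show ?thesis using assms arrg_prod_arr cell_const_tensor
  by (auto simp: pure_weight_def)
qed

lemma prim_mod_Times_left:
 assumes "subspace K'"
 shows "prim_mod (K \<times> K') (r, 0) \<longleftrightarrow> prim_mod K (r :: 'a::euclidean_space)"
proof -
 have 0: "(0 :: 'b) \<in> lat" "0 \<in> K'" using assms subspace_0 by auto
 have "(\<exists>v\<in>lat \<times> lat. v - q *R (r, 0) \<in> K \<times> K') \<longleftrightarrow> (\<exists>v\<in>lat. v - q *R r \<in> K)" for q
  using 0 by force
 moreover have "(\<forall>k\<in>K \<times> K'. (r, 0) \<bullet> k = 0) \<longleftrightarrow> (\<forall>k\<in>K. r \<bullet> k = 0)" using 0 by (force simp: inner_Pair)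
 moreover have "(r, 0 :: 'b) \<noteq> 0 \<longleftrightarrow> r \<noteq> 0" by (simp add: zero_prod_def)
 ultimately show ?thesis unfolding prim_mod_def lat_Times by (simp only:)
qed

lemma prim_mod_Times_right:
 assumes "subspace K"
 shows "prim_mod (K \<times> K') (0, r) \<longleftrightarrow> prim_mod K' (r :: 'a::euclidean_space)"
proof -
 have 0: "(0 :: 'b) \<in> lat" "0 \<in> K" using assms subspace_0 by auto
 have "(\<exists>v\<in>lat \<times> lat. v - q *R (0, r) \<in> K \<times> K') \<longleftrightarrow> (\<exists>v\<in>lat. v - q *R r \<in> K')" for q
  using 0 by force
 moreover have "(\<forall>k\<in>K \<times> K'. (0, r) \<bullet> k = 0) \<longleftrightarrow> (\<forall>k\<in>K'. r \<bullet> k = 0)" using 0 by (force simp: inner_Pair)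
 moreover have "(0 :: 'b, r) \<noteq> 0 \<longleftrightarrow> r \<noteq> 0" by (simp add: zero_prod_def)
 ultimately show ?thesis unfolding prim_mod_def lat_Times by (simp only:)
qed

lemma germ_dim_le:
 assumes "pure_weight H c (f :: 'a::euclidean_space => real)" "germ f t s \<noteq> 0"
 shows "dim (tang H t) + c \<le> DIM('a)"
 using germ_dim[OF assms] dim_subset[OF tang_subset_link[of H t s]] by linarith

lemma germ_full_dim:
 assumes "pure_weight H c (f :: 'a::euclidean_space => real)" "germ f t s \<noteq> 0" "dim (tang H t) + c = DIM('a)"
 shows "s \<in> tang H t"
proof -
 have "tang H t = tang (larr H t) s"
  using germ_dim[OF assms(1,2)] assms(3)
  by (intro subspace_dim_equal sub_tang tang_subset_link) simp
 then show ?thesis using mem_tang_link by blast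
qed

text \<open>By dimension a ridge next to nonzero weight is a ridge of one factor times a maximal
  cell of the other. Primitive vectors are orthogonal to the maximal cell and so have no component
  there; the sum is the one of the first factor scaled by the weight of the second.\<close>

lemma bal_weight_tensor:
 fixes f :: "'a::euclidean_space => real" and g :: "'b::euclidean_space => real"
 assumes f: "bal_weight H c f" and g: "bal_weight H' d g"
 shows "bal_weight (prod_arr H H') (c + d) (tensor f g)"
 unfolding bal_weight_def
proof (intro conjI allI impI)
 note pf = bal_pure[OF f] and pg = bal_pure[OF g]
 note gt = germ_tensor[OF pureD(2)[OF pf] pureD(2)[OF pg] pureD(3)[OF pf] pureD(3)[OF pg]]
 show "pure_weight (prod_arr H H') (c + d) (tensor f g)" using pf pg by (rule pure_weight_tensor)
 fix p assume dim: "dim (tang (prod_arr H H') p) + 1 + (c + d) = DIM('a \<times> 'b)"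
 obtain t y where p: "p = (t, y)" by (cases p)
 let ?K = "tang H t" and ?K' = "tang H' y"
 have dims: "dim ?K + dim ?K' + 1 + (c + d) = DIM('a) + DIM('b)"
  using dim by (simp add: p tang_prod_arr dim_Times sub_tang)
 let ?R = "{r. prim_mod (?K \<times> ?K') r \<and> germ (tensor f g) (t, y) r \<noteq> 0}"
 show "balanced_at (prod_arr H H') (tensor f g) p"
  unfolding balanced_at_def p tang_prod_arr
 proof (cases "?R = {}")
  case True
  then show "(\<Sum>r\<in>?R. germ (tensor f g) (t, y) r *R r) = 0" by (simp only: sum.empty)
 next
  case False
  then obtain r0 s0 where "germ f t r0 \<noteq> 0" "germ g y s0 \<noteq> 0" by (auto simp: gt)
  then have "dim ?K + c \<le> DIM('a)" "dim ?K' + d \<le> DIM('b)" using germ_dim_le pf pg by blast+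
  then consider "dim ?K + 1 + c = DIM('a)" "dim ?K' + d = DIM('b)" | "dim ?K + c = DIM('a)" "dim ?K' + 1 + d = DIM('b)"
   using dims by linarith
  then show "(\<Sum>r\<in>?R. germ (tensor f g) (t, y) r *R r) = 0"
  proof cases
   case 1
   have s0: "s = 0" if "(r, s) \<in> ?R" for r s
   proof -
    have "germ g y s \<noteq> 0" using that by (auto simp: gt)
    then have "(0, s) \<in> ?K \<times> ?K'" using germ_full_dim[OF pg _ 1(2)] subspace_0[OF sub_tang] by auto
    then have "(r, s) \<bullet> (0, s) = 0" using that unfolding prim_mod_def by blast
    then show ?thesis by (simp add: inner_Pair)
   qed
   let ?R1 = "{r. prim_mod ?K r \<and> germ f t r \<noteq> 0}"
   have bal: "(\<Sum>r\<in>?R1. germ f t r *R r) = 0" using f 1 by (auto simp: bal_weight_def balanced_at_def)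
   show ?thesis
   proof (cases "g y = 0")
    case True
    have "?R = {}" using s0 True by (force simp: gt germ_0)
    then show ?thesis by (simp only: sum.empty)
   next
    case False
    have "?R = (\<lambda>r. (r, 0 :: 'b)) ` ?R1"
    proof (intro equalityI subsetI)
     fix p assume "p \<in> ?R"
     then show "p \<in> (\<lambda>r. (r, 0 :: 'b)) ` ?R1"
      using s0[of "fst p" "snd p"] prim_mod_Times_left[OF sub_tang, of ?K H' y "fst p"]
      by (cases p) (auto simp: gt)
    next
     fix p assume "p \<in> (\<lambda>r. (r, 0 :: 'b)) ` ?R1"
     then show "p \<in> ?R"
      using prim_mod_Times_left[OF sub_tang, of ?K H' y] False by (auto simp: gt germ_0)
    qed
    then have "(\<Sum>r\<in>?R. germ (tensor f g) (t, y) r *R r) = (\<Sum>r\<in>?R1. (germ f t r * g y) *R (r, 0))"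
     by (simp add: sum.reindex inj_on_def gt germ_0)
    also have "\<dots> = (g y *R (\<Sum>r\<in>?R1. germ f t r *R r), 0)"
     by (simp add: sum_prod scaleR_sum_right mult.commute)
    also have "\<dots> = 0" using bal by (simp add: zero_prod_def)
    finally show ?thesis .
   qed
  next
   case 2
   have s0: "r = 0" if "(r, s) \<in> ?R" for r s
   proof -
    have "germ f t r \<noteq> 0" using that by (auto simp: gt)
    then have "(r, 0) \<in> ?K \<times> ?K'" using germ_full_dim[OF pf _ 2(1)] subspace_0[OF sub_tang] by auto
    then have "(r, s) \<bullet> (r, 0) = 0" using that unfolding prim_mod_def by blast
    then show ?thesis by (simp add: inner_Pair)
   qed
   let ?R1 = "{r. prim_mod ?K' r \<and> germ g y r \<noteq> 0}"
   have bal: "(\<Sum>r\<in>?R1. germ g y r *R r) = 0" using g 2 by (auto simp: bal_weight_def balanced_at_def)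
   show ?thesis
   proof (cases "f t = 0")
    case True
    have "?R = {}" using s0 True by (force simp: gt germ_0)
    then show ?thesis by (simp only: sum.empty)
   next
    case False
    have "?R = (\<lambda>r. (0 :: 'a, r)) ` ?R1"
    proof (intro equalityI subsetI)
     fix p assume "p \<in> ?R"
     then show "p \<in> (\<lambda>r. (0 :: 'a, r)) ` ?R1"
      using s0[of "fst p" "snd p"] prim_mod_Times_right[OF sub_tang, of H t ?K' "snd p"]
      by (cases p) (auto simp: gt)
    next
     fix p assume "p \<in> (\<lambda>r. (0 :: 'a, r)) ` ?R1"
     then show "p \<in> ?R"
      using prim_mod_Times_right[OF sub_tang, of H t ?K'] False by (auto simp: gt germ_0)
    qed
    then have "(\<Sum>r\<in>?R. germ (tensor f g) (t, y) r *R r) = (\<Sum>r\<in>?R1. (germ g y r * f t) *R (0, r))"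
     by (simp add: sum.reindex inj_on_def gt germ_0 mult.commute)
    also have "\<dots> = (0, f t *R (\<Sum>r\<in>?R1. germ g y r *R r))"
     by (simp add: sum_prod scaleR_sum_right mult.commute)
    also have "\<dots> = 0" using bal by (simp add: zero_prod_def)
    finally show ?thesis .
   qed
  qed
 qed
qed

subsection \<open>Displacement degrees\<close>

text \<open>For the spans of two cells this is the index \<open>[N : N_\<sigma> + N_\<tau>]\<close>
  of the multiplicity formula.\<close>

definition pair_ix :: "'a::euclidean_space set => 'a set => nat"
 where "pair_ix D E = grp_ix lat (msum (lat \<inter> D) (lat \<inter> E))"

definition triple_ix :: "'a::euclidean_space set => 'a set => 'a set => nat"
 where "triple_ix D E F = grp_ix lat {(x - y, x - z) |x y z. x \<in> lat \<inter> D \<and> y \<in> lat \<inter> E \<and> z \<in> lat \<inter> F}"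

lemma subspace_uminus_iff: "subspace E ==> - b \<in> E \<longleftrightarrow> b \<in> (E :: 'a::real_vector set)"
 by (metis add.inverse_inverse subspace_neg)

lemma lat_uminus_iff: "- b \<in> lat \<longleftrightarrow> b \<in> lat"
 by (metis add.inverse_inverse subgrp_uminus lat_subgroup)

lemma pair_ix_diff:
 assumes "subspace E"
 shows "pair_ix D E = grp_ix lat {a - b |a b. a \<in> lat \<inter> D \<and> b \<in> lat \<inter> E}"
proof -
 have "(msum (lat \<inter> D) (lat \<inter> E)) = {a - b |a b. a \<in> lat \<inter> D \<and> b \<in> lat \<inter> E}"
 proof (intro equalityI subsetI)
  fix x assume "x \<in> (msum (lat \<inter> D) (lat \<inter> E))"
  then obtain a b where "x = a - (- b)" "a \<in> lat \<inter> D" "- b \<in> lat \<inter> E"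
   using subspace_uminus_iff[OF assms] lat_uminus_iff by auto
  then show "x \<in> {a - b |a b. a \<in> lat \<inter> D \<and> b \<in> lat \<inter> E}" by blast
 next
  fix x assume "x \<in> {a - b |a b. a \<in> lat \<inter> D \<and> b \<in> lat \<inter> E}"
  then obtain a b where "x = a + (- b)" "a \<in> lat \<inter> D" "- b \<in> lat \<inter> E"
   using subspace_uminus_iff[OF assms] lat_uminus_iff by auto
  then show "x \<in> (msum (lat \<inter> D) (lat \<inter> E))" by blast
 qed
 then show ?thesis by (simp add: pair_ix_def)
qed

lemma pair_ix_commute: "pair_ix D E = pair_ix E D"
proof -
 have "(msum (lat \<inter> D) (lat \<inter> E)) = (msum (lat \<inter> E) (lat \<inter> D))"
  by (metis (no_types, opaque_lifting) add.commute)
 then show ?thesis by (simp add: pair_ix_def)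
qed

lemma lat_Int_subgroup: "subspace D ==> subgrp (lat \<inter> D)"
 using subgrp_Int lat_subgroup subgrp_subspace by blast

lemma sum_subgroup:
 assumes "subgrp A" "subgrp B"
 shows "subgrp (msum A B)"
 unfolding subgrp_def
proof (intro conjI ballI)
 show "0 \<in> (msum A B)" using assms subgrp_0 by (metis (mono_tags, lifting) add.right_neutral mem_Collect_eq)
 fix x y assume "x \<in> (msum A B)" "y \<in> (msum A B)"
 then obtain a b a' b' where "x = a + b" "y = a' + b'" "a \<in> A" "b \<in> B" "a' \<in> A" "b' \<in> B" by blast
 then have "x - y = (a - a') + (b - b')" "a - a' \<in> A" "b - b' \<in> B" using assms subgrp_diff by auto
 then show "x - y \<in> (msum A B)" by blast
qed

text \<open>Exactness for the coordinate \<open>x - y\<close>: its image gives the first index, and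
  on its kernel \<open>x = y\<close> runs through the lattice of \<open>D \<inter> E\<close>, which
  gives the second. The intersection spans the cell in which the first two factors meet
  stably.\<close>

lemma triple_ix_eq:
 assumes D: "subspace D" and E: "subspace E" and F: "subspace F"
 shows "triple_ix D E F = pair_ix D E * pair_ix (D \<inter> E) (F :: 'a::euclidean_space set)"
proof -
 let ?G = "{(x - y, x - z) |x y z. x \<in> lat \<inter> D \<and> y \<in> lat \<inter> E \<and> z \<in> lat \<inter> F}"
 note sg = lat_Int_subgroup[OF D] lat_Int_subgroup[OF E] lat_Int_subgroup[OF F]
 have G: "subgrp ?G"
  unfolding subgrp_def
 proof (intro conjI ballI)
  have "(0 - 0, 0 - 0) \<in> ?G" using sg subgrp_0 by blast
  then show "0 \<in> ?G" by (simp add: zero_prod_def)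
  fix p q assume "p \<in> ?G" "q \<in> ?G"
  then obtain x y z x' y' z' where *: "p = (x - y, x - z)" "q = (x' - y', x' - z')"
   "x \<in> lat \<inter> D" "y \<in> lat \<inter> E" "z \<in> lat \<inter> F" "x' \<in> lat \<inter> D" "y' \<in> lat \<inter> E" "z' \<in> lat \<inter> F" by blast
  then have "p - q = ((x - x') - (y - y'), (x - x') - (z - z'))" by simp
  moreover have "x - x' \<in> lat \<inter> D" "y - y' \<in> lat \<inter> E" "z - z' \<in> lat \<inter> F" using * sg subgrp_diff by blast+
  ultimately show "p - q \<in> ?G" by blast
 qed
 have Glat: "?G \<subseteq> lat" using lat_subgroup subgrp_diff by (fastforce simp: lat_Times)
 have "grp_ix lat ?G = grp_ix (fst ` (lat :: ('a \<times> 'a) set)) (fst ` ?G) *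
   grp_ix {a \<in> lat. fst a = 0} {a \<in> ?G. fst a = 0}"
  by (rule grp_ix_exact[OF lat_subgroup G Glat]) simp
 moreover have "fst ` (lat :: ('a \<times> 'a) set) = lat"
  using subgrp_0[OF lat_subgroup] by (auto simp: lat_Times)
 moreover have "fst ` ?G = {a - b |a b. a \<in> lat \<inter> D \<and> b \<in> lat \<inter> E}"
 proof (intro equalityI subsetI)
  fix u assume "u \<in> {a - b |a b. a \<in> lat \<inter> D \<and> b \<in> lat \<inter> E}"
  then obtain a b where ab: "u = a - b" "a \<in> lat \<inter> D" "b \<in> lat \<inter> E" by blast
  have "(a - b, a - 0) \<in> ?G" using ab subgrp_0[OF sg(3)] by blast
  moreover have "u = fst (a - b, a - 0)" using ab by simp
  ultimately show "u \<in> fst ` ?G" by (rule rev_image_eqI)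
 next
  fix u assume "u \<in> fst ` ?G"
  then obtain x y z where "u = x - y" "x \<in> lat \<inter> D" "y \<in> lat \<inter> E" by auto
  then show "u \<in> {a - b |a b. a \<in> lat \<inter> D \<and> b \<in> lat \<inter> E}" by blast
 qed
 moreover have "{a \<in> (lat :: ('a \<times> 'a) set). fst a = 0} = Pair 0 ` lat"
  using subgrp_0[OF lat_subgroup] by (auto simp: lat_Times)
 moreover have "{a \<in> ?G. fst a = 0} = Pair (0::'a) ` {a - b |a b. a \<in> lat \<inter> (D \<inter> E) \<and> b \<in> lat \<inter> F}"
 proof (intro equalityI subsetI)
  fix p assume "p \<in> {a \<in> ?G. fst a = 0}"
  then obtain x y z where "p = (x - y, x - z)" "x - y = 0" "x \<in> lat \<inter> D" "y \<in> lat \<inter> E" "z \<in> lat \<inter> F" by auto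
  then show "p \<in> Pair 0 ` {a - b |a b. a \<in> lat \<inter> (D \<inter> E) \<and> b \<in> lat \<inter> F}" by auto
 next
  fix p :: "'a \<times> 'a" assume "p \<in> Pair 0 ` {a - b |a b. a \<in> lat \<inter> (D \<inter> E) \<and> b \<in> lat \<inter> F}"
  then obtain a b where "p = (a - a, a - b)" "a \<in> lat \<inter> D" "a \<in> lat \<inter> E" "b \<in> lat \<inter> F" by auto
  then show "p \<in> {a \<in> ?G. fst a = 0}" by fastforce
 qed
 moreover have "grp_ix (Pair (0::'a) ` lat) (Pair 0 ` {a - b |a b. a \<in> lat \<inter> (D \<inter> E) \<and> b \<in> lat \<inter> F})
   = grp_ix lat {a - b |a b. a \<in> lat \<inter> (D \<inter> E) \<and> b \<in> lat \<inter> F}"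
 proof (rule grp_ix_inj_image[OF lat_subgroup])
  have "{a - b |a b. a \<in> lat \<inter> (D \<inter> E) \<and> b \<in> lat \<inter> F} = (msum (lat \<inter> (D \<inter> E)) (lat \<inter> F))"
   by (metis (no_types, opaque_lifting) subgrp_uminus diff_minus_eq_add sg(3) uminus_add_conv_diff add.commute)
  then show "subgrp {a - b |a b. a \<in> lat \<inter> (D \<inter> E) \<and> b \<in> lat \<inter> F}"
   using sum_subgroup[OF lat_Int_subgroup[OF subspace_inter[OF D E]] sg(3)] by simp
  show "{a - b |a b. a \<in> lat \<inter> (D \<inter> E) \<and> b \<in> lat \<inter> F} \<subseteq> lat" using lat_subgroup subgrp_diff by blast
 qed (auto simp: zero_prod_def)
 ultimately show ?thesis by (simp add: triple_ix_def pair_ix_diff E F)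
qed

text \<open>The lattice automorphism \<open>(a, b) \<mapsto> (b - a, - a)\<close> turns
  \<open>(x - y, x - z)\<close> into \<open>(y - z, y - x)\<close>.\<close>

lemma triple_ix_rotate:
 assumes D: "subspace D" and E: "subspace E" and F: "subspace F"
 shows "triple_ix E F D = triple_ix D E (F :: 'a::euclidean_space set)"
proof -
 let ?f = "\<lambda>(a :: 'a, b :: 'a). (b - a, - a)"
 let ?G = "{(x - y, x - z) |x y z. x \<in> lat \<inter> D \<and> y \<in> lat \<inter> E \<and> z \<in> lat \<inter> F}"
 let ?G' = "{(x - y, x - z) |x y z. x \<in> lat \<inter> E \<and> y \<in> lat \<inter> F \<and> z \<in> lat \<inter> D}"
 have "?f ` lat = lat"
 proof (intro equalityI subsetI)
  fix p assume "p \<in> ?f ` lat"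
  then show "p \<in> lat" using lat_subgroup subgrp_diff by (auto simp: lat_Times lat_uminus_iff)
 next
  fix p :: "'a \<times> 'a" assume p: "p \<in> lat"
  then have "p = ?f (- snd p, fst p - snd p)" by (cases p) simp
  moreover have "(- snd p, fst p - snd p) \<in> lat"
   using p lat_subgroup subgrp_diff by (auto simp: lat_Times lat_uminus_iff mem_Times_iff)
  ultimately show "p \<in> ?f ` lat" by blast
 qed
 moreover have "?f ` ?G = ?G'"
 proof (intro equalityI subsetI)
  fix p assume "p \<in> ?f ` ?G"
  then obtain x y z where "p = (y - z, y - x)" "x \<in> lat \<inter> D" "y \<in> lat \<inter> E" "z \<in> lat \<inter> F" by auto
  then show "p \<in> ?G'" by blast
 next
  fix p assume "p \<in> ?G'"
  then obtain x y z where *: "p = (y - z, y - x)" "x \<in> lat \<inter> D" "y \<in> lat \<inter> E" "z \<in> lat \<inter> F" by blast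
  then have "p = ?f (x - y, x - z)" by simp
  then show "p \<in> ?f ` ?G" using * by blast
 qed
 moreover have "grp_ix (?f ` lat) (?f ` ?G) = grp_ix lat ?G"
 proof (rule grp_ix_inj_image[OF lat_subgroup])
  note sg = lat_Int_subgroup[OF D] lat_Int_subgroup[OF E] lat_Int_subgroup[OF F]
  show "subgrp ?G"
   unfolding subgrp_def
  proof (intro conjI ballI)
   have "(0 - 0, 0 - 0) \<in> ?G" using sg subgrp_0 by blast
   then show "0 \<in> ?G" by (simp add: zero_prod_def)
   fix p q assume "p \<in> ?G" "q \<in> ?G"
   then obtain x y z x' y' z' where *: "p = (x - y, x - z)" "q = (x' - y', x' - z')"
    "x \<in> lat \<inter> D" "y \<in> lat \<inter> E" "z \<in> lat \<inter> F" "x' \<in> lat \<inter> D" "y' \<in> lat \<inter> E" "z' \<in> lat \<inter> F" by blast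
   then have "p - q = ((x - x') - (y - y'), (x - x') - (z - z'))" by simp
   moreover have "x - x' \<in> lat \<inter> D" "y - y' \<in> lat \<inter> E" "z - z' \<in> lat \<inter> F" using * sg subgrp_diff by blast+
   ultimately show "p - q \<in> ?G" by blast
  qed
  show "?G \<subseteq> lat" using lat_subgroup subgrp_diff by (fastforce simp: lat_Times)
 qed (auto simp: zero_prod_def)
 ultimately show ?thesis by (simp add: triple_ix_def)
qed

text \<open>The two arrangements may differ, so that a linear space can be paired with a fan without
  refining the fan.\<close>

definition pair_deg ::
  "('a::euclidean_space \<times> real) set => ('a \<times> real) set => ('a => real) => ('a => real) => 'a => real"
 where "pair_deg H H' f g v = (\<Sum>(A, B) | A \<in> ocells H \<and> B \<in> ocells H' \<and> v \<in> mdiff A B.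
  on_cell f A * on_cell g B * pair_ix (dirs A) (dirs B))"

definition triple_diff :: "'a::minus set => 'a set => 'a set => ('a \<times> 'a) set"
 where "triple_diff A B C = {(x - y, x - z) |x y z. x \<in> A \<and> y \<in> B \<and> z \<in> C}"

definition triple_deg ::
  "('a::euclidean_space \<times> real) set => ('a \<times> real) set => ('a \<times> real) set =>
   ('a => real) => ('a => real) => ('a => real) => 'a \<times> 'a => real"
 where "triple_deg H H' H'' f g h p = (\<Sum>(A, B, C) |
   A \<in> ocells H \<and> B \<in> ocells H' \<and> C \<in> ocells H'' \<and> p \<in> triple_diff A B C.
  on_cell f A * on_cell g B * on_cell h C * triple_ix (dirs A) (dirs B) (dirs C))"

definition diff2 :: "'a::real_vector \<times> 'a => 'a"
 where "diff2 = (\<lambda>(x, y). x - y)"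

definition diff3 :: "'a::real_vector \<times> 'a \<times> 'a => 'a \<times> 'a"
 where "diff3 = (\<lambda>(x, y, z). (x - y, x - z))"

lemma linear_diff2: "linear diff2"
 by (rule linearI) (auto simp: diff2_def algebra_simps)

lemma linear_diff3: "linear diff3"
 by (rule linearI) (auto simp: diff3_def algebra_simps)

lemma diff2_image: "diff2 ` (A \<times> B) = mdiff A B"
 by (force simp: diff2_def minkowski_diff_def)

lemma diff3_image: "diff3 ` (A \<times> B \<times> C) = triple_diff A B C"
 by (force simp: diff3_def triple_diff_def)

text \<open>The difference vanishes on diagonal pairs, and the common lineality space, embedded
  diagonally, serves as \<open>K\<close>. The dimension hypothesis says that this space has exactly
  the expected dimension of the intersection.\<close>

lemma proj_deg_pair:
 fixes f g :: "'a::euclidean_space => real"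
 assumes f: "bal_weight H c f" and g: "bal_weight H' d g" and cen: "central H" "central H'"
  and dim: "dim (tang H 0 \<inter> tang H' 0) + c + d = DIM('a)"
 shows "proj_deg (prod_arr H H') (c + d) (tensor f g) (diff2 :: 'a \<times> 'a => 'a)
  ((\<lambda>k. (k, k)) ` (tang H 0 \<inter> tang H' 0))"
proof (rule proj_deg.intro)
 let ?K = "tang H 0 \<inter> tang H' 0"
 have lin: "linear (\<lambda>k::'a. (k, k))" by (rule linearI) auto
 show "bal_weight (prod_arr H H') (c + d) (tensor f g)" using f g by (rule bal_weight_tensor)
 show "central (prod_arr H H')" using cen by (rule central_prod_arr)
 show "linear (diff2 :: 'a \<times> 'a => 'a)" by (rule linear_diff2)
 show "diff2 ` lat \<subseteq> (lat :: 'a set)" using lat_subgroup subgrp_diff by (auto simp: diff2_def lat_Times)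
 show "subspace ((\<lambda>k. (k, k)) ` ?K)"
  by (rule linear_subspace_image[OF lin]) (intro subspace_inter sub_tang)
 show "diff2 k = 0" if "k \<in> (\<lambda>k. (k, k)) ` ?K" for k using that by (auto simp: diff2_def)
 show "(\<lambda>k. (k, k)) ` ?K \<subseteq> tang (prod_arr H H') 0"
  by (auto simp: zero_prod_def tang_prod_arr)
 have "dim ((\<lambda>k. (k, k)) ` ?K) = dim ?K" using lin by (intro dim_image_eq) (auto simp: inj_on_def)
 then show "dim ((\<lambda>k. (k, k)) ` ?K) + DIM('a) + (c + d) = DIM('a \<times> 'a)" using dim by simp
qed

lemma pair_deg_deg:
 fixes f g :: "'a::euclidean_space => real"
 assumes f: "pure_weight H c f" and g: "pure_weight H' d g"
  and loc: "proj_deg (prod_arr H H') e (tensor f g) (diff2 :: 'a \<times> 'a => 'a) K"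
 shows "proj_deg.deg (prod_arr H H') (tensor f g) diff2 v = pair_deg H H' f g v"
proof -
 interpret proj_deg "prod_arr H H'" e "tensor f g" "diff2 :: 'a \<times> 'a => 'a" K by (rule loc)
 let ?S = "{(A, B). A \<in> ocells H \<and> B \<in> ocells H' \<and> v \<in> mdiff A B}"
 have img: "{C \<in> ocells (prod_arr H H'). v \<in> diff2 ` C} = (\<lambda>(A, B). A \<times> B) ` ?S"
  unfolding ocells_prod_arr Collect_image_pred
  by (rule arg_cong[where f = "image _"]) (auto simp: diff2_image[symmetric])
 have inj: "inj_on (\<lambda>(A, B). A \<times> B) ?S" by (rule inj_on_subset[OF inj_on_prod_cells[of H H']]) auto
 have term_eq: "on_cell (tensor f g) (A \<times> B) * ix (A \<times> B) = on_cell f A * on_cell g B * pair_ix (dirs A) (dirs B)"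
  if "A \<in> ocells H" "B \<in> ocells H'" for A B
 proof -
  have "diff2 ` (lat \<inter> dirs (A \<times> B)) = {a - b |a b. a \<in> lat \<inter> dirs A \<and> b \<in> lat \<inter> dirs B}"
   unfolding dirs_Times_cells[OF pureD(2)[OF f] pureD(2)[OF g] that] lat_Times Times_Int_Times diff2_image
   by (auto simp: minkowski_diff_def)
  then have "ix (A \<times> B) = pair_ix (dirs A) (dirs B)"
   by (simp add: ix_def pair_ix_diff sub_dirs)
  then show ?thesis using on_cell_tensor[OF pureD(3)[OF f] pureD(3)[OF g] that] by simp
 qed
 show ?thesis
  unfolding deg_def img pair_deg_def sum.reindex[OF inj] by (intro sum.cong) (auto simp: term_eq)
qed

theorem pair_deg_constant:
 fixes f g :: "'a::euclidean_space => real"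
 assumes f: "bal_weight H c f" and g: "bal_weight H' d g" and cen: "central H" "central H'"
  and dim: "dim (tang H 0 \<inter> tang H' 0) + c + d = DIM('a)"
 shows "\<exists>m. generic (\<lambda>v. pair_deg H H' f g v = m)"
proof -
 note loc = proj_deg_pair[OF assms]
 show ?thesis
  using proj_deg.deg_constant[OF loc]
   pair_deg_deg[OF bal_pure[OF f] bal_pure[OF g] loc] by simp
qed

lemma proj_deg_triple:
 fixes f g h :: "'a::euclidean_space => real"
 assumes f: "bal_weight H c f" and g: "bal_weight H' d g" and h: "bal_weight H'' e h"
  and cen: "central H" "central H'" "central H''"
  and dim: "dim (tang H 0 \<inter> tang H' 0 \<inter> tang H'' 0) + c + d + e = DIM('a)"
 shows "proj_deg (prod_arr H (prod_arr H' H'')) (c + (d + e)) (tensor f (tensor g h))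
  (diff3 :: 'a \<times> 'a \<times> 'a => 'a \<times> 'a)
  ((\<lambda>k. (k, k, k)) ` (tang H 0 \<inter> tang H' 0 \<inter> tang H'' 0))"
proof (rule proj_deg.intro)
 let ?K = "tang H 0 \<inter> tang H' 0 \<inter> tang H'' 0"
 have lin: "linear (\<lambda>k::'a. (k, k, k))" by (rule linearI) auto
 show "bal_weight (prod_arr H (prod_arr H' H'')) (c + (d + e)) (tensor f (tensor g h))"
  using f g h by (intro bal_weight_tensor)
 show "central (prod_arr H (prod_arr H' H''))" using cen by (intro central_prod_arr)
 show "linear (diff3 :: 'a \<times> 'a \<times> 'a => 'a \<times> 'a)" by (rule linear_diff3)
 show "diff3 ` lat \<subseteq> (lat :: ('a \<times> 'a) set)" using lat_subgroup subgrp_diff by (fastforce simp: diff3_def lat_Times)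
 show "subspace ((\<lambda>k. (k, k, k)) ` ?K)"
  by (rule linear_subspace_image[OF lin]) (intro subspace_inter sub_tang)
 show "diff3 k = 0" if "k \<in> (\<lambda>k. (k, k, k)) ` ?K" for k using that by (auto simp: diff3_def zero_prod_def)
 show "(\<lambda>k. (k, k, k)) ` ?K \<subseteq> tang (prod_arr H (prod_arr H' H'')) 0"
  by (auto simp: zero_prod_def tang_prod_arr)
 have "dim ((\<lambda>k. (k, k, k)) ` ?K) = dim ?K" using lin by (intro dim_image_eq) (auto simp: inj_on_def)
 then show "dim ((\<lambda>k. (k, k, k)) ` ?K) + DIM('a \<times> 'a) + (c + (d + e)) = DIM('a \<times> 'a \<times> 'a)" using dim by simp
qed

lemma dirs_Times3_cells:
 assumes "finite H" "finite H'" "finite H''" "A \<in> ocells H" "B \<in> ocells H'" "C \<in> ocells H''"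
 shows "dirs (A \<times> B \<times> C) = dirs A \<times> dirs B \<times> dirs C"
proof -
 have "finite (prod_arr H' H'')" using assms by (simp add: prod_arr_def)
 moreover have "B \<times> C \<in> ocells (prod_arr H' H'')" using assms by (auto simp: ocells_prod_arr)
 ultimately show ?thesis using dirs_Times_cells[of H "prod_arr H' H''" A "B \<times> C"] dirs_Times_cells[of H' H'' B C] assms by simp
qed

lemma ocells_prod_arr3:
 "ocells (prod_arr H (prod_arr H' H'')) = (\<lambda>(A, B, C). A \<times> B \<times> C) ` (ocells H \<times> ocells H' \<times> ocells H'')"
 unfolding ocells_prod_arr by (auto simp: image_iff)

lemma inj_on_prod_cells3:
 "inj_on (\<lambda>(A, B, C). A \<times> B \<times> C) (ocells H \<times> ocells H' \<times> ocells H'')"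
proof (rule inj_onI)
 fix p q :: "'a set \<times> 'b set \<times> 'c set"
 assume p: "p \<in> ocells H \<times> ocells H' \<times> ocells H''"
  and q: "q \<in> ocells H \<times> ocells H' \<times> ocells H''"
  and pq: "(\<lambda>(A, B, C). A \<times> B \<times> C) p = (\<lambda>(A, B, C). A \<times> B \<times> C) q"
 obtain A B C where pABC: "p = (A, B, C)" by (cases p)
 obtain A' B' C' where qABC: "q = (A', B', C')" by (cases q)
 have cells: "A \<in> ocells H" "B \<in> ocells H'" "C \<in> ocells H''"
  "A' \<in> ocells H" "B' \<in> ocells H'" "C' \<in> ocells H''" and eq: "A \<times> B \<times> C = A' \<times> B' \<times> C'"
  using p q pq by (auto simp: pABC qABC)
 have ne: "A \<noteq> {}" "B \<noteq> {}" "C \<noteq> {}" "A' \<noteq> {}" "B' \<noteq> {}" "C' \<noteq> {}"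
  using cells ocells_nonempty by auto
 then have "A = A' \<and> B \<times> C = B' \<times> C'" using eq unfolding times_eq_iff[of A] by blast
 then have "A = A' \<and> B = B' \<and> C = C'" using ne unfolding times_eq_iff[of B] by blast
 then show "p = q" by (simp add: pABC qABC)
qed

lemma triple_deg_term:
 fixes f g h :: "'a::euclidean_space => real"
 assumes f: "pure_weight H c f" and g: "pure_weight H' d g" and h: "pure_weight H'' e h"
  and loc: "proj_deg (prod_arr H (prod_arr H' H'')) e' (tensor f (tensor g h)) (diff3 :: 'a \<times> 'a \<times> 'a => 'a \<times> 'a) K"
  and cells: "A \<in> ocells H" "B \<in> ocells H'" "C \<in> ocells H''"
 shows "on_cell (tensor f (tensor g h)) (A \<times> B \<times> C) = on_cell f A * on_cell g B * on_cell h C"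
  "proj_deg.ix (diff3 :: 'a \<times> 'a \<times> 'a => 'a \<times> 'a) (A \<times> B \<times> C) = triple_ix (dirs A) (dirs B) (dirs C)"
proof -
 interpret proj_deg "prod_arr H (prod_arr H' H'')" e' "tensor f (tensor g h)" "diff3 :: 'a \<times> 'a \<times> 'a => 'a \<times> 'a" K by (rule loc)
 have "B \<times> C \<in> ocells (prod_arr H' H'')" using cells by (auto simp: ocells_prod_arr)
 then show "on_cell (tensor f (tensor g h)) (A \<times> B \<times> C) = on_cell f A * on_cell g B * on_cell h C"
  using on_cell_tensor[OF pureD(3)[OF f] cell_const_tensor[OF pureD(3)[OF g] pureD(3)[OF h]] cells(1)]
   on_cell_tensor[OF pureD(3)[OF g] pureD(3)[OF h] cells(2,3)] by simp
 have "diff3 ` (lat \<inter> dirs (A \<times> B \<times> C)) = {(x - y, x - z) |x y z. x \<in> lat \<inter> dirs A \<and> y \<in> lat \<inter> dirs B \<and> z \<in> lat \<inter> dirs C}"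
  unfolding dirs_Times3_cells[OF pureD(2)[OF f] pureD(2)[OF g] pureD(2)[OF h] cells] lat_Times Times_Int_Times diff3_image
  by (auto simp: triple_diff_def)
 then show "ix (A \<times> B \<times> C) = triple_ix (dirs A) (dirs B) (dirs C)"
  by (simp add: ix_def triple_ix_def)
qed

lemma triple_deg_deg:
 fixes f g h :: "'a::euclidean_space => real"
 assumes f: "pure_weight H c f" and g: "pure_weight H' d g" and h: "pure_weight H'' e h"
  and loc: "proj_deg (prod_arr H (prod_arr H' H'')) e' (tensor f (tensor g h)) (diff3 :: 'a \<times> 'a \<times> 'a => 'a \<times> 'a) K"
 shows "proj_deg.deg (prod_arr H (prod_arr H' H'')) (tensor f (tensor g h)) diff3 v = triple_deg H H' H'' f g h v"
proof -
 interpret proj_deg "prod_arr H (prod_arr H' H'')" e' "tensor f (tensor g h)" "diff3 :: 'a \<times> 'a \<times> 'a => 'a \<times> 'a" K by (rule loc)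
 let ?S = "{(A, B, C). A \<in> ocells H \<and> B \<in> ocells H' \<and> C \<in> ocells H'' \<and> v \<in> triple_diff A B C}"
 have img: "{C \<in> ocells (prod_arr H (prod_arr H' H'')). v \<in> diff3 ` C} = (\<lambda>(A, B, C). A \<times> B \<times> C) ` ?S"
  unfolding ocells_prod_arr3 Collect_image_pred
  by (rule arg_cong[where f = "image _"]) (auto simp: diff3_image[symmetric])
 have inj: "inj_on (\<lambda>(A, B, C). A \<times> B \<times> C) ?S" by (rule inj_on_subset[OF inj_on_prod_cells3[of H H' H'']]) auto
 show ?thesis
  unfolding deg_def img triple_deg_def sum.reindex[OF inj]
  by (intro sum.cong) (auto simp: triple_deg_term[OF assms])
qed

theorem triple_deg_constant:
 fixes f g h :: "'a::euclidean_space => real"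
 assumes f: "bal_weight H c f" and g: "bal_weight H' d g" and h: "bal_weight H'' e h"
  and cen: "central H" "central H'" "central H''"
  and dim: "dim (tang H 0 \<inter> tang H' 0 \<inter> tang H'' 0) + c + d + e = DIM('a)"
 shows "\<exists>m. generic (\<lambda>v. triple_deg H H' H'' f g h v = m)"
proof -
 note loc = proj_deg_triple[OF assms]
 show ?thesis
  using proj_deg.deg_constant[OF loc]
   triple_deg_deg[OF bal_pure[OF f] bal_pure[OF g] bal_pure[OF h] loc] by simp
qed


subsection \<open>Links of cells\<close>

lemma central_tang_0:
 assumes "central H"
 shows "tang H 0 \<subseteq> tang H x"
proof
 fix k assume k: "k \<in> tang H 0"
 have "u \<bullet> k = 0" if "(u, c) \<in> H" for u c
 proof -
  have "c = 0" using assms that by (auto simp: central_def)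
  then show ?thesis using k that by (auto simp: tang_def)
 qed
 then show "k \<in> tang H x" by (auto simp: tang_def)
qed

text \<open>All directions that enter \<open>cell H y\<close> from \<open>x\<close> have the same
  signs on the hyperplanes through \<open>x\<close>, and these signs determine which cell is
  entered.\<close>

lemma link_open_cell:
 assumes fin: "finite H" and s: "s \<in> link x (cell H y)"
 shows "link x (cell H y) = cell (larr H x) s"
proof (intro equalityI subsetI)
 fix q assume q: "q \<in> link x (cell H y)"
 have "near0 (\<lambda>r. x + r *R q \<in> cell H y)" "near0 (\<lambda>r. x + r *R s \<in> cell H y)"
  using q s by (auto simp: link_def)
 then obtain r where e: "x + r *R q \<in> cell H y" "x + r *R s \<in> cell H y"
   "\<forall>(u, c)\<in>H. sgn (u \<bullet> (x + r *R q) - c) = step_sgn u c x q"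
   "\<forall>(u, c)\<in>H. sgn (u \<bullet> (x + r *R s) - c) = step_sgn u c x s"
  using near0_ex[OF eventually_conj[OF _ eventually_conj[OF _
   eventually_conj[OF near0_step[OF fin, of x q] near0_step[OF fin, of x s]]]]] by blast
 show "q \<in> cell (larr H x) s"
 proof (rule link_cell_stepD)
  fix w d assume "(w, d) \<in> H"
  then show "step_sgn w d x q = step_sgn w d x s" using e by (fastforce simp: cell_def)
 qed
next
 fix q assume q: "q \<in> cell (larr H x) s"
 have s': "near0 (\<lambda>r. x + r *R s \<in> cell H y)" using s by (simp add: link_def)
 have "near0 (\<lambda>r. x + r *R q \<in> cell H y)"
  using eventually_conj[OF s' eventually_conj[OF near0_step[OF fin, of x q] near0_step[OF fin, of x s]]]
 proof eventually_elim
  case (elim r)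
  have "sgn (w \<bullet> (x + r *R q) - d) = sgn (w \<bullet> y - d)" if wd: "(w, d) \<in> H" for w d
  proof -
   have "sgn (w \<bullet> (x + r *R q) - d) = step_sgn w d x q" using elim wd by auto
   also have "\<dots> = step_sgn w d x s" using link_cell_step[OF q wd] .
   also have "\<dots> = sgn (w \<bullet> (x + r *R s) - d)" using elim wd by auto
   also have "\<dots> = sgn (w \<bullet> y - d)" using elim wd by (fastforce simp: cell_def)
   finally show ?thesis .
  qed
  then show ?case by (auto simp: cell_def)
 qed
 then show "q \<in> link x (cell H y)" by (simp add: link_def)
qed

lemma link_disjoint:
 assumes "A \<in> ocells H" "B \<in> ocells H" "s \<in> link x A" "s \<in> link x B"
 shows "A = B"
proof -
 have "near0 (\<lambda>e. x + e *R s \<in> A \<and> x + e *R s \<in> B)"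
  using assms by (auto simp: link_def intro: eventually_conj)
 then obtain z where z: "z \<in> A" "z \<in> B" using near0_ex by blast
 obtain y y' where "A = cell H y" "B = cell H y'" using assms by (auto simp: ocells_def)
 then show ?thesis using z cell_eq_iff by metis
qed

lemma ex_link_open_cell:
 assumes "finite H"
 shows "\<exists>A\<in>ocells H. s \<in> link x A"
proof -
 obtain y where "near0 (\<lambda>e. x + e *R s \<in> cell H y)"
  by (rule cell_step[OF assms, of x s])
 then show ?thesis by (auto simp: ocells_def link_def)
qed

lemma link_open_cell_props:
 assumes fin: "finite H" and f: "cell_const H f" and A: "A \<in> ocells H" and s: "s \<in> link x A"
 shows "link x A = cell (larr H x) s" "on_cell (germ f x) (link x A) = on_cell f A"
  "dirs (link x A) = dirs A"
proof -
 obtain y where y: "A = cell H y" using A by (auto simp: ocells_def)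
 show l: "link x A = cell (larr H x) s" using link_open_cell[OF fin] s y by simp
 have ev: "near0 (\<lambda>e. x + e *R s \<in> cell H y)" using s y by (simp add: link_def)
 then have "near0 (\<lambda>e. f (x + e *R s) = f y)"
  by eventually_elim (use f in \<open>auto simp: cell_const_def\<close>)
 then have "germ f x s = f y" by (rule germ_eqI)
 then show "on_cell (germ f x) (link x A) = on_cell f A"
  using l y on_cell_cell[OF cell_const_germ[OF fin f]] on_cell_cell[OF f] by simp
 obtain e where "x + e *R s \<in> cell H y" "tang H (x + e *R s) = tang (larr H x) s"
  using near0_ex[OF eventually_conj[OF ev near0_tang[OF fin, of x s]]] by blast
 then have "tang (larr H x) s = tang H y" using cell_tang by metis
 then show "dirs (link x A) = dirs A"
  using l y dirs_cell[OF fin] dirs_cell[OF finite_larr[OF fin]] by simp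
qed

lemma link_cell_cong:
 assumes fin: "finite H" and A: "A \<in> ocells H" and y: "y \<in> cell H x"
 shows "link y A = link x A"
proof -
 obtain z where z: "A = cell H z" using A by (auto simp: ocells_def)
 have imp: "s \<in> link y A" if s: "s \<in> link x A" and y: "y \<in> cell H x" for s x y
 proof -
  have s': "near0 (\<lambda>e. x + e *R s \<in> cell H z)" using s z by (simp add: link_def)
  have st: "step_sgn w d y s = step_sgn w d x s" if "(w, d) \<in> H" for w d
   using y that cell_zero_iff[OF y that] by (auto simp: step_sgn_def cell_def)
  have "near0 (\<lambda>e. y + e *R s \<in> cell H z)"
   using eventually_conj[OF s' eventually_conj[OF near0_step[OF fin, of x s] near0_step[OF fin, of y s]]]
  proof eventually_elim
   case (elim e)
   have "sgn (w \<bullet> (y + e *R s) - d) = sgn (w \<bullet> z - d)" if wd: "(w, d) \<in> H" for w d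
   proof -
    have "sgn (w \<bullet> (y + e *R s) - d) = step_sgn w d y s" using elim wd by auto
    also have "\<dots> = step_sgn w d x s" using st[OF wd] .
    also have "\<dots> = sgn (w \<bullet> (x + e *R s) - d)" using elim wd by auto
    also have "\<dots> = sgn (w \<bullet> z - d)" using elim wd by (fastforce simp: cell_def)
    finally show ?thesis .
   qed
   then show ?case by (auto simp: cell_def)
  qed
  then show ?thesis by (simp add: link_def z)
 qed
 have "x \<in> cell H y" using y cell_eq_iff cell_refl by metis
 then show ?thesis using imp y by blast
qed

lemma link_add_tan:
 assumes fin: "finite H" and A: "A \<in> ocells H" and s: "s \<in> link x A" and k: "k \<in> tang H x"
 shows "s + k \<in> link x A"
proof -
 obtain z where z: "A = cell H z" using A by (auto simp: ocells_def)
 have "s + k \<in> cell (larr H x) s"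
  using k by (intro cell_tan_add cell_refl) (auto simp: larr_def tang_def)
 then show ?thesis using link_open_cell[OF fin] s z by metis
qed

lemma link_tan_subset:
 assumes fin: "finite H" and A: "A \<in> ocells H" and s: "s \<in> link x A"
 shows "tang H x \<subseteq> dirs A"
proof -
 obtain z where z: "A = cell H z" using A by (auto simp: ocells_def)
 have "x \<in> ccell H z" using into_ccell[OF fin] s z by (auto simp: link_def)
 then show ?thesis using ccell_tang z dirs_cell[OF fin] by metis
qed

subsection \<open>Stable products of weights\<close>

text \<open>The displacement rule at every point, without reference to supports or positivity:
  outside the stable intersection the generic degree is simply 0. Points of other than the expected
  codimension get weight 0, which makes the result pure.\<close>

definition prod_weight ::
  "('a::euclidean_space \<times> real) set => nat => nat => ('a => real) => ('a => real) => 'a => real"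
 where "prod_weight H c d f g x = (if dim (tang H x) + c + d = DIM('a)
  then generic_value (pair_deg (larr H x) (larr H x) (germ f x) (germ g x)) else 0)"

text \<open>Taking links matches the cells of \<open>H\<close> near \<open>x\<close> with the cells
  of the local fan and preserves weights and spans. Cells with empty link drop out because their
  differences are empty.\<close>

lemma pair_deg_link:
 assumes fin: "finite H" and f: "cell_const H f" and g: "cell_const H g"
 shows "pair_deg (larr H x) (larr H x) (germ f x) (germ g x) u =
  (\<Sum>(A, B) | A \<in> ocells H \<and> B \<in> ocells H \<and> u \<in> mdiff (link x A) (link x B).
   on_cell f A * on_cell g B * pair_ix (dirs A) (dirs B))"
proof -
 let ?L = "larr H x"
 let ?S = "{(A, B). A \<in> ocells H \<and> B \<in> ocells H \<and> u \<in> mdiff (link x A) (link x B)}"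
 let ?T = "{(A, B). A \<in> ocells ?L \<and> B \<in> ocells ?L \<and> u \<in> mdiff A B}"
 let ?F = "map_prod (link x) (link x)"
 have "?F ` ?S = ?T"
 proof (intro equalityI subsetI)
  fix p assume "p \<in> ?F ` ?S"
  then obtain A B where p: "p = (link x A, link x B)" "A \<in> ocells H" "B \<in> ocells H"
   "u \<in> mdiff (link x A) (link x B)" by auto
  then obtain s t where "s \<in> link x A" "t \<in> link x B" by (auto simp: minkowski_diff_def)
  then have "link x A = cell ?L s" "link x B = cell ?L t" using p link_open_cell_props(1)[OF fin f] by blast+
  then show "p \<in> ?T" using p unfolding ocells_def by blast
 next
  fix p assume "p \<in> ?T"
  then obtain s t where p: "p = (cell ?L s, cell ?L t)" "u \<in> mdiff (cell ?L s) (cell ?L t)"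
   by (auto simp: ocells_def)
  obtain A where A: "A \<in> ocells H" "s \<in> link x A" using ex_link_open_cell[OF fin] by blast
  obtain B where B: "B \<in> ocells H" "t \<in> link x B" using ex_link_open_cell[OF fin] by blast
  have "p = ?F (A, B)" using p link_open_cell_props(1)[OF fin f A] link_open_cell_props(1)[OF fin f B] by simp
  moreover have "(A, B) \<in> ?S"
   using A B p link_open_cell_props(1)[OF fin f A] link_open_cell_props(1)[OF fin f B] by simp
  ultimately show "p \<in> ?F ` ?S" by blast
 qed
 moreover have "inj_on ?F ?S"
 proof (rule inj_onI, clarify)
  fix A B A' B' assume *: "A \<in> ocells H" "B \<in> ocells H" "A' \<in> ocells H" "B' \<in> ocells H"
   "u \<in> mdiff (link x A) (link x B)" "?F (A, B) = ?F (A', B')"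
  then obtain s t where "s \<in> link x A" "t \<in> link x B" by (auto simp: minkowski_diff_def)
  then show "A = A' \<and> B = B'" using * link_disjoint[of _ H] by simp metis
 qed
 moreover have "on_cell (germ f x) (link x A) * on_cell (germ g x) (link x B) * pair_ix (dirs (link x A)) (dirs (link x B))
   = on_cell f A * on_cell g B * pair_ix (dirs A) (dirs B)" if AB: "(A, B) \<in> ?S" for A B
 proof -
  obtain s t where "s \<in> link x A" "t \<in> link x B" using AB by (auto simp: minkowski_diff_def)
  then show ?thesis using AB link_open_cell_props[OF fin f] link_open_cell_props[OF fin g] by simp
 qed
 ultimately show ?thesis
  unfolding pair_deg_def
  by (intro sum.reindex_cong[of ?F]) auto
qed

lemma pair_deg_link_generic:
 fixes f g :: "'a::euclidean_space => real"
 assumes f: "bal_weight H c f" and g: "bal_weight H d g"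
  and dim: "dim (tang H x) + c + d = DIM('a)"
 shows "generic (\<lambda>v. pair_deg (larr H x) (larr H x) (germ f x) (germ g x) v = prod_weight H c d f g x)"
proof -
 obtain m where m: "generic (\<lambda>v. pair_deg (larr H x) (larr H x) (germ f x) (germ g x) v = m)"
  using pair_deg_constant[OF bal_weight_germ[OF f] bal_weight_germ[OF g] central_larr central_larr, of x x] dim
  by (auto simp: tang_link_0)
 then show ?thesis using generic_value_eq[OF m] dim by (simp add: prod_weight_def)
qed

lemma cell_const_prod_weight:
 assumes "finite H" "cell_const H f" "cell_const H g"
 shows "cell_const H (prod_weight H c d f g)"
 unfolding cell_const_def
proof (intro allI impI)
 fix x y assume y: "y \<in> cell H x"
 show "prod_weight H c d f g y = prod_weight H c d f g x"
  unfolding prod_weight_def cell_tang[OF y] larr_cell_cong[OF y]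
   germ_cell_cong[OF assms(1,2) y] germ_cell_cong[OF assms(1,3) y] ..
qed

lemma pure_prod_weight:
 assumes "pure_weight H c f" "pure_weight H d g"
 shows "pure_weight H (c + d) (prod_weight H c d f g)"
 unfolding pure_weight_def
 using assms pureD(1,2,3)[OF assms(1)] pureD(3)[OF assms(2)] cell_const_prod_weight
 by (auto simp: prod_weight_def add.assoc)

lemma pair_ix_nonzero_sum:
 assumes "subspace D" "subspace E" "pair_ix D E \<noteq> 0"
 shows "(msum D E) = (UNIV :: 'a::euclidean_space set)"
proof (rule ccontr)
 let ?S = "(msum D E)" and ?L = "(msum (lat \<inter> D) (lat \<inter> E))"
 assume ne: "?S \<noteq> UNIV"
 have "subspace ?S" using assms subspace_sums by blast
 moreover have "?L \<subseteq> ?S" by blast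
 ultimately have "span ?L \<subseteq> ?S" by (simp add: span_minimal)
 moreover have "?L \<subseteq> lat" using subgrp_add[OF lat_subgroup] by blast
 ultimately have "grp_ix lat ?L = 0"
  using ne by (intro grp_ix_lat_eq_0 sum_subgroup lat_Int_subgroup assms) auto
 then show False using assms(3) by (simp add: pair_ix_def)
qed

lemma pair_ix_pos:
 assumes D: "subspace D" "span (D \<inter> lat) = D" and E: "subspace E" "span (E \<inter> lat) = E"
  and sum: "(msum D E) = (UNIV :: 'a::euclidean_space set)"
 shows "pair_ix D E > 0"
 unfolding pair_ix_def
proof (rule grp_ix_lat_pos)
 let ?L = "(msum (lat \<inter> D) (lat \<inter> E))"
 show "subgrp ?L" by (intro sum_subgroup lat_Int_subgroup D E)
 show "?L \<subseteq> lat" using subgrp_add[OF lat_subgroup] by blast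
 have "D \<inter> lat \<subseteq> ?L"
 proof
  fix a assume "a \<in> D \<inter> lat"
  then have "a = a + 0 \<and> a \<in> lat \<inter> D \<and> 0 \<in> lat \<inter> E" using subspace_0[OF E(1)] by simp
  then show "a \<in> ?L" by blast
 qed
 moreover have "E \<inter> lat \<subseteq> ?L"
 proof
  fix a assume "a \<in> E \<inter> lat"
  then have "a = 0 + a \<and> 0 \<in> lat \<inter> D \<and> a \<in> lat \<inter> E" using subspace_0[OF D(1)] by simp
  then show "a \<in> ?L" by blast
 qed
 ultimately have "D \<subseteq> span ?L" "E \<subseteq> span ?L" using span_mono[of "D \<inter> lat" ?L] span_mono[of "E \<inter> lat" ?L] D(2) E(2) by simp_all
 then have "(msum D E) \<subseteq> span ?L" using span_add by blast
 then show "span ?L = UNIV" using sum by auto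
qed

lemma dim_sum_UNIV:
 assumes "subspace D" "subspace E" "(msum D E) = (UNIV :: 'a::euclidean_space set)"
 shows "dim D + dim E = DIM('a) + dim (D \<inter> E)"
 using dim_sums_Int[OF assms(1,2)] assms(3) by simp

lemma finite_pairs: "finite X ==> finite Y ==> finite {(A, B). A \<in> X \<and> B \<in> Y \<and> P A B}"
 by (rule finite_subset[of _ "X \<times> Y"]) auto

text \<open>Displacing by \<open>(\<epsilon> u, w)\<close> with \<open>\<epsilon>\<close> small, the triple degree is computed by first
  intersecting the first two weights and then displacing the third one.\<close>

theorem triple_localization:
 fixes f g h :: "'a::euclidean_space => real"
 assumes f: "bal_weight H c f" and g: "bal_weight H d g" and h: "bal_weight H' e h"
  and cen: "central H" "central H'"
  and dim: "dim (tang H 0 \<inter> tang H' 0) + c + d + e = DIM('a)"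
  and m: "generic (\<lambda>p. triple_deg H H H' f g h p = m)"
 shows "generic (\<lambda>w. pair_deg H H' (prod_weight H c d f g) h w = m)"
proof -
 note pf = bal_pure[OF f] and pg = bal_pure[OF g] and ph = bal_pure[OF h]
 note fin = pureD(2)[OF pf] and fin' = pureD(2)[OF ph]
 note cf = pureD(3)[OF pf] and cg = pureD(3)[OF pg] and ch = pureD(3)[OF ph]
 let ?K = "tang H 0 \<inter> tang H' 0"
 let ?F = "tensor f (tensor g h)" and ?HH = "prod_arr H (prod_arr H H')"
 have loc: "proj_deg ?HH (c + (d + e)) ?F (diff3 :: 'a \<times> 'a \<times> 'a => 'a \<times> 'a)
  ((\<lambda>k. (k, k, k)) ` (tang H 0 \<inter> tang H 0 \<inter> tang H' 0))"
  by (rule proj_deg_triple[OF f g h cen(1,1,2)]) (use dim in simp)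
 interpret L: proj_deg ?HH "c + (d + e)" ?F "diff3 :: 'a \<times> 'a \<times> 'a => 'a \<times> 'a"
  "(\<lambda>k. (k, k, k)) ` (tang H 0 \<inter> tang H 0 \<inter> tang H' 0)" by (rule loc)
 note tdeg = triple_deg_deg[OF pf pg ph loc] and tterm = triple_deg_term[OF pf pg ph loc]
 let ?P = "prod_weight H c d f g"
 have cP: "cell_const H ?P" by (rule cell_const_prod_weight[OF fin cf cg])
 obtain G where G: "finite G" "\<And>V. V \<in> G ==> subspace V \<and> V \<noteq> UNIV" "\<And>p. p \<notin> \<Union>G ==> triple_deg H H H' f g h p = m"
  using m by (auto simp: generic_def)
 \<comment> \<open>Traces of an exceptional subspace on the two factors. With \<open>u\<close> and
   \<open>w\<close> outside the proper traces, at most one point \<open>(j u, w)\<close> lies in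
   \<open>V\<close>, so that small \<open>j > 0\<close> give generic displacements.\<close>
 define V1 where "V1 V = {u :: 'a. (u, 0 :: 'a) \<in> V}" for V
 define V2 where "V2 V = {w :: 'a. (0 :: 'a, w) \<in> V}" for V
 have subV: "subspace (V1 V)" "subspace (V2 V)" if V: "V \<in> G" for V
 proof -
  have s: "subspace V" using G V by blast
  have "(0, 0) \<in> V" using subspace_0[OF s] by (simp add: zero_prod_def)
  moreover have "(a + b, 0) \<in> V" if "(a, 0) \<in> V" "(b, 0) \<in> V" for a b using subspace_add[OF s that] by simp
  moreover have "(0, a + b) \<in> V" if "(0, a) \<in> V" "(0, b) \<in> V" for a b using subspace_add[OF s that] by simp
  moreover have "(r *R a, 0) \<in> V" if "(a, 0) \<in> V" for a r using subspace_scale[OF s that, of r] by simp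
  moreover have "(0, r *R a) \<in> V" if "(0, a) \<in> V" for a r using subspace_scale[OF s that, of r] by simp
  ultimately show "subspace (V1 V)" "subspace (V2 V)" by (auto simp: V1_def V2_def subspace_def)
 qed
 define S where "S A B = (msum (dirs A) (dirs B))" for A B :: "'a set"
 have subS: "subspace (S A B)" for A B unfolding S_def by (intro subspace_sums sub_dirs)
 \<comment> \<open>The second condition makes every pair of cells with \<open>w\<close> in its
   difference transversal.\<close>
 have gw: "generic (\<lambda>w. (\<forall>V\<in>G. V2 V \<noteq> UNIV --> w \<notin> V2 V) \<and>
   (\<forall>p\<in>ocells H \<times> ocells H'. S (fst p) (snd p) \<noteq> UNIV --> w \<notin> S (fst p) (snd p)))"
 proof (intro generic_conj generic_ball)
  fix V assume "V \<in> G"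
  then show "generic (\<lambda>w. V2 V \<noteq> UNIV --> w \<notin> V2 V)"
   using generic_not_mem[OF subV(2)] by (cases "V2 V = UNIV") (auto intro: generic_True)
 next
  fix p show "generic (\<lambda>w. S (fst p) (snd p) \<noteq> UNIV --> w \<notin> S (fst p) (snd p))"
   using generic_not_mem[OF subS] by (cases "S (fst p) (snd p) = UNIV") (auto intro: generic_True)
 qed (use G finite_ocells[OF fin] finite_ocells[OF fin'] in auto)
 show ?thesis
 proof (rule generic_mono[OF gw])
  fix w assume w: "(\<forall>V\<in>G. V2 V \<noteq> UNIV --> w \<notin> V2 V) \<and>
   (\<forall>p\<in>ocells H \<times> ocells H'. S (fst p) (snd p) \<noteq> UNIV --> w \<notin> S (fst p) (snd p))"
  define xr where "xr A = (SOME x. x \<in> A)" for A :: "'a set"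
  have xr: "xr A \<in> A" "A = cell H (xr A)" if Ac: "A \<in> ocells H" for A
  proof -
   show *: "xr A \<in> A" unfolding xr_def using ocells_nonempty[OF Ac] by (simp add: some_in_eq)
   obtain x where "A = cell H x" using Ac unfolding ocells_def by blast
   then show "A = cell H (xr A)" using * cell_eq_iff by metis
  qed
  define ok where "ok A \<longleftrightarrow> dim (dirs A) + c + d = DIM('a)" for A :: "'a set"
  have dirs_xr: "dirs A = tang H (xr A)" if "A \<in> ocells H" for A
   using xr(2)[OF that] dirs_cell[OF fin] by metis
  \<comment> \<open>With \<open>w\<close> fixed, \<open>u\<close> is taken generic simultaneously
    for the local products at one representative of each cell of the expected dimension.\<close>
  have gu: "generic (\<lambda>u. (\<forall>V\<in>G. V1 V \<noteq> UNIV --> u \<notin> V1 V) \<and>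
   (\<forall>A\<in>{A \<in> ocells H. ok A}. pair_deg (larr H (xr A)) (larr H (xr A)) (germ f (xr A)) (germ g (xr A)) u = ?P (xr A)))"
  proof (intro generic_conj generic_ball)
   fix V assume "V \<in> G"
   then show "generic (\<lambda>w. V1 V \<noteq> UNIV --> w \<notin> V1 V)"
    using generic_not_mem[OF subV(1)] by (cases "V1 V = UNIV") (auto intro: generic_True)
  next
   fix A assume "A \<in> {A \<in> ocells H. ok A}"
   then show "generic (\<lambda>u. pair_deg (larr H (xr A)) (larr H (xr A)) (germ f (xr A)) (germ g (xr A)) u = ?P (xr A))"
    by (intro pair_deg_link_generic f g) (auto simp: ok_def dirs_xr)
  qed (use G finite_ocells[OF fin] in auto)
  then obtain u where u: "\<And>V. V \<in> G ==> V1 V \<noteq> UNIV ==> u \<notin> V1 V"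
   "\<And>A. A \<in> ocells H ==> ok A ==>
    pair_deg (larr H (xr A)) (larr H (xr A)) (germ f (xr A)) (germ g (xr A)) u = ?P (xr A)"
   using generic_ex[OF gu] by blast
  have evG: "near0 (\<lambda>j. \<forall>V\<in>G. (j *R u, w) \<notin> V)"
  proof (rule eventually_ball_finite[OF G(1)], rule ballI)
   fix V assume V: "V \<in> G"
   have sV: "subspace V" using G(2) V by blast
   show "near0 (\<lambda>j. (j *R u, w) \<notin> V)"
   proof (cases "V1 V = UNIV")
    case True
    have "(j *R u, w) \<notin> V" for j
    proof
     assume a: "(j *R u, w) \<in> V"
     have *: "(b, 0) \<in> V" for b using True unfolding V1_def by blast
     have "(j *R u, w) - (j *R u, 0) \<in> V" using subspace_diff[OF sV a *] .
     then have "w \<in> V2 V" by (simp add: V2_def)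
     then have V2: "V2 V = UNIV" using w V by blast
     have "(b, b') \<in> V" for b b'
     proof -
      have "(0, b') \<in> V" using V2 unfolding V2_def by blast
      then have "(b, 0) + (0, b') \<in> V" using * subspace_add[OF sV] by blast
      then show ?thesis by simp
     qed
     then have "V = UNIV" by auto
     then show False using G(2) V by blast
    qed
    then show ?thesis by simp
   next
    case False
    then have u1: "u \<notin> V1 V" using u(1) V by blast
    have uniq: "j = \<delta>" if "(j *R u, w) \<in> V" "(\<delta> *R u, w) \<in> V" for j \<delta>
    proof (rule ccontr)
     assume ne: "j \<noteq> \<delta>"
     have "(1 / (j - \<delta>)) *R ((j *R u, w) - (\<delta> *R u, w)) \<in> V"
      using subspace_scale[OF sV subspace_diff[OF sV that]] .
     then have "((1 / (j - \<delta>)) *R (j *R u - \<delta> *R u), 0) \<in> V" by simp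
     then have "(1 / (j - \<delta>)) *R (j - \<delta>) *R u \<in> V1 V" by (simp add: V1_def scaleR_left_diff_distrib)
     then show False using ne u1 by simp
    qed
    show ?thesis
    proof (cases "\<exists>\<delta>>0. (\<delta> *R u, w) \<in> V")
     case True
     then obtain \<delta> where d: "\<delta> > 0" "(\<delta> *R u, w) \<in> V" by blast
     show ?thesis unfolding eventually_at_right[OF d(1)] using d uniq by blast
    next
     case False
     then show ?thesis unfolding eventually_at_right[OF zero_less_one] using zero_less_one by blast
    qed
   qed
  qed
  \<comment> \<open>The product cells whose image is entered from \<open>(0, w)\<close> in direction
    \<open>(u, 0)\<close>; they compute the degree at \<open>(j u, w)\<close> for small
    \<open>j\<close>.\<close>
  let ?Act = "{C \<in> L.active. L.plus (0, w) (u, 0) C}"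
  have mL: "(\<Sum>C\<in>?Act. on_cell ?F C * L.ix C) = m"
  proof -
   have "near0 (\<lambda>j. (\<Sum>C\<in>?Act. on_cell ?F C * L.ix C) = m)"
    using L.deg_plus[of "(0, w)" "(u, 0)"] evG
   proof eventually_elim
    case (elim j)
    have "triple_deg H H H' f g h (j *R u, w) = m" using elim(2) by (intro G(3)) auto
    then show ?case using elim(1) by (simp add: tdeg)
   qed
   then show ?thesis by simp
  qed
  define S1 where "S1 = {(A, B). A \<in> ocells H \<and> B \<in> ocells H' \<and> w \<in> mdiff A B}"
  define S1' where "S1' = {(A, B). A \<in> ocells H \<and> B \<in> ocells H' \<and> (w \<in> mdiff A B \<and> ok A)}"
  define S2 where "S2 A = {(C, D). C \<in> ocells H \<and> D \<in> ocells H \<and>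
   u \<in> mdiff (link (xr A) C) (link (xr A) D)}" for A
  define wt where "wt = (\<lambda>((A, B), (C, D)). on_cell f C * on_cell g D * on_cell h B *
   (pair_ix (dirs C) (dirs D) * pair_ix (dirs A) (dirs B)))"
  have finS: "finite S1'" "finite (S2 A)" "finite S1" for A
   unfolding S1'_def S2_def S1_def using finite_ocells[OF fin] finite_ocells[OF fin'] by (auto intro!: finite_pairs)
  have onP: "on_cell ?P A = (if ok A then (\<Sum>(C, D)\<in>S2 A. on_cell f C * on_cell g D * pair_ix (dirs C) (dirs D)) else 0)"
   if A: "A \<in> ocells H" for A
  proof -
   have e: "on_cell ?P A = ?P (xr A)" using on_cell_cell[OF cP] xr(2)[OF A] by metis
   show ?thesis
   proof (cases "ok A")
    case True
    then show ?thesis using e u(2)[OF A True] pair_deg_link[OF fin cf cg] by (simp add: S2_def)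
   next
    case False
    then show ?thesis using e dirs_xr[OF A] by (simp add: prod_weight_def ok_def)
   qed
  qed
  have "pair_deg H H' ?P h w = (\<Sum>(A, B)\<in>S1. on_cell ?P A * on_cell h B * pair_ix (dirs A) (dirs B))"
   by (simp add: pair_deg_def S1_def)
  also have "\<dots> = (\<Sum>(A, B)\<in>S1'. on_cell ?P A * on_cell h B * pair_ix (dirs A) (dirs B))"
   by (rule sum.mono_neutral_right[OF finS(3)]) (auto simp: S1_def S1'_def onP split: if_splits)
  also have "\<dots> = (\<Sum>p\<in>S1'. \<Sum>q\<in>S2 (fst p). wt (p, q))"
  proof (rule sum.cong[OF refl])
   fix p assume "p \<in> S1'"
   then obtain A B where p: "p = (A, B)" "A \<in> ocells H" "ok A" by (auto simp: S1'_def)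
   show "(case p of (A, B) => on_cell ?P A * on_cell h B * pair_ix (dirs A) (dirs B)) = (\<Sum>q\<in>S2 (fst p). wt (p, q))"
    unfolding p(1) prod.case onP[OF p(2)] fst_conv
    using p(3) by (auto simp: wt_def sum_distrib_right intro!: sum.cong)
  qed
  also have "\<dots> = (\<Sum>q\<in>(SIGMA p:S1'. S2 (fst p)). wt q)"
   using finS by (subst sum.Sigma) auto
  also have "\<dots> = (\<Sum>q\<in>{q \<in> SIGMA p:S1'. S2 (fst p). wt q \<noteq> 0}. wt q)"
   using finS by (intro sum.mono_neutral_right) auto
  finally have RHS: "pair_deg H H' ?P h w = (\<Sum>q\<in>{q \<in> SIGMA p:S1'. S2 (fst p). wt q \<noteq> 0}. wt q)" .
  let ?Q = "{q \<in> SIGMA p:S1'. S2 (fst p). wt q \<noteq> 0}"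
  \<comment> \<open>A term of the iterated sum consists of a cell \<open>A\<close> of the first
    intersection that meets \<open>B\<close> after displacement by \<open>w\<close>, and of cells
    \<open>C\<close>, \<open>D\<close> around \<open>A\<close> that meet after displacement by
    \<open>u\<close>. The matching cell of the triple product forgets \<open>A\<close>, which is
    recovered as the cell of \<open>x\<close> for a lift \<open>(x, x, z)\<close> of
    \<open>(0, w)\<close>.\<close>
  define J where "J = (\<lambda>((A::'a set, B::'a set), (C::'a set, D::'a set)). C \<times> D \<times> B)"
  have dimf: "dim (dirs C) + c = DIM('a)" if "C \<in> ocells H" "on_cell f C \<noteq> 0" for C
   using that pureD(4)[OF pf] on_cell_cell[OF cf] dirs_cell[OF fin] by (auto simp: ocells_def)
  have dimg: "dim (dirs C) + d = DIM('a)" if "C \<in> ocells H" "on_cell g C \<noteq> 0" for C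
   using that pureD(4)[OF pg] on_cell_cell[OF cg] dirs_cell[OF fin] by (auto simp: ocells_def)
  have dimh: "dim (dirs C) + e = DIM('a)" if "C \<in> ocells H'" "on_cell h C \<noteq> 0" for C
   using that pureD(4)[OF ph] on_cell_cell[OF ch] dirs_cell[OF fin'] by (auto simp: ocells_def)
  have dimCD: "dim (dirs C \<inter> dirs D) + c + d = DIM('a)"
   if "C \<in> ocells H" "on_cell f C \<noteq> 0" "D \<in> ocells H" "on_cell g D \<noteq> 0" "pair_ix (dirs C) (dirs D) \<noteq> 0" for C D
   using dim_sum_UNIV[OF sub_dirs sub_dirs pair_ix_nonzero_sum[OF sub_dirs sub_dirs that(5)]]
    dimf[OF that(1,2)] dimg[OF that(3,4)] by linarith
  have Qprops: "A \<in> ocells H \<and> B \<in> ocells H' \<and> C \<in> ocells H \<and> D \<in> ocells H \<and> w \<in> mdiff A B \<and>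
    ok A \<and> u \<in> mdiff (link (xr A) C) (link (xr A) D) \<and> on_cell f C \<noteq> 0 \<and> on_cell g D \<noteq> 0 \<and> on_cell h B \<noteq> 0 \<and>
    pair_ix (dirs C) (dirs D) \<noteq> 0 \<and> pair_ix (dirs A) (dirs B) \<noteq> 0 \<and> dirs A = dirs C \<inter> dirs D"
   if "((A, B), (C, D)) \<in> ?Q" for A B C D
  proof -
   have 1: "A \<in> ocells H" "B \<in> ocells H'" "C \<in> ocells H" "D \<in> ocells H" "w \<in> mdiff A B"
    "ok A" "u \<in> mdiff (link (xr A) C) (link (xr A) D)" using that by (auto simp: S1'_def S2_def)
   have 2: "on_cell f C \<noteq> 0" "on_cell g D \<noteq> 0" "on_cell h B \<noteq> 0" "pair_ix (dirs C) (dirs D) \<noteq> 0" "pair_ix (dirs A) (dirs B) \<noteq> 0"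
    using that by (auto simp: wt_def)
   obtain q1 q2 where q: "q1 \<in> link (xr A) C" "q2 \<in> link (xr A) D" using 1 by (auto simp: minkowski_diff_def)
   have sub: "dirs A \<subseteq> dirs C \<inter> dirs D"
    using link_tan_subset[OF fin 1(3) q(1)] link_tan_subset[OF fin 1(4) q(2)] dirs_xr[OF 1(1)] by simp
   have "dim (dirs C \<inter> dirs D) \<le> dim (dirs A)" using dimCD[OF 1(3) 2(1) 1(4) 2(2,4)] 1(6) by (simp add: ok_def)
   then have "dirs A = dirs C \<inter> dirs D"
    by (intro subspace_dim_equal[OF sub_dirs _ sub]) (auto intro: subspace_inter sub_dirs)
   then show ?thesis using 1 2 by blast
  qed
  have term_eq: "on_cell ?F (J q) * L.ix (J q) = wt q" if "q \<in> ?Q" for q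
  proof -
   obtain A B C D where q: "q = ((A, B), (C, D))" by (metis surj_pair)
   have p: "B \<in> ocells H'" "C \<in> ocells H" "D \<in> ocells H" "dirs A = dirs C \<inter> dirs D" using Qprops that q by blast+
   have "triple_ix (dirs C) (dirs D) (dirs B) = pair_ix (dirs C) (dirs D) * pair_ix (dirs A) (dirs B)"
    using triple_ix_eq[OF sub_dirs sub_dirs sub_dirs] p by metis
   then show ?thesis using tterm[OF p(2,3,1)] by (simp add: q J_def wt_def)
  qed
  have wS: "S A B = UNIV" if wA: "A \<in> ocells H" and wB: "B \<in> ocells H'" and wx: "x \<in> A" "z \<in> B" "w = x - z" for A B x z
  proof (rule ccontr)
   assume "S A B \<noteq> UNIV"
   then have "w \<notin> S A B" using w wA wB by auto
   moreover have "x \<in> dirs A" "- z \<in> dirs B"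
   proof -
    obtain a where a: "A = cell H a" using wA unfolding ocells_def by blast
    obtain b where b: "B = cell H' b" using wB unfolding ocells_def by blast
    note ab = a b
    have "x \<in> tang H x" "z \<in> tang H' z" using cen by (auto simp: tang_def central_def)
    then show "x \<in> dirs A" "- z \<in> dirs B"
     using ab wx cell_tang[of x H a] cell_tang[of z H' b] dirs_cell[OF fin] dirs_cell[OF fin']
      subspace_neg[OF sub_tang] by metis+
   qed
   moreover have "w = x + (- z)" using wx by simp
   ultimately show False unfolding S_def by blast
  qed
  have into: "J q \<in> ?Act" if "q \<in> ?Q" for q
  proof -
   obtain A B C D where q: "q = ((A, B), (C, D))" by (metis surj_pair)
   note p = Qprops[OF that[unfolded q]]
   have cells: "A \<in> ocells H" "B \<in> ocells H'" "C \<in> ocells H" "D \<in> ocells H" using p by auto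
   obtain x z where xz: "x \<in> A" "z \<in> B" "w = x - z" using p by (auto simp: minkowski_diff_def)
   obtain q1 q2 where q12: "q1 \<in> link (xr A) C" "q2 \<in> link (xr A) D" "u = q1 - q2" using p by (auto simp: minkowski_diff_def)
   have xA: "xr A \<in> cell H x"
   proof -
    obtain a where "A = cell H a" using cells by (auto simp: ocells_def)
    then show ?thesis using xz xr(1)[OF cells(1)] cell_eq_iff by metis
   qed
   have lk: "q1 \<in> link x C" "q2 \<in> link x D"
    using q12 link_cell_cong[OF fin cells(3) xA] link_cell_cong[OF fin cells(4) xA] by auto
   have dA: "dirs A = tang H x"
    using dirs_xr[OF cells(1)] cell_tang[OF xA] by simp
   \<comment> \<open>The first and the third component must move by the same vector. Splitting
     \<open>q1 = a + b\<close> along \<open>A\<close> and \<open>B\<close> and subtracting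
     \<open>a\<close> from both \<open>q1\<close> and \<open>q2\<close> achieves this and leaves the
     difference \<open>u\<close> unchanged.\<close>
   have "q1 \<in> S A B" using wS[OF cells(1,2) xz] by blast
   then obtain a b where ab: "q1 = a + b" "a \<in> dirs A" "b \<in> dirs B" by (auto simp: S_def)
   have "- a \<in> tang H x" using ab dA subspace_neg[OF sub_tang] by metis
   then have l1: "q1 + - a \<in> link x C" and l2: "q2 + - a \<in> link x D"
    using link_add_tan[OF fin] cells lk by blast+
   obtain z0 where z0: "B = cell H' z0" using cells by (auto simp: ocells_def)
   have "b \<in> tang H' z" using ab z0 dirs_cell[OF fin'] xz cell_tang by metis
   then have l3: "b \<in> link z B" using step_tang[OF fin'] xz z0 cell_eq_iff unfolding link_def by (metis mem_Collect_eq)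
   have b: "q1 + - a = b" using ab by simp
   have "near0 (\<lambda>j. (x + j *R b, x + j *R (q2 + - a), z + j *R b) \<in> C \<times> D \<times> B)"
    using l1 l2 l3 unfolding b link_def by (auto intro: eventually_conj)
   then have "near0 (\<lambda>j. (0, w) + j *R (u, 0) \<in> diff3 ` (C \<times> D \<times> B))"
   proof eventually_elim
    case (elim j)
    have "diff3 (x + j *R b, x + j *R (q2 + - a), z + j *R b) = (0, w) + j *R (u, 0)"
    proof -
     have u': "b - (q2 + - a) = u" using q12 ab by (simp add: algebra_simps)
     have "x + j *R b - (x + j *R (q2 + - a)) = j *R (b - (q2 + - a))"
      unfolding scaleR_right_diff_distrib by simp
     then show ?thesis using xz u' by (simp add: diff3_def)
    qed
    then show ?case using elim by (metis image_eqI)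
   qed
   then have pl: "L.plus (0, w) (u, 0) (J q)" by (simp add: L.plus_def q J_def)
   have "on_cell ?F (J q) * L.ix (J q) \<noteq> 0" using term_eq[OF that] that by simp
   moreover have "J q \<in> ocells ?HH" using cells by (force simp: q J_def ocells_prod_arr3)
   ultimately show ?thesis using pl by (auto simp: L.active_def)
  qed
  have kerK: "x - x' \<in> ?K" if "J q \<in> L.active" "(x, x, z) \<in> dirs (J q)" "(x', x', z') \<in> dirs (J q)" "x - z = x' - z'" for q x x' z z'
  proof -
   have "(x, x, z) - (x', x', z') \<in> dirs (J q)" using that subspace_diff[OF sub_dirs] by blast
   moreover have "diff3 ((x, x, z) - (x', x', z')) = 0" using that(4) by (simp add: diff3_def zero_prod_def algebra_simps)
   ultimately have "(x, x, z) - (x', x', z') \<in> (\<lambda>k. (k, k, k)) ` (tang H 0 \<inter> tang H 0 \<inter> tang H' 0)"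
    using L.active_kernel[OF that(1)] by blast
   then show ?thesis by auto
  qed
  have inj: "inj_on J ?Q"
  proof (rule inj_onI)
   fix q q' assume qq: "q \<in> ?Q" "q' \<in> ?Q" "J q = J q'"
   obtain A B C D where q: "q = ((A, B), (C, D))" by (metis surj_pair)
   obtain A' B' C' D' where q': "q' = ((A', B'), (C', D'))" by (metis surj_pair)
   note p = Qprops[OF qq(1)[unfolded q]] and p' = Qprops[OF qq(2)[unfolded q']]
   have "(C, D, B) = (C', D', B')"
    by (rule inj_onD[OF inj_on_prod_cells3[of H H H']]) (use qq p p' in \<open>auto simp: q q' J_def\<close>)
   then have eq: "C = C'" "D = D'" "B = B'" by auto
   have act: "J q \<in> L.active" using into[OF qq(1)] by blast
   have dq: "dirs (J q) = dirs C \<times> dirs D \<times> dirs B" using p dirs_Times3_cells[OF fin fin fin'] by (simp add: q J_def)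
   have pt: "\<exists>x z. x \<in> A'' \<and> w = x - z \<and> (x, x, z) \<in> dirs (J q)" if "((A'', B), (C, D)) \<in> ?Q" for A''
   proof -
    note p'' = Qprops[OF that]
    obtain x z where xz: "x \<in> A''" "z \<in> B" "w = x - z" using p'' by (auto simp: minkowski_diff_def)
    obtain a where a: "A'' = cell H a" using p'' by (auto simp: ocells_def)
    have "x \<in> tang H x" using cen by (auto simp: tang_def central_def)
    then have "x \<in> dirs A''" using a xz cell_tang dirs_cell[OF fin] by metis
    moreover have "z \<in> dirs B"
    proof -
     obtain b where b: "B = cell H' b" using p by (auto simp: ocells_def)
     have "z \<in> tang H' z" using cen by (auto simp: tang_def central_def)
     then show ?thesis using b xz cell_tang dirs_cell[OF fin'] by metis
    qed
    ultimately show ?thesis using xz p'' dq by auto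
   qed
   obtain x z where x: "x \<in> A" "w = x - z" "(x, x, z) \<in> dirs (J q)" using pt[of A] qq(1) q by auto
   obtain x' z' where x': "x' \<in> A'" "w = x' - z'" "(x', x', z') \<in> dirs (J q)" using pt[of A'] qq(2) q' eq by auto
   \<comment> \<open>Two lifts of \<open>(0, w)\<close> differ by an element of the common lineality
     space, under which cells are invariant.\<close>
   have k: "x' - x \<in> ?K" using kerK[OF act x'(3) x(3)] x x' by simp
   obtain a where a: "A = cell H a" using p by (auto simp: ocells_def)
   have "x + (x' - x) \<in> cell H a" using x(1) a k cen
    by (intro cell_tan_add) (auto simp: tang_def central_def)
   then have "x' \<in> cell H a" by simp
   moreover obtain a' where a': "A' = cell H a'" using p' by (auto simp: ocells_def)
   ultimately have "A = A'" using x'(1) a cell_eq_iff by metis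
   then show "q = q'" using eq q q' by simp
  qed
  have onto: "E \<in> J ` ?Q" if E: "E \<in> ?Act" for E
  proof -
   have actE: "E \<in> L.active" and plE: "L.plus (0, w) (u, 0) E" using E by auto
   obtain C D B where CDB: "E = C \<times> D \<times> B" "C \<in> ocells H" "D \<in> ocells H" "B \<in> ocells H'"
    using actE by (auto simp: L.active_def ocells_prod_arr3)
   have dE: "dirs E = dirs C \<times> dirs D \<times> dirs B" using CDB dirs_Times3_cells[OF fin fin fin'] by simp
   obtain p where p: "p \<in> dirs E" "diff3 p = (0, w)" using L.active_lift[OF actE] by metis
   obtain q where q: "q \<in> dirs E" "diff3 q = (u, 0)" using L.active_lift[OF actE] by metis
   obtain x z where px: "p = (x, x, z)" "x - z = w" using p(2) by (cases p) (auto simp: diff3_def)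
   obtain q1 q2 where qq: "q = (q1, q2, q1)" "q1 - q2 = u" using q(2) by (cases q) (auto simp: diff3_def)
   have ev: "near0 (\<lambda>j. p + j *R q \<in> E)"
    using L.plus_iff[OF actE p(1) q(1)] plE p q by simp
   have l: "q1 \<in> link x C" "q2 \<in> link x D" "q1 \<in> link z B"
    unfolding link_def mem_Collect_eq by (rule eventually_mono[OF ev], simp add: px qq CDB)+
   let ?A = "cell H x"
   have A: "?A \<in> ocells H" by (simp add: ocells_def)
   obtain b where b: "B = cell H' b" using CDB by (auto simp: ocells_def)
   have zB: "z \<in> ccell H' b" using into_ccell[OF fin'] l b by (auto simp: link_def)
   let ?B = "cell H' z"
   have B': "?B \<in> ocells H'" by (simp add: ocells_def)
   have sum: "S ?A ?B = UNIV" using wS[OF A B', of x z] px by simp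
   have dA: "dirs ?A = tang H x" and dB: "dirs ?B = tang H' z" "dirs B = tang H' b"
    using dirs_cell[OF fin] dirs_cell[OF fin'] b by auto
   have nz: "on_cell f C \<noteq> 0" "on_cell g D \<noteq> 0" "on_cell h B \<noteq> 0" "triple_ix (dirs C) (dirs D) (dirs B) \<noteq> 0"
    using actE tterm[OF CDB(2,3,4)] CDB(1) by (auto simp: L.active_def)
   have ti: "triple_ix (dirs C) (dirs D) (dirs B) = pair_ix (dirs C) (dirs D) * pair_ix (dirs C \<inter> dirs D) (dirs B)"
    by (rule triple_ix_eq[OF sub_dirs sub_dirs sub_dirs])
   have nz2: "pair_ix (dirs C) (dirs D) \<noteq> 0" "pair_ix (dirs C \<inter> dirs D) (dirs B) \<noteq> 0" using nz ti by auto
   have subA: "dirs ?A \<subseteq> dirs C \<inter> dirs D"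
    using link_tan_subset[OF fin CDB(2) l(1)] link_tan_subset[OF fin CDB(3) l(2)] dA by simp
   have subB: "dirs ?B \<subseteq> dirs B" using ccell_tang[OF zB] dB by simp
   have "dirs ?A \<inter> dirs ?B \<subseteq> ?K"
   proof
    fix k assume k: "k \<in> dirs ?A \<inter> dirs ?B"
    then have "(k, k, k) \<in> dirs E" using subA subB dE by auto
    moreover have "diff3 (k, k, k) = 0" by (simp add: diff3_def zero_prod_def)
    ultimately show "k \<in> ?K" using L.active_kernel[OF actE, of "(k, k, k)"] by auto
   qed
   moreover have "?K \<subseteq> dirs ?A \<inter> dirs ?B"
    using dA dB central_tang_0[OF cen(1), of x] central_tang_0[OF cen(2), of z] by blast
   ultimately have KAB: "dirs ?A \<inter> dirs ?B = ?K" by blast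
   \<comment> \<open>Transversality of the cells of \<open>x\<close> and \<open>z\<close> bounds the
     sum of their dimensions from below, and inclusion in the spans of \<open>C\<close>,
     \<open>D\<close> and \<open>B\<close> bounds it from above. Equality holds throughout, so the
     cell of \<open>x\<close> has the expected dimension and \<open>z\<close> lies in the open cell
     \<open>B\<close>.\<close>
   have "dim (dirs ?A) + dim (dirs ?B) = DIM('a) + dim ?K"
    using dim_sum_UNIV[OF sub_dirs sub_dirs sum[unfolded S_def]] KAB by simp
   moreover have "dim (dirs ?A) \<le> dim (dirs C \<inter> dirs D)" "dim (dirs ?B) \<le> dim (dirs B)"
    using subA subB dim_subset by blast+
   moreover have "dim (dirs C \<inter> dirs D) + c + d = DIM('a)" using dimCD CDB nz nz2 by blast
   moreover have "dim (dirs B) + e = DIM('a)" using dimh CDB nz by blast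
   ultimately have dims: "dim (dirs ?A) = dim (dirs C \<inter> dirs D)" "dim (dirs ?B) = dim (dirs B)" "ok ?A"
    using dim by (auto simp: ok_def)
   have "z \<in> B" using ccell_dim_eq[OF zB] dims dB b by simp
   have eqA: "dirs ?A = dirs C \<inter> dirs D"
    by (rule subspace_dim_equal[OF sub_dirs _ subA]) (use dims in \<open>auto intro: subspace_inter sub_dirs\<close>)
   have xrA: "xr ?A \<in> cell H x" using xr(1)[OF A] .
   have "((?A, B), (C, D)) \<in> ?Q"
   proof -
    have "w = x - z \<and> x \<in> ?A \<and> z \<in> B" using px \<open>z \<in> B\<close> by simp
    then have "w \<in> mdiff ?A B" unfolding minkowski_diff_def by blast
    then have "(?A, B) \<in> S1'" using A CDB dims by (simp add: S1'_def)
    moreover have "u \<in> mdiff (link (xr ?A) C) (link (xr ?A) D)"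
     using l qq link_cell_cong[OF fin CDB(2) xrA] link_cell_cong[OF fin CDB(3) xrA] by (auto simp: minkowski_diff_def)
    then have "(C, D) \<in> S2 ?A" using CDB by (simp add: S2_def)
    moreover have "wt ((?A, B), (C, D)) \<noteq> 0" using nz nz2 eqA by (simp add: wt_def)
    ultimately show ?thesis by simp
   qed
   moreover have "J ((?A, B), (C, D)) = E" by (simp add: J_def CDB)
   ultimately show ?thesis by (rule rev_image_eqI[OF _ sym])
  qed
  have "J ` ?Q = ?Act" using into onto by blast
  then have "(\<Sum>C\<in>?Act. on_cell ?F C * L.ix C) = (\<Sum>q\<in>?Q. on_cell ?F (J q) * L.ix (J q))"
   using sum.reindex[OF inj, of "\<lambda>C. on_cell ?F C * L.ix C"] by simp
  also have "\<dots> = (\<Sum>q\<in>?Q. wt q)" using term_eq by (intro sum.cong) auto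
  finally show "pair_deg H H' ?P h w = m" using mL RHS by simp
 qed
qed


subsection \<open>Associativity, balancing and positivity for fans\<close>

lemma generic_linear_bij:
 assumes P: "generic P" and lin: "linear f" and bij: "bij f"
 shows "generic (\<lambda>v. P (f v))"
proof -
 obtain H where H: "finite H" "\<And>V. V \<in> H ==> subspace V \<and> V \<noteq> UNIV" "\<And>v. v \<notin> \<Union>H ==> P v"
  using P by (auto simp: generic_def)
 show ?thesis
 proof (rule genericI[of "(\<lambda>V. f -` V) ` H"])
  fix V assume "V \<in> (\<lambda>V. f -` V) ` H"
  then obtain W where W: "W \<in> H" "V = f -` W" by blast
  have "f -` W \<noteq> UNIV"
  proof
   assume "f -` W = UNIV"
   then have "W = UNIV" using bij by (metis bij_is_surj surj_image_vimage_eq)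
   then show False using H W by blast
  qed
  then show "subspace V \<and> V \<noteq> UNIV" using W H linear_subspace_vimage[OF lin] by blast
 qed (use H in auto)
qed

lemma pair_deg_swap:
 "pair_deg H H' f g v = pair_deg H' H g f (- v)"
proof -
 have mem: "v \<in> mdiff A B \<longleftrightarrow> - v \<in> mdiff B A" for A B :: "'a set"
  unfolding minkowski_diff_def by (auto; metis minus_diff_eq minus_minus)
 show ?thesis
  unfolding pair_deg_def
  by (rule sum.reindex_bij_witness[of _ prod.swap prod.swap]) (auto simp: mem pair_ix_commute mult_ac)
qed

lemma triple_deg_rotate:
 "triple_deg H H' H'' f g h (a, b) = triple_deg H' H'' H g h f (b - a, - a)"
proof -
 have mem: "(a, b) \<in> triple_diff A B C \<longleftrightarrow> (b - a, - a) \<in> triple_diff B C A" for A B C :: "'a set"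
 proof
  assume "(a, b) \<in> triple_diff A B C"
  then obtain x y z where "a = x - y" "b = x - z" "x \<in> A" "y \<in> B" "z \<in> C" by (auto simp: triple_diff_def)
  moreover from this have "(b - a, - a) = (y - z, y - x)" by simp
  ultimately show "(b - a, - a) \<in> triple_diff B C A" unfolding triple_diff_def by blast
 next
  assume "(b - a, - a) \<in> triple_diff B C A"
  then obtain x y z where *: "b - a = y - z" "- a = y - x" "x \<in> A" "y \<in> B" "z \<in> C" by (auto simp: triple_diff_def)
  then have "a = x - y" by (metis minus_diff_eq minus_minus)
  moreover from this have "b = x - z" using *(1) by (simp add: algebra_simps)
  ultimately show "(a, b) \<in> triple_diff A B C" using * unfolding triple_diff_def by blast
 qed
 show ?thesis
  unfolding triple_deg_def
  by (rule sum.reindex_bij_witness[of _ "\<lambda>(B, C, A). (A, B, C)" "\<lambda>(A, B, C). (B, C, A)"])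
   (auto simp: mem triple_ix_rotate[OF sub_dirs sub_dirs sub_dirs] mult_ac)
qed

theorem fan_assoc:
 fixes f g h :: "'a::euclidean_space => real"
 assumes f: "bal_weight H c f" and g: "bal_weight H d g" and h: "bal_weight H e h"
  and cen: "central H" and dim: "dim (tang H 0) + c + d + e = DIM('a)"
 shows "generic_value (pair_deg H H (prod_weight H c d f g) h) =
  generic_value (pair_deg H H f (prod_weight H d e g h))"
proof -
 obtain m where m: "generic (\<lambda>v. triple_deg H H H f g h v = m)"
  using triple_deg_constant[OF f g h cen cen cen] dim by auto
 obtain m' where m': "generic (\<lambda>v. triple_deg H H H g h f v = m')"
  using triple_deg_constant[OF g h f cen cen cen] dim by (auto simp: ac_simps)
 \<comment> \<open>The coordinate change of \<open>triple_deg_rotate\<close>, which moves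
   \<open>f\<close> behind \<open>g\<close> and \<open>h\<close>.\<close>
 let ?k = "\<lambda>(a :: 'a, b :: 'a). (b - a, - a)"
 have "linear ?k" by (rule linearI) (auto simp: algebra_simps)
 moreover have "bij ?k"
  by (rule bij_betw_byWitness[of _ "\<lambda>(x, y). (- y, x - y)"]) auto
 ultimately have "generic (\<lambda>v. triple_deg H H H g h f (?k v) = m')"
  using generic_linear_bij[OF m'] by blast
 moreover have "triple_deg H H H g h f (?k v) = triple_deg H H H f g h v" for v
  using triple_deg_rotate[of H H H f g h "fst v" "snd v"] by (simp add: case_prod_beta)
 ultimately have "generic (\<lambda>v. triple_deg H H H f g h v = m')" by simp
 then have eq: "m = m'" using generic_conj[OF m] generic_ex by blast
 have "generic (\<lambda>w. pair_deg H H (prod_weight H c d f g) h w = m)"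
  by (rule triple_localization[OF f g h cen cen _ m]) (use dim in simp)
 then have 1: "generic_value (pair_deg H H (prod_weight H c d f g) h) = m" by (rule generic_value_eq)
 have "generic (\<lambda>w. pair_deg H H (prod_weight H d e g h) f w = m')"
  by (rule triple_localization[OF g h f cen cen _ m']) (use dim in simp)
 then have "generic (\<lambda>w. pair_deg H H (prod_weight H d e g h) f (- w) = m')"
  by (rule generic_linear_bij) (auto simp: linear_iff bij_uminus)
 then have "generic (\<lambda>w. pair_deg H H f (prod_weight H d e g h) w = m')"
  using pair_deg_swap[of H H f "prod_weight H d e g h"] by simp
 then have "generic_value (pair_deg H H f (prod_weight H d e g h)) = m'" by (rule generic_value_eq)
 then show ?thesis using 1 eq by simp
qed

section \<open>Linear spaces as third factors\<close>

definition orth :: "'a::real_inner set => 'a set"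
 where "orth S = {x. \<forall>s\<in>S. s \<bullet> x = 0}"

definition orth_arr :: "'a::euclidean_space set => ('a \<times> real) set"
 where "orth_arr S = (\<lambda>s. (s, 0)) ` S"

text \<open>A linear space with multiplicity 1. When \<open>S\<close> is independent it is a
  balanced weight of codimension \<open>card S\<close>, and pairing with it tests a fan.\<close>

definition orth_weight :: "'a::euclidean_space set => 'a => real"
 where "orth_weight S x = of_bool (x \<in> orth S)"

lemma subspace_orth_set: "subspace (orth S)"
 by (simp add: orth_def subspace_orth)

lemma central_orth_arr: "central (orth_arr S)"
 by (auto simp: central_def orth_arr_def)

lemma tan_orth_arr: "x \<in> orth S ==> tang (orth_arr S) x = orth S"
 by (auto simp: tang_def orth_arr_def orth_def)

lemma orth_subset_tan: "orth S \<subseteq> tang (orth_arr S) x"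
 by (auto simp: tang_def orth_arr_def orth_def)

lemma cell_orth_arr: "x \<in> orth S ==> cell (orth_arr S) x = orth S"
 by (auto simp: cell_def orth_arr_def orth_def sgn_0_0)

text \<open>Every tangent space of the arrangement contains \<open>orth S\<close>, whose codimension
  is already \<open>card S\<close>, so there are no ridges at which balancing could fail.\<close>

lemma orth_weight_balanced:
 fixes S :: "'a::euclidean_space set"
 assumes S: "finite S" "S \<subseteq> lat" and dim: "dim (orth S) + card S = DIM('a)"
 shows "bal_weight (orth_arr S) (card S) (orth_weight S)"
 unfolding bal_weight_def pure_weight_def
proof (intro conjI allI impI)
 show "arrg (orth_arr S)" using S by (auto simp: arrg_def orth_arr_def)
 show "cell_const (orth_arr S) (orth_weight S)"
  unfolding cell_const_def
 proof (intro allI impI)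
  fix x y assume y: "y \<in> cell (orth_arr S) x"
  have "y \<in> orth S \<longleftrightarrow> x \<in> orth S"
   using cell_orth_arr y cell_eq_iff cell_refl by metis
  then show "orth_weight S y = orth_weight S x" by (simp add: orth_weight_def)
 qed
 show "dim (tang (orth_arr S) x) + card S = DIM('a)" if "orth_weight S x \<noteq> 0" for x
  using that dim tan_orth_arr[of x S] by (auto simp: orth_weight_def)
 fix t assume "dim (tang (orth_arr S) t) + 1 + card S = DIM('a)"
 moreover have "dim (orth S) \<le> dim (tang (orth_arr S) t)" by (rule dim_subset[OF orth_subset_tan])
 ultimately show "balanced_at (orth_arr S) (orth_weight S) t" using dim by linarith
qed

lemma pair_deg_orth:
 fixes P :: "'a::euclidean_space => real"
 assumes S: "finite S" "S \<subseteq> lat" and dim: "dim (orth S) + card S = DIM('a)" and fin: "finite H"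
 shows "pair_deg H (orth_arr S) P (orth_weight S) w =
  (\<Sum>A | A \<in> ocells H \<and> w \<in> mdiff A (orth S). on_cell P A * pair_ix (dirs A) (orth S))"
proof -
 have c: "cell_const (orth_arr S) (orth_weight S)"
  using bal_pure[OF orth_weight_balanced[OF S dim]] pureD(3) by blast
 have fS: "finite (orth_arr S)" using S by (simp add: orth_arr_def)
 have z: "0 \<in> orth S" by (simp add: orth_def)
 have L: "orth S \<in> ocells (orth_arr S)" using cell_orth_arr[OF z] by (metis ocells_def rangeI)
 have onL: "on_cell (orth_weight S) (orth S) = 1"
  using on_cell_cell[OF c, of 0] cell_orth_arr[OF z] z by (simp add: orth_weight_def)
 have dL: "dirs (orth S) = orth S" using dirs_cell[OF fS, of 0] cell_orth_arr[OF z] tan_orth_arr[OF z] by simp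
 have on0: "on_cell (orth_weight S) B = 0" if B: "B \<in> ocells (orth_arr S)" "B \<noteq> orth S" for B
 proof -
  obtain b where b: "B = cell (orth_arr S) b" using B(1) unfolding ocells_def by blast
  then have "b \<notin> orth S" using B(2) cell_orth_arr by blast
  then show ?thesis using b on_cell_cell[OF c] by (simp add: orth_weight_def)
 qed
 let ?S = "{(A, B). A \<in> ocells H \<and> B \<in> ocells (orth_arr S) \<and> w \<in> mdiff A B}"
 let ?T = "{A. A \<in> ocells H \<and> w \<in> mdiff A (orth S)}"
 have "pair_deg H (orth_arr S) P (orth_weight S) w =
   (\<Sum>(A, B)\<in>(\<lambda>A. (A, orth S)) ` ?T. on_cell P A * on_cell (orth_weight S) B * pair_ix (dirs A) (dirs B))"
  unfolding pair_deg_def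
 proof (rule sum.mono_neutral_right)
  show "finite ?S" using finite_ocells[OF fin] finite_ocells[OF fS] by (rule finite_pairs)
  show "(\<lambda>A. (A, orth S)) ` ?T \<subseteq> ?S" using L by auto
  show "\<forall>i\<in>?S - (\<lambda>A. (A, orth S)) ` ?T. (case i of (A, B) => on_cell P A * on_cell (orth_weight S) B * pair_ix (dirs A) (dirs B)) = 0"
   using on0 by fastforce
 qed
 also have "\<dots> = (\<Sum>A\<in>?T. on_cell P A * pair_ix (dirs A) (orth S))"
  by (subst sum.reindex) (auto simp: inj_on_def onL dL)
 finally show ?thesis .
qed

lemma dim_cut:
 fixes W :: "'a::euclidean_space set"
 assumes "subspace W" "x \<in> W" "u \<bullet> x \<noteq> 0"
 shows "dim (W \<inter> {y. u \<bullet> y = 0}) + 1 = dim W"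
proof -
 have lin: "linear (\<lambda>y. u \<bullet> y)" by (rule linearI) (auto simp: inner_add_right)
 have "(\<lambda>y. u \<bullet> y) ` W = UNIV"
 proof -
  have "r \<in> (\<lambda>y. u \<bullet> y) ` W" for r
   using assms by (intro image_eqI[of _ _ "(r / (u \<bullet> x)) *R x"]) (auto simp: subspace_scale)
  then show ?thesis by auto
 qed
 moreover have "{y \<in> W. u \<bullet> y = 0} = W \<inter> {y. u \<bullet> y = 0}" by auto
 ultimately show ?thesis using dim_image_kernel[OF lin assms(1)] by simp
qed

text \<open>A vector is kept only if it cuts \<open>M \<inter> orth S\<close> properly; it then
  lowers the dimension of this space and that of \<open>orth S\<close> by one. Applied to the
  normals of a fan this gives a rational complement of \<open>M\<close> modulo the lineality
  space.\<close>

lemma orth_select: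
 fixes M :: "'a::euclidean_space set"
 assumes "finite U" "subspace M"
 shows "\<exists>S\<subseteq>U. M \<inter> orth S = M \<inter> orth U \<and> dim (M \<inter> orth S) + card S = dim M \<and> dim (orth S) + card S = DIM('a)"
 using assms(1)
proof (induction U rule: finite_induct)
 case empty
 then show ?case by (simp add: orth_def)
next
 case (insert u U)
 then obtain S where S: "S \<subseteq> U" "M \<inter> orth S = M \<inter> orth U" "dim (M \<inter> orth S) + card S = dim M"
  "dim (orth S) + card S = DIM('a)" by blast
 show ?case
 proof (cases "\<forall>x\<in>M \<inter> orth S. u \<bullet> x = 0")
  case True
  then have "M \<inter> orth S = M \<inter> orth (insert u U)" using S(2) by (auto simp: orth_def)
  then show ?thesis using S by blast
 next
  case False
  then obtain x where x: "x \<in> M" "x \<in> orth S" "u \<bullet> x \<noteq> 0" by blast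
  have uS: "u \<notin> S" using x by (auto simp: orth_def)
  have finS: "finite S" using S insert finite_subset by blast
  have e: "orth (insert u T) = orth T \<inter> {y. u \<bullet> y = 0}" for T by (auto simp: orth_def)
  have "dim (M \<inter> orth S \<inter> {y. u \<bullet> y = 0}) + 1 = dim (M \<inter> orth S)"
   using x assms by (intro dim_cut[of _ x]) (auto intro: subspace_inter subspace_orth_set)
  moreover have "dim (orth S \<inter> {y. u \<bullet> y = 0}) + 1 = dim (orth S)"
   using x by (intro dim_cut[of _ x]) (auto intro: subspace_orth_set)
  moreover have "M \<inter> orth (insert u S) = M \<inter> orth (insert u U)" using S(2) unfolding e by blast
  ultimately have "insert u S \<subseteq> insert u U \<and> M \<inter> orth (insert u S) = M \<inter> orth (insert u U) \<and>
    dim (M \<inter> orth (insert u S)) + card (insert u S) = dim M \<and> dim (orth (insert u S)) + card (insert u S) = DIM('a)"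
   using S uS finS by (auto simp: e Int_assoc)
  then show ?thesis by blast
 qed
qed

lemma tang_0_orth: "central H ==> tang H 0 = orth (fst ` H)"
 by (force simp: tang_def orth_def central_def)

lemma dirs_subset_span: "dirs C \<subseteq> span C"
 unfolding dirs_def by (rule span_minimal) (auto intro: span_diff span_base)

lemma subspace_full:
 fixes X :: "'a::euclidean_space set"
 shows "subspace X ==> dim X = DIM('a) ==> X = UNIV"
 using dim_eq_full[of X] span_eq_iff[of X] by simp

text \<open>A rational linear space complementary to \<open>M\<close> modulo the lineality space is
  added as third factor. At a generic displacement inside their triple difference the two
  transversal cells contribute a positive term, so the constant triple degree is positive. Computed
  through the product of \<open>f\<close> and \<open>g\<close>, it requires a positive weight
  there.\<close>

theorem fan_positive:
 fixes f g :: "'a::euclidean_space => real"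
 assumes f: "bal_weight H c f" and g: "bal_weight H d g" and cen: "central H"
  and nonneg: "\<And>x. f x \<ge> 0" "\<And>x. g x \<ge> 0" and xy: "f x \<noteq> 0" "g y \<noteq> 0"
  and sum: "(msum (tang H x) (tang H y)) = UNIV"
 shows "\<exists>z. prod_weight H c d f g z > 0"
proof -
 note pf = bal_pure[OF f] and pg = bal_pure[OF g]
 note arr = pureD(1)[OF pf] and fin = pureD(2)[OF pf] and cf = pureD(3)[OF pf] and cg = pureD(3)[OF pg]
 define M where "M = tang H x \<inter> tang H y"
 have subM: "subspace M" unfolding M_def by (intro subspace_inter sub_tang)
 have dimM: "dim M + c + d = DIM('a)"
  using dim_sum_UNIV[OF sub_tang sub_tang sum] pureD(4)[OF pf xy(1)] pureD(4)[OF pg xy(2)]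
  by (simp add: M_def)
 let ?K = "tang H 0"
 have KM: "?K \<subseteq> M" unfolding M_def using central_tang_0[OF cen] by blast
 have finU: "finite (fst ` H)" using fin by simp
 obtain S where S: "S \<subseteq> fst ` H" "M \<inter> orth S = M \<inter> orth (fst ` H)" "dim (M \<inter> orth S) + card S = dim M" "dim (orth S) + card S = DIM('a)"
  using orth_select[OF finU subM] by blast
 have "fst ` H \<subseteq> lat" using arr by (auto simp: arrg_def)
 then have Slat: "finite S" "S \<subseteq> lat" using S(1) finU finite_subset by auto
 have KMS: "M \<inter> orth S = ?K" using S(2) KM tang_0_orth[OF cen] by blast
 have z: "0 \<in> orth S" by (simp add: orth_def)
 let ?HS = "orth_arr S"
 note h = orth_weight_balanced[OF Slat S(4)] and ph = bal_pure[OF orth_weight_balanced[OF Slat S(4)]]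
 have "?K \<inter> tang ?HS 0 = ?K" using KMS tan_orth_arr[OF z] by blast
 then have dimK: "dim (?K \<inter> tang ?HS 0) + c + d + card S = DIM('a)" using KMS S(3) dimM by simp
 obtain m where m: "generic (\<lambda>p. triple_deg H H ?HS f g (orth_weight S) p = m)"
  using triple_deg_constant[OF f g h cen cen central_orth_arr] dimK by auto
 let ?A = "cell H x" and ?B = "cell H y" and ?L = "orth S"
 have cells: "?A \<in> ocells H" "?B \<in> ocells H" "?L \<in> ocells ?HS"
  using cell_orth_arr[OF z] by (auto simp: ocells_def)
 have dA: "dirs ?A = tang H x" "dirs ?B = tang H y" using dirs_cell[OF fin] by auto
 have dL: "dirs ?L = ?L" using dirs_cell[OF pureD(2)[OF ph], of 0] cell_orth_arr[OF z] tan_orth_arr[OF z] by simp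
 have onL: "on_cell (orth_weight S) ?L = 1"
  using on_cell_cell[OF pureD(3)[OF ph], of 0] cell_orth_arr[OF z] z by (simp add: orth_weight_def)
 have sumMK: "(msum M ?L) = UNIV"
 proof -
  have "dim (msum M ?L) = DIM('a)"
   using dim_sums_Int[OF subM subspace_orth_set[of S]] S(3,4) by simp
  moreover have "subspace (msum M ?L)" by (intro subspace_sums subM subspace_orth_set)
  ultimately show ?thesis by (rule subspace_full[rotated])
 qed
 \<comment> \<open>A convex set contains a generic point as soon as it spans, and the chosen
   displacement has to lie in this particular difference.\<close>
 have "span (triple_diff ?A ?B ?L) = UNIV"
 proof -
  have "(v, w) \<in> diff3 ` (dirs ?A \<times> dirs ?B \<times> dirs ?L)" for v w
  proof -
   have "v \<in> (msum (tang H x) (tang H y))" using sum by simp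
   then obtain a b where ab: "v = a + b" "a \<in> tang H x" "b \<in> tang H y" by blast
   have "w - a \<in> (msum M ?L)" using sumMK by simp
   then obtain k l where kl: "w - a = k + l" "k \<in> M" "l \<in> ?L" by blast
   have "a + k \<in> dirs ?A" using ab kl dA by (auto simp: M_def subspace_add sub_tang)
   moreover have "k - b \<in> dirs ?B" using ab kl dA by (auto simp: M_def subspace_diff sub_tang)
   moreover have "- l \<in> dirs ?L" using kl dL subspace_neg[OF subspace_orth_set] by metis
   moreover have "(v, w) = diff3 (a + k, k - b, - l)" using ab kl by (simp add: diff3_def algebra_simps)
   ultimately show ?thesis by blast
  qed
  then have "UNIV \<subseteq> diff3 ` (dirs ?A \<times> dirs ?B \<times> dirs ?L)" by auto
  also have "\<dots> = diff3 ` dirs (?A \<times> ?B \<times> ?L)"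
   using dirs_Times3_cells[OF fin fin pureD(2)[OF ph] cells] by simp
  also have "\<dots> \<subseteq> diff3 ` span (?A \<times> ?B \<times> ?L)" using dirs_subset_span by blast
  also have "\<dots> = span (triple_diff ?A ?B ?L)" using linear_span_image[OF linear_diff3] diff3_image by metis
  finally show ?thesis by blast
 qed
 moreover have "convex (triple_diff ?A ?B ?L)"
  unfolding diff3_image[symmetric]
  by (intro convex_linear_image linear_diff3 convex_Times convex_cell subspace_imp_convex subspace_orth_set)
 moreover have "triple_diff ?A ?B ?L \<noteq> {}"
  unfolding diff3_image[symmetric] using z cell_refl by blast
 ultimately obtain p where p: "p \<in> triple_diff ?A ?B ?L" "triple_deg H H ?HS f g (orth_weight S) p = m"
  using generic_convex[OF m] by blast
 have onf: "on_cell f A \<ge> 0" "on_cell g A \<ge> 0" "on_cell (orth_weight S) A \<ge> 0" for A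
  using nonneg by (auto simp: on_cell_def orth_weight_def)
 have ti: "triple_ix (dirs ?A) (dirs ?B) (dirs ?L) > 0"
 proof -
  have "pair_ix (dirs ?A) (dirs ?B) > 0"
   unfolding dA by (intro pair_ix_pos sub_tang tang_span_lat arr sum)
  moreover have "pair_ix M ?L > 0"
  proof (intro pair_ix_pos subM subspace_orth_set sumMK)
   show "span (M \<inter> lat) = M" unfolding M_def
    by (intro rational_subspace_span_lat rational_subspace_Int rational_tang arr)
   have "rational_subspace ?L" using Slat by (auto simp: rational_subspace_def orth_def)
   then show "span (?L \<inter> lat) = ?L" by (rule rational_subspace_span_lat)
  qed
  ultimately show ?thesis
   using triple_ix_eq[OF sub_dirs sub_dirs sub_dirs, of ?A ?B ?L] unfolding dL dA M_def by simp
 qed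
 have "m > 0"
 proof -
  let ?S = "{(A, B, C). A \<in> ocells H \<and> B \<in> ocells H \<and> C \<in> ocells ?HS \<and> p \<in> triple_diff A B C}"
  let ?t = "\<lambda>(A, B, C). on_cell f A * on_cell g B * on_cell (orth_weight S) C * triple_ix (dirs A) (dirs B) (dirs C)"
  have "finite ?S"
   by (rule finite_subset[of _ "ocells H \<times> ocells H \<times> ocells ?HS"])
    (use finite_ocells[OF fin] finite_ocells[OF pureD(2)[OF ph]] in auto)
  moreover have "(?A, ?B, ?L) \<in> ?S" using cells p by simp
  moreover have "?t q \<ge> 0" for q using onf by (cases q) simp
  ultimately have "?t (?A, ?B, ?L) \<le> sum ?t ?S" by (intro member_le_sum) auto
  moreover have "?t (?A, ?B, ?L) > 0"
   using ti xy nonneg[of x] nonneg[of y] onL on_cell_cell[OF cf, of x] on_cell_cell[OF cg, of y] by simp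
  ultimately show ?thesis using p(2) by (simp add: triple_deg_def)
 qed
 have "generic (\<lambda>w. pair_deg H ?HS (prod_weight H c d f g) (orth_weight S) w = m)"
  by (rule triple_localization[OF f g h cen central_orth_arr dimK m])
 then obtain w where w: "pair_deg H ?HS (prod_weight H c d f g) (orth_weight S) w = m" using generic_ex by blast
 have "\<exists>A\<in>ocells H. on_cell (prod_weight H c d f g) A > 0"
 proof (rule ccontr)
  assume "\<not> ?thesis"
  then have "on_cell (prod_weight H c d f g) A \<le> 0" if "A \<in> ocells H" for A using that by force
  then have "pair_deg H ?HS (prod_weight H c d f g) (orth_weight S) w \<le> 0"
   unfolding pair_deg_def using onf(3)
   by (intro sum_nonpos) (auto intro!: mult_nonpos_nonneg)
  then show False using w \<open>m > 0\<close> by simp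
 qed
 then show ?thesis unfolding on_cell_def by blast
qed

text \<open>\<open>J\<close> depends on \<open>u\<close> alone. The lattice of the hyperplane
  together with that of the cell behind \<open>r\<close> is generated by the former and one vector
  congruent to \<open>r\<close>, so that \<open>grp_ix_adjoin\<close> applies with a functional
  proportional to \<open>u\<close>.\<close>

lemma pair_ix_ray:
 fixes u :: "'a::euclidean_space"
 assumes u: "u \<in> lat" "u \<noteq> 0"
 shows "\<exists>J>0. \<forall>K r. rational_subspace K \<and> K \<subseteq> orth {u} \<and> prim_mod K r -->
   pair_ix {k + q *R r |k q. k \<in> K} (orth {u}) = J * \<bar>u \<bullet> r\<bar>"
proof -
 let ?L = "orth {u}" and ?T = "lat \<inter> orth {u}"
 have ratL: "rational_subspace ?L" using u by (auto simp: rational_subspace_def orth_def)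
 have spanT: "span ?T = ?L" using rational_subspace_span_lat[OF ratL] by (simp add: Int_commute)
 have subL: "subspace ?L" by (rule subspace_orth_set)
 have "UNIV \<inter> {y. u \<bullet> y = 0} = ?L" by (auto simp: orth_def)
 then have dimL: "dim ?L + 1 = DIM('a)" using dim_cut[of UNIV u u] u by simp
 then have dimT: "dim ?T + 1 = DIM('a)" using spanT by (metis dim_span)
 obtain a where a: "\<And>t. t \<in> ?T ==> a \<bullet> t = 0"
  "\<And>w. w \<in> lat ==> grp_ix lat {t + of_int k *R w |t k. t \<in> ?T} = \<bar>a \<bullet> w\<bar>"
  using grp_ix_adjoin[OF lat_Int_subgroup[OF subL] _ dimT] by blast
 have aL: "a \<bullet> y = 0" if "y \<in> ?L" for y
  using orthogonal_to_span[of y ?T a] a(1) that spanT by (auto simp: orthogonal_def)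
 have au: "a \<bullet> y = ((a \<bullet> u) / (u \<bullet> u)) * (u \<bullet> y)" for y
 proof -
  have "y - ((u \<bullet> y) / (u \<bullet> u)) *R u \<in> ?L" using u by (simp add: orth_def inner_diff_right)
  then have "a \<bullet> (y - ((u \<bullet> y) / (u \<bullet> u)) *R u) = 0" by (rule aL)
  then show ?thesis by (simp add: inner_diff_right)
 qed
 define J where "J = \<bar>(a \<bullet> u) / (u \<bullet> u)\<bar>"
 have "a \<bullet> u \<noteq> 0"
 proof -
  let ?G = "{t + of_int k *R u |t k. t \<in> ?T}"
  have eq: "{t + w |t w. t \<in> ?T \<and> w \<in> range (\<lambda>k::int. of_int k *R u)} = ?G" by blast
  have rg: "subgrp (range (\<lambda>k::int. of_int k *R u))"
   unfolding subgrp_def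
  proof (intro conjI ballI)
   show "0 \<in> range (\<lambda>k::int. of_int k *R u)" by (rule range_eqI[of _ _ 0]) simp
   fix x y assume "x \<in> range (\<lambda>k::int. of_int k *R u)" "y \<in> range (\<lambda>k::int. of_int k *R u)"
   then obtain i j :: int where "x = of_int i *R u" "y = of_int j *R u" by blast
   then show "x - y \<in> range (\<lambda>k::int. of_int k *R u)"
    by (intro range_eqI[of _ _ "i - j"]) (simp add: scaleR_left_diff_distrib)
  qed
  have "subgrp ?G" using sum_subgroup[OF lat_Int_subgroup[OF subL] rg] unfolding eq .
  moreover have "?G \<subseteq> lat" using u subgrp_add[OF lat_subgroup] subgrp_of_int[OF lat_subgroup] by blast
  moreover have "span ?G = UNIV"
  proof -
   have "?T \<subseteq> ?G"
   proof
    fix t assume "t \<in> ?T"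
    then have "t = t + of_int 0 *R u \<and> t \<in> ?T" by simp
    then show "t \<in> ?G" by blast
   qed
   then have 1: "?L \<subseteq> span ?G" using spanT span_mono[of ?T ?G] by simp
   have "u = 0 + of_int 1 *R u \<and> 0 \<in> ?T" by (simp add: orth_def)
   then have 2: "u \<in> span ?G" by (intro span_base) blast
   have "y \<in> span ?G" for y
   proof -
    have "y - ((u \<bullet> y) / (u \<bullet> u)) *R u \<in> ?L" using u by (simp add: orth_def inner_diff_right)
    then have "(y - ((u \<bullet> y) / (u \<bullet> u)) *R u) + ((u \<bullet> y) / (u \<bullet> u)) *R u \<in> span ?G"
     using 1 2 by (intro span_add span_scale) auto
    then show ?thesis by simp
   qed
   then show ?thesis by auto
  qed
  ultimately have "grp_ix lat ?G > 0" by (rule grp_ix_lat_pos)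
  then show ?thesis using a(2)[OF u(1)] by auto
 qed
 then have "J > 0" using u by (simp add: J_def)
 moreover have "pair_ix {k + q *R r |k q. k \<in> K} ?L = J * \<bar>u \<bullet> r\<bar>"
  if K: "rational_subspace K" "K \<subseteq> ?L" and r: "prim_mod K r" for K r
 proof -
  have subK: "subspace K" using K rational_subspace_imp_subspace by blast
  obtain v where v: "v \<in> lat" "v - r \<in> K" using prim_mod_rep[OF r] by metis
  have "{x + y |x y. x \<in> lat \<inter> {k + q *R r |k q. k \<in> K} \<and> y \<in> ?T} = {t + of_int k *R v |t k. t \<in> ?T}"
   unfolding prim_mod_lattice[OF r subK v]
  proof (intro equalityI subsetI)
   fix z assume "z \<in> {x + y |x y. x \<in> {k + of_int j *R v |k j. k \<in> lat \<inter> K} \<and> y \<in> ?T}"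
   then obtain k j y where kj: "z = (k + of_int j *R v) + y" "k \<in> lat \<inter> K" "y \<in> ?T" by blast
   then have "k + y \<in> ?T" using K(2) subgrp_add[OF lat_Int_subgroup[OF subL]] by blast
   moreover have "z = (k + y) + of_int j *R v" using kj(1) by (simp add: ac_simps)
   ultimately show "z \<in> {t + of_int k *R v |t k. t \<in> ?T}" by blast
  next
   fix z assume "z \<in> {t + of_int k *R v |t k. t \<in> ?T}"
   then obtain t j where tj: "z = t + of_int j *R v" "t \<in> ?T" by blast
   moreover have "z = (0 + of_int j *R v) + t" using tj(1) by (simp add: ac_simps)
   moreover have "0 \<in> lat \<inter> K" using subspace_0[OF subK] by simp
   ultimately show "z \<in> {x + y |x y. x \<in> {k + of_int j *R v |k j. k \<in> lat \<inter> K} \<and> y \<in> ?T}" by blast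
  qed
  then have "pair_ix {k + q *R r |k q. k \<in> K} ?L = \<bar>a \<bullet> v\<bar>" using a(2)[OF v(1)] by (simp add: pair_ix_def)
  also have "a \<bullet> v = a \<bullet> r" using aL[of "v - r"] v K by (auto simp: inner_diff_right)
  also have "\<bar>a \<bullet> r\<bar> = J * \<bar>u \<bullet> r\<bar>" unfolding J_def abs_mult[symmetric] using au[of r] by simp
  finally show ?thesis .
 qed
 ultimately show ?thesis by blast
qed

text \<open>For each normal \<open>u\<close> of the arrangement the product is paired with the
  hyperplane \<open>orth {u}\<close>. The degrees at \<open>w\<close> and \<open>- w\<close> agree;
  they count the rays on the two sides, which yields \<open>u \<bullet> s = 0\<close> for the
  balancing sum \<open>s\<close>. Hence \<open>s\<close> lies in the lineality space, to which it is
  also orthogonal.\<close>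

theorem fan_balanced:
 fixes f g :: "'a::euclidean_space => real"
 assumes f: "bal_weight H c f" and g: "bal_weight H d g" and cen: "central H"
  and dim: "dim (tang H 0) + 1 + c + d = DIM('a)"
 shows "balanced_at H (prod_weight H c d f g) 0"
proof -
 note pf = bal_pure[OF f] and pg = bal_pure[OF g]
 note arr = pureD(1)[OF pf] and fin = pureD(2)[OF pf] and cf = pureD(3)[OF pf] and cg = pureD(3)[OF pg]
 let ?P = "prod_weight H c d f g" and ?K = "tang H 0"
 have pP: "pure_weight H (c + d) ?P" by (rule pure_prod_weight[OF pf pg])
 note cP = pureD(3)[OF pP]
 have germP: "germ ?P 0 = ?P" using germ_central[OF cen cP] by auto
 have lk0: "larr H 0 = H" by (rule larr_central[OF cen])
 define R where "R = {r. prim_mod ?K r \<and> ?P r \<noteq> 0}"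
 have finR: "finite R" unfolding R_def
  using finite_primitive_germ[OF pP, of 0] dim germP by simp
 define s where "s = (\<Sum>r\<in>R. ?P r *R r)"
 have dimr: "dim (tang H r) = dim ?K + 1" if "r \<in> R" for r
  using pureD(4)[OF pP, of r] that dim by (simp add: R_def)
 have dr: "dirs (cell H r) = {k + q *R r |k q. k \<in> ?K}" if r: "r \<in> R" for r
 proof -
  have "r \<in> tang H r" using cen by (auto simp: tang_def central_def)
  then have "tang H r = {k + q *R r |k q. k \<in> ?K}"
   using r dimr[OF r] prim_mod_notin
   by (intro subspace_adjoin_eq sub_tang central_tang_0[OF cen]) (auto simp: R_def)
  then show ?thesis using dirs_cell[OF fin] by simp
 qed
 have us: "u \<bullet> s = 0" if uH: "(u, c0) \<in> H" for u c0
 proof (cases "u = 0")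
  case False
  have c0: "c0 = 0" using cen uH by (auto simp: central_def)
  have ulat: "u \<in> lat" using arr uH by (auto simp: arrg_def)
  let ?L = "orth {u}" and ?HS = "orth_arr {u}"
  have "UNIV \<inter> {y. u \<bullet> y = 0} = ?L" by (auto simp: orth_def)
  then have dimL: "dim ?L + card {u} = DIM('a)" using dim_cut[of UNIV u u] False by simp
  have S: "finite {u}" "{u} \<subseteq> lat" using ulat by auto
  note h = orth_weight_balanced[OF S dimL]
  have z: "0 \<in> ?L" by (simp add: orth_def)
  have KL: "?K \<subseteq> ?L" using uH c0 by (auto simp: tang_def orth_def)
  then have "?K \<inter> tang ?HS 0 = ?K" using tan_orth_arr[OF z] by blast
  then have dimK: "dim (?K \<inter> tang ?HS 0) + c + d + card {u} = DIM('a)" using dim by simp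
  obtain m where m: "generic (\<lambda>p. triple_deg H H ?HS f g (orth_weight {u}) p = m)"
   using triple_deg_constant[OF f g h cen cen central_orth_arr] dimK by auto
  have gm: "generic (\<lambda>w. pair_deg H ?HS ?P (orth_weight {u}) w = m)"
   by (rule triple_localization[OF f g h cen central_orth_arr dimK m])
  then have gm': "generic (\<lambda>w. pair_deg H ?HS ?P (orth_weight {u}) (- w) = m)"
   by (rule generic_linear_bij) (auto simp: linear_iff bij_uminus)
  have "?L \<noteq> UNIV" using False by (auto simp: orth_def set_eq_iff)
  then have gL: "generic (\<lambda>w. w \<notin> ?L)" by (intro generic_not_mem subspace_orth_set)
  obtain w where w: "pair_deg H ?HS ?P (orth_weight {u}) w = m" "pair_deg H ?HS ?P (orth_weight {u}) (- w) = m" "u \<bullet> w \<noteq> 0"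
   using generic_ex[OF generic_conj[OF gm generic_conj[OF gm' gL]]] by (auto simp: orth_def)
  obtain J where k: "J > 0" "\<forall>K r. rational_subspace K \<and> K \<subseteq> orth {u} \<and> prim_mod K r -->
   pair_ix {k + q *R r |k q. k \<in> K} (orth {u}) = J * \<bar>u \<bullet> r\<bar>"
   using pair_ix_ray[OF ulat False] by blast
  have ix: "pair_ix (dirs (cell H r)) ?L = J * \<bar>u \<bullet> r\<bar>" if "r \<in> R" for r
   using k(2) rational_tang[OF arr, of 0] KL that dr by (simp add: R_def)
  have deg: "pair_deg H ?HS ?P (orth_weight {u}) w = (\<Sum>r\<in>R. ?P r * (J * \<bar>u \<bullet> r\<bar>) * of_bool (sgn (u \<bullet> r) = sgn (u \<bullet> w)))"
   if w0: "u \<bullet> w \<noteq> 0" for w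
  proof -
   have mem: "w \<in> mdiff (cell H r) ?L \<longleftrightarrow> sgn (u \<bullet> r) = sgn (u \<bullet> w)" for r
   proof
    assume "w \<in> mdiff (cell H r) ?L"
    then obtain x y where xy: "w = x - y" "x \<in> cell H r" "u \<bullet> y = 0" by (auto simp: minkowski_diff_def orth_def)
    have "sgn (u \<bullet> x) = sgn (u \<bullet> r)" using xy(2) uH c0 by (auto simp: cell_def)
    then show "sgn (u \<bullet> r) = sgn (u \<bullet> w)" using xy by (simp add: inner_diff_right)
   next
    assume e: "sgn (u \<bullet> r) = sgn (u \<bullet> w)"
    then have r0: "u \<bullet> r \<noteq> 0" using w0 by (metis sgn_0_0)
    have "(u \<bullet> w) / (u \<bullet> r) > 0" using e r0 w0 by (auto simp: sgn_if zero_less_divide_iff split: if_splits)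
    then have "((u \<bullet> w) / (u \<bullet> r)) *R r \<in> cell H r" by (rule scale_cell[OF cen])
    moreover have "((u \<bullet> w) / (u \<bullet> r)) *R r - w \<in> ?L" using r0 by (simp add: orth_def inner_diff_right)
    moreover have "w = ((u \<bullet> w) / (u \<bullet> r)) *R r - (((u \<bullet> w) / (u \<bullet> r)) *R r - w)" by simp
    ultimately show "w \<in> mdiff (cell H r) ?L" unfolding minkowski_diff_def by blast
   qed
   define R' where "R' = {r \<in> R. sgn (u \<bullet> r) = sgn (u \<bullet> w)}"
   have inj: "inj_on (cell H) R'"
   proof (rule inj_onI)
    fix r r' assume r: "r \<in> R'" "r' \<in> R'" "cell H r = cell H r'"
    have "r' \<in> cell (larr H 0) r" using r lk0 by (metis cell_refl)
    then show "r = r'" using prim_mod_cell_unique[OF refl, of H 0 r r'] r dimr lk0 by (auto simp: R'_def R_def)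
   qed
   have "pair_deg H ?HS ?P (orth_weight {u}) w =
     (\<Sum>A | A \<in> ocells H \<and> w \<in> mdiff A ?L. on_cell ?P A * pair_ix (dirs A) ?L)"
    by (rule pair_deg_orth[OF S dimL fin])
   also have "\<dots> = (\<Sum>A\<in>cell H ` R'. on_cell ?P A * pair_ix (dirs A) ?L)"
   proof (rule sum.mono_neutral_right)
    show "finite {A \<in> ocells H. w \<in> mdiff A ?L}" using finite_ocells[OF fin] by simp
    show "cell H ` R' \<subseteq> {A \<in> ocells H. w \<in> mdiff A ?L}" using mem by (auto simp: R'_def ocells_def)
    show "\<forall>A\<in>{A \<in> ocells H. w \<in> mdiff A ?L} - cell H ` R'. on_cell ?P A * pair_ix (dirs A) ?L = 0"
    proof
     fix A assume A: "A \<in> {A \<in> ocells H. w \<in> mdiff A ?L} - cell H ` R'"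
     then obtain y where y: "A = cell H y" unfolding ocells_def by blast
     have "?P y = 0"
     proof (rule ccontr)
      assume Py: "?P y \<noteq> 0"
      then have "dim (tang (larr H 0) y) = dim (tang H 0) + 1"
       using pureD(4)[OF pP Py] dim lk0 by simp
      then obtain r where r: "prim_mod ?K r" "r \<in> cell H y" using ex_prim_mod_tan[OF arr] lk0 by metis
      then have "r \<in> R" using Py cP by (auto simp: R_def cell_const_def)
      moreover have Ar: "A = cell H r" using r y cell_eq_iff by metis
      moreover have "sgn (u \<bullet> r) = sgn (u \<bullet> w)" using A Ar mem by blast
      ultimately show False using A by (auto simp: R'_def)
     qed
     then show "on_cell ?P A * pair_ix (dirs A) ?L = 0" using y on_cell_cell[OF cP] by simp
    qed
   qed
   also have "\<dots> = (\<Sum>r\<in>R'. ?P r * (J * \<bar>u \<bullet> r\<bar>))"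
    unfolding sum.reindex[OF inj] by (rule sum.cong) (auto simp: R'_def on_cell_cell[OF cP] ix)
   also have "\<dots> = (\<Sum>r\<in>R. ?P r * (J * \<bar>u \<bullet> r\<bar>) * of_bool (sgn (u \<bullet> r) = sgn (u \<bullet> w)))"
    unfolding R'_def using finR by (simp add: sum.inter_filter if_distrib of_bool_def cong: if_cong)
   finally show ?thesis .
  qed
  \<comment> \<open>Rays on the side of \<open>w\<close> enter the first degree and rays on the
    other side the second; the factor \<open>sgn (u \<bullet> w)\<close> turns the absolute values
    into signed ones.\<close>
  have "0 = sgn (u \<bullet> w) * (pair_deg H ?HS ?P (orth_weight {u}) w - pair_deg H ?HS ?P (orth_weight {u}) (- w))"
   using w by simp
  also have "\<dots> = (\<Sum>r\<in>R. J * (?P r * (u \<bullet> r)))"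
  proof -
   have "sgn (u \<bullet> w) * (x * (J * \<bar>y\<bar>) * of_bool (sgn y = sgn (u \<bullet> w)) - x * (J * \<bar>y\<bar>) * of_bool (sgn y = sgn (u \<bullet> - w))) = J * (x * y)"
    for x y :: real using w(3) by (auto simp: sgn_if)
   then show ?thesis
    unfolding deg[OF w(3)] deg[of "- w", simplified, OF w(3)]
    by (simp add: sum_subtractf[symmetric] sum_distrib_left)
  qed
  also have "\<dots> = J * (u \<bullet> s)" by (simp add: s_def inner_sum_right sum_distrib_left)
  finally show ?thesis using k(1) by simp
 qed simp
 have "s \<in> ?K" using us by (auto simp: tang_def)
 moreover have "s \<bullet> k = 0" if "k \<in> ?K" for k
  using that by (auto simp: s_def inner_sum_left R_def prim_mod_def intro!: sum.neutral)
 ultimately have "s \<bullet> s = 0" by blast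
 then show ?thesis by (simp add: balanced_at_def germP s_def R_def)
qed

subsection \<open>The algebra of balanced weights\<close>

text \<open>After a short step all ingredients of the product at \<open>x + e s\<close>, namely
  tangent space, local arrangement and germs, are those of the local fan at
  \<open>x\<close>.\<close>

lemma germ_prod_weight:
 fixes f g :: "'a::euclidean_space => real"
 assumes "finite H" "cell_const H f" "cell_const H g"
 shows "germ (prod_weight H c d f g) x = prod_weight (larr H x) c d (germ f x) (germ g x)"
proof
 fix s
 show "germ (prod_weight H c d f g) x s = prod_weight (larr H x) c d (germ f x) (germ g x) s"
 proof (rule germ_eqI)
  show "near0 (\<lambda>e. prod_weight H c d f g (x + e *R s) = prod_weight (larr H x) c d (germ f x) (germ g x) s)"
   using near0_tang[OF assms(1), of x s] eventually_link_link[OF assms(1), of x s]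
    eventually_germ_germ[OF assms(1,2), of x s] eventually_germ_germ[OF assms(1,3), of x s]
   by eventually_elim (simp add: prod_weight_def)
 qed
qed

theorem balanced_prod_weight:
 fixes f g :: "'a::euclidean_space => real"
 assumes f: "bal_weight H c f" and g: "bal_weight H d g"
 shows "bal_weight H (c + d) (prod_weight H c d f g)"
 unfolding bal_weight_def
proof (intro conjI allI impI)
 note pf = bal_pure[OF f] and pg = bal_pure[OF g]
 show "pure_weight H (c + d) (prod_weight H c d f g)" by (rule pure_prod_weight[OF pf pg])
 fix t assume t: "dim (tang H t) + 1 + (c + d) = DIM('a)"
 let ?L = "larr H t" and ?P = "prod_weight (larr H t) c d (germ f t) (germ g t)"
 have "balanced_at ?L ?P 0"
  by (rule fan_balanced[OF bal_weight_germ[OF f] bal_weight_germ[OF g] central_larr])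
   (use t in \<open>simp add: tang_link_0\<close>)
 moreover have "germ ?P 0 = ?P"
 proof -
  have "cell_const ?L ?P"
   using cell_const_prod_weight[OF finite_larr cell_const_germ cell_const_germ] pureD(2,3)[OF pf] pureD(3)[OF pg] by blast
  then show ?thesis using germ_central[OF central_larr] by blast
 qed
 moreover have "germ (prod_weight H c d f g) t = ?P"
  using germ_prod_weight pureD(2,3)[OF pf] pureD(3)[OF pg] by blast
 ultimately show "balanced_at H (prod_weight H c d f g) t" by (simp add: balanced_at_def tang_link_0)
qed

theorem prod_weight_assoc:
 fixes f g h :: "'a::euclidean_space => real"
 assumes f: "bal_weight H c f" and g: "bal_weight H d g" and h: "bal_weight H e h"
 shows "prod_weight H (c + d) e (prod_weight H c d f g) h = prod_weight H c (d + e) f (prod_weight H d e g h)"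
proof
 fix x
 note pf = bal_pure[OF f] and pg = bal_pure[OF g] and ph = bal_pure[OF h]
 note gp = germ_prod_weight[OF pureD(2,3)[OF pf] pureD(3)[OF pg]] germ_prod_weight[OF pureD(2)[OF pf] pureD(3)[OF pg] pureD(3)[OF ph]]
 show "prod_weight H (c + d) e (prod_weight H c d f g) h x = prod_weight H c (d + e) f (prod_weight H d e g h) x"
 proof (cases "dim (tang H x) + c + d + e = DIM('a)")
  case True
  have "generic_value (pair_deg (larr H x) (larr H x) (prod_weight (larr H x) c d (germ f x) (germ g x)) (germ h x)) =
   generic_value (pair_deg (larr H x) (larr H x) (germ f x) (prod_weight (larr H x) d e (germ g x) (germ h x)))"
   by (rule fan_assoc[OF bal_weight_germ[OF f] bal_weight_germ[OF g] bal_weight_germ[OF h] central_larr])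
    (use True in \<open>simp add: tang_link_0\<close>)
  then show ?thesis using True gp by (simp add: prod_weight_def[of H "c + d"] prod_weight_def[of H c "d + e"])
 qed (simp add: prod_weight_def[of H "c + d"] prod_weight_def[of H c "d + e"] add.assoc)
qed

lemma germ_sum:
 assumes "finite H" "finite I" "\<And>i. i \<in> I ==> cell_const H (f i)"
 shows "germ (\<lambda>x. \<Sum>i\<in>I. a i * f i x) x s = (\<Sum>i\<in>I. a i * (germ (f i) x s :: real))"
proof (rule germ_eqI)
 have "near0 (\<lambda>e. \<forall>i\<in>I. f i (x + e *R s) = germ (f i) x s)"
  using assms(2) eventually_germ[OF assms(1) assms(3)] by (intro eventually_ball_finite) auto
 then show "near0 (\<lambda>e. (\<Sum>i\<in>I. a i * f i (x + e *R s)) = (\<Sum>i\<in>I. a i * germ (f i) x s))"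
  by eventually_elim simp
qed

lemma bal_weight_sum:
 fixes f :: "'i => 'a::euclidean_space => real"
 assumes H: "arrg H" and I: "finite I" and f: "\<And>i. i \<in> I ==> bal_weight H c (f i)"
 shows "bal_weight H c (\<lambda>x. \<Sum>i\<in>I. a i * f i x)"
 unfolding bal_weight_def pure_weight_def
proof (intro conjI allI impI)
 note fin = arrg_finite[OF H]
 have cf: "cell_const H (f i)" if "i \<in> I" for i using pureD(3)[OF bal_pure[OF f[OF that]]] .
 show "arrg H" by (rule H)
 show "cell_const H (\<lambda>x. \<Sum>i\<in>I. a i * f i x)" using cf by (auto simp: cell_const_def intro!: sum.cong)
 show "dim (tang H x) + c = DIM('a)" if nz: "(\<Sum>i\<in>I. a i * f i x) \<noteq> 0" for x
 proof -
  have "\<exists>i\<in>I. f i x \<noteq> 0"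
  proof (rule ccontr)
   assume "\<not> ?thesis"
   then have "(\<Sum>i\<in>I. a i * f i x) = 0" by (intro sum.neutral) auto
   then show False using nz by simp
  qed
  then obtain i where "i \<in> I" "f i x \<noteq> 0" by blast
  then show ?thesis using pureD(4)[OF bal_pure[OF f]] by blast
 qed
 fix t assume t: "dim (tang H t) + 1 + c = DIM('a)"
 let ?K = "tang H t"
 \<comment> \<open>One index set for all summands: a primitive vector at which the total germ
   cancels may still occur for some \<open>f i\<close>.\<close>
 define R where "R = (\<Union>i\<in>I. {r. prim_mod ?K r \<and> germ (f i) t r \<noteq> 0})"
 have finR: "finite R" unfolding R_def using I finite_primitive_germ[OF bal_pure[OF f] t] by blast
 have gs: "germ (\<lambda>x. \<Sum>i\<in>I. a i * f i x) t r = (\<Sum>i\<in>I. a i * germ (f i) t r)" for r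
  by (rule germ_sum[OF fin I cf])
 have z: "(\<Sum>r\<in>R. germ (f i) t r *R r) = 0" if i: "i \<in> I" for i
 proof -
  have "(\<Sum>r\<in>R. germ (f i) t r *R r) = (\<Sum>r | prim_mod ?K r \<and> germ (f i) t r \<noteq> 0. germ (f i) t r *R r)"
   using finR i by (intro sum.mono_neutral_right) (auto simp: R_def)
  then show ?thesis using f[OF i] t by (auto simp: bal_weight_def balanced_at_def)
 qed
 have sub: "{r. prim_mod ?K r \<and> germ (\<lambda>x. \<Sum>i\<in>I. a i * f i x) t r \<noteq> 0} \<subseteq> R"
 proof
  fix r assume r: "r \<in> {r. prim_mod ?K r \<and> germ (\<lambda>x. \<Sum>i\<in>I. a i * f i x) t r \<noteq> 0}"
  then have "(\<Sum>i\<in>I. a i * germ (f i) t r) \<noteq> 0" using gs by simp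
  have "\<exists>i\<in>I. germ (f i) t r \<noteq> 0"
  proof (rule ccontr)
   assume "\<not> ?thesis"
   then have "(\<Sum>i\<in>I. a i * germ (f i) t r) = 0" by (intro sum.neutral) auto
   then show False using \<open>(\<Sum>i\<in>I. a i * germ (f i) t r) \<noteq> 0\<close> by simp
  qed
  then obtain i where "i \<in> I" "germ (f i) t r \<noteq> 0" by blast
  then show "r \<in> R" using r by (auto simp: R_def)
 qed
 have "(\<Sum>r | prim_mod ?K r \<and> germ (\<lambda>x. \<Sum>i\<in>I. a i * f i x) t r \<noteq> 0. germ (\<lambda>x. \<Sum>i\<in>I. a i * f i x) t r *R r)
   = (\<Sum>r\<in>R. germ (\<lambda>x. \<Sum>i\<in>I. a i * f i x) t r *R r)"
  by (rule sum.mono_neutral_left[OF finR sub]) (auto simp: R_def)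
 also have "\<dots> = (\<Sum>r\<in>R. \<Sum>i\<in>I. a i *R germ (f i) t r *R r)" by (simp add: gs scaleR_sum_left)
 also have "\<dots> = (\<Sum>i\<in>I. a i *R (\<Sum>r\<in>R. germ (f i) t r *R r))" by (subst sum.swap) (simp add: scaleR_sum_right)
 also have "\<dots> = 0" using z by simp
 finally show "balanced_at H (\<lambda>x. \<Sum>i\<in>I. a i * f i x) t" by (simp add: balanced_at_def)
qed

text \<open>Degrees are bilinear at each fixed displacement, and one displacement can be generic for
  the finitely many pairs at once.\<close>

lemma prod_weight_bilinear:
 fixes f :: "'i => 'a::euclidean_space => real" and g :: "'j => 'a => real"
 assumes H: "arrg H" and I: "finite I" and J: "finite J"
  and f: "\<And>i. i \<in> I ==> bal_weight H c (f i)" and g: "\<And>j. j \<in> J ==> bal_weight H d (g j)"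
 shows "prod_weight H c d (\<lambda>x. \<Sum>i\<in>I. a i * f i x) (\<lambda>x. \<Sum>j\<in>J. b j * g j x) x =
  (\<Sum>(i, j)\<in>I \<times> J. a i * b j * prod_weight H c d (f i) (g j) x)"
proof (cases "dim (tang H x) + c + d = DIM('a)")
 case True
 note fin = arrg_finite[OF H]
 have cf: "cell_const H (f i)" if "i \<in> I" for i using pureD(3)[OF bal_pure[OF f[OF that]]] .
 have cg: "cell_const H (g j)" if "j \<in> J" for j using pureD(3)[OF bal_pure[OF g[OF that]]] .
 let ?L = "larr H x"
 have gf: "germ (\<lambda>x. \<Sum>i\<in>I. a i * f i x) x = (\<lambda>s. \<Sum>i\<in>I. a i * germ (f i) x s)" by (rule ext, rule germ_sum[OF fin I cf])
 have gg: "germ (\<lambda>x. \<Sum>j\<in>J. b j * g j x) x = (\<lambda>s. \<Sum>j\<in>J. b j * germ (g j) x s)" by (rule ext, rule germ_sum[OF fin J cg])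
 have bil: "pair_deg ?L ?L (\<lambda>s. \<Sum>i\<in>I. a i * germ (f i) x s) (\<lambda>s. \<Sum>j\<in>J. b j * germ (g j) x s) v =
   (\<Sum>(i, j)\<in>I \<times> J. a i * b j * pair_deg ?L ?L (germ (f i) x) (germ (g j) x) v)" for v
 proof -
  let ?S = "{(A, B). A \<in> ocells ?L \<and> B \<in> ocells ?L \<and> v \<in> mdiff A B}"
  let ?t = "\<lambda>A B i j. a i * b j * (on_cell (germ (f i) x) A * on_cell (germ (g j) x) B * pair_ix (dirs A) (dirs B))"
  have "pair_deg ?L ?L (\<lambda>s. \<Sum>i\<in>I. a i * germ (f i) x s) (\<lambda>s. \<Sum>j\<in>J. b j * germ (g j) x s) v =
    (\<Sum>(A, B)\<in>?S. \<Sum>(i, j)\<in>I \<times> J. ?t A B i j)"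
   unfolding pair_deg_def
  proof (rule sum.cong[OF refl], clarify)
   fix A B
   have "on_cell (\<lambda>s. \<Sum>i\<in>I. a i * germ (f i) x s) A * on_cell (\<lambda>s. \<Sum>j\<in>J. b j * germ (g j) x s) B =
     (\<Sum>i\<in>I. \<Sum>j\<in>J. (a i * on_cell (germ (f i) x) A) * (b j * on_cell (germ (g j) x) B))"
    by (simp add: on_cell_def sum_product)
   then show "on_cell (\<lambda>s. \<Sum>i\<in>I. a i * germ (f i) x s) A * on_cell (\<lambda>s. \<Sum>j\<in>J. b j * germ (g j) x s) B * real (pair_ix (dirs A) (dirs B)) =
     (\<Sum>(i, j)\<in>I \<times> J. ?t A B i j)"
    by (simp add: sum_distrib_right sum_distrib_left sum.cartesian_product[symmetric] mult_ac)
  qed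
  also have "\<dots> = (\<Sum>(i, j)\<in>I \<times> J. \<Sum>(A, B)\<in>?S. ?t A B i j)"
   unfolding case_prod_beta by (rule sum.swap)
  also have "\<dots> = (\<Sum>(i, j)\<in>I \<times> J. a i * b j * pair_deg ?L ?L (germ (f i) x) (germ (g j) x) v)"
   by (simp add: pair_deg_def sum_distrib_left case_prod_beta)
  finally show ?thesis .
 qed
 have "generic (\<lambda>v. \<forall>p\<in>I \<times> J. pair_deg ?L ?L (germ (f (fst p)) x) (germ (g (snd p)) x) v = prod_weight H c d (f (fst p)) (g (snd p)) x)"
  using I J by (intro generic_ball) (auto intro!: pair_deg_link_generic f g True)
 then have "generic (\<lambda>v. pair_deg ?L ?L (\<lambda>s. \<Sum>i\<in>I. a i * germ (f i) x s) (\<lambda>s. \<Sum>j\<in>J. b j * germ (g j) x s) v =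
   (\<Sum>(i, j)\<in>I \<times> J. a i * b j * prod_weight H c d (f i) (g j) x))"
  by (rule generic_mono) (auto simp: bil intro!: sum.cong)
 then show ?thesis using True by (simp add: prod_weight_def[of H c d "\<lambda>x. \<Sum>i\<in>I. a i * f i x"] gf gg generic_value_eq)
next
 case False
 then show ?thesis by (simp add: prod_weight_def)
qed


subsection \<open>Polyhedra cut out by an arrangement\<close>

text \<open>Inequalities are used with the orientation in which they occur in \<open>H\<close>. A
  set cut out by \<open>H\<close> is a union of cells of \<open>H\<close>.\<close>

definition cut_out :: "('a::euclidean_space \<times> real) set => 'a set => bool"
 where "cut_out H Q \<longleftrightarrow> (\<exists>F\<subseteq>H. Q = {x. \<forall>(u, c)\<in>F. u \<bullet> x \<le> c})"

lemma cut_out_mono: "cut_out H Q ==> H \<subseteq> H' ==> cut_out H' Q"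
 unfolding cut_out_def by blast

lemma cut_out_Int: "cut_out H Q ==> cut_out H T ==> cut_out H (Q \<inter> T)"
proof -
 assume "cut_out H Q" "cut_out H T"
 then obtain F G where "F \<subseteq> H" "Q = {x. \<forall>(u, c)\<in>F. u \<bullet> x \<le> c}" "G \<subseteq> H" "T = {x. \<forall>(u, c)\<in>G. u \<bullet> x \<le> c}"
  unfolding cut_out_def by blast
 then show ?thesis unfolding cut_out_def by (intro exI[of _ "F \<union> G"]) auto
qed

lemma cut_out_ccell: "cut_out H Q ==> x \<in> Q ==> ccell H x \<subseteq> Q"
 unfolding cut_out_def ccell_def by fastforce

lemma cut_out_cell: "cut_out H Q ==> x \<in> Q ==> cell H x \<subseteq> Q"
 using cut_out_ccell cell_subset_ccell by blast

lemma cut_out_convex: "cut_out H Q ==> convex Q"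
proof -
 assume "cut_out H Q"
 then obtain F where "Q = (\<Inter>(u, c)\<in>F. {x. u \<bullet> x \<le> c})" unfolding cut_out_def by blast
 then show ?thesis by (auto intro!: convex_INT convex_halfspace_le)
qed

lemma cut_out_polyhedron: "cut_out H Q ==> finite H ==> polyhedron Q"
proof -
 assume "cut_out H Q" and fin: "finite H"
 then obtain F where F: "F \<subseteq> H" "Q = \<Inter>((\<lambda>(u, c). {x. u \<bullet> x \<le> c}) ` F)" unfolding cut_out_def by blast
 then have "finite ((\<lambda>(u, c). {x. u \<bullet> x \<le> c}) ` F)" using fin finite_subset by blast
 then show ?thesis unfolding F(2) by (rule polyhedron_Inter) (auto intro: polyhedron_halfspace_le)
qed

lemma dirs_eq_span:
 assumes "a \<in> C"
 shows "dirs C = span ((+) (- a) ` C)"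
proof
 show "dirs C \<subseteq> span ((+) (- a) ` C)"
  unfolding dirs_def
 proof (rule span_minimal)
  show "{x - y |x y. x \<in> C \<and> y \<in> C} \<subseteq> span ((+) (- a) ` C)"
  proof clarify
   fix x y assume "x \<in> C" "y \<in> C"
   then have "(- a + x) - (- a + y) \<in> span ((+) (- a) ` C)" by (intro span_diff span_base) auto
   then show "x - y \<in> span ((+) (- a) ` C)" by simp
  qed
 qed simp
 have "(+) (- a) ` C \<subseteq> dirs C" using assms dirs_diff by fastforce
 then show "span ((+) (- a) ` C) \<subseteq> dirs C" by (simp add: span_minimal sub_dirs)
qed

lemma affine_hull_dirs:
 assumes "a \<in> C"
 shows "affine hull C = (+) a ` dirs C"
 using affine_hull_span_gen[OF hull_inc[OF assms]] dirs_eq_span[OF assms] by simp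

lemma aff_dim_dirs:
 fixes C :: "'a::euclidean_space set"
 assumes "C \<noteq> {}"
 shows "aff_dim C = int (dim (dirs C))"
proof -
 obtain a where a: "a \<in> C" using assms by blast
 show ?thesis using aff_dim_eq_dim[OF hull_inc[OF a]] dirs_eq_span[OF a] by simp
qed

lemma affine_hull_dirs_iff:
 assumes "a \<in> C"
 shows "x \<in> affine hull C \<longleftrightarrow> x - a \<in> dirs C"
 unfolding affine_hull_dirs[OF assms] by (auto simp: image_iff) (metis add.commute diff_add_cancel)

lemma finite_cosets_tan:
 assumes "finite H"
 shows "finite (range (\<lambda>x. (+) x ` tang H x))"
proof -
 have c: "cell_const H (\<lambda>x. (+) x ` tang H x)"
  unfolding cell_const_def
 proof (intro allI impI)
  fix x y assume y: "y \<in> cell H x"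
  have "y - x \<in> tang H x" using y cell_subset_ccell ccell_diff_tan by blast
  then have "x - y \<in> tang H x" using subspace_neg[OF sub_tang] by (metis minus_diff_eq)
  then have 1: "(+) x ` tang H x \<subseteq> (+) y ` tang H x"
   by (auto simp: image_iff intro!: bexI[of _ "_ + (x - y)"] subspace_add[OF sub_tang])
  have "(+) y ` tang H x \<subseteq> (+) x ` tang H x" using \<open>y - x \<in> tang H x\<close>
   by (auto simp: image_iff intro!: bexI[of _ "_ + (y - x)"] subspace_add[OF sub_tang])
  then show "(+) y ` tang H y = (+) x ` tang H x" using 1 cell_tang[OF y] by auto
 qed
 have "range (\<lambda>x. (+) x ` tang H x) = on_cell (\<lambda>x. (+) x ` tang H x) ` ocells H"
  unfolding ocells_def image_image by (simp add: on_cell_cell[OF c])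
 then show ?thesis using finite_ocells[OF assms] by simp
qed

text \<open>The set is covered by the finitely many affine spaces \<open>x + tang H x\<close> of its
  points \<open>x\<close>, hence contained in one of them.\<close>

lemma ex_generic_point:
 assumes fin: "finite H" and C: "convex C" "C \<noteq> {}"
 shows "\<exists>z\<in>C. dirs C \<subseteq> tang H z"
proof -
 let ?F = "(\<lambda>x. (+) x ` tang H x) ` C"
 have "finite ?F" using finite_cosets_tan[OF fin] by (rule rev_finite_subset) auto
 moreover have "affine A" if "A \<in> ?F" for A
  using that subspace_imp_affine[OF sub_tang] by (auto simp: affine_translation[symmetric])
 moreover have "C \<subseteq> \<Union>?F"
 proof
  fix x assume "x \<in> C"
  moreover have "x = x + 0 \<and> 0 \<in> tang H x" using subspace_0[OF sub_tang] by simp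
  ultimately show "x \<in> \<Union>?F" by blast
 qed
 ultimately obtain z where z: "z \<in> C" "C \<subseteq> (+) z ` tang H z"
  using convex_subset_Union_affine[of ?F C] C by blast
 have "dirs C \<subseteq> tang H z"
  unfolding dirs_def
 proof (rule span_minimal[OF _ sub_tang], clarify)
  fix a b assume "a \<in> C" "b \<in> C"
  then obtain s t where "a = z + s" "b = z + t" "s \<in> tang H z" "t \<in> tang H z" using z(2) by blast
  then show "a - b \<in> tang H z" using subspace_diff[OF sub_tang] by simp
 qed
 then show ?thesis using z by blast
qed

lemma cut_out_tan:
 assumes "finite H" "cut_out H Q" "x \<in> Q"
 shows "tang H x \<subseteq> dirs Q"
 using dirs_cell[OF assms(1), of x] dirs_mono[OF cut_out_cell[OF assms(2,3)]] by simp

lemma cut_out_generic: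
 assumes "finite H" "cut_out H Q" "Q \<noteq> {}"
 obtains z where "z \<in> Q" "tang H z = dirs Q"
 using ex_generic_point[OF assms(1) cut_out_convex[OF assms(2)] assms(3)] cut_out_tan[OF assms(1,2)] by blast

text \<open>Near \<open>z\<close> the hyperplanes that miss \<open>z\<close> keep their sign, and in
  the directions of \<open>Q\<close> so do those through \<open>z\<close>.\<close>

lemma generic_rel_interior:
 assumes fin: "finite H" and sub: "cell H z \<subseteq> Q" and d: "dirs Q = tang H z"
 shows "z \<in> rel_interior Q"
proof -
 let ?U = "\<Inter>(u, c)\<in>H. {y. u \<bullet> z \<noteq> c --> sgn (u \<bullet> y - c) = sgn (u \<bullet> z - c)}"
 have "open {y. u \<bullet> z \<noteq> c --> sgn (u \<bullet> y - c) = sgn (u \<bullet> z - c)}" for u :: 'a and c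
 proof -
  consider "u \<bullet> z = c" | "u \<bullet> z < c" | "u \<bullet> z > c" by linarith
  then show ?thesis
  proof cases
   case 2
   then have "{y. u \<bullet> z \<noteq> c --> sgn (u \<bullet> y - c) = sgn (u \<bullet> z - c)} = {y. u \<bullet> y < c}"
    by (auto simp: sgn_if split: if_splits)
   then show ?thesis by (simp add: open_halfspace_lt)
  next
   case 3
   then have "{y. u \<bullet> z \<noteq> c --> sgn (u \<bullet> y - c) = sgn (u \<bullet> z - c)} = {y. u \<bullet> y > c}"
    by (auto simp: sgn_if split: if_splits)
   then show ?thesis by (simp add: open_halfspace_gt)
  qed simp
 qed
 then have "open ?U" using fin by (intro open_INT) auto
 moreover have "z \<in> ?U" by auto
 ultimately obtain e where e: "e > 0" "ball z e \<subseteq> ?U" using open_contains_ball by blast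
 have z: "z \<in> Q" using sub by auto
 have "ball z e \<inter> affine hull Q \<subseteq> Q"
 proof
  fix y assume y: "y \<in> ball z e \<inter> affine hull Q"
  then have t: "y - z \<in> tang H z" using affine_hull_dirs_iff[OF z] d by simp
  have "sgn (u \<bullet> y - c) = sgn (u \<bullet> z - c)" if uc: "(u, c) \<in> H" for u c
  proof (cases "u \<bullet> z = c")
   case True
   then have "u \<bullet> y = c" using t uc by (auto simp: tang_def inner_diff_right)
   then show ?thesis using True by simp
  next
   case False
   have "y \<in> ?U" using y e by blast
   then show ?thesis using False uc by blast
  qed
  then show "y \<in> Q" using sub by (auto simp: cell_def)
 qed
 then show ?thesis using z e mem_rel_interior_ball by blast
qed

lemma dirs_ccell:
 assumes "finite H"
 shows "dirs (ccell H x) = tang H x"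
proof
 show "dirs (ccell H x) \<subseteq> tang H x"
  unfolding dirs_def
 proof (rule span_minimal[OF _ sub_tang], clarify)
  fix a b assume "a \<in> ccell H x" "b \<in> ccell H x"
  then have "(a - x) - (b - x) \<in> tang H x" using ccell_diff_tan subspace_diff[OF sub_tang] by blast
  then show "a - b \<in> tang H x" by simp
 qed
 show "tang H x \<subseteq> dirs (ccell H x)" using dirs_mono[OF cell_subset_ccell] dirs_cell[OF assms] by metis
qed

lemma mem_ccell_self [simp]: "x \<in> ccell H x"
 using cell_subset_ccell cell_refl by blast

lemma ccell_cell_eq: "y \<in> cell H x ==> ccell H y = ccell H x"
proof -
 have imp: "ccell H y \<subseteq> ccell H x" if y: "y \<in> cell H x" for x y
 proof
  fix z assume z: "z \<in> ccell H y"
  have "(u \<bullet> x \<le> c --> u \<bullet> z \<le> c) \<and> (u \<bullet> x \<ge> c --> u \<bullet> z \<ge> c)" if uc: "(u, c) \<in> H" for u c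
  proof -
   have "y \<in> ccell H x" using y cell_subset_ccell by blast
   then have "(u \<bullet> x \<le> c --> u \<bullet> y \<le> c) \<and> (u \<bullet> x \<ge> c --> u \<bullet> y \<ge> c)" using uc by (auto simp: ccell_def)
   moreover have "(u \<bullet> y \<le> c --> u \<bullet> z \<le> c) \<and> (u \<bullet> y \<ge> c --> u \<bullet> z \<ge> c)" using z uc by (auto simp: ccell_def)
   ultimately show ?thesis by blast
  qed
  then show "z \<in> ccell H x" by (auto simp: ccell_def)
 qed
 assume "y \<in> cell H x"
 moreover from this have "x \<in> cell H y" using cell_eq_iff cell_refl by metis
 ultimately show ?thesis using imp by blast
qed

lemma ccell_trans: "z \<in> ccell H y ==> y \<in> ccell H x ==> z \<in> ccell H x"
 unfolding ccell_def by fastforce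

lemma convex_ccell: "convex (ccell H x)"
proof -
 have "ccell H x = (\<Inter>(u, c)\<in>H. {y. u \<bullet> x \<le> c --> u \<bullet> y \<le> c} \<inter> {y. u \<bullet> x \<ge> c --> u \<bullet> y \<ge> c})"
  by (auto simp: ccell_def)
 moreover have "convex ({y. u \<bullet> x \<le> c --> u \<bullet> y \<le> c} \<inter> {y. u \<bullet> x \<ge> c --> u \<bullet> y \<ge> c})" for u :: 'a and c
  by (intro convex_Int; cases "u \<bullet> x \<le> c"; cases "u \<bullet> x \<ge> c") (auto simp: convex_halfspace_le convex_halfspace_ge)
 ultimately show ?thesis by (auto intro!: convex_INT)
qed

text \<open>At \<open>a\<close> and \<open>b\<close> a hyperplane takes values of the sign
  prescribed by \<open>x\<close>. If the value at a point strictly between them also obeys the sign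
  prescribed by \<open>y\<close>, then so do both values, because the signs agree or both values are
  0.\<close>

lemma ccell_Int_face: "(ccell H x \<inter> ccell H y) face_of ccell H x"
 unfolding face_of_def
proof (intro conjI ballI impI)
 show "convex (ccell H x \<inter> ccell H y)" by (intro convex_Int convex_ccell)
 fix a b p assume a: "a \<in> ccell H x" and b: "b \<in> ccell H x" and p: "p \<in> ccell H x \<inter> ccell H y" "p \<in> open_segment a b"
 obtain t where t: "0 < t" "t < 1" "p = (1 - t) *R a + t *R b" using p(2) by (auto simp: in_segment)
 have key: "(u \<bullet> y \<le> c --> u \<bullet> a \<le> c \<and> u \<bullet> b \<le> c) \<and> (u \<bullet> y \<ge> c --> u \<bullet> a \<ge> c \<and> u \<bullet> b \<ge> c)" if uc: "(u, c) \<in> H" for u c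
 proof -
  have up: "u \<bullet> p - c = (1 - t) * (u \<bullet> a - c) + t * (u \<bullet> b - c)" by (simp add: t inner_add_right algebra_simps)
  have A: "(u \<bullet> x \<le> c --> u \<bullet> a \<le> c) \<and> (u \<bullet> x \<ge> c --> u \<bullet> a \<ge> c)" using a uc by (auto simp: ccell_def)
  have B: "(u \<bullet> x \<le> c --> u \<bullet> b \<le> c) \<and> (u \<bullet> x \<ge> c --> u \<bullet> b \<ge> c)" using b uc by (auto simp: ccell_def)
  have P: "(u \<bullet> y \<le> c --> u \<bullet> p \<le> c) \<and> (u \<bullet> y \<ge> c --> u \<bullet> p \<ge> c)" using p uc by (auto simp: ccell_def)
  have pos: "\<alpha> = 0 \<and> \<beta> = 0" if "\<alpha> \<ge> 0" "\<beta> \<ge> 0" "(1 - t) * \<alpha> + t * \<beta> \<le> 0" for \<alpha> \<beta> :: real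
  proof -
   have "(1 - t) * \<alpha> \<ge> 0" "t * \<beta> \<ge> 0" using t that by simp_all
   then have "(1 - t) * \<alpha> = 0" "t * \<beta> = 0" using that by linarith+
   then show ?thesis using t by simp
  qed
  show ?thesis
  proof (intro conjI impI)
   assume y: "u \<bullet> y \<le> c"
   show "u \<bullet> a \<le> c" "u \<bullet> b \<le> c"
    using A B P y up pos[of "u \<bullet> a - c" "u \<bullet> b - c"] by (cases "u \<bullet> x \<le> c"; force)+
  next
   assume y: "u \<bullet> y \<ge> c"
   have "(1 - t) * (c - u \<bullet> a) + t * (c - u \<bullet> b) = - (u \<bullet> p - c)" unfolding up by (simp add: algebra_simps)
   then show "u \<bullet> a \<ge> c" "u \<bullet> b \<ge> c"
    using A B P y pos[of "c - u \<bullet> a" "c - u \<bullet> b"] by (cases "u \<bullet> x \<ge> c"; force)+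
  qed
 qed
 show "a \<in> ccell H x \<inter> ccell H y" using a key by (auto simp: ccell_def)
 show "b \<in> ccell H x \<inter> ccell H y" using b key by (auto simp: ccell_def)
qed auto

lemma ccell_face: "z \<in> ccell H x ==> ccell H z face_of ccell H x"
 using ccell_Int_face[of H x z] ccell_trans by (metis inf.absorb2 subsetI)

lemma ccell_rel_interior:
 assumes "finite H"
 shows "rel_interior (ccell H x) = cell H x"
proof
 show "cell H x \<subseteq> rel_interior (ccell H x)"
 proof
  fix y assume y: "y \<in> cell H x"
  show "y \<in> rel_interior (ccell H x)"
   by (rule generic_rel_interior[OF assms])
    (use y cell_subset_ccell[of H y] ccell_cell_eq[OF y] dirs_ccell[OF assms] cell_tang[OF y] in auto)
 qed
 show "rel_interior (ccell H x) \<subseteq> cell H x"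
 proof
  fix y assume y: "y \<in> rel_interior (ccell H x)"
  then have yc: "y \<in> ccell H x" using rel_interior_subset by blast
  have "ccell H x \<subseteq> ccell H y"
   by (rule subset_of_face_of[OF ccell_face[OF yc] order_refl]) (use y mem_ccell_self[of y H] in blast)
  then have "x \<in> ccell H y" by auto
  then show "y \<in> cell H x" using ccell_tang_eq[OF yc] ccell_tang by blast
 qed
qed

lemma face_of_ccell:
 assumes fin: "finite H" and F: "F face_of ccell H x" "F \<noteq> {}"
 obtains z where "z \<in> ccell H x" "F = ccell H z"
proof -
 have "convex F" using F face_of_imp_convex by blast
 then obtain z where z: "z \<in> rel_interior F" using F rel_interior_eq_empty by blast
 then have zF: "z \<in> F" using rel_interior_subset by blast
 then have zx: "z \<in> ccell H x" using F face_of_imp_subset by blast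
 have "F = ccell H z"
  by (rule face_of_eq[OF F(1) ccell_face[OF zx]]) (use z ccell_rel_interior[OF fin, of z] in auto)
 then show thesis using that zx by blast
qed

lemma ccell_rational:
 assumes "arrg (H :: ((real ^ 'n) \<times> real) set)"
 shows "rational_polyhedron (ccell H x)"
 unfolding rational_polyhedron_def
proof (intro exI conjI)
 let ?F = "{(u, c) \<in> H. u \<bullet> x \<le> c} \<union> (\<lambda>(u, c). (- u, - c)) ` {(u, c) \<in> H. u \<bullet> x \<ge> c}"
 have "finite H" using assms arrg_finite by blast
 then show "finite ?F" by (auto intro!: finite_imageI elim: rev_finite_subset)
 show "?F \<subseteq> int_lattice \<times> UNIV"
  using assms by (auto simp: arrg_def lat_vec[symmetric] lat_uminus_iff)
 show "ccell H x = {x. \<forall>(u, c)\<in>?F. u \<bullet> x \<le> c}" by (auto simp: ccell_def ball_Un)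
qed

subsection \<open>Complexes and weight functions\<close>

definition adapted :: "'n::finite wcomplex => ((real ^ 'n) \<times> real) set => bool"
 where "adapted X H \<longleftrightarrow> arrg H \<and> (\<forall>Q\<in>cells X. cut_out H Q)"

text \<open>Where the tangent space of \<open>H\<close> has the dimension of a facet, at most one
  facet contains \<open>x\<close> and the sum has at most one term. Elsewhere the value is set to 0,
  so that smaller cells of \<open>H\<close> inside a facet carry no weight.\<close>

definition wgt :: "'n::finite wcomplex => ((real ^ 'n) \<times> real) set => real ^ 'n => rat"
 where "wgt X H x = (if dim (tang H x) + codim X = CARD('n)
  then \<Sum>Q | Q \<in> facets X \<and> x \<in> Q. mult X Q else 0)"

lemma adaptedD:
 "adapted X H ==> arrg H" "adapted X H ==> finite H" "adapted X H ==> Q \<in> cells X ==> cut_out H Q"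
 by (auto simp: adapted_def arrg_def)

lemma adapted_mono: "adapted X H ==> H \<subseteq> H' ==> arrg H' ==> adapted X H'"
 unfolding adapted_def by (blast intro: cut_out_mono)

lemma arrg_Un: "arrg H ==> arrg H' ==> arrg (H \<union> H')"
 by (auto simp: arrg_def)

lemma complexD:
 assumes "pure_complex X"
 shows "finite (cells X)" "Q \<in> cells X ==> rational_polyhedron Q" "Q \<in> cells X ==> Q \<noteq> {}"
  "Q \<in> cells X ==> F face_of Q ==> F \<noteq> {} ==> F \<in> cells X"
  "Q \<in> cells X ==> T \<in> cells X ==> Q \<inter> T face_of Q"
  "Q \<in> cells X ==> T \<in> cells X ==> Q \<inter> T face_of T"
  "Q \<in> cells X ==> \<exists>T\<in>facets X. Q \<subseteq> T"
 using assms unfolding pure_complex_def polyhedral_complex_def by blast+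

lemma facet_cell: "Q \<in> facets X ==> Q \<in> cells X"
 by (simp add: facets_def)

lemma ex_adapted:
 assumes "pure_complex X"
 shows "\<exists>H. adapted X H"
proof -
 have "\<forall>Q\<in>cells X. \<exists>F. finite F \<and> F \<subseteq> int_lattice \<times> UNIV \<and> Q = {x. \<forall>(u, c)\<in>F. u \<bullet> x \<le> c}"
  using complexD(2)[OF assms] by (auto simp: rational_polyhedron_def)
 from bchoice[OF this] obtain F where
  F: "\<forall>Q\<in>cells X. finite (F Q) \<and> F Q \<subseteq> int_lattice \<times> UNIV \<and> Q = {x. \<forall>(u, c)\<in>F Q. u \<bullet> x \<le> c}" ..
 have "arrg (\<Union>(F ` cells X))"
  using F complexD(1)[OF assms] by (fastforce simp: arrg_def lat_vec)
 moreover have "cut_out (\<Union>(F ` cells X)) Q" if "Q \<in> cells X" for Q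
  unfolding cut_out_def using F that by (intro exI[of _ "F Q"]) auto
 ultimately show ?thesis by (auto simp: adapted_def)
qed

lemma facet_dim:
 assumes "pure_complex (X :: 'n::finite wcomplex)" "Q \<in> facets X"
 shows "dim (dirs Q) + codim X = CARD('n)"
 using assms aff_dim_dirs[OF complexD(3)[OF assms(1) facet_cell[OF assms(2)]]] by (simp add: facets_def)

text \<open>\<open>Q \<inter> T\<close> is a face of \<open>Q\<close> whose directions contain the
  tangent space at \<open>x\<close>, so it has the dimension of \<open>Q\<close>.\<close>

lemma facet_unique:
 assumes X: "pure_complex (X :: 'n::finite wcomplex)" and H: "adapted X H"
  and x: "dim (tang H x) + codim X = CARD('n)"
  and s: "Q \<in> facets X" "x \<in> Q" and t: "T \<in> cells X" "x \<in> T"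
 shows "Q \<subseteq> T"
proof -
 note sc = facet_cell[OF s(1)]
 have face: "Q \<inter> T face_of Q" using complexD(5)[OF X sc t(1)] .
 have co: "cut_out H (Q \<inter> T)" using cut_out_Int adaptedD(3)[OF H] sc t by blast
 have "tang H x \<subseteq> dirs (Q \<inter> T)" using cut_out_tan[OF adaptedD(2)[OF H] co] s t by blast
 then have "dim (tang H x) \<le> dim (dirs (Q \<inter> T))" by (rule dim_subset)
 then have "dim (dirs Q) \<le> dim (dirs (Q \<inter> T))" using facet_dim[OF X s(1)] x by linarith
 then have "\<not> aff_dim (Q \<inter> T) < aff_dim Q"
 proof -
  have "Q \<noteq> {}" "Q \<inter> T \<noteq> {}" using s t by blast+
  then show ?thesis using aff_dim_dirs[of Q] aff_dim_dirs[of "Q \<inter> T"] \<open>dim (dirs Q) \<le> dim (dirs (Q \<inter> T))\<close> by simp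
 qed
 then have "Q \<inter> T = Q" using face_of_aff_dim_lt[OF cut_out_convex[OF adaptedD(3)[OF H sc]] face] by blast
 then show ?thesis by blast
qed

lemma wgt_facet:
 assumes X: "pure_complex (X :: 'n::finite wcomplex)" and H: "adapted X H"
  and x: "dim (tang H x) + codim X = CARD('n)" and s: "Q \<in> facets X" "x \<in> Q"
 shows "wgt X H x = mult X Q"
proof -
 have "{T. T \<in> facets X \<and> x \<in> T} = {Q}"
  using facet_unique[OF X H x] s facet_cell by (blast intro: subset_antisym)
 then show ?thesis using x by (simp add: wgt_def)
qed

lemma wgt_nonzero:
 assumes "wgt (X :: 'n::finite wcomplex) H x \<noteq> 0"
 obtains Q where "Q \<in> facets X" "x \<in> Q" "dim (tang H x) + codim X = CARD('n)"
proof -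
 have d: "dim (tang H x) + codim X = CARD('n)" using assms by (auto simp: wgt_def split: if_splits)
 have "(\<Sum>Q | Q \<in> facets X \<and> x \<in> Q. mult X Q) \<noteq> 0" using assms d by (simp add: wgt_def)
 then have "{Q. Q \<in> facets X \<and> x \<in> Q} \<noteq> {}" by (metis (no_types, lifting) sum.empty)
 then show thesis using that d by blast
qed

lemma wgt_cell_const:
 assumes "adapted X H"
 shows "cell_const H (wgt X H)"
 unfolding cell_const_def
proof (intro allI impI)
 fix x y assume y: "y \<in> cell H x"
 have x: "x \<in> cell H y" using y cell_eq_iff cell_refl by metis
 have "x \<in> Q \<longleftrightarrow> y \<in> Q" if "Q \<in> facets X" for Q
  using cut_out_cell[OF adaptedD(3)[OF assms facet_cell[OF that]]] x y by blast
 then have "{Q. Q \<in> facets X \<and> y \<in> Q} = {Q. Q \<in> facets X \<and> x \<in> Q}" by blast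
 then show "wgt X H y = wgt X H x" by (simp add: wgt_def cell_tang[OF y])
qed

lemma wgt_pure:
 assumes "adapted (X :: 'n::finite wcomplex) H"
 shows "pure_weight H (codim X) (\<lambda>x. of_rat (wgt X H x))"
 using assms wgt_cell_const[OF assms] by (auto simp: pure_weight_def adapted_def cell_const_def wgt_def)

lemma ex_refined_point:
 assumes "finite H'" "finite H" "H \<subseteq> H'"
 obtains z where "z \<in> cell H x" "tang H' z = tang H x"
proof -
 obtain z where z: "z \<in> cell H x" "dirs (cell H x) \<subseteq> tang H' z"
  using ex_generic_point[OF assms(1) convex_cell, of H x] cell_refl by blast
 have "tang H' z \<subseteq> tang H z" using assms(3) by (auto simp: tang_def)
 then show thesis using that z dirs_cell[OF assms(2), of x] cell_tang[OF z(1)] by blast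
qed

text \<open>A coarse cell contains points with the same tangent space in the finer arrangement, so
  fine equality implies coarse equality. Conversely, a fine cell of facet dimension inside a coarse
  cell of larger dimension meets no facet, since a facet contains the coarse cells of its
  points.\<close>

lemma wgt_refine:
 assumes X: "pure_complex (X :: 'n::finite wcomplex)" and Y: "pure_complex (Y :: 'n::finite wcomplex)"
  and H: "adapted X H" "adapted Y H" and c: "codim X = codim Y" and H': "H \<subseteq> H'" "arrg H'"
 shows "wgt X H = wgt Y H \<longleftrightarrow> wgt X H' = wgt Y H'"
proof
 note fin = adaptedD(2)[OF H(1)] and fin' = arrg_finite[OF H'(2)]
 assume eq: "wgt X H' = wgt Y H'"
 show "wgt X H = wgt Y H"
 proof
  fix x
  show "wgt X H x = wgt Y H x"
  proof (cases "dim (tang H x) + codim X = CARD('n)")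
   case True
   obtain z where z: "z \<in> cell H x" "tang H' z = tang H x" using ex_refined_point[OF fin' fin H'(1)] by metis
   have "wgt X H x = wgt X H z" "wgt Y H x = wgt Y H z"
    using wgt_cell_const[OF H(1)] wgt_cell_const[OF H(2)] z by (auto simp: cell_const_def)
   moreover have "wgt X H z = wgt X H' z" "wgt Y H z = wgt Y H' z"
    using z cell_tang[OF z(1)] by (simp_all add: wgt_def)
   ultimately show ?thesis using eq by simp
  qed (simp add: wgt_def c)
 qed
next
 assume eq: "wgt X H = wgt Y H"
 show "wgt X H' = wgt Y H'"
 proof
  fix x
  show "wgt X H' x = wgt Y H' x"
  proof (cases "dim (tang H' x) + codim X = CARD('n)")
   case True
   show ?thesis
   proof (cases "dim (tang H x) + codim X = CARD('n)")
    case True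
    then have "wgt X H x = wgt X H' x" "wgt Y H x = wgt Y H' x"
     using \<open>dim (tang H' x) + codim X = CARD('n)\<close> c by (simp_all add: wgt_def)
    then show ?thesis using eq by metis
   next
    case False
    have "tang H' x \<subseteq> tang H x" using H'(1) by (auto simp: tang_def)
    then have "dim (tang H' x) \<le> dim (tang H x)" by (rule dim_subset)
    then have big: "dim (tang H x) + codim X > CARD('n)" using True False by linarith
    have no: "x \<notin> Q" if Z: "pure_complex Z" "adapted Z H" "codim Z = codim X" and s: "Q \<in> facets Z" for Q Z
    proof
     assume "x \<in> Q"
     then have "tang H x \<subseteq> dirs Q"
      using cut_out_tan[OF adaptedD(2)[OF Z(2)] adaptedD(3)[OF Z(2) facet_cell[OF s]]] by blast
     then have "dim (tang H x) \<le> dim (dirs Q)" by (rule dim_subset)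
     then show False using facet_dim[OF Z(1) s] Z(3) big by linarith
    qed
    have "wgt X H' x = 0" "wgt Y H' x = 0"
     using no[OF X H(1)] no[OF Y H(2)] c by (auto simp: wgt_def intro!: sum.neutral)
    then show ?thesis by simp
   qed
  qed (simp add: wgt_def c)
 qed
qed

lemma pure_drop_zero:
 assumes X: "pure_complex (X :: 'n::finite wcomplex)"
 shows "pure_complex (drop_zero X)" "facets (drop_zero X) = {Q \<in> facets X. mult X Q \<noteq> 0}"
proof -
 have cz: "cells (drop_zero X) = {T \<in> cells X. \<exists>Q\<in>facets X. mult X Q \<noteq> 0 \<and> T \<subseteq> Q}" "codim (drop_zero X) = codim X"
  by (simp_all add: drop_zero_def)
 show fz: "facets (drop_zero X) = {Q \<in> facets X. mult X Q \<noteq> 0}"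
 proof (intro equalityI subsetI)
  fix Q assume s: "Q \<in> facets (drop_zero X)"
  then obtain R where r: "R \<in> facets X" "mult X R \<noteq> 0" "Q \<subseteq> R" and sX: "Q \<in> facets X"
   by (auto simp: facets_def cz)
  have "Q \<inter> R face_of R" using complexD(6)[OF X facet_cell[OF sX] facet_cell[OF r(1)]] .
  then have face: "Q face_of R" using r by (simp add: inf.absorb1)
  have "convex R" using cut_out_convex ex_adapted[OF X] adaptedD(3) facet_cell[OF r(1)] by blast
  then have "Q = R" using face_of_aff_dim_lt[OF _ face] sX r(1) by (auto simp: facets_def)
  then show "Q \<in> {Q \<in> facets X. mult X Q \<noteq> 0}" using r by simp
 qed (auto simp: facets_def cz)
 show "pure_complex (drop_zero X)"
  unfolding pure_complex_def polyhedral_complex_def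
 proof (intro conjI ballI allI impI)
  show "finite (cells (drop_zero X))" using complexD(1)[OF X] by (simp add: cz)
  fix Q assume s: "Q \<in> cells (drop_zero X)"
  then have sX: "Q \<in> cells X" by (simp add: cz)
  show "rational_polyhedron Q" "Q \<noteq> {}" using complexD(2,3)[OF X sX] by auto
  show "F \<in> cells (drop_zero X)" if F: "F face_of Q \<and> F \<noteq> {}" for F
  proof -
   have "F \<in> cells X" "F \<subseteq> Q" using F complexD(4)[OF X sX] face_of_imp_subset by auto
   then show ?thesis using s unfolding cz by blast
  qed
  show "Q \<inter> T face_of Q" "Q \<inter> T face_of T" if "T \<in> cells (drop_zero X)" for T
   using complexD(5,6)[OF X sX] that by (auto simp: cz)
  show "\<exists>R\<in>facets (drop_zero X). Q \<subseteq> R" using s by (auto simp: fz cz)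
 qed
qed

lemma mult_drop_zero [simp]: "mult (drop_zero X) = mult X" "codim (drop_zero X) = codim X"
 by (simp_all add: drop_zero_def)

lemma adapted_drop_zero: "adapted X H ==> adapted (drop_zero X) H"
 by (auto simp: adapted_def drop_zero_def)

lemma wgt_drop_zero:
 assumes X: "pure_complex (X :: 'n::finite wcomplex)"
 shows "wgt (drop_zero X) H = wgt X H"
proof
 fix x
 have "finite (facets X)" using complexD(1)[OF X] by (simp add: facets_def)
 then have "(\<Sum>Q | Q \<in> facets (drop_zero X) \<and> x \<in> Q. mult X Q) = (\<Sum>Q | Q \<in> facets X \<and> x \<in> Q. mult X Q)"
  by (intro sum.mono_neutral_left) (auto simp: pure_drop_zero(2)[OF X])
 then show "wgt (drop_zero X) H x = wgt X H x" by (simp add: wgt_def)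
qed

lemma refines_wgt:
 assumes X: "pure_complex (X :: 'n::finite wcomplex)" and W: "refines W X"
  and H: "adapted X H" "adapted W H"
 shows "wgt W H = wgt X H"
proof
 fix x
 have pW: "pure_complex W" and c: "codim W = codim X" and un: "\<Union>(cells W) = \<Union>(cells X)"
  and sub: "\<And>Q. Q \<in> cells W ==> \<exists>T\<in>cells X. Q \<subseteq> T"
  and m: "\<And>Q T. Q \<in> facets W ==> T \<in> facets X ==> Q \<subseteq> T ==> mult W Q = mult X T"
  using W by (auto simp: refines_def)
 show "wgt W H x = wgt X H x"
 proof (cases "dim (tang H x) + codim X = CARD('n) \<and> x \<in> \<Union>(cells X)")
  case True
  then have d: "dim (tang H x) + codim X = CARD('n)" "dim (tang H x) + codim W = CARD('n)" using c by auto
  obtain Q0 where "Q0 \<in> cells W" "x \<in> Q0" using True un by blast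
  then obtain Q where s: "Q \<in> facets W" "x \<in> Q" using complexD(7)[OF pW] by blast
  obtain T0 where t0: "T0 \<in> cells X" "Q \<subseteq> T0" using sub facet_cell[OF s(1)] by blast
  then obtain T where t: "T \<in> facets X" "Q \<subseteq> T" using complexD(7)[OF X] by blast
  then show ?thesis
   using wgt_facet[OF pW H(2) d(2) s] wgt_facet[OF X H(1) d(1) t(1)] s m by auto
 next
  case False
  have "wgt W H x = 0"
  proof (rule ccontr)
   assume "wgt W H x \<noteq> 0"
   then obtain Q where "Q \<in> facets W" "x \<in> Q" "dim (tang H x) + codim W = CARD('n)" using wgt_nonzero by blast
   then show False using False un c facet_cell[of _ W] by auto
  qed
  moreover have "wgt X H x = 0"
  proof (rule ccontr)
   assume "wgt X H x \<noteq> 0"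
   then obtain Q where "Q \<in> facets X" "x \<in> Q" "dim (tang H x) + codim X = CARD('n)" using wgt_nonzero by blast
   then show False using False facet_cell[of _ X] by auto
  qed
  ultimately show ?thesis by simp
 qed
qed

section \<open>The complex of closed cells of an arrangement\<close>

definition cell_complex :: "((real ^ 'n) \<times> real) set => nat => (real ^ 'n) set => (real ^ 'n => rat) => 'n::finite wcomplex"
 where "cell_complex H c S f = \<lparr>codim = c, cells = {ccell H x |x. \<exists>y\<in>S. x \<in> ccell H y}, mult = (\<lambda>G. f (relint_point G))\<rparr>"

lemma cell_complex_sel [simp]:
 "codim (cell_complex H c S f) = c" "cells (cell_complex H c S f) = {ccell H x |x. \<exists>y\<in>S. x \<in> ccell H y}"
 "mult (cell_complex H c S f) = (\<lambda>G. f (relint_point G))"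
 by (simp_all add: cell_complex_def)

lemma aff_dim_ccell:
 assumes "finite H"
 shows "aff_dim (ccell H x) = int (dim (tang H x))"
proof -
 have "ccell H x \<noteq> {}" using mem_ccell_self[of x H] by blast
 then show ?thesis using aff_dim_dirs[of "ccell H x"] dirs_ccell[OF assms, of x] by simp
qed

lemma relint_point_mem:
 fixes G :: "'a::euclidean_space set"
 assumes "convex G" "G \<noteq> {}"
 shows "relint_point G \<in> rel_interior G"
 unfolding relint_point_def using assms by (simp add: some_in_eq rel_interior_eq_empty)

lemma relint_point_ccell: "finite H ==> relint_point (ccell H x) \<in> cell H x"
 using relint_point_mem[OF convex_ccell, of H x] ccell_rel_interior[of H x] mem_ccell_self[of x H] by (metis empty_iff)

lemma facets_cell_complex:
 assumes "finite H" "\<And>y. y \<in> S ==> dim (tang H y) + c = CARD('n)"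
 shows "facets (cell_complex H c S f) = ccell H ` (S :: (real ^ 'n) set)"
proof (intro equalityI subsetI)
 fix Q assume "Q \<in> facets (cell_complex H c S f)"
 then obtain x y where x: "Q = ccell H x" "y \<in> S" "x \<in> ccell H y" "aff_dim Q = int CARD('n) - int c"
  by (auto simp: facets_def)
 then have "dim (tang H y) \<le> dim (tang H x)" using assms(2)[OF x(2)] aff_dim_ccell[OF assms(1), of x] by simp
 then have "x \<in> cell H y" using ccell_dim_eq x by blast
 then show "Q \<in> ccell H ` S" using x ccell_cell_eq by blast
next
 fix Q assume "Q \<in> ccell H ` S"
 then obtain y where y: "Q = ccell H y" "y \<in> S" by blast
 then have "aff_dim Q = int CARD('n) - int c" using aff_dim_ccell[OF assms(1), of y] assms(2)[OF y(2)] by simp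
 moreover have "Q \<in> cells (cell_complex H c S f)" unfolding cell_complex_sel using y mem_ccell_self[of y H] by blast
 ultimately show "Q \<in> facets (cell_complex H c S f)" by (simp add: facets_def)
qed

lemma finite_ccells:
 assumes "finite H"
 shows "finite (range (ccell H))"
proof -
 have "cell_const H (ccell H)" by (auto simp: cell_const_def ccell_cell_eq)
 then have "range (ccell H) = on_cell (ccell H) ` ocells H"
  unfolding ocells_def image_image by (simp add: on_cell_cell)
 then show ?thesis using finite_ocells[OF assms] by simp
qed

lemma pure_cell_complex:
 assumes H: "arrg H" and S: "\<And>y. y \<in> S ==> dim (tang H y) + c = CARD('n)"
 shows "pure_complex (cell_complex H c (S :: (real ^ 'n) set) f)"
proof -
 note fin = arrg_finite[OF H]
 let ?X = "cell_complex H c S f"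
 show ?thesis
  unfolding pure_complex_def polyhedral_complex_def
 proof (intro conjI ballI allI impI)
  show "finite (cells ?X)" by (rule finite_subset[OF _ finite_ccells[OF fin]]) auto
  fix Q assume "Q \<in> cells ?X"
  then obtain x y where x: "Q = ccell H x" "y \<in> S" "x \<in> ccell H y" by auto
  show "rational_polyhedron Q" using x ccell_rational[OF H] by simp
  show "Q \<noteq> {}" using x mem_ccell_self by blast
  show "F \<in> cells ?X" if F: "F face_of Q \<and> F \<noteq> {}" for F
  proof -
   obtain z where z: "z \<in> ccell H x" "F = ccell H z" using face_of_ccell[OF fin] F x by metis
   then have "z \<in> ccell H y" using x ccell_trans by blast
   then show ?thesis using x z by auto
  qed
  show "Q \<inter> T face_of Q" if "T \<in> cells ?X" for T using that x ccell_Int_face by auto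
  show "Q \<inter> T face_of T" if "T \<in> cells ?X" for T
  proof -
   obtain w where "T = ccell H w" using \<open>T \<in> cells ?X\<close> by auto
   then show ?thesis using x ccell_Int_face[of H w x] by (simp add: Int_commute)
  qed
  have "facets ?X = ccell H ` S" using facets_cell_complex[OF fin S] .
  then have "ccell H y \<in> facets ?X" using x(2) by blast
  moreover have "Q \<subseteq> ccell H y" unfolding x(1) using ccell_trans[OF _ x(3)] by blast
  ultimately show "\<exists>T\<in>facets ?X. Q \<subseteq> T" by blast
 qed
qed

lemma ccell_cut_out:
 assumes "\<And>u c. (u, c) \<in> H ==> (- u, - c) \<in> H"
 shows "cut_out H (ccell H x)"
 unfolding cut_out_def
proof (intro exI conjI)
 let ?F = "{(u, c) \<in> H. u \<bullet> x \<le> c}"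
 show "?F \<subseteq> H" by auto
 show "ccell H x = {y. \<forall>(u, c)\<in>?F. u \<bullet> y \<le> c}"
 proof (intro equalityI subsetI)
  fix y assume y: "y \<in> {y. \<forall>(u, c)\<in>?F. u \<bullet> y \<le> c}"
  have "(u \<bullet> x \<le> c --> u \<bullet> y \<le> c) \<and> (u \<bullet> x \<ge> c --> u \<bullet> y \<ge> c)" if uc: "(u, c) \<in> H" for u c
  proof -
   have "u \<bullet> x \<le> c --> u \<bullet> y \<le> c" using y uc by blast
   moreover have "- u \<bullet> x \<le> - c --> - u \<bullet> y \<le> - c" using y assms[OF uc] by blast
   ultimately show ?thesis by simp
  qed
  then show "y \<in> ccell H x" by (auto simp: ccell_def)
 qed (auto simp: ccell_def)
qed

text \<open>Closed under negation, so that both inequalities of a hyperplane are available and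
  closed cells are cut out by \<open>H\<close>.\<close>

definition sym_arr :: "('a::euclidean_space \<times> real) set => bool"
 where "sym_arr H \<longleftrightarrow> arrg H \<and> (\<forall>u c. (u, c) \<in> H --> (- u, - c) \<in> H)"

lemma ex_sym_arr:
 assumes "arrg H"
 shows "\<exists>H'. H \<subseteq> H' \<and> sym_arr H'"
proof (intro exI conjI)
 let ?H' = "H \<union> (\<lambda>(u, c). (- u, - c)) ` H"
 show "sym_arr ?H'" using assms by (force simp: sym_arr_def arrg_def lat_uminus_iff)
qed auto

lemma adapted_cell_complex: "sym_arr H ==> adapted (cell_complex H c S f) H"
proof -
 assume H: "sym_arr H"
 have "cut_out H (ccell H x)" for x using H by (intro ccell_cut_out) (simp add: sym_arr_def)
 then show ?thesis using H by (auto simp: adapted_def sym_arr_def)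
qed

lemma wgt_cell_complex:
 assumes H: "sym_arr H" and S: "\<And>y. y \<in> S ==> dim (tang H y) + c = CARD('n)"
  and inv: "\<And>x y. y \<in> S ==> x \<in> cell H y ==> x \<in> S" and f: "cell_const H f"
 shows "wgt (cell_complex H c (S :: (real ^ 'n) set) f) H x = (if x \<in> S then f x else 0)"
proof -
 have arr: "arrg H" using H by (simp add: sym_arr_def)
 note fin = arrg_finite[OF arr]
 let ?X = "cell_complex H c S f"
 note pure = pure_cell_complex[OF arr S, where f = f] and ad = adapted_cell_complex[OF H, of c S f]
 show ?thesis
 proof (cases "x \<in> S")
  case True
  have "facets ?X = ccell H ` S" using facets_cell_complex[OF fin S] .
  then have "ccell H x \<in> facets ?X" using True by blast
  then have "wgt ?X H x = mult ?X (ccell H x)" using S[OF True] by (intro wgt_facet pure ad) auto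
  also have "\<dots> = f x" using relint_point_ccell[OF fin, of x] f by (simp add: cell_const_def)
  finally show ?thesis using True by simp
 next
  case False
  have "wgt ?X H x = 0"
  proof (rule ccontr)
   assume "wgt ?X H x \<noteq> 0"
   then obtain Q where s: "Q \<in> facets ?X" "x \<in> Q" "dim (tang H x) + c = CARD('n)" using wgt_nonzero by (metis cell_complex_sel(1))
   moreover have "facets ?X = ccell H ` S" using facets_cell_complex[OF fin S] .
   ultimately obtain y where y: "y \<in> S" "x \<in> ccell H y" by blast
   have "x \<in> cell H y" by (rule ccell_dim_eq[OF y(2)]) (use S[OF y(1)] s(3) in simp)
   then show False using inv y False by blast
  qed
  then show ?thesis using False by simp
 qed
qed

text \<open>A point \<open>x\<close> of a facet is joined to a generic point \<open>z\<close> of it.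
  Points of the segment just behind \<open>x\<close> have the full tangent space of the facet, and
  \<open>x\<close> lies in their closed cell.\<close>

lemma union_drop_zero:
 assumes X: "pure_complex (X :: 'n::finite wcomplex)" and H: "adapted X H"
 shows "\<Union>(cells (drop_zero X)) = {x. \<exists>y. wgt X H y \<noteq> 0 \<and> x \<in> ccell H y}"
proof (intro equalityI subsetI)
 note fin = adaptedD(2)[OF H]
 fix x assume "x \<in> \<Union>(cells (drop_zero X))"
 then obtain Q where s: "Q \<in> facets X" "mult X Q \<noteq> 0" "x \<in> Q" by (auto simp: drop_zero_def)
 note co = adaptedD(3)[OF H facet_cell[OF s(1)]]
 obtain z where z: "z \<in> Q" "tang H z = dirs Q" using cut_out_generic[OF fin co] s(3) by blast
 obtain r where e: "r > 0" "r < 1" "\<forall>(u, c)\<in>H. sgn (u \<bullet> (x + r *R (z - x)) - c) = step_sgn u c x (z - x)"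
 proof -
  have "near0 (\<lambda>r. r < (1::real))" using eventually_at_right[OF zero_less_one] zero_less_one by blast
  then have "near0 (\<lambda>r. r < 1 \<and> (\<forall>(u, c)\<in>H. sgn (u \<bullet> (x + r *R (z - x)) - c) = step_sgn u c x (z - x)))"
   using near0_step[OF fin, of x "z - x"] by eventually_elim simp
  then show thesis using that near0_ex by blast
 qed
 let ?y = "x + r *R (z - x)"
 have "?y = (1 - r) *R x + r *R z" by (simp add: algebra_simps)
 then have ys: "?y \<in> Q" using convexD[OF cut_out_convex[OF co] s(3) z(1), of "1 - r" r] e by simp
 have "near0 (\<lambda>d. x + d *R (z - x) \<in> cell H ?y)"
  using near0_step[OF fin, of x "z - x"] by eventually_elim (rule cell_iff_step[OF e(3)])
 then have xc: "x \<in> ccell H ?y" by (rule into_ccell[OF fin])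
 have "tang H z \<subseteq> tang H ?y"
 proof
  fix k assume k: "k \<in> tang H z"
  have "u \<bullet> k = 0" if "(u, c) \<in> H" "u \<bullet> ?y = c" for u c
  proof -
   have "u \<bullet> x = c \<and> u \<bullet> (z - x) = 0" using step_sgn_zero_iff[OF e(3) that(1)] that(2) by blast
   then have "u \<bullet> z = c" by (simp add: inner_diff_right)
   then show ?thesis using k that by (auto simp: tang_def)
  qed
  then show "k \<in> tang H ?y" by (auto simp: tang_def)
 qed
 moreover have "tang H ?y \<subseteq> dirs Q" using cut_out_tan[OF fin co ys] .
 ultimately have "tang H ?y = dirs Q" using z by blast
 then have "wgt X H ?y = mult X Q" using wgt_facet[OF X H _ s(1) ys] facet_dim[OF X s(1)] by simp
 then have "wgt X H ?y \<noteq> 0" using s(2) by simp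
 then show "x \<in> {x. \<exists>y. wgt X H y \<noteq> 0 \<and> x \<in> ccell H y}" using xc by blast
next
 fix x assume "x \<in> {x. \<exists>y. wgt X H y \<noteq> 0 \<and> x \<in> ccell H y}"
 then obtain y where y: "wgt X H y \<noteq> 0" "x \<in> ccell H y" by blast
 obtain Q where s: "Q \<in> facets X" "y \<in> Q" "dim (tang H y) + codim X = CARD('n)" using wgt_nonzero[OF y(1)] by blast
 have "mult X Q \<noteq> 0" using wgt_facet[OF X H s(3,1,2)] y by simp
 moreover have "x \<in> Q" using cut_out_ccell[OF adaptedD(3)[OF H facet_cell[OF s(1)]] s(2)] y by blast
 ultimately show "x \<in> \<Union>(cells (drop_zero X))" using s facet_cell by (auto simp: drop_zero_def)
qed

lemma refines_cell_complex:
 assumes X: "pure_complex (X :: 'n::finite wcomplex)" and H: "adapted X H" and c: "codim X = c"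
 shows "refines (cell_complex H c {y. wgt X H y \<noteq> 0} (wgt X H)) (drop_zero X)"
proof -
 let ?S = "{y. wgt X H y \<noteq> 0}"
 let ?W = "cell_complex H c ?S (wgt X H)"
 note fin = adaptedD(2)[OF H]
 have S: "dim (tang H y) + c = CARD('n)" if "y \<in> ?S" for y
  using that c by (auto simp: wgt_def split: if_splits)
 note pW = pure_cell_complex[OF adaptedD(1)[OF H], of ?S c, OF S]
 have sub: "\<exists>T\<in>cells (drop_zero X). ccell H y \<subseteq> T" if y: "y \<in> ?S" for y
 proof -
  obtain Q where s: "Q \<in> facets X" "y \<in> Q" "dim (tang H y) + codim X = CARD('n)" using wgt_nonzero y by blast
  have "mult X Q \<noteq> 0" using wgt_facet[OF X H s(3,1,2)] y by simp
  then show ?thesis using s facet_cell cut_out_ccell[OF adaptedD(3)[OF H facet_cell[OF s(1)]] s(2)]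
   by (auto simp: drop_zero_def)
 qed
 show ?thesis
  unfolding refines_def
 proof (intro conjI ballI impI)
  show "pure_complex ?W" using pW by blast
  show "codim ?W = codim (drop_zero X)" using c by simp
  show "\<Union>(cells ?W) = \<Union>(cells (drop_zero X))"
  proof (intro equalityI subsetI)
   fix x assume "x \<in> \<Union>(cells ?W)"
   then obtain z y where "x \<in> ccell H z" "z \<in> ccell H y" "y \<in> ?S" by auto
   then show "x \<in> \<Union>(cells (drop_zero X))" unfolding union_drop_zero[OF X H] using ccell_trans by blast
  next
   fix x assume "x \<in> \<Union>(cells (drop_zero X))"
   then obtain y where "wgt X H y \<noteq> 0" "x \<in> ccell H y" unfolding union_drop_zero[OF X H] by blast
   then have "ccell H x \<in> cells ?W" by auto
   then show "x \<in> \<Union>(cells ?W)" using mem_ccell_self by blast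
  qed
  show "\<exists>T\<in>cells (drop_zero X). Q \<subseteq> T" if "Q \<in> cells ?W" for Q
  proof -
   obtain x y where xy: "Q = ccell H x" "y \<in> ?S" "x \<in> ccell H y" using \<open>Q \<in> cells ?W\<close> by auto
   then show ?thesis using sub[OF xy(2)] ccell_trans by blast
  qed
  fix Q T assume s: "Q \<in> facets ?W" and t: "T \<in> facets (drop_zero X)" "Q \<subseteq> T"
  have "facets ?W = ccell H ` ?S" using facets_cell_complex[OF fin S] .
  then obtain y where y: "Q = ccell H y" "y \<in> ?S" using s by blast
  have "y \<in> T" using t y mem_ccell_self by blast
  moreover have "T \<in> facets X" using t pure_drop_zero(2)[OF X] by blast
  ultimately have "wgt X H y = mult X T" using wgt_facet[OF X H] S[OF y(2)] c by simp
  moreover have "wgt X H (relint_point Q) = wgt X H y"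
   using relint_point_ccell[OF fin, of y] wgt_cell_const[OF H] y by (simp add: cell_const_def)
  ultimately show "mult ?W Q = mult (drop_zero X) T" by simp
 qed
qed

lemma tropical_pure: "tropical_cycle X ==> pure_complex X"
 by (simp add: tropical_cycle_def)

text \<open>Adding the hyperplanes of a common refinement to \<open>H\<close> does not affect
  equality of weights, and there all three weights can be compared. Conversely, equal weights
  produce the same complex of closed cells of \<open>H\<close>, which refines both cycles after
  removal of facets of multiplicity 0.\<close>

theorem cycle_eq_iff:
 fixes X Y :: "'n::finite wcomplex"
 assumes HX: "adapted X H" and HY: "adapted Y H"
 shows "X \<approx> Y \<longleftrightarrow> tropical_cycle X \<and> tropical_cycle Y \<and> codim X = codim Y \<and> wgt X H = wgt Y H"
proof
 assume "X \<approx> Y"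
 then obtain W where t: "tropical_cycle X" "tropical_cycle Y" and W: "refines W (drop_zero X)" "refines W (drop_zero Y)"
  by (auto simp: cycle_eq_def)
 note pX = tropical_pure[OF t(1)] and pY = tropical_pure[OF t(2)]
 have c: "codim X = codim Y" using W by (simp add: refines_def)
 have "pure_complex W" using W by (simp add: refines_def)
 then obtain HW where HW: "adapted W HW" using ex_adapted by blast
 let ?H = "H \<union> HW"
 have arr: "arrg ?H" using HX HW adaptedD(1) arrg_Un by blast
 have ad: "adapted X ?H" "adapted Y ?H" "adapted W ?H" using HX HY HW adapted_mono arr by blast+
 have "wgt X ?H = wgt Y ?H"
  using refines_wgt[OF pure_drop_zero(1)[OF pX] W(1) adapted_drop_zero[OF ad(1)] ad(3)]
   refines_wgt[OF pure_drop_zero(1)[OF pY] W(2) adapted_drop_zero[OF ad(2)] ad(3)]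
   wgt_drop_zero[OF pX] wgt_drop_zero[OF pY] by simp
 then have "wgt X H = wgt Y H"
  using wgt_refine[OF pX pY HX HY c _ arr] by blast
 then show "tropical_cycle X \<and> tropical_cycle Y \<and> codim X = codim Y \<and> wgt X H = wgt Y H" using t c by blast
next
 assume *: "tropical_cycle X \<and> tropical_cycle Y \<and> codim X = codim Y \<and> wgt X H = wgt Y H"
 then have "refines (cell_complex H (codim X) {y. wgt X H y \<noteq> 0} (wgt X H)) (drop_zero X)"
  "refines (cell_complex H (codim X) {y. wgt X H y \<noteq> 0} (wgt X H)) (drop_zero Y)"
  using refines_cell_complex[OF tropical_pure HX refl] refines_cell_complex[OF tropical_pure HY] by metis+
 then show "X \<approx> Y" using * unfolding cycle_eq_def by blast
qed


subsection \<open>Balancing of complexes and of weight functions\<close>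

lemma module_int: "module (\<lambda>(k::int) x :: 'a::real_vector. of_int k *R x)"
 by unfold_locales (auto simp: algebra_simps)

lemma module_rat: "module (\<lambda>(q::rat) x :: 'a::real_vector. of_rat q *R x)"
 by unfold_locales (auto simp: algebra_simps of_rat_add of_rat_mult)

lemma int_span_insert:
 assumes N: "subgrp (N :: 'a::real_vector set)"
 shows "int_span (insert v N) = {k + of_int j *R v |k j. k \<in> N}"
proof -
 interpret M: module "\<lambda>(k::int) x :: 'a. of_int k *R x" by (rule module_int)
 have "M.subspace N" using N by (auto simp: M.subspace_def subgrp_0 subgrp_add subgrp_of_int)
 then have s: "M.span N = N" by simp
 show ?thesis
  unfolding int_span_def M.span_insert s
 proof (intro equalityI subsetI)
  fix x assume "x \<in> {x. \<exists>k. x - of_int k *R v \<in> N}"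
  then obtain j where "x - of_int j *R v \<in> N" by blast
  moreover have "x = (x - of_int j *R v) + of_int j *R v" by simp
  ultimately show "x \<in> {k + of_int j *R v |k j. k \<in> N}" by blast
 next
  fix x assume "x \<in> {k + of_int j *R v |k j. k \<in> N}"
  then obtain k j where "x = k + of_int j *R v" "k \<in> N" by blast
  then have "x - of_int j *R v \<in> N" by simp
  then show "x \<in> {x. \<exists>k. x - of_int k *R v \<in> N}" by blast
 qed
qed

lemma rat_combination_multiple:
 assumes "finite S" "\<And>s. s \<in> S ==> v s \<in> lat"
 shows "\<exists>m::nat. m > 0 \<and> real m *R (\<Sum>s\<in>S. of_rat (q s) *R v s) \<in> lat"
 using assms
proof (induction S rule: finite_induct)
 case empty
 then show ?case by (intro exI[of _ 1]) simp
next
 case (insert s S)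
 then obtain m where m: "m > 0" "real m *R (\<Sum>s\<in>S. of_rat (q s) *R v s) \<in> lat" by auto
 obtain a b where ab: "quotient_of (q s) = (a, b)" by (cases "quotient_of (q s)")
 then have b: "b > 0" "q s = of_int a / of_int b" using quotient_of_denom_pos quotient_of_div by blast+
 define k where "k = nat b * m"
 have qk: "real k * of_rat (q s) = real_of_int (a * int m)"
  using b by (simp add: k_def of_rat_divide)
 have "real k *R (\<Sum>s\<in>insert s S. of_rat (q s) *R v s) =
   real_of_int (a * int m) *R v s + real (nat b) *R (real m *R (\<Sum>s\<in>S. of_rat (q s) *R v s))"
  using insert(1,2) qk by (simp add: scaleR_add_right k_def)
 also have "\<dots> \<in> lat"
  by (rule subgrp_add[OF lat_subgroup lat_scale lat_scale[OF m(2)]]) (use insert.prems in auto)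
 finally have "real k *R (\<Sum>s\<in>insert s S. of_rat (q s) *R v s) \<in> lat" .
 moreover have "k > 0" using b m by (simp add: k_def)
 ultimately show ?case by blast
qed

text \<open>A rational combination of lattice vectors has a positive integer multiple in the
  lattice; if it lies in \<open>K\<close>, this multiple lies in \<open>lat \<inter> K\<close>. The
  rational span in the definition of balancing can thus be replaced by a real subspace.\<close>

lemma rat_span_lat_iff:
 assumes K: "subspace K" and S: "finite S" "\<And>s. s \<in> S ==> v s \<in> lat"
 shows "(\<Sum>s\<in>S. of_rat (q s) *R v s) \<in> rat_span (lat \<inter> K) \<longleftrightarrow> (\<Sum>s\<in>S. of_rat (q s) *R v s) \<in> (K :: 'a::euclidean_space set)"
proof -
 interpret M: module "\<lambda>(q::rat) x :: 'a. of_rat q *R x" by (rule module_rat)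
 let ?w = "\<Sum>s\<in>S. of_rat (q s) *R v s"
 show ?thesis
 proof
  have "M.subspace K" using K by (auto simp: M.subspace_def subspace_0 subspace_add subspace_scale)
  then have "M.span (lat \<inter> K) \<subseteq> K" by (intro M.span_minimal) auto
  then show "?w \<in> rat_span (lat \<inter> K) ==> ?w \<in> K" by (auto simp: rat_span_def)
 next
  assume w: "?w \<in> K"
  obtain m where m: "m > 0" "real m *R ?w \<in> lat" using rat_combination_multiple[of S v q] S by blast
  have "real m *R ?w \<in> lat \<inter> K" using m w K subspace_scale by blast
  then have "of_rat (1 / of_nat m) *R (real m *R ?w) \<in> M.span (lat \<inter> K)" by (intro M.span_scale M.span_base)
  moreover have "of_rat (1 / of_nat m) *R (real m *R ?w) = ?w" using m(1) by (simp add: of_rat_divide)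
  ultimately show "?w \<in> rat_span (lat \<inter> K)" by (simp add: rat_span_def)
 qed
qed

lemma polyhedron_lattice_dirs:
 assumes "Q \<noteq> {}"
 shows "polyhedron_lattice Q = lat \<inter> dirs Q"
proof -
 obtain a where a: "a \<in> Q" using assms by blast
 have "(\<forall>x\<in>affine hull Q. x + v \<in> affine hull Q) \<longleftrightarrow> v \<in> dirs Q" for v
 proof
  assume "\<forall>x\<in>affine hull Q. x + v \<in> affine hull Q"
  then have "a + v \<in> affine hull Q" using a hull_inc by metis
  then show "v \<in> dirs Q" using affine_hull_dirs_iff[OF a] by simp
 next
  assume v: "v \<in> dirs Q"
  show "\<forall>x\<in>affine hull Q. x + v \<in> affine hull Q"
  proof
   fix x assume "x \<in> affine hull Q"
   then have "(x - a) + v \<in> dirs Q" using affine_hull_dirs_iff[OF a] v subspace_add[OF sub_dirs] by blast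
   then show "x + v \<in> affine hull Q" using affine_hull_dirs_iff[OF a] by (simp add: algebra_simps)
  qed
 qed
 then show ?thesis by (auto simp: polyhedron_lattice_def lat_vec)
qed

section \<open>Links of polyhedra\<close>

lemma link_halfspaces:
 assumes fin: "finite F" and t: "\<forall>(u, c)\<in>F. u \<bullet> t \<le> c"
 shows "link t {x. \<forall>(u, c)\<in>F. u \<bullet> x \<le> c} = {q. \<forall>(u, c)\<in>F. u \<bullet> t = c --> u \<bullet> q \<le> 0}"
proof (intro equalityI subsetI)
 fix q assume "q \<in> link t {x. \<forall>(u, c)\<in>F. u \<bullet> x \<le> c}"
 then have "near0 (\<lambda>r. \<forall>(u, c)\<in>F. u \<bullet> (t + r *R q) \<le> c)" by (simp add: link_def)
 then obtain r where e: "r > 0" "\<forall>(u, c)\<in>F. u \<bullet> (t + r *R q) \<le> c" using near0_ex by blast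
 have "u \<bullet> q \<le> 0" if "(u, c) \<in> F" "u \<bullet> t = c" for u c
 proof -
  have "u \<bullet> t + r * (u \<bullet> q) \<le> c" using e(2) that(1) by (fastforce simp: inner_add_right)
  then have "r * (u \<bullet> q) \<le> 0" using that(2) by simp
  then show ?thesis using e(1) by (simp add: mult_le_0_iff)
 qed
 then show "q \<in> {q. \<forall>(u, c)\<in>F. u \<bullet> t = c --> u \<bullet> q \<le> 0}" by blast
next
 fix q assume q: "q \<in> {q. \<forall>(u, c)\<in>F. u \<bullet> t = c --> u \<bullet> q \<le> 0}"
 have "near0 (\<lambda>r. \<forall>(u, c)\<in>F. u \<bullet> (t + r *R q) \<le> c)"
  using near0_step[OF fin, of t q]
 proof eventually_elim
  case (elim r)
  have "u \<bullet> (t + r *R q) \<le> c" if uc: "(u, c) \<in> F" for u c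
  proof -
   have s: "sgn (u \<bullet> (t + r *R q) - c) = step_sgn u c t q" using elim uc by auto
   have "u \<bullet> t \<le> c" using t uc by auto
   moreover have "u \<bullet> t = c --> u \<bullet> q \<le> 0" using q uc by auto
   ultimately have "step_sgn u c t q \<le> 0" by (auto simp: step_sgn_def)
   then have "sgn (u \<bullet> (t + r *R q) - c) \<le> 0" using s by simp
   then show ?thesis by (simp add: sgn_le_0_iff)
  qed
  then show ?case by blast
 qed
 then show "q \<in> link t {x. \<forall>(u, c)\<in>F. u \<bullet> x \<le> c}" by (simp add: link_def)
qed

lemma cut_out_link:
 assumes fin: "finite H" and co: "cut_out H Q" and t: "t \<in> Q"
 obtains F where "F \<subseteq> H" "Q = {x. \<forall>(u, c)\<in>F. u \<bullet> x \<le> c}"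
  "link t Q = {q. \<forall>(u, c)\<in>F. u \<bullet> t = c --> u \<bullet> q \<le> 0}"
proof -
 obtain F where F: "F \<subseteq> H" "Q = {x. \<forall>(u, c)\<in>F. u \<bullet> x \<le> c}" using co unfolding cut_out_def by blast
 have "finite F" using F fin finite_subset by blast
 moreover have "\<forall>(u, c)\<in>F. u \<bullet> t \<le> c" using t F by blast
 ultimately have "link t {x. \<forall>(u, c)\<in>F. u \<bullet> x \<le> c} = {q. \<forall>(u, c)\<in>F. u \<bullet> t = c --> u \<bullet> q \<le> 0}" by (rule link_halfspaces)
 then show thesis by (intro that[OF F]) (simp only: F(2))
qed

lemma link_cut_out_props:
 assumes fin: "finite H" and co: "cut_out H Q" and t: "t \<in> Q"
 shows link_add_tang: "q \<in> link t Q ==> k \<in> tang H t ==> q + k \<in> link t Q"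
  and link_scaleR: "q \<in> link t Q ==> r \<ge> 0 ==> r *R q \<in> link t Q"
  and link_diff_mem: "s \<in> Q ==> s - t \<in> link t Q"
  and polyhedron_link: "polyhedron (link t Q)"
proof -
 obtain F where F: "F \<subseteq> H" "Q = {x. \<forall>(u, c)\<in>F. u \<bullet> x \<le> c}"
  "link t Q = {q. \<forall>(u, c)\<in>F. u \<bullet> t = c --> u \<bullet> q \<le> 0}" by (rule cut_out_link[OF assms])
 show "q + k \<in> link t Q" if q: "q \<in> link t Q" and k: "k \<in> tang H t"
 proof -
  have "u \<bullet> (q + k) \<le> 0" if uc: "(u, c) \<in> F" "u \<bullet> t = c" for u c
  proof -
   have "u \<bullet> q \<le> 0" using q uc F(3) by blast
   moreover have "u \<bullet> k = 0" using k uc F(1) by (auto simp: tang_def)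
   ultimately show ?thesis by (simp add: inner_add_right)
  qed
  then show ?thesis unfolding F(3) by blast
 qed
 show "r *R q \<in> link t Q" if "q \<in> link t Q" "r \<ge> 0"
  using that unfolding F(3) by (fastforce simp: mult_nonneg_nonpos)
 show "s - t \<in> link t Q" if s: "s \<in> Q"
 proof -
  have "u \<bullet> (s - t) \<le> 0" if uc: "(u, c) \<in> F" "u \<bullet> t = c" for u c
  proof -
   have "u \<bullet> s \<le> c" using s uc F(2) by blast
   then show ?thesis using uc by (simp add: inner_diff_right)
  qed
  then show ?thesis unfolding F(3) by blast
 qed
 have e: "link t Q = \<Inter>((\<lambda>(u, c). {q. u \<bullet> q \<le> 0}) ` {(u, c) \<in> F. u \<bullet> t = c})" unfolding F(3) by fastforce
 have "finite ((\<lambda>(u, c). {q. u \<bullet> q \<le> 0}) ` {(u, c) \<in> F. u \<bullet> t = c})"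
  using finite_subset[OF F(1) fin] by (intro finite_imageI) (auto elim: rev_finite_subset)
 then show "polyhedron (link t Q)" unfolding e by (rule polyhedron_Inter) (auto intro: polyhedron_halfspace_le)
qed

lemma link_subset_dirs:
 assumes "t \<in> Q"
 shows "link t Q \<subseteq> dirs Q"
proof
 fix q assume "q \<in> link t Q"
 then obtain r where e: "r > 0" "t + r *R q \<in> Q" unfolding link_def using near0_ex by blast
 have "(1 / r) *R ((t + r *R q) - t) \<in> dirs Q" by (intro subspace_scale sub_dirs dirs_diff e assms)
 then show "q \<in> dirs Q" using e by simp
qed

text \<open>An inequality tight at a relative interior point of \<open>T\<close> is tight on all of
  \<open>T\<close>, so the same inequalities are active at \<open>t\<close> and \<open>t'\<close>.
  This connects \<open>relint_point\<close> in the definitions with points that are generic for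
  \<open>H\<close>.\<close>

lemma link_rel_interior:
 assumes fin: "finite H" and co: "cut_out H Q" and sub: "T \<subseteq> Q" and t: "t \<in> T" "tang H t = dirs T"
  and cv: "convex T" and t': "t' \<in> rel_interior T"
 shows "link t' Q = link t Q"
proof -
 obtain F where F: "F \<subseteq> H" "Q = {x. \<forall>(u, c)\<in>F. u \<bullet> x \<le> c}" using co unfolding cut_out_def by blast
 have finF: "finite F" using F fin finite_subset by blast
 have t't: "t' \<in> T" using t' rel_interior_subset by blast
 have l: "link s Q = {q. \<forall>(u, c)\<in>F. u \<bullet> s = c --> u \<bullet> q \<le> 0}" if "s \<in> T" for s
  unfolding F(2) using that sub F(2) by (intro link_halfspaces finF) blast
 have "u \<bullet> t' = c \<longleftrightarrow> u \<bullet> t = c" if uc: "(u, c) \<in> F" for u c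
 proof
  assume "u \<bullet> t = c"
  moreover have "t' - t \<in> tang H t" using dirs_diff[OF t't t(1)] t(2) by simp
  ultimately have "u \<bullet> (t' - t) = 0" using uc F(1) by (auto simp: tang_def)
  then show "u \<bullet> t' = c" using \<open>u \<bullet> t = c\<close> by (simp add: inner_diff_right)
 next
  assume e': "u \<bullet> t' = c"
  obtain m where m: "m > 1" "(1 - m) *R t + m *R t' \<in> T"
   using convex_rel_interior_if[OF cv t'] hull_inc[OF t(1)] by (metis order_refl)
  then have "u \<bullet> ((1 - m) *R t + m *R t') \<le> c" using uc sub F(2) by blast
  then have "(1 - m) * (u \<bullet> t - c) \<le> 0" using e' by (simp add: inner_add_right algebra_simps)
  then have "u \<bullet> t \<ge> c" using m(1) by (simp add: mult_le_0_iff)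
  moreover have "u \<bullet> t \<le> c" using t(1) sub uc F(2) by blast
  ultimately show "u \<bullet> t = c" by simp
 qed
 then have "(\<forall>(u, c)\<in>F. u \<bullet> t' = c --> u \<bullet> q \<le> 0) \<longleftrightarrow> (\<forall>(u, c)\<in>F. u \<bullet> t = c --> u \<bullet> q \<le> 0)" for q by blast
 then show ?thesis unfolding l[OF t't] l[OF t(1)] by blast
qed

lemma mem_link_tan:
 assumes fin: "finite H" and co: "cut_out H Q" and r: "r \<in> link t Q"
 shows "tang (larr H t) r \<subseteq> dirs Q"
proof -
 have "near0 (\<lambda>e. t + e *R r \<in> Q \<and> tang H (t + e *R r) = tang (larr H t) r)"
  using r near0_tang[OF fin] by (auto simp: link_def intro: eventually_conj)
 then obtain e where "t + e *R r \<in> Q" "tang H (t + e *R r) = tang (larr H t) r"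
  using near0_ex by blast
 then show ?thesis using cut_out_tan[OF fin co] by metis
qed

lemma germ_facet:
 assumes X: "pure_complex (X :: 'n::finite wcomplex)" and H: "adapted X H"
  and s: "Q \<in> facets X" and r: "r \<in> link t Q" and d: "tang (larr H t) r = dirs Q"
 shows "germ (wgt X H) t r = mult X Q"
proof (rule germ_eqI)
 note fin = adaptedD(2)[OF H]
 have "near0 (\<lambda>e. t + e *R r \<in> Q)" using r by (simp add: link_def)
 then show "near0 (\<lambda>e. wgt X H (t + e *R r) = mult X Q)"
  using near0_tang[OF fin, of t r]
 proof eventually_elim
  case (elim e)
  then show ?case using wgt_facet[OF X H _ s] facet_dim[OF X s] d by simp
 qed
qed

lemma germ_nonzero_facet:
 assumes X: "pure_complex (X :: 'n::finite wcomplex)" and H: "adapted X H"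
  and g: "germ (wgt X H) t r \<noteq> 0"
 obtains Q where "Q \<in> facets X" "t \<in> Q" "r \<in> link t Q" "mult X Q = germ (wgt X H) t r"
  "tang (larr H t) r = dirs Q"
proof -
 note fin = adaptedD(2)[OF H]
 obtain y where y: "near0 (\<lambda>e. t + e *R r \<in> cell H y)" "\<forall>(u, c)\<in>H. sgn (u \<bullet> y - c) = step_sgn u c t r"
  by (rule cell_step[OF fin, of t r])
 have gy: "germ (wgt X H) t r = wgt X H y" by (rule germ_step[OF fin wgt_cell_const[OF H] y(2)])
 then obtain Q where s: "Q \<in> facets X" "y \<in> Q" "dim (tang H y) + codim X = CARD('n)"
  using g wgt_nonzero by metis
 note co = adaptedD(3)[OF H facet_cell[OF s(1)]]
 have "r \<in> link t Q" using y(1) cut_out_cell[OF co s(2)] unfolding link_def by (auto elim: eventually_mono)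
 moreover have "t \<in> Q" using into_ccell[OF fin y(1)] cut_out_ccell[OF co s(2)] by blast
 moreover have "mult X Q = germ (wgt X H) t r" using wgt_facet[OF X H s(3,1,2)] gy by simp
 moreover have "tang (larr H t) r = dirs Q"
 proof -
  have "tang H y \<subseteq> dirs Q" using cut_out_tan[OF fin co s(2)] .
  then have "tang H y = dirs Q"
   using facet_dim[OF X s(1)] s(3) by (intro subspace_dim_equal sub_tang sub_dirs) auto
  then show ?thesis using tang_step_sgn[OF y(2)] by simp
 qed
 ultimately show thesis using that s by blast
qed

lemma germ_of_rat:
 assumes "finite H" "cell_const H f"
 shows "germ (\<lambda>x. of_rat (f x) :: real) t s = of_rat (germ f t s)"
 by (rule germ_eqI) (use eventually_germ[OF assms, of t s] in \<open>auto elim: eventually_mono\<close>)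

lemma ridge_dim:
 assumes "pure_complex (X :: 'n::finite wcomplex)" "T \<in> ridges X"
 shows "dim (dirs T) + 1 + codim X = CARD('n)" "T \<in> cells X" "T \<noteq> {}"
proof -
 show "T \<in> cells X" using assms by (simp add: ridges_def)
 then show "T \<noteq> {}" using complexD(3)[OF assms(1)] by blast
 then show "dim (dirs T) + 1 + codim X = CARD('n)"
  using assms(2) aff_dim_dirs[of T] by (simp add: ridges_def)
qed

text \<open>The choice by \<open>SOME\<close> is justified by a lattice vector congruent to the
  primitive vector on the side of \<open>Q\<close>. The link may be taken at \<open>t\<close>
  instead of \<open>relint_point T\<close> by \<open>link_rel_interior\<close>.\<close>

lemma lattice_normal_props:
 assumes X: "pure_complex (X :: 'n::finite wcomplex)" and H: "adapted X H"
  and s: "Q \<in> facets X" and r: "T \<in> ridges X" "T \<subseteq> Q" and t: "t \<in> T" "tang H t = dirs T"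
 shows "lattice_normal Q T \<in> lat" "lattice_normal Q T \<in> link t Q"
  "lat \<inter> dirs Q = {k + of_int j *R lattice_normal Q T |k j. k \<in> lat \<inter> dirs T}"
proof -
 note fin = adaptedD(2)[OF H] and arr = adaptedD(1)[OF H]
 note co = adaptedD(3)[OF H facet_cell[OF s]]
 note rd = ridge_dim[OF X r(1)]
 have cvt: "convex T" using cut_out_convex adaptedD(3)[OF H rd(2)] by blast
 let ?K = "dirs T" and ?D = "dirs Q"
 have sne: "Q \<noteq> {}" using t r by blast
 have lk: "link (relint_point T) Q = link t Q"
  by (rule link_rel_interior[OF fin co r(2) t cvt relint_point_mem[OF cvt rd(3)]])
 obtain z where z: "z \<in> Q" "tang H z = ?D" using cut_out_generic[OF fin co sne] by blast
 have ratK: "rational_subspace ?K" using rational_tang[OF arr, of t] t by simp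
 have spanD: "span (?D \<inter> lat) = ?D" using tang_span_lat[OF arr, of z] z by simp
 have KD: "?K \<subseteq> ?D" by (rule dirs_mono[OF r(2)])
 have dim: "dim ?D = dim ?K + 1" using facet_dim[OF X s] rd(1) by simp
 have ts: "t \<in> Q" using t r by blast
 have "\<exists>x\<in>Q. x - t \<notin> ?K"
 proof (rule ccontr)
  assume c: "\<not> ?thesis"
  have "?D \<subseteq> ?K"
   unfolding dirs_def[of Q]
  proof (rule span_minimal[OF _ sub_dirs], clarify)
   fix a b assume "a \<in> Q" "b \<in> Q"
   then have "(a - t) - (b - t) \<in> ?K" using c subspace_diff[OF sub_dirs] by blast
   then show "a - b \<in> ?K" by simp
  qed
  then show False using dim_subset[of ?D ?K] dim by simp
 qed
 then obtain x where x: "x \<in> Q" "x - t \<notin> ?K" by blast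
 have xD: "x - t \<in> ?D" by (rule dirs_diff[OF x(1) ts])
 obtain p q where p: "prim_mod ?K p" "q > 0" "(x - t) - q *R p \<in> ?K"
  using ex_prim_mod[OF ratK sub_dirs spanD KD dim xD x(2)] by blast
 obtain v where v: "v \<in> lat" "v - p \<in> ?K" using prim_mod_rep[OF p(1)] by metis
 have pD: "p \<in> ?D"
 proof -
  have "(x - t) - ((x - t) - q *R p) \<in> ?D"
   by (rule subspace_diff[OF sub_dirs xD]) (use p(3) KD in blast)
  then have "(1 / q) *R ((x - t) - ((x - t) - q *R p)) \<in> ?D"
   by (intro subspace_scale[OF sub_dirs])
  then show ?thesis using p(2) by simp
 qed
 have D: "?D = {k + q *R p |k q. k \<in> ?K}"
  by (rule subspace_adjoin_eq[OF sub_dirs sub_dirs KD pD prim_mod_notin[OF p(1)] dim])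
 have lD: "lat \<inter> ?D = {k + of_int j *R v |k j. k \<in> lat \<inter> ?K}"
  unfolding D by (rule prim_mod_lattice[OF p(1) sub_dirs v])
 \<comment> \<open>\<open>v\<close> differs by a vector tangent to \<open>T\<close> from a positive
   multiple of \<open>x - t\<close>, which points into \<open>Q\<close>.\<close>
 have vl: "v \<in> link t Q"
 proof -
  have "(1 / q) *R (x - t) \<in> link t Q" using link_scaleR[OF fin co ts link_diff_mem[OF fin co ts x(1)]] p(2) by simp
  moreover have "(v - p) - (1 / q) *R ((x - t) - q *R p) \<in> tang H t"
   unfolding t(2) by (rule subspace_diff[OF sub_dirs v(2) subspace_scale[OF sub_dirs p(3)]])
  ultimately have "(1 / q) *R (x - t) + ((v - p) - (1 / q) *R ((x - t) - q *R p)) \<in> link t Q"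
   by (rule link_add_tang[OF fin co ts])
  moreover have "(1 / q) *R (x - t) + ((v - p) - (1 / q) *R ((x - t) - q *R p)) = v"
  proof -
   have "(1 / q) *R (x - t - q *R p) = (1 / q) *R (x - t) - p" using p(2) by (simp add: scaleR_right_diff_distrib)
   then show ?thesis by simp
  qed
  ultimately show ?thesis by simp
 qed
 have pl: "polyhedron_lattice T = lat \<inter> ?K" "polyhedron_lattice Q = lat \<inter> ?D"
  using polyhedron_lattice_dirs rd(3) sne by auto
 note ii = int_span_insert[OF lat_Int_subgroup[OF sub_dirs]]
 have ex: "v \<in> int_lattice \<and> v \<in> link (relint_point T) Q \<and> int_span (insert v (polyhedron_lattice T)) = polyhedron_lattice Q"
  unfolding pl ii lk using v vl lD by (simp add: lat_vec)
 have "lattice_normal Q T \<in> int_lattice \<and> lattice_normal Q T \<in> link (relint_point T) Q \<and>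
   int_span (insert (lattice_normal Q T) (polyhedron_lattice T)) = polyhedron_lattice Q"
  unfolding lattice_normal_def by (rule someI[where P = "\<lambda>v. v \<in> int_lattice \<and> v \<in> link (relint_point T) Q \<and>
   int_span (insert v (polyhedron_lattice T)) = polyhedron_lattice Q", OF ex])
 then show "lattice_normal Q T \<in> lat" "lattice_normal Q T \<in> link t Q"
  "lat \<inter> dirs Q = {k + of_int j *R lattice_normal Q T |k j. k \<in> lat \<inter> dirs T}"
  unfolding pl ii lk by (auto simp: lat_vec)
qed

text \<open>The component of the lattice normal orthogonal to \<open>dirs T\<close> is primitive,
  and it stays in the link because it differs from the normal by a vector tangent to
  \<open>T\<close>.\<close>

lemma ridge_normal:
 assumes X: "pure_complex (X :: 'n::finite wcomplex)" and H: "adapted X H"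
  and s: "Q \<in> facets X" and r: "T \<in> ridges X" "T \<subseteq> Q" and t: "t \<in> T" "tang H t = dirs T"
 obtains p where "prim_mod (dirs T) p" "lattice_normal Q T - p \<in> dirs T" "p \<in> link t Q"
  "tang (larr H t) p = dirs Q"
proof -
 note fin = adaptedD(2)[OF H] and arr = adaptedD(1)[OF H]
 note co = adaptedD(3)[OF H facet_cell[OF s]]
 note rd = ridge_dim[OF X r(1)] and ln = lattice_normal_props[OF assms]
 let ?K = "dirs T" and ?D = "dirs Q" and ?v = "lattice_normal Q T"
 have sne: "Q \<noteq> {}" and ts: "t \<in> Q" using t r by blast+
 have spanK: "span ?K = ?K" using sub_dirs[of T] by (simp only: span_eq_iff)
 obtain k p where kp: "k \<in> span ?K" "\<And>w. w \<in> span ?K ==> orthogonal p w" "?v = k + p"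
  using orthogonal_subspace_decomp_exists by blast
 have kK: "k \<in> ?K" using kp spanK by simp
 have vp: "?v - p \<in> ?K" using kp kK by simp
 have dim: "dim ?D = dim ?K + 1" using facet_dim[OF X s] rd(1) by simp
 obtain z where z: "z \<in> Q" "tang H z = ?D" using cut_out_generic[OF fin co sne] by blast
 have pK: "p \<notin> ?K"
 proof
  assume "p \<in> ?K"
  then have "?v \<in> ?K" using kp(3) kK subspace_add[OF sub_dirs] by metis
  then have "lat \<inter> ?D \<subseteq> ?K" unfolding ln(3) by (auto intro!: subspace_add[OF sub_dirs] subspace_scale[OF sub_dirs])
  then have "span (?D \<inter> lat) \<subseteq> ?K" by (intro span_minimal sub_dirs) auto
  then have "?D \<subseteq> ?K" using tang_span_lat[OF arr, of z] z by simp
  then show False using dim_subset[of ?D ?K] dim by simp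
 qed
 have KD: "?K \<subseteq> ?D" by (rule dirs_mono[OF r(2)])
 have vD: "?v \<in> ?D" using link_subset_dirs[OF ts] ln(2) by blast
 have pD: "p \<in> ?D"
 proof -
  have "?v - k \<in> ?D" using vD kK KD subspace_diff[OF sub_dirs] by blast
  then show ?thesis using kp(3) by simp
 qed
 have prim: "prim_mod ?K p"
  unfolding prim_mod_def
 proof (intro conjI ballI allI iffI)
  fix w assume "w \<in> ?K" then show "p \<bullet> w = 0" using kp(2) spanK by (simp add: orthogonal_def)
 next
  show "p \<noteq> 0" using pK subspace_0[OF sub_dirs] by metis
 next
  fix q :: real assume "\<exists>v\<in>lat. v - q *R p \<in> ?K"
  then obtain w where w: "w \<in> lat" "w - q *R p \<in> ?K" by blast
  have "w = (w - q *R p) + q *R p" by simp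
  then have "w \<in> ?D" using w KD pD by (metis subspace_add[OF sub_dirs] subspace_scale[OF sub_dirs] subsetD)
  then obtain k' j where kj: "w = k' + of_int j *R ?v" "k' \<in> lat \<inter> ?K" using w ln(3) by blast
  have "(of_int j - q) *R p = (w - q *R p) - k' - of_int j *R k" using kj(1) kp(3) by (simp add: algebra_simps)
  also have "\<dots> \<in> ?K"
   using subspace_diff[OF sub_dirs subspace_diff[OF sub_dirs w(2), of k'] subspace_scale[OF sub_dirs kK]] kj(2) by blast
  finally have "(of_int j - q) *R p \<in> ?K" .
  have "of_int j - q = 0"
  proof (rule ccontr)
   assume ne: "of_int j - q \<noteq> 0"
   have "(1 / (of_int j - q)) *R ((of_int j - q) *R p) \<in> ?K"
    using \<open>(of_int j - q) *R p \<in> ?K\<close> subspace_scale[OF sub_dirs] by blast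
   then show False using ne pK by simp
  qed
  then have "q = of_int j" by simp
  then show "q \<in> \<int>" by simp
 next
  fix q :: real assume q: "q \<in> \<int>"
  have "q *R ?v - q *R p = q *R (?v - p)" by (simp add: algebra_simps)
  also have "\<dots> \<in> ?K" using vp subspace_scale[OF sub_dirs] by blast
  finally show "\<exists>v\<in>lat. v - q *R p \<in> ?K" using lat_scale[OF ln(1) q] by blast
 qed
 have "?v + - k \<in> link t Q"
  by (rule link_add_tang[OF fin co ts ln(2)]) (use kK t(2) subspace_neg[OF sub_dirs] in auto)
 then have pl: "p \<in> link t Q" using kp(3) by simp
 have "tang (larr H t) p = ?D"
 proof (rule subspace_dim_equal[OF sub_tang sub_dirs mem_link_tan[OF fin co pl]])
  have "insert p ?K \<subseteq> tang (larr H t) p"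
   using tang_subset_link[of H t p] mem_tang_link[of p H t] t by auto
  then have "dim (insert p ?K) \<le> dim (tang (larr H t) p)" by (rule dim_subset)
  moreover have "dim (insert p ?K) = dim ?K + 1" using pK spanK by (simp add: dim_insert del: span_eq_iff)
  ultimately show "dim ?D \<le> dim (tang (larr H t) p)" using dim by simp
 qed
 then show thesis using that prim vp pl by blast
qed

lemma facet_link_unique:
 assumes X: "pure_complex (X :: 'n::finite wcomplex)" and H: "adapted X H"
  and s: "Q \<in> facets X" "Q' \<in> facets X" and r: "r \<in> link t Q" "r \<in> link t Q'"
  and d: "dim (tang (larr H t) r) + codim X = CARD('n)"
 shows "Q = Q'"
proof -
 note fin = adaptedD(2)[OF H]
 have "near0 (\<lambda>h. t + h *R r \<in> Q \<and> t + h *R r \<in> Q' \<and> tang H (t + h *R r) = tang (larr H t) r)"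
  using r near0_tang[OF fin, of t r] by (simp add: link_def eventually_conj_iff)
 then obtain h where e: "t + h *R r \<in> Q" "t + h *R r \<in> Q'" "tang H (t + h *R r) = tang (larr H t) r"
  using near0_ex by blast
 have d': "dim (tang H (t + h *R r)) + codim X = CARD('n)" using d e by simp
 show ?thesis
  using facet_unique[OF X H d' s(1) e(1) facet_cell[OF s(2)] e(2)]
   facet_unique[OF X H d' s(2) e(2) facet_cell[OF s(1)] e(1)] by blast
qed

text \<open>\<open>R \<inter> Q\<close> is a face of \<open>R\<close>, and a face of
  \<open>R\<close> that meets the relative interior of \<open>G\<close> contains
  \<open>G\<close>.\<close>

lemma gen_sub_cell:
 assumes X: "pure_complex (X :: 'n::finite wcomplex)" and H: "adapted X H"
  and g: "G \<subseteq> R" "R \<in> cells X" "t \<in> rel_interior G" and s: "Q \<in> cells X" "t \<in> Q"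
 shows "G \<subseteq> Q"
proof -
 have "t \<in> G" using g rel_interior_subset by blast
 have "R \<inter> Q face_of R" using complexD(5)[OF X g(2) s(1)] .
 then have "G \<subseteq> R \<inter> Q" by (rule subset_of_face_of[OF _ g(1)]) (use g s \<open>t \<in> G\<close> in blast)
 then show ?thesis by blast
qed

text \<open>The facets of nonzero multiplicity around \<open>T\<close> correspond to the primitive
  vectors with nonzero germ, which agree with the lattice normals modulo \<open>dirs T\<close>. The
  sum of primitive vectors is orthogonal to \<open>dirs T\<close>, so lying in \<open>dirs T\<close>
  means being 0.\<close>

lemma ridge_balanced:
 assumes X: "pure_complex (X :: 'n::finite wcomplex)" and H: "adapted X H"
  and r: "T \<in> ridges X" and t: "t \<in> T" "tang H t = dirs T"
 shows "(\<Sum>Q | Q \<in> facets X \<and> T \<subseteq> Q. of_rat (mult X Q) *R lattice_normal Q T) \<in> rat_span (polyhedron_lattice T)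
  \<longleftrightarrow> balanced_at H (\<lambda>x. of_rat (wgt X H x)) t"
proof -
 note fin = adaptedD(2)[OF H] and arr = adaptedD(1)[OF H] and rd = ridge_dim[OF X r]
 let ?K = "dirs T" and ?w = "\<lambda>x. real_of_rat (wgt X H x)"
 have cot: "cut_out H T" using adaptedD(3)[OF H rd(2)] .
 have tri: "t \<in> rel_interior T" by (rule generic_rel_interior[OF fin cut_out_cell[OF cot t(1)]]) (use t in simp)
 have gw: "germ ?w t q = of_rat (germ (wgt X H) t q)" for q
  by (rule germ_of_rat[OF fin wgt_cell_const[OF H]])
 define A where "A = {Q \<in> facets X. T \<subseteq> Q}"
 have finA: "finite A" using complexD(1)[OF X] by (auto simp: A_def facets_def)
 have "\<exists>p. prim_mod ?K p \<and> lattice_normal Q T - p \<in> ?K \<and> p \<in> link t Q \<and> tang (larr H t) p = dirs Q"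
  if "Q \<in> A" for Q
  by (rule ridge_normal[OF X H _ r _ t, of Q]) (use that in \<open>auto simp: A_def\<close>)
 then have "\<forall>Q\<in>A. \<exists>p. prim_mod ?K p \<and> lattice_normal Q T - p \<in> ?K \<and> p \<in> link t Q \<and> tang (larr H t) p = dirs Q" by blast
 from bchoice[OF this] obtain \<rho> where \<rho>:
  "\<And>Q. Q \<in> A ==> prim_mod ?K (\<rho> Q)" "\<And>Q. Q \<in> A ==> lattice_normal Q T - \<rho> Q \<in> ?K"
  "\<And>Q. Q \<in> A ==> \<rho> Q \<in> link t Q" "\<And>Q. Q \<in> A ==> tang (larr H t) (\<rho> Q) = dirs Q" by blast
 define A' where "A' = {Q \<in> A. mult X Q \<noteq> 0}"
 have germ\<rho>: "germ (wgt X H) t (\<rho> Q) = mult X Q" if "Q \<in> A" for Q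
  using germ_facet[OF X H _ \<rho>(3)[OF that] \<rho>(4)[OF that]] that by (simp add: A_def)
 define R where "R = {q. prim_mod (tang H t) q \<and> germ ?w t q \<noteq> 0}"
 have inj: "inj_on \<rho> A'"
 proof (rule inj_onI)
  fix Q Q' assume s: "Q \<in> A'" "Q' \<in> A'" "\<rho> Q = \<rho> Q'"
  then have a: "Q \<in> A" "Q' \<in> A" by (auto simp: A'_def)
  show "Q = Q'"
  proof (rule facet_link_unique[OF X H _ _ \<rho>(3)[OF a(1)]])
   show "\<rho> Q \<in> link t Q'" using \<rho>(3)[OF a(2)] s(3) by simp
   show "dim (tang (larr H t) (\<rho> Q)) + codim X = CARD('n)"
    using \<rho>(4)[OF a(1)] facet_dim[OF X, of Q] a by (simp add: A_def)
  qed (use a in \<open>auto simp: A_def\<close>)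
 qed
 have im: "\<rho> ` A' = R"
 proof (intro equalityI subsetI)
  fix q assume "q \<in> \<rho> ` A'"
  then show "q \<in> R" using \<rho>(1) germ\<rho> t(2) by (auto simp: R_def gw A'_def)
 next
  fix q assume q: "q \<in> R"
  then have q1: "prim_mod ?K q" "germ (wgt X H) t q \<noteq> 0" using t(2) by (auto simp: R_def gw)
  obtain Q where s: "Q \<in> facets X" "t \<in> Q" "q \<in> link t Q" "mult X Q = germ (wgt X H) t q"
   using germ_nonzero_facet[OF X H q1(2)] by metis
  note sc = facet_cell[OF s(1)]
  have ts: "T \<subseteq> Q" by (rule gen_sub_cell[OF X H order_refl rd(2) tri sc s(2)])
  then have sA: "Q \<in> A" "Q \<in> A'" using s q1 by (auto simp: A_def A'_def)
  have KD: "?K \<subseteq> dirs Q" by (rule dirs_mono[OF ts])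
  have D: "dirs Q = {k + a *R \<rho> Q |k a. k \<in> ?K}"
   using facet_dim[OF X s(1)] rd(1) link_subset_dirs[OF s(2)] \<rho>(3)[OF sA(1)] prim_mod_notin[OF \<rho>(1)[OF sA(1)]]
   by (intro subspace_adjoin_eq sub_dirs KD) auto
  have "q \<in> dirs Q" using link_subset_dirs[OF s(2)] s(3) by blast
  then obtain k a where ka: "q = k + a *R \<rho> Q" "k \<in> ?K" using D by blast
  have "k \<bullet> k = 0"
  proof -
   have "q \<bullet> k = 0" "\<rho> Q \<bullet> k = 0" using q1 \<rho>(1)[OF sA(1)] ka(2) by (auto simp: prim_mod_def)
   then show ?thesis using ka(1) by (simp add: inner_add_left)
  qed
  then have qa: "q = a *R \<rho> Q" using ka by simp
  have "a \<noteq> 0" using qa q1(1) by (auto simp: prim_mod_def)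
  \<comment> \<open>If \<open>q\<close> and \<open>\<rho> Q\<close> pointed to opposite sides,
    \<open>t\<close> would lie strictly between two points of \<open>Q\<close>; the face
    \<open>T\<close> would then contain both, although \<open>\<rho> Q\<close> is not tangent to
    \<open>T\<close>.\<close>
  moreover have "\<not> a < 0"
  proof
   assume a: "a < 0"
   obtain d where e: "d > 0" "t + d *R q \<in> Q" "t + d *R \<rho> Q \<in> Q"
   proof -
    have "near0 (\<lambda>d. t + d *R q \<in> Q \<and> t + d *R \<rho> Q \<in> Q)"
     using s(3) \<rho>(3)[OF sA(1)] by (auto simp: link_def intro: eventually_conj)
    then show thesis using that near0_ex by blast
   qed
   let ?x = "t + d *R q" and ?y = "t + d *R \<rho> Q"
   have face: "T face_of Q" using complexD(6)[OF X rd(2) sc] ts by (simp add: inf.absorb1)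
   have \<rho>0: "\<rho> Q \<noteq> 0" using \<rho>(1)[OF sA(1)] by (auto simp: prim_mod_def)
   have "t \<in> open_segment ?x ?y"
    unfolding in_segment
   proof (intro conjI exI)
    show "?x \<noteq> ?y" using e(1) a \<rho>0 qa by auto
    \<comment> \<open>The convex coefficient solving \<open>(1 - b) a + b = 0\<close>.\<close>
    let ?b = "(- a) / (1 - a)"
    show "0 < ?b" "?b < 1" using a by (auto simp: field_simps)
    have "(1 - ?b) * a + ?b = 0" using a by (simp add: field_simps)
    then have "((1 - ?b) * (d * a) + ?b * d) = 0" by (metis (no_types, opaque_lifting) distrib_left mult.commute mult.left_commute mult_zero_right)
    then have z: "((1 - ?b) * (d * a) + ?b * d) *R \<rho> Q = 0" by simp
    have "(1 - ?b) *R ?x + ?b *R ?y = t + ((1 - ?b) * (d * a) + ?b * d) *R \<rho> Q"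
    proof -
     have "(1 - b) *R (t + d *R (a *R w)) + b *R (t + d *R w) = t + ((1 - b) * (d * a) + b * d) *R w" for b w
      by (simp add: algebra_simps)
     then show ?thesis unfolding qa by this
    qed
    then show "t = (1 - ?b) *R ?x + ?b *R ?y" using z by simp
   qed
   then have "?y \<in> T" using face_ofD[OF face _ e(2,3) t(1)] by blast
   then have "?y - t \<in> ?K" using t dirs_diff by blast
   then have "(1 / d) *R (?y - t) \<in> ?K" using subspace_scale[OF sub_dirs] by blast
   then show False using e(1) prim_mod_notin[OF \<rho>(1)[OF sA(1)]] by simp
  qed
  ultimately have "a = 1" using prim_mod_unique[OF \<rho>(1)[OF sA(1)], of a] q1(1) qa by simp
  then show "q \<in> \<rho> ` A'" using qa sA by simp
 qed
 have sumR: "(\<Sum>q\<in>R. germ ?w t q *R q) = (\<Sum>Q\<in>A. of_rat (mult X Q) *R \<rho> Q)"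
 proof -
  have "(\<Sum>q\<in>R. germ ?w t q *R q) = (\<Sum>Q\<in>A'. of_rat (mult X Q) *R \<rho> Q)"
   unfolding im[symmetric] sum.reindex[OF inj] using germ\<rho> by (intro sum.cong) (auto simp: gw A'_def)
  also have "\<dots> = (\<Sum>Q\<in>A. of_rat (mult X Q) *R \<rho> Q)"
   by (rule sum.mono_neutral_left[OF finA]) (auto simp: A'_def)
  finally show ?thesis .
 qed
 let ?s = "\<Sum>Q\<in>A. of_rat (mult X Q) *R lattice_normal Q T" and ?s' = "\<Sum>Q\<in>A. real_of_rat (mult X Q) *R \<rho> Q"
 have diff: "?s - ?s' \<in> ?K"
 proof -
  have "?s - ?s' = (\<Sum>Q\<in>A. of_rat (mult X Q) *R (lattice_normal Q T - \<rho> Q))"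
   by (simp add: sum_subtractf[symmetric] scaleR_right_diff_distrib)
  also have "\<dots> \<in> ?K" using \<rho>(2) by (intro subspace_sum subspace_scale sub_dirs)
  finally show ?thesis .
 qed
 have "?s \<in> rat_span (polyhedron_lattice T) \<longleftrightarrow> ?s \<in> ?K"
  unfolding polyhedron_lattice_dirs[OF rd(3)]
  using lattice_normal_props(1)[OF X H _ r _ t] by (intro rat_span_lat_iff sub_dirs finA) (auto simp: A_def)
 also have "\<dots> \<longleftrightarrow> ?s' \<in> ?K"
 proof
  assume "?s \<in> ?K"
  then have "?s - (?s - ?s') \<in> ?K" using diff subspace_diff[OF sub_dirs] by blast
  then show "?s' \<in> ?K" by simp
 next
  assume "?s' \<in> ?K"
  then have "?s' + (?s - ?s') \<in> ?K" using diff subspace_add[OF sub_dirs] by blast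
  then show "?s \<in> ?K" by simp
 qed
 also have "\<dots> \<longleftrightarrow> ?s' = 0"
 proof
  assume "?s' \<in> ?K"
  moreover have "?s' \<bullet> k = 0" if "k \<in> ?K" for k
   using \<rho>(1) that by (auto simp: inner_sum_left prim_mod_def intro!: sum.neutral)
  ultimately have "?s' \<bullet> ?s' = 0" by blast
  then show "?s' = 0" by simp
 next
  assume "?s' = 0"
  then show "?s' \<in> ?K" using subspace_0[OF sub_dirs] by simp
 qed
 also have "\<dots> \<longleftrightarrow> balanced_at H ?w t"
  unfolding balanced_at_def R_def[symmetric] sumR ..
 finally show ?thesis unfolding A_def .
qed

text \<open>The weight has more ridges than the complex, as a ridge of \<open>H\<close> may lie in
  the relative interior of a facet. There the germ is invariant under \<open>q \<mapsto> - q\<close>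
  and the sum cancels. At all other ridges \<open>ridge_balanced\<close> applies, or no facet is
  present.\<close>

theorem balanced_iff_weight:
 assumes X: "pure_complex (X :: 'n::finite wcomplex)" and H: "adapted X H"
 shows "balanced X \<longleftrightarrow> bal_weight H (codim X) (\<lambda>x. of_rat (wgt X H x))"
proof
 note fin = adaptedD(2)[OF H]
 let ?w = "\<lambda>x. real_of_rat (wgt X H x)"
 assume bal: "bal_weight H (codim X) ?w"
 show "balanced X"
  unfolding balanced_def
 proof
  fix T assume r: "T \<in> ridges X"
  note rd = ridge_dim[OF X r]
  obtain t where t: "t \<in> T" "tang H t = dirs T" using cut_out_generic[OF fin adaptedD(3)[OF H rd(2)] rd(3)] by blast
  have "balanced_at H ?w t" using bal rd(1) t by (simp add: bal_weight_def)
  then show "(\<Sum>Q | Q \<in> facets X \<and> T \<subseteq> Q. of_rat (mult X Q) *R lattice_normal Q T) \<in> rat_span (polyhedron_lattice T)"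
   using ridge_balanced[OF X H r t] by blast
 qed
next
 note fin = adaptedD(2)[OF H]
 let ?w = "\<lambda>x. real_of_rat (wgt X H x)"
 have gw: "germ ?w t q = of_rat (germ (wgt X H) t q)" for t q
  by (rule germ_of_rat[OF fin wgt_cell_const[OF H]])
 assume bal: "balanced X"
 show "bal_weight H (codim X) ?w"
  unfolding bal_weight_def
 proof (intro conjI allI impI wgt_pure[OF H])
  fix t :: "real ^ 'n" assume d: "dim (tang H t) + 1 + codim X = DIM(real ^ 'n)"
  let ?K = "tang H t"
  let ?R = "{q. prim_mod ?K q \<and> germ ?w t q \<noteq> 0}"
  show "balanced_at H ?w t"
  proof (cases "\<exists>T\<in>ridges X. t \<in> T")
   case True
   then obtain T where r: "T \<in> ridges X" "t \<in> T" by blast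
   note rd = ridge_dim[OF X r(1)]
   have "?K \<subseteq> dirs T" using cut_out_tan[OF fin adaptedD(3)[OF H rd(2)] r(2)] .
   then have "?K = dirs T"
    using rd(1) d by (intro subspace_dim_equal sub_tang sub_dirs) auto
   then show ?thesis using ridge_balanced[OF X H r] bal r by (auto simp: balanced_def)
  next
   case False
   show ?thesis
   proof (cases "\<exists>Q\<in>facets X. t \<in> Q")
    case none: False
    have "?R = {}"
    proof -
     have "germ (wgt X H) t q = 0" for q
      using none germ_nonzero_facet[OF X H, of t q] by metis
     then show ?thesis by (simp add: gw)
    qed
    then show ?thesis unfolding balanced_at_def by (simp only: sum.empty)
   next
    case True
    then obtain Q where s: "Q \<in> facets X" "t \<in> Q" by blast
    note sc = facet_cell[OF s(1)]
    note co = adaptedD(3)[OF H sc]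
    \<comment> \<open>A relative boundary point would lie on a face of codimension one in
      \<open>Q\<close>, which is a ridge of \<open>X\<close>.\<close>
    have tri: "t \<in> rel_interior Q"
    proof (rule ccontr)
     assume "t \<notin> rel_interior Q"
     then obtain F where F: "F facet_of Q" "t \<in> F"
      using rel_boundary_of_polyhedron[OF cut_out_polyhedron[OF co fin]] s(2) by blast
     then have "F \<in> cells X" using complexD(4)[OF X sc] by (auto simp: facet_of_def)
     then have "F \<in> ridges X" using F s(1) by (auto simp: facet_of_def ridges_def facets_def)
     then show False using False F by blast
    qed
    have only: "Q' = Q" if s': "Q' \<in> facets X" "t \<in> Q'" for Q'
    proof -
     have sub: "Q \<subseteq> Q'" by (rule gen_sub_cell[OF X H order_refl sc tri facet_cell[OF s'(1)] s'(2)])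
     then have "Q face_of Q'" using complexD(6)[OF X sc facet_cell[OF s'(1)]] by (simp add: inf.absorb1)
     then show ?thesis
      using face_of_aff_dim_lt[OF cut_out_convex[OF adaptedD(3)[OF H facet_cell[OF s'(1)]]]] s(1) s'(1)
      by (fastforce simp: facets_def)
    qed
    have sym: "germ (wgt X H) t (- q) = germ (wgt X H) t q" if q: "germ (wgt X H) t q \<noteq> 0" "prim_mod ?K q" for q
    proof -
     obtain Q' where s': "Q' \<in> facets X" "t \<in> Q'" "q \<in> link t Q'" "mult X Q' = germ (wgt X H) t q"
      "tang (larr H t) q = dirs Q'" using germ_nonzero_facet[OF X H q(1)] by metis
     note eq = only[OF s'(1,2)]
     have "- q \<in> link t Q"
     proof -
      have qd: "q \<in> dirs Q" using link_subset_dirs[OF s'(2)] s'(3) eq by blast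
      obtain e where e: "e > 0" "ball t e \<inter> affine hull Q \<subseteq> Q" using tri mem_rel_interior_ball by blast
      have q0: "q \<noteq> 0" using q(2) by (auto simp: prim_mod_def)
      have "t + h *R (- q) \<in> Q" if "0 < h" "h < e / norm q" for h
      proof -
       have "dist t (t + h *R (- q)) < e" using that q0 by (simp add: dist_norm field_simps)
       moreover have "t + h *R (- q) \<in> affine hull Q"
        unfolding affine_hull_dirs_iff[OF s(2)]
        using subspace_scale[OF sub_dirs subspace_neg[OF sub_dirs qd], of h] by simp
       ultimately show ?thesis using e(2) by auto
      qed
      moreover have "0 < e / norm q" using e(1) q0 by simp
      ultimately show ?thesis unfolding link_def mem_Collect_eq eventually_at_right[OF \<open>0 < e / norm q\<close>] by blast
     qed
     moreover have "tang (larr H t) (- q) = dirs Q"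
     proof -
      have "tang (larr H t) (- q) = tang (larr H t) q" by (simp add: tang_def larr_def)
      then show ?thesis using s'(5) eq by simp
     qed
     ultimately have "germ (wgt X H) t (- q) = mult X Q" using germ_facet[OF X H s(1)] by blast
     then show ?thesis using s'(4) eq by simp
    qed
    let ?s = "\<Sum>q\<in>?R. germ ?w t q *R q"
    have neg: "- q \<in> ?R" if "q \<in> ?R" for q
     using that sym[of q] prim_mod_uminus[OF sub_tang] by (auto simp: gw)
    have "?s = (\<Sum>q\<in>?R. germ ?w t (- q) *R (- q))"
     by (rule sum.reindex_bij_witness[of _ uminus uminus]) (use neg in auto)
    also have "\<dots> = (\<Sum>q\<in>?R. - (germ ?w t q *R q))"
     by (rule sum.cong) (use sym in \<open>auto simp: gw\<close>)
    also have "\<dots> = - ?s" by (simp only: sum_negf)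
    finally have "?s = - ?s" .
    then have "?s + ?s = 0" by (rule eq_neg_iff_add_eq_0[THEN iffD1])
    then have "2 *R ?s = 0" by (simp only: scaleR_2)
    then have "?s = 0" by (simp only: scaleR_eq_0_iff) simp
    then show ?thesis unfolding balanced_at_def .
   qed
  qed
 qed
qed


subsection \<open>The stable product of positive cycles\<close>

text \<open>A cell of least dimension among those through \<open>x\<close> has no proper face
  through \<open>x\<close>.\<close>

lemma carrier_cell:
 assumes X: "pure_complex (X :: 'n::finite wcomplex)" and s: "Q \<in> cells X" "x \<in> Q"
 obtains R where "R \<in> cells X" "x \<in> rel_interior R"
proof -
 obtain H where H: "adapted X H" using ex_adapted[OF X] by blast
 define R where "R = arg_min (\<lambda>R. dim (dirs R)) (\<lambda>R. R \<in> cells X \<and> x \<in> R)"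
 have r: "R \<in> cells X" "x \<in> R" and min: "\<And>R'. R' \<in> cells X ==> x \<in> R' ==> dim (dirs R) \<le> dim (dirs R')"
  using arg_min_nat_lemma[of "\<lambda>R. R \<in> cells X \<and> x \<in> R" Q "\<lambda>R. dim (dirs R)"] s unfolding R_def by blast+
 have "x \<in> rel_interior R"
 proof (rule ccontr)
  assume "x \<notin> rel_interior R"
  then obtain F where F: "F facet_of R" "x \<in> F"
   using rel_boundary_of_polyhedron[OF cut_out_polyhedron[OF adaptedD(3)[OF H r(1)] adaptedD(2)[OF H]]] r(2) by blast
  then have "F \<in> cells X" using complexD(4)[OF X r(1)] by (auto simp: facet_of_def)
  then have "dim (dirs R) \<le> dim (dirs F)" using min F by blast
  moreover have "int (dim (dirs F)) = int (dim (dirs R)) - 1"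
  proof -
   have "F \<noteq> {}" "R \<noteq> {}" using F(2) r(2) by blast+
   then show ?thesis using F(1) aff_dim_dirs[of F] aff_dim_dirs[of R] by (simp add: facet_of_def)
  qed
  ultimately show False by linarith
 qed
 then show thesis using that r by blast
qed

lemma dirs_link:
 assumes fin: "finite H" and co: "cut_out H Q" and x: "x \<in> Q"
 shows "dirs (link x Q) = dirs Q"
proof
 note sub = link_subset_dirs[OF x]
 show "dirs (link x Q) \<subseteq> dirs Q"
  unfolding dirs_def[of "link x Q"]
 proof (rule span_minimal[OF _ sub_dirs], clarify)
  fix a b assume "a \<in> link x Q" "b \<in> link x Q"
  then show "a - b \<in> dirs Q" using sub subspace_diff[OF sub_dirs] by blast
 qed
 show "dirs Q \<subseteq> dirs (link x Q)"
  unfolding dirs_def[of Q]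
 proof (rule span_minimal[OF _ sub_dirs], clarify)
  fix a b assume "a \<in> Q" "b \<in> Q"
  then have "(a - x) - (b - x) \<in> dirs (link x Q)" by (intro dirs_diff link_diff_mem[OF fin co x])
  then show "a - b \<in> dirs (link x Q)" by simp
 qed
qed

text \<open>The direction from \<open>x\<close> to a relative interior point of \<open>Q\<close>
  enters \<open>T\<close> if the links agree, so \<open>T\<close> meets the relative interior of
  \<open>Q\<close> and contains \<open>Q\<close>.\<close>

lemma link_inj:
 assumes X: "pure_complex (X :: 'n::finite wcomplex)"
 shows "inj_on (link x) {Q \<in> cells X. x \<in> Q}"
proof -
 obtain H where H: "adapted X H" using ex_adapted[OF X] by blast
 have sub: "Q \<subseteq> T" if s: "Q \<in> cells X" "x \<in> Q" and t: "T \<in> cells X" "x \<in> T" and e: "link x Q = link x T" for Q T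
 proof -
  note co = adaptedD(3)[OF H s(1)] and fin = adaptedD(2)[OF H]
  have cv: "convex Q" by (rule cut_out_convex[OF co])
  have z: "relint_point Q \<in> rel_interior Q" by (rule relint_point_mem[OF cv]) (use s in blast)
  have z': "relint_point Q \<in> Q" using z rel_interior_subset by blast
  have "relint_point Q - x \<in> link x T" using link_diff_mem[OF fin co s(2) z'] e by simp
  moreover have "near0 (\<lambda>r. r \<le> 1)" by (auto simp: eventually_at_right_field intro!: exI[of _ 1])
  ultimately have "near0 (\<lambda>r. x + r *R (relint_point Q - x) \<in> T \<and> r \<le> 1)"
   by (simp add: link_def eventually_conj_iff)
  then obtain r where e: "r > 0" "r \<le> 1" "x + r *R (relint_point Q - x) \<in> T" using near0_ex by blast
  have "x - r *R (x - relint_point Q) \<in> rel_interior Q" by (rule rel_interior_convex_shrink[OF cv z s(2) e(1,2)])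
  then have "x + r *R (relint_point Q - x) \<in> rel_interior Q" by (simp add: algebra_simps)
  then show ?thesis by (rule gen_sub_cell[OF X H order_refl s(1) _ t(1) e(3)])
 qed
 show ?thesis
 proof (rule inj_onI)
  fix Q T assume "Q \<in> {Q \<in> cells X. x \<in> Q}" "T \<in> {Q \<in> cells X. x \<in> Q}" "link x Q = link x T"
  then show "Q = T" using sub[of Q T] sub[of T Q] by auto
 qed
qed

lemma mult_link_complex:
 assumes X: "pure_complex (X :: 'n::finite wcomplex)" and s: "Q \<in> cells X" "x \<in> Q"
 shows "mult (link_complex x X) (link x Q) = mult X Q"
 using the_inv_into_f_f[OF link_inj[OF X], of Q x] s by (simp add: link_complex_def)

lemma facets_link_complex:
 assumes X: "pure_complex (X :: 'n::finite wcomplex)"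
 shows "facets (link_complex x X) = link x ` {Q \<in> facets X. x \<in> Q}"
proof -
 obtain H where H: "adapted X H" using ex_adapted[OF X] by blast
 have "aff_dim (link x Q) = aff_dim Q" if s: "Q \<in> cells X" "x \<in> Q" for Q
 proof -
  note co = adaptedD(3)[OF H s(1)] and fin = adaptedD(2)[OF H]
  have "link x Q \<noteq> {}" using link_diff_mem[OF fin co s(2) s(2)] by blast
  moreover have "Q \<noteq> {}" using s(2) by blast
  ultimately show ?thesis using aff_dim_dirs[of "link x Q"] aff_dim_dirs[of Q] dirs_link[OF fin co s(2)] by simp
 qed
 then show ?thesis unfolding facets_def link_complex_def by auto
qed

lemma supp_link_complex:
 assumes X: "pure_complex (X :: 'n::finite wcomplex)"
 shows "v \<in> supp (link_complex x X) \<longleftrightarrow> (\<exists>Q\<in>facets X. x \<in> Q \<and> mult X Q \<noteq> 0 \<and> v \<in> link x Q)"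
proof -
 have "mult (link_complex x X) (link x Q) = mult X Q" if "Q \<in> facets X" "x \<in> Q" for Q
  using mult_link_complex[OF X facet_cell[OF that(1)] that(2)] .
 then show ?thesis unfolding supp_def facets_link_complex[OF X] by auto
qed

lemma tang_link_diff: "tang H z \<subseteq> tang (larr H x) (z - x)"
 by (auto simp: tang_def larr_def inner_diff_right)

lemma rational_polyhedron_Int:
 assumes "rational_polyhedron Q" "rational_polyhedron T"
 shows "rational_polyhedron (Q \<inter> T)"
proof -
 obtain F where F: "finite F" "F \<subseteq> int_lattice \<times> UNIV" "Q = {x. \<forall>(u, c)\<in>F. u \<bullet> x \<le> c}"
  using assms(1) unfolding rational_polyhedron_def by blast
 obtain G where G: "finite G" "G \<subseteq> int_lattice \<times> UNIV" "T = {x. \<forall>(u, c)\<in>G. u \<bullet> x \<le> c}"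
  using assms(2) unfolding rational_polyhedron_def by blast
 have "Q \<inter> T = {x. \<forall>(u, c)\<in>F \<union> G. u \<bullet> x \<le> c}" using F(3) G(3) by blast
 then show ?thesis unfolding rational_polyhedron_def using F(1,2) G(1,2) by (intro exI[of _ "F \<union> G"]) auto
qed

text \<open>The difference map on \<open>D \<times> E\<close> has a linear section, and the cones are invariant under its
  kernel \<open>D \<inter> E\<close>, so that the difference of the cones is cut out by the pulled back conditions.\<close>

lemma closed_mdiff:
 fixes S T :: "'a::euclidean_space set"
 assumes D: "subspace D" "S \<subseteq> D" and E: "subspace E" "T \<subseteq> E"
  and sum: "(msum D E) = UNIV"
  and S: "closed S" "\<And>s k. s \<in> S ==> k \<in> D \<inter> E ==> s + k \<in> S"
  and T: "closed T" "\<And>s k. s \<in> T ==> k \<in> D \<inter> E ==> s + k \<in> T"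
 shows "closed (mdiff S T)"
proof -
 let ?f = "\<lambda>p::'a \<times> 'a. fst p - snd p"
 have lf: "linear ?f" by (rule linearI) (auto simp: algebra_simps)
 obtain g where g: "range g \<subseteq> D \<times> E" "linear g" "\<And>v. v \<in> ?f ` (D \<times> E) ==> ?f (g v) = v"
  using linear_exists_right_inverse_on[OF lf subspace_Times[OF D(1) E(1)]] by blast
 have surj: "v \<in> ?f ` (D \<times> E)" for v
 proof -
  obtain a b where ab: "v = a + b" "a \<in> D" "b \<in> E" using sum by blast
  then have "v = ?f (a, - b)" "(a, - b) \<in> D \<times> E" using subspace_neg[OF E(1)] by auto
  then show ?thesis by blast
 qed
 have fg: "fst (g v) - snd (g v) = v" for v using g(3)[OF surj] .
 have gm: "fst (g v) \<in> D" "snd (g v) \<in> E" for v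
 proof -
  have "g v \<in> D \<times> E" using g(1) by blast
  then show "fst (g v) \<in> D" "snd (g v) \<in> E" by (simp_all add: mem_Times_iff)
 qed
 have "mdiff S T = {v. fst (g v) \<in> S} \<inter> {v. snd (g v) \<in> T}"
 proof (intro equalityI subsetI)
  fix v assume "v \<in> mdiff S T"
  then obtain s t where st: "v = s - t" "s \<in> S" "t \<in> T" by (auto simp: minkowski_diff_def)
  have "fst (g v) - snd (g v) = s - t" using fg[of v] st(1) by simp
  then have e: "fst (g v) - s = snd (g v) - t" by (simp add: diff_eq_eq algebra_simps)
  have "fst (g v) - s \<in> D" using gm st D subspace_diff by blast
  moreover have "fst (g v) - s \<in> E" unfolding e using gm st E subspace_diff by blast
  ultimately have k: "fst (g v) - s \<in> D \<inter> E" by blast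
  then have "snd (g v) - t \<in> D \<inter> E" using e by simp
  then have "s + (fst (g v) - s) \<in> S" "t + (snd (g v) - t) \<in> T" using S(2) T(2) st k by blast+
  then show "v \<in> {v. fst (g v) \<in> S} \<inter> {v. snd (g v) \<in> T}" by simp
 next
  fix v assume "v \<in> {v. fst (g v) \<in> S} \<inter> {v. snd (g v) \<in> T}"
  then show "v \<in> mdiff S T" unfolding minkowski_diff_def using fg[of v] by force
 qed
 moreover have "continuous_on UNIV (\<lambda>v. fst (g v))" "continuous_on UNIV (\<lambda>v. snd (g v))"
  using linear_continuous_on[OF g(2)[THEN linear_conv_bounded_linear[THEN iffD1]]] by (auto intro: continuous_intros)
 then have "closed ((\<lambda>v. fst (g v)) -` S)" "closed ((\<lambda>v. snd (g v)) -` T)"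
  using S(1) T(1) by (simp_all add: continuous_on_closed_vimage)
 ultimately show ?thesis by (simp add: vimage_def closed_Int)
qed

locale refinement =
 fixes X Y :: "'n::finite wcomplex" and H :: "((real ^ 'n) \<times> real) set"
 assumes X: "pure_complex X" and Y: "pure_complex Y" and HX: "adapted X H" and HY: "adapted Y H"
begin

abbreviation "wX \<equiv> \<lambda>x. real_of_rat (wgt X H x)"
abbreviation "wY \<equiv> \<lambda>x. real_of_rat (wgt Y H x)"
abbreviation "prodXY \<equiv> prod_weight H (codim X) (codim Y) wX wY"

lemma arr: "arrg H" and fin: "finite H"
 using adaptedD[OF HX] by blast+

lemma cwX: "cell_const H wX" and cwY: "cell_const H wY"
 using pureD(3)[OF wgt_pure[OF HX]] pureD(3)[OF wgt_pure[OF HY]] .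

text \<open>These pairs carry the displaced multiplicities at \<open>x\<close>: when the spans do
  not add up to the whole space, the lattice index is 0.\<close>

definition transv :: "real ^ 'n => ((real ^ 'n) set \<times> (real ^ 'n) set) set"
 where "transv x = {(Q, T). Q \<in> facets X \<and> T \<in> facets Y \<and> x \<in> Q \<and> x \<in> T \<and> mult X Q \<noteq> 0 \<and> mult Y T \<noteq> 0 \<and>
  (msum (dirs Q) (dirs T)) = UNIV}"

lemma finite_transv: "finite (transv x)"
proof (rule finite_subset)
 show "transv x \<subseteq> cells X \<times> cells Y" by (auto simp: transv_def facets_def)
qed (use complexD(1)[OF X] complexD(1)[OF Y] in blast)

lemma transv_dim:
 assumes "(Q, T) \<in> transv x"
 shows "dim (dirs Q \<inter> dirs T) + codim X + codim Y = CARD('n)"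
proof -
 have "dim (dirs Q) + dim (dirs T) = DIM(real ^ 'n) + dim (dirs Q \<inter> dirs T)"
  using assms by (intro dim_sum_UNIV sub_dirs) (auto simp: transv_def)
 moreover have "dim (dirs Q) + codim X = CARD('n)" "dim (dirs T) + codim Y = CARD('n)"
  using assms facet_dim[OF X] facet_dim[OF Y] by (auto simp: transv_def)
 ultimately show ?thesis by simp
qed

lemma tan_transv:
 assumes s: "Q \<in> facets X" "x \<in> Q" and t: "T \<in> facets Y" "x \<in> T"
  and sum: "(msum (dirs Q) (dirs T)) = UNIV"
  and dim: "dim (tang H x) + codim X + codim Y = CARD('n)"
 shows "dirs Q \<inter> dirs T = tang H x"
proof (rule subspace_dim_equal[symmetric])
 have "dim (dirs Q) + dim (dirs T) = DIM(real ^ 'n) + dim (dirs Q \<inter> dirs T)"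
  by (rule dim_sum_UNIV[OF sub_dirs sub_dirs sum])
 then show "dim (dirs Q \<inter> dirs T) \<le> dim (tang H x)"
  using facet_dim[OF X s(1)] facet_dim[OF Y t(1)] dim by simp
 show "tang H x \<subseteq> dirs Q \<inter> dirs T"
  using cut_out_tan[OF fin adaptedD(3)[OF HX facet_cell[OF s(1)]] s(2)]
   cut_out_tan[OF fin adaptedD(3)[OF HY facet_cell[OF t(1)]] t(2)] by blast
qed (intro sub_tang subspace_inter sub_dirs)+

lemma stable_supp_iff:
 "x \<in> stable_supp X Y \<longleftrightarrow> (\<forall>v. \<exists>Q\<in>facets X. \<exists>T\<in>facets Y. x \<in> Q \<and> x \<in> T \<and> mult X Q \<noteq> 0 \<and> mult Y T \<noteq> 0 \<and>
  v \<in> mdiff (link x Q) (link x T))"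
proof -
 have "v \<in> mdiff (supp (link_complex x X)) (supp (link_complex x Y)) \<longleftrightarrow>
  (\<exists>Q\<in>facets X. \<exists>T\<in>facets Y. x \<in> Q \<and> x \<in> T \<and> mult X Q \<noteq> 0 \<and> mult Y T \<noteq> 0 \<and>
  v \<in> mdiff (link x Q) (link x T))" for v
  unfolding minkowski_diff_def mem_Collect_eq supp_link_complex[OF X] supp_link_complex[OF Y] by blast
 then show ?thesis unfolding stable_supp_def by blast
qed

text \<open>Otherwise the finitely many differences of links lie in proper subspaces, and these do
  not cover the space.\<close>

lemma stable_supp_transv:
 assumes "x \<in> stable_supp X Y"
 shows "transv x \<noteq> {}"
proof
 assume e: "transv x = {}"
 let ?P = "{(Q, T). Q \<in> facets X \<and> T \<in> facets Y \<and> x \<in> Q \<and> x \<in> T \<and> mult X Q \<noteq> 0 \<and> mult Y T \<noteq> 0}"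
 have finP: "finite ?P"
 proof (rule finite_subset)
  show "?P \<subseteq> cells X \<times> cells Y" by (auto simp: facets_def)
 qed (use complexD(1)[OF X] complexD(1)[OF Y] in blast)
 have "generic (\<lambda>v. \<forall>p\<in>?P. v \<notin> (msum (dirs (fst p)) (dirs (snd p))))"
 proof (rule generic_ball[OF finP], rule generic_not_mem)
  fix p assume "p \<in> ?P"
  then show "(msum (dirs (fst p)) (dirs (snd p))) \<noteq> UNIV" using e by (force simp: transv_def)
  show "subspace (msum (dirs (fst p)) (dirs (snd p)))" by (intro subspace_sums sub_dirs)
 qed
 then obtain v where v: "\<forall>p\<in>?P. v \<notin> (msum (dirs (fst p)) (dirs (snd p)))" using generic_ex by blast
 obtain Q T where st: "Q \<in> facets X" "T \<in> facets Y" "x \<in> Q" "x \<in> T" "mult X Q \<noteq> 0" "mult Y T \<noteq> 0"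
  "v \<in> mdiff (link x Q) (link x T)" using assms stable_supp_iff by blast
 obtain s t where "v = s - t" "s \<in> link x Q" "t \<in> link x T" using st(7) by (auto simp: minkowski_diff_def)
 then have "v = s + - t" "s \<in> dirs Q" "- t \<in> dirs T"
  using link_subset_dirs[OF st(3)] link_subset_dirs[OF st(4)] subspace_neg[OF sub_dirs] by auto
 then have "v \<in> (msum (dirs Q) (dirs T))" by blast
 then show False using v st by force
qed

text \<open>Facets through \<open>x\<close> contain the whole cell. A displacement realized at
  \<open>x\<close> is realized at \<open>y\<close> by pointing from \<open>y\<close> to the same two
  points of the facets; the common vector \<open>x - y\<close> cancels.\<close>

lemma stable_supp_cell:
 assumes r: "U \<in> cells X" "P \<in> cells Y" and x: "x \<in> rel_interior (U \<inter> P)" "x \<in> stable_supp X Y"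
 shows "U \<inter> P \<subseteq> stable_supp X Y"
proof
 fix y assume y: "y \<in> U \<inter> P"
 show "y \<in> stable_supp X Y"
  unfolding stable_supp_iff
 proof
  fix v
  obtain Q T where st: "Q \<in> facets X" "T \<in> facets Y" "x \<in> Q" "x \<in> T" "mult X Q \<noteq> 0" "mult Y T \<noteq> 0"
   "v \<in> mdiff (link x Q) (link x T)" using x(2) stable_supp_iff by blast
  note cs = facet_cell[OF st(1)] and ct = facet_cell[OF st(2)]
  have ys: "y \<in> Q" using gen_sub_cell[OF X HX Int_lower1 r(1) x(1) cs st(3)] y by blast
  have yt: "y \<in> T" using gen_sub_cell[OF Y HY Int_lower2 r(2) x(1) ct st(4)] y by blast
  note cos = adaptedD(3)[OF HX cs] and cot = adaptedD(3)[OF HY ct]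
  obtain s t where v: "v = s - t" "s \<in> link x Q" "t \<in> link x T" using st(7) by (auto simp: minkowski_diff_def)
  have "near0 (\<lambda>d. x + d *R s \<in> Q \<and> x + d *R t \<in> T)"
   using v by (simp add: link_def eventually_conj_iff)
  then obtain d where e: "d > 0" "x + d *R s \<in> Q" "x + d *R t \<in> T" using near0_ex by blast
  have "(1 / d) *R (x + d *R s - y) \<in> link y Q" "(1 / d) *R (x + d *R t - y) \<in> link y T"
   using e by (auto intro!: link_scaleR[OF fin cos ys] link_scaleR[OF fin cot yt]
    link_diff_mem[OF fin cos ys] link_diff_mem[OF fin cot yt])
  moreover have "v = (1 / d) *R (x + d *R s - y) - (1 / d) *R (x + d *R t - y)"
   using e(1) v(1) by (simp add: algebra_simps)
  ultimately have "v \<in> mdiff (link y Q) (link y T)" unfolding minkowski_diff_def by blast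
  then show "\<exists>Q\<in>facets X. \<exists>T\<in>facets Y. y \<in> Q \<and> y \<in> T \<and> mult X Q \<noteq> 0 \<and> mult Y T \<noteq> 0 \<and>
   v \<in> mdiff (link y Q) (link y T)" using st ys yt by blast
 qed
qed

text \<open>The right hand side is the multiplicity of the displaced intersection at a generic point of a cell.\<close>

lemma pair_deg_facets:
 assumes dim: "dim (tang H x) + codim X + codim Y = CARD('n)"
 shows "generic (\<lambda>v. pair_deg (larr H x) (larr H x) (germ wX x) (germ wY x) v =
  (\<Sum>(Q, D) | (Q, D) \<in> transv x \<and> v \<in> mdiff (link x Q) (link x D).
   of_rat (mult X Q) * of_rat (mult Y D) * pair_ix (dirs Q) (dirs D)))"
proof -
 let ?P = "ocells H \<times> ocells H"
 have "generic (\<lambda>v. \<forall>p\<in>{p \<in> ?P. (msum (dirs (fst p)) (dirs (snd p))) \<noteq> UNIV}.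
  v \<notin> (msum (dirs (fst p)) (dirs (snd p))))"
 proof (rule generic_ball)
  show "finite {p \<in> ?P. (msum (dirs (fst p)) (dirs (snd p))) \<noteq> UNIV}"
   using finite_ocells[OF fin] by simp
  fix p assume "p \<in> {p \<in> ?P. (msum (dirs (fst p)) (dirs (snd p))) \<noteq> UNIV}"
  then have "(msum (dirs (fst p)) (dirs (snd p))) \<noteq> UNIV" by blast
  then show "generic (\<lambda>v. v \<notin> (msum (dirs (fst p)) (dirs (snd p))))"
   by (rule generic_not_mem[OF subspace_sums[OF sub_dirs sub_dirs]])
 qed
 then show ?thesis
 proof (rule generic_mono)
  fix v assume gen: "\<forall>p\<in>{p \<in> ?P. (msum (dirs (fst p)) (dirs (snd p))) \<noteq> UNIV}.
   v \<notin> (msum (dirs (fst p)) (dirs (snd p)))"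
  let ?t = "\<lambda>A B. on_cell wX A * on_cell wY B * pair_ix (dirs A) (dirs B)"
  let ?u = "\<lambda>Q D. of_rat (mult X Q) * of_rat (mult Y D) * real (pair_ix (dirs Q) (dirs D))"
  define S where "S = {(A, B). A \<in> ocells H \<and> B \<in> ocells H \<and> v \<in> mdiff (link x A) (link x B)}"
  define S1 where "S1 = {(A, B) \<in> S. ?t A B \<noteq> 0}"
  define T where "T = {(Q, D). (Q, D) \<in> transv x \<and> v \<in> mdiff (link x Q) (link x D)}"
  \<comment> \<open>Each open cell that contributes lies in a unique facet; passing to it turns
    pairs of open cells into pairs of facets.\<close>
  define FX where "FX A = (SOME Q. Q \<in> facets X \<and> A \<subseteq> Q)" for A
  define FY where "FY A = (SOME Q. Q \<in> facets Y \<and> A \<subseteq> Q)" for A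
  have key: "F A \<in> facets Z \<and> A \<subseteq> F A \<and> dirs A = dirs (F A) \<and> on_cell w A = of_rat (mult Z (F A)) \<and>
    (\<forall>Q. Q \<in> facets Z \<and> A \<subseteq> Q --> Q = F A)"
   if Z: "pure_complex Z" "adapted Z H" and w: "w = (\<lambda>x. real_of_rat (wgt Z H x))"
    and F: "F A = (SOME Q. Q \<in> facets Z \<and> A \<subseteq> Q)" and A: "A \<in> ocells H"
    and ex: "Q0 \<in> facets Z" "A \<subseteq> Q0" "dim (dirs A) + codim Z = CARD('n)"
   for Z w F A Q0
  proof -
   obtain y where y: "A = cell H y" using A by (auto simp: ocells_def)
   have FA: "F A \<in> facets Z" "A \<subseteq> F A" unfolding F using someI[of "\<lambda>Q. Q \<in> facets Z \<and> A \<subseteq> Q" Q0] ex by auto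
   have dA: "dirs A = tang H y" unfolding y by (rule dirs_cell[OF fin])
   have dy: "dim (tang H y) + codim Z = CARD('n)" using ex(3) dA by simp
   have yF: "y \<in> F A" using FA y by auto
   have "dirs A = dirs (F A)"
    by (rule subspace_dim_equal[OF sub_dirs sub_dirs dirs_mono[OF FA(2)]]) (use facet_dim[OF Z(1) FA(1)] ex(3) in simp)
   moreover have "on_cell w A = of_rat (mult Z (F A))"
    using on_cell_cell[OF pureD(3)[OF wgt_pure[OF Z(2)]], of y] wgt_facet[OF Z dy FA(1) yF] by (simp add: w y)
   moreover have "Q = F A" if s: "Q \<in> facets Z" "A \<subseteq> Q" for Q
   proof -
    have ys: "y \<in> Q" using s y by auto
    show ?thesis using facet_unique[OF Z dy s(1) ys facet_cell[OF FA(1)] yF] facet_unique[OF Z dy FA(1) yF facet_cell[OF s(1)] ys] by blast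
   qed
   ultimately show ?thesis using FA by blast
  qed
  have nz: "\<exists>Q0. Q0 \<in> facets Z \<and> A \<subseteq> Q0 \<and> dim (dirs A) + codim Z = CARD('n)"
   if Z: "pure_complex Z" "adapted Z H" and w: "on_cell (\<lambda>x. real_of_rat (wgt Z H x)) A \<noteq> 0" and A: "A \<in> ocells H" for Z A
  proof -
   obtain y where y: "A = cell H y" using A by (auto simp: ocells_def)
   have "wgt Z H y \<noteq> 0" using w on_cell_cell[OF pureD(3)[OF wgt_pure[OF Z(2)]], of y] y by simp
   then obtain Q where s: "Q \<in> facets Z" "y \<in> Q" "dim (tang H y) + codim Z = CARD('n)" using wgt_nonzero by blast
   moreover have "A \<subseteq> Q" unfolding y by (rule cut_out_cell[OF adaptedD(3)[OF Z(2) facet_cell[OF s(1)]] s(2)])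
   moreover have "dirs A = tang H y" unfolding y by (rule dirs_cell[OF fin])
   ultimately show ?thesis by auto
  qed
  note keyX = key[where F = FX and Z = X, OF X HX refl FX_def] and keyY = key[where F = FY and Z = Y, OF Y HY refl FY_def]
  have lk: "x \<in> Q \<and> link x A \<subseteq> link x Q" if a: "cut_out H Q" "A \<in> ocells H" "s \<in> link x A" "A \<subseteq> Q" for A Q s
  proof -
   obtain y where y: "A = cell H y" using a(2) by (auto simp: ocells_def)
   have "x \<in> ccell H y" using into_ccell[OF fin, of x s y] a(3) by (simp add: link_def y)
   moreover have "y \<in> Q" using a(4) y by auto
   ultimately have "x \<in> Q" using cut_out_ccell[OF a(1)] by blast
   moreover have "link x A \<subseteq> link x Q" using a(4) by (auto simp: link_def elim!: eventually_mono)
   ultimately show ?thesis by blast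
  qed
  have S1: "(FX A, FY B) \<in> T \<and> ?t A B = ?u (FX A) (FY B) \<and> dirs A = dirs (FX A) \<and> dirs B = dirs (FY B) \<and>
    dirs (FX A) \<inter> dirs (FY B) = tang H x" if AB: "(A, B) \<in> S1" for A B
  proof -
   have A: "A \<in> ocells H" "B \<in> ocells H" "v \<in> mdiff (link x A) (link x B)" and nz0: "?t A B \<noteq> 0"
    using AB by (auto simp: S1_def S_def)
   obtain Q0 where s0: "Q0 \<in> facets X" "A \<subseteq> Q0" "dim (dirs A) + codim X = CARD('n)" using nz[OF X HX _ A(1)] nz0 by auto
   obtain D0 where t0: "D0 \<in> facets Y" "B \<subseteq> D0" "dim (dirs B) + codim Y = CARD('n)" using nz[OF Y HY _ A(2)] nz0 by auto
   note kX = keyX[OF A(1) s0] and kY = keyY[OF A(2) t0]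
   have fX: "FX A \<in> facets X" "A \<subseteq> FX A" "dirs A = dirs (FX A)" "on_cell wX A = of_rat (mult X (FX A))" using kX by blast+
   have fY: "FY B \<in> facets Y" "B \<subseteq> FY B" "dirs B = dirs (FY B)" "on_cell wY B = of_rat (mult Y (FY B))" using kY by blast+
   obtain s t where v: "v = s - t" "s \<in> link x A" "t \<in> link x B" using A(3) by (auto simp: minkowski_diff_def)
   have xs: "x \<in> FX A" "link x A \<subseteq> link x (FX A)" using lk[OF adaptedD(3)[OF HX facet_cell[OF fX(1)]] A(1) v(2) fX(2)] by blast+
   have ys: "x \<in> FY B" "link x B \<subseteq> link x (FY B)" using lk[OF adaptedD(3)[OF HY facet_cell[OF fY(1)]] A(2) v(3) fY(2)] by blast+
   have eq: "?t A B = ?u (FX A) (FY B)" using fX fY by simp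
   have sum: "(msum (dirs (FX A)) (dirs (FY B))) = UNIV"
    using nz0 fX(3) fY(3) by (intro pair_ix_nonzero_sum sub_dirs) auto
   have "(FX A, FY B) \<in> transv x" using sum fX fY xs ys nz0 eq by (auto simp: transv_def)
   moreover have "v \<in> mdiff (link x (FX A)) (link x (FY B))" using v xs ys by (auto simp: minkowski_diff_def)
   ultimately have "(FX A, FY B) \<in> T" by (simp add: T_def)
   then show ?thesis using eq fX(3) fY(3) tan_transv[OF fX(1) xs(1) fY(1) ys(1) sum dim] by blast
  qed
  have finS: "finite S" unfolding S_def by (rule finite_subset[of _ ?P]) (use finite_ocells[OF fin] in auto)
  have "pair_deg (larr H x) (larr H x) (germ wX x) (germ wY x) v = (\<Sum>(A, B)\<in>S. ?t A B)"
   unfolding pair_deg_link[OF fin cwX cwY] S_def ..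
  also have "\<dots> = (\<Sum>(A, B)\<in>S1. ?t A B)"
   by (rule sum.mono_neutral_right[OF finS]) (auto simp: S1_def)
  also have "\<dots> = (\<Sum>(Q, D)\<in>T. ?u Q D)"
  proof (rule sum.reindex_cong[symmetric, of "map_prod FX FY"])
   \<comment> \<open>For two pairs with the same facets the entering directions differ by a vector
     in both spans, hence by a vector tangent at \<open>x\<close>. Links are invariant under it, so
     the open cells coincide.\<close>
   show "inj_on (map_prod FX FY) S1"
   proof (rule inj_onI, clarify)
    fix A B A' B' assume a: "(A, B) \<in> S1" "(A', B') \<in> S1" "map_prod FX FY (A, B) = map_prod FX FY (A', B')"
    obtain s t where v: "v = s - t" "s \<in> link x A" "t \<in> link x B" using a by (auto simp: S1_def S_def minkowski_diff_def)
    obtain s' t' where v': "v = s' - t'" "s' \<in> link x A'" "t' \<in> link x B'" using a by (auto simp: S1_def S_def minkowski_diff_def)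
    have oc: "A \<in> ocells H" "B \<in> ocells H" "A' \<in> ocells H" "B' \<in> ocells H" using a by (auto simp: S1_def S_def)
    note p = S1[OF a(1)] and p' = S1[OF a(2)]
    have e: "FX A' = FX A" "FY B' = FY B" using a(3) by auto
    have sd: "s \<in> dirs (FX A)" "s' \<in> dirs (FX A)" "t \<in> dirs (FY B)" "t' \<in> dirs (FY B)"
    proof -
     have mem: "r \<in> dirs C" if C: "C \<in> ocells H" "r \<in> link x C" for C r
     proof -
      obtain y where y: "C = cell H y" using C(1) by (auto simp: ocells_def)
      have "near0 (\<lambda>h. x + h *R r \<in> C \<and> tang H (x + h *R r) = tang (larr H x) r)"
       using C(2) near0_tang[OF fin, of x r] by (simp add: link_def eventually_conj_iff)
      then obtain h where e: "x + h *R r \<in> C" "tang H (x + h *R r) = tang (larr H x) r"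
       using near0_ex by blast
      have "tang H (x + h *R r) = tang H y" by (rule cell_tang) (use e y in simp)
      then show ?thesis using mem_tang_link[of r H x] e(2) dirs_cell[OF fin, of y] y by simp
     qed
     show "s \<in> dirs (FX A)" "s' \<in> dirs (FX A)" "t \<in> dirs (FY B)" "t' \<in> dirs (FY B)"
      using mem[OF oc(1) v(2)] mem[OF oc(3) v'(2)] mem[OF oc(2) v(3)] mem[OF oc(4) v'(3)] p p' e by auto
    qed
    have d: "s - s' = t - t'" using v v' by (simp add: algebra_simps)
    have "s - s' \<in> dirs (FX A)" by (rule subspace_diff[OF sub_dirs sd(1,2)])
    moreover have "s - s' \<in> dirs (FY B)" unfolding d by (rule subspace_diff[OF sub_dirs sd(3,4)])
    ultimately have k: "s - s' \<in> tang H x" using p by blast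
    then have k': "t - t' \<in> tang H x" using d by simp
    have "s' + (s - s') \<in> link x A'" "t' + (t - t') \<in> link x B'"
     by (rule link_add_tan[OF fin oc(3) v'(2) k], rule link_add_tan[OF fin oc(4) v'(3) k'])
    then have "s \<in> link x A'" "t \<in> link x B'" by simp_all
    then show "A = A' \<and> B = B'" using link_disjoint[OF oc(1,3) v(2)] link_disjoint[OF oc(2,4) v(3)] by blast
   qed
   show "T = map_prod FX FY ` S1"
   proof (intro equalityI subsetI)
    fix p assume "p \<in> map_prod FX FY ` S1" then show "p \<in> T" using S1 by auto
   next
    fix p assume "p \<in> T"
    then obtain Q D where p: "p = (Q, D)" "(Q, D) \<in> transv x" "v \<in> mdiff (link x Q) (link x D)"
     by (auto simp: T_def)
    then have f: "Q \<in> facets X" "D \<in> facets Y" "x \<in> Q" "x \<in> D" "mult X Q \<noteq> 0" "mult Y D \<noteq> 0" by (auto simp: transv_def)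
    obtain s t where v: "v = s - t" "s \<in> link x Q" "t \<in> link x D" using p(3) by (auto simp: minkowski_diff_def)
    obtain A where A: "A \<in> ocells H" "s \<in> link x A" using ex_link_open_cell[OF fin] by blast
    obtain B where B: "B \<in> ocells H" "t \<in> link x B" using ex_link_open_cell[OF fin] by blast
    have sub: "C \<subseteq> J \<and> r \<in> dirs C" if C: "C \<in> ocells H" "r \<in> link x C" "r \<in> link x J" "cut_out H J" for C r J
    proof -
     obtain y where y: "C = cell H y" using C(1) by (auto simp: ocells_def)
     have "near0 (\<lambda>h. x + h *R r \<in> C \<and> x + h *R r \<in> J \<and> tang H (x + h *R r) = tang (larr H x) r)"
      using C(2,3) near0_tang[OF fin, of x r] by (simp add: link_def eventually_conj_iff)
     then obtain h where e: "x + h *R r \<in> C" "x + h *R r \<in> J" "tang H (x + h *R r) = tang (larr H x) r"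
      using near0_ex by blast
     have "cell H (x + h *R r) = C" using e(1) unfolding y cell_eq_iff .
     then have "C \<subseteq> J" using cut_out_cell[OF C(4) e(2)] by simp
     moreover have "tang H (x + h *R r) = tang H y" by (rule cell_tang) (use e y in simp)
     ultimately show ?thesis using mem_tang_link[of r H x] e(3) dirs_cell[OF fin, of y] y by simp
    qed
    have sA: "A \<subseteq> Q" "s \<in> dirs A" using sub[OF A v(2) adaptedD(3)[OF HX facet_cell[OF f(1)]]] by blast+
    have sB: "B \<subseteq> D" "t \<in> dirs B" using sub[OF B v(3) adaptedD(3)[OF HY facet_cell[OF f(2)]]] by blast+
    \<comment> \<open>Genericity of \<open>v\<close> excludes that it is realized only in smaller
      cells of the facets: the spans of \<open>A\<close> and \<open>B\<close> must add up to the
      whole space, and this forces both to have facet dimension.\<close>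
    have "v = s + - t" "- t \<in> dirs B" using v sB subspace_neg[OF sub_dirs] by auto
    then have "v \<in> (msum (dirs A) (dirs B))" using sA by blast
    then have sumAB: "(msum (dirs A) (dirs B)) = UNIV" using bspec[OF gen, of "(A, B)"] A B by auto
    have "dim (dirs A) + dim (dirs B) = DIM(real ^ 'n) + dim (dirs A \<inter> dirs B)"
     by (rule dim_sum_UNIV[OF sub_dirs sub_dirs sumAB])
    moreover have "dim (tang H x) \<le> dim (dirs A \<inter> dirs B)"
     using link_tan_subset[OF fin A] link_tan_subset[OF fin B] by (intro dim_subset) blast
    moreover have "dim (dirs A) \<le> dim (dirs Q)" "dim (dirs B) \<le> dim (dirs D)" by (intro dim_subset dirs_mono sA sB)+
    moreover note facet_dim[OF X f(1)] facet_dim[OF Y f(2)] dim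
    ultimately have dA: "dim (dirs A) + codim X = CARD('n)" and dB: "dim (dirs B) + codim Y = CARD('n)" by simp_all
    note kX = keyX[OF A(1) f(1) sA(1) dA] and kY = keyY[OF B(1) f(2) sB(1) dB]
    have FA: "FX A = Q" "FY B = D" using kX kY f sA sB by metis+
    have "on_cell wX A = of_rat (mult X Q)" "on_cell wY B = of_rat (mult Y D)" using kX kY FA by auto
    moreover have "pair_ix (dirs A) (dirs B) > 0"
    proof (rule pair_ix_pos[OF sub_dirs _ sub_dirs _ sumAB])
     obtain y y' where y: "A = cell H y" "B = cell H y'" using A B by (auto simp: ocells_def)
     show "span (dirs A \<inter> lat) = dirs A" "span (dirs B \<inter> lat) = dirs B"
      unfolding y dirs_cell[OF fin] by (rule tang_span_lat[OF arr])+
    qed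
    ultimately have "(A, B) \<in> S1" using A B v f by (auto simp: S1_def S_def minkowski_diff_def)
    then show "p \<in> map_prod FX FY ` S1" using p(1) FA by force
   qed
   fix p assume "p \<in> S1"
   then obtain A B where p: "p = (A, B)" "(A, B) \<in> S1" by (cases p) auto
   have "?t A B = ?u (FX A) (FY B)" using S1[OF p(2)] by blast
   then show "(case map_prod FX FY p of (Q, D) => ?u Q D) = (case p of (A, B) => ?t A B)"
    unfolding p by (simp only: map_prod_simp case_prod_conv)
  qed
  finally show "pair_deg (larr H x) (larr H x) (germ wX x) (germ wY x) v =
   (\<Sum>(Q, D) | (Q, D) \<in> transv x \<and> v \<in> mdiff (link x Q) (link x D).
    of_rat (mult X Q) * of_rat (mult Y D) * pair_ix (dirs Q) (dirs D))" unfolding T_def .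
 qed
qed


text \<open>\<open>relint_point G\<close>, used in the definition, and the generic point
  \<open>x\<close> are both in the relative interior of \<open>G\<close>; so they lie in the same
  facets and see the same links. Pairs outside \<open>transv x\<close> have multiplicity or index
  0.\<close>

lemma displaced_mult_facets:
 assumes g: "G \<in> common_refinement X Y" and x: "x \<in> G" "tang H x = dirs G"
 shows "real_of_rat (displaced_mult X Y G v) =
  (\<Sum>(Q, R) | (Q, R) \<in> transv x \<and> v \<in> mdiff (link x Q) (link x R).
   of_rat (mult X Q) * of_rat (mult Y R) * pair_ix (dirs Q) (dirs R))"
proof -
 obtain U P where r: "U \<in> cells X" "P \<in> cells Y" "G = U \<inter> P" using g by (auto simp: common_refinement_def)
 have co: "cut_out H G" unfolding r(3) by (rule cut_out_Int[OF adaptedD(3)[OF HX r(1)] adaptedD(3)[OF HY r(2)]])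
 have cv: "convex G" by (rule cut_out_convex[OF co])
 let ?w = "relint_point G"
 have w: "?w \<in> rel_interior G" by (rule relint_point_mem[OF cv]) (use x in blast)
 have wg: "?w \<in> G" using w rel_interior_subset by blast
 have xr: "x \<in> rel_interior G" by (rule generic_rel_interior[OF fin cut_out_cell[OF co x(1)]]) (use x in simp)
 have gr: "G \<subseteq> U" "G \<subseteq> P" using r(3) by blast+
 have at_x: "facets (link_complex ?w Z) = link x ` {Q \<in> facets Z. x \<in> Q}"
  "\<And>Q. Q \<in> {Q \<in> facets Z. x \<in> Q} ==> mult (link_complex ?w Z) (link x Q) = mult Z Q"
  "\<And>Q. Q \<in> {Q \<in> facets Z. x \<in> Q} ==> polyhedron_lattice (link x Q) = lat \<inter> dirs Q"
  if Z: "pure_complex Z" "adapted Z H" and r: "U \<in> cells Z" "G \<subseteq> U" for Z U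
 proof -
  have m: "?w \<in> Q \<longleftrightarrow> x \<in> Q" "x \<in> Q ==> link ?w Q = link x Q" if s: "Q \<in> cells Z" for Q
  proof -
   show "?w \<in> Q \<longleftrightarrow> x \<in> Q"
    using gen_sub_cell[OF Z r(2,1) xr s] gen_sub_cell[OF Z r(2,1) w s] wg x(1) by blast
   show "link ?w Q = link x Q" if xs: "x \<in> Q"
    by (rule link_rel_interior[OF fin adaptedD(3)[OF Z(2) s] gen_sub_cell[OF Z r(2,1) xr s xs] x cv w])
  qed
  show "facets (link_complex ?w Z) = link x ` {Q \<in> facets Z. x \<in> Q}"
   unfolding facets_link_complex[OF Z(1)] by (rule image_cong) (use m facet_cell in blast)+
  fix Q assume s: "Q \<in> {Q \<in> facets Z. x \<in> Q}"
  then show "mult (link_complex ?w Z) (link x Q) = mult Z Q"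
   using mult_link_complex[OF Z(1), of Q ?w] m[of Q] facet_cell[of Q Z] by simp
  have s: "cut_out H Q" "x \<in> Q" using s adaptedD(3)[OF Z(2)] facet_cell by auto
  have "link x Q \<noteq> {}" using link_diff_mem[OF fin s s(2)] by blast
  then show "polyhedron_lattice (link x Q) = lat \<inter> dirs Q" using polyhedron_lattice_dirs dirs_link[OF fin s] by metis
 qed
 note zX = at_x[OF X HX r(1) gr(1)] and zY = at_x[OF Y HY r(2) gr(2)]
 let ?LX = "link_complex ?w X" and ?LY = "link_complex ?w Y"
 let ?FX = "{Q \<in> facets X. x \<in> Q}" and ?FY = "{R \<in> facets Y. x \<in> R}"

 let ?d = "\<lambda>Q R. mult ?LX Q * mult ?LY R *
    of_nat (lattice_index (msum (polyhedron_lattice Q) (polyhedron_lattice R)))"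
 let ?u = "\<lambda>Q R. mult X Q * mult Y R * of_nat (pair_ix (dirs Q) (dirs R))"
 let ?S = "{(Q, R). Q \<in> ?FX \<and> R \<in> ?FY \<and> v \<in> mdiff (link x Q) (link x R)}"
 let ?T = "{(Q, R). (Q, R) \<in> transv x \<and> v \<in> mdiff (link x Q) (link x R)}"
 have "displaced_mult X Y G v = (\<Sum>(Q, R) | Q \<in> link x ` ?FX \<and> R \<in> link x ` ?FY \<and> v \<in> mdiff Q R. ?d Q R)"
  unfolding displaced_mult_def Let_def zX(1) zY(1) ..
 also have "\<dots> = (\<Sum>(Q, R)\<in>?S. ?u Q R)"
 proof (rule sum.reindex_cong[of "map_prod (link x) (link x)"])
  have "inj_on (link x) ?FX" "inj_on (link x) ?FY"
   by (rule inj_on_subset[OF link_inj[OF X, of x]], use facet_cell in blast)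
    (rule inj_on_subset[OF link_inj[OF Y, of x]], use facet_cell in blast)
  then have "inj_on (map_prod (link x) (link x)) (?FX \<times> ?FY)" by (rule map_prod_inj_on)
  then show "inj_on (map_prod (link x) (link x)) ?S" by (rule inj_on_subset) auto
  show "{(Q, R). Q \<in> link x ` ?FX \<and> R \<in> link x ` ?FY \<and> v \<in> mdiff Q R} = map_prod (link x) (link x) ` ?S"
   by (auto simp: image_iff)
  fix p assume "p \<in> ?S"
  then obtain Q R where p: "p = (Q, R)" "Q \<in> ?FX" "R \<in> ?FY" by blast
  show "(case map_prod (link x) (link x) p of (Q, R) => ?d Q R) = (case p of (Q, R) => ?u Q R)"
   unfolding p(1) map_prod_simp case_prod_conv zX(2,3)[OF p(2)] zY(2,3)[OF p(3)] pair_ix_def lattice_index_eq ..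
 qed
 also have "\<dots> = (\<Sum>(Q, R)\<in>?T. ?u Q R)"
 proof (rule sum.mono_neutral_right)
  show "finite ?S"
  proof (rule finite_subset)
   show "?S \<subseteq> cells X \<times> cells Y" using facet_cell by blast
  qed (use complexD(1)[OF X] complexD(1)[OF Y] in blast)
  show "?T \<subseteq> ?S" by (auto simp: transv_def)
  show "\<forall>p\<in>?S - ?T. (case p of (Q, R) => ?u Q R) = 0"
  proof (clarify, rule ccontr)
   fix Q R assume a: "Q \<in> facets X" "x \<in> Q" "R \<in> facets Y" "x \<in> R" "(Q, R) \<notin> transv x" "?u Q R \<noteq> 0"
   then have "(msum (dirs Q) (dirs R)) = UNIV" by (intro pair_ix_nonzero_sum sub_dirs) auto
   then show False using a by (auto simp: transv_def)
  qed
 qed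
 finally show ?thesis by (simp add: of_rat_sum of_rat_mult case_prod_unfold)
qed

end

locale positive_refinement = refinement X Y H for X Y :: "'n::finite wcomplex" and H +
 assumes posX: "positive_cycle X" and posY: "positive_cycle Y"
begin

lemma tX: "bal_weight H (codim X) wX" and tY: "bal_weight H (codim Y) wY"
 using posX posY balanced_iff_weight[OF X HX] balanced_iff_weight[OF Y HY]
 by (auto simp: positive_cycle_def tropical_cycle_def)

text \<open>Both sides are the generic value of the same sum over pairs of facets, by
  \<open>pair_deg_facets\<close> and \<open>displaced_mult_facets\<close>.\<close>

lemma stable_mult_prod_weight:
 assumes g: "G \<in> common_refinement X Y" and x: "x \<in> G" "tang H x = dirs G"
  and dim: "dim (tang H x) + codim X + codim Y = CARD('n)"
 shows "real_of_rat (stable_mult X Y G) = prodXY x"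
proof -
 have "generic (\<lambda>v. pair_deg (larr H x) (larr H x) (germ wX x) (germ wY x) v = prodXY x)"
  by (rule pair_deg_link_generic[OF tX tY]) (use dim in simp)
 from generic_conj[OF this pair_deg_facets[OF dim]]
 have gen: "generic (\<lambda>v. real_of_rat (displaced_mult X Y G v) = prodXY x)"
  by (rule generic_mono) (use displaced_mult_facets[OF g x] in simp)
 then obtain v0 where v0: "real_of_rat (displaced_mult X Y G v0) = prodXY x" using generic_ex by blast
 have "generic (\<lambda>v. displaced_mult X Y G v = displaced_mult X Y G v0)"
  by (rule generic_mono[OF gen]) (use v0 in \<open>metis of_rat_eq_iff\<close>)
 then have "generic_value (displaced_mult X Y G) = displaced_mult X Y G v0" by (rule generic_value_eq)
 moreover have "stable_mult X Y G = generic_value (displaced_mult X Y G)"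
  unfolding stable_mult_def generic_value_def generic_def ..
 ultimately show ?thesis using v0 by simp
qed

text \<open>A nonzero generic degree puts every generic displacement into the union of the
  differences of links of transversal facets. This union is closed, hence the whole space.\<close>

lemma prod_weight_stable_supp:
 assumes nz: "prodXY x \<noteq> 0"
 shows "x \<in> stable_supp X Y"
proof -
 have dim: "dim (tang H x) + codim X + codim Y = CARD('n)" using nz by (simp add: prod_weight_def split: if_splits)
 let ?M = "\<Union>(Q, T)\<in>transv x. mdiff (link x Q) (link x T)"
 have "generic (\<lambda>v. pair_deg (larr H x) (larr H x) (germ wX x) (germ wY x) v = prodXY x)"
  by (rule pair_deg_link_generic[OF tX tY]) (use dim in simp)
 from generic_conj[OF this pair_deg_facets[OF dim]]
 have "generic (\<lambda>v. v \<in> ?M)"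
 proof (rule generic_mono)
  fix v assume v: "pair_deg (larr H x) (larr H x) (germ wX x) (germ wY x) v = prodXY x \<and>
   pair_deg (larr H x) (larr H x) (germ wX x) (germ wY x) v =
   (\<Sum>(Q, T) | (Q, T) \<in> transv x \<and> v \<in> mdiff (link x Q) (link x T).
    of_rat (mult X Q) * of_rat (mult Y T) * pair_ix (dirs Q) (dirs T))"
  show "v \<in> ?M"
  proof (rule ccontr)
   assume "v \<notin> ?M"
   then have e: "{(Q, T). (Q, T) \<in> transv x \<and> v \<in> mdiff (link x Q) (link x T)} = {}" by blast
   show False using v nz unfolding e by simp
  qed
 qed
 moreover have "closed ?M"
 proof (rule closed_UN[OF finite_transv], clarify)
  fix Q T assume t: "(Q, T) \<in> transv x"
  then have f: "Q \<in> facets X" "x \<in> Q" "T \<in> facets Y" "x \<in> T" and sum: "(msum (dirs Q) (dirs T)) = UNIV"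
   by (auto simp: transv_def)
  note cos = adaptedD(3)[OF HX facet_cell[OF f(1)]] and cot = adaptedD(3)[OF HY facet_cell[OF f(3)]]
  show "closed (mdiff (link x Q) (link x T))"
   by (rule closed_mdiff[OF sub_dirs link_subset_dirs[OF f(2)] sub_dirs link_subset_dirs[OF f(4)] sum];
    (unfold tan_transv[OF f sum dim])?)
    (auto intro: polyhedron_imp_closed polyhedron_link[OF fin cos f(2)] polyhedron_link[OF fin cot f(4)]
    link_add_tang[OF fin cos f(2)] link_add_tang[OF fin cot f(4)])
 qed
 ultimately have "?M = UNIV" by (rule generic_dense)
 then have M: "v \<in> ?M" for v by blast
 show ?thesis
  unfolding stable_supp_iff
 proof
  fix v
  obtain Q T where "(Q, T) \<in> transv x" "v \<in> mdiff (link x Q) (link x T)" using M[of v] by blast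
  then show "\<exists>Q\<in>facets X. \<exists>T\<in>facets Y. x \<in> Q \<and> x \<in> T \<and> mult X Q \<noteq> 0 \<and> mult Y T \<noteq> 0 \<and>
   v \<in> mdiff (link x Q) (link x T)" unfolding transv_def by blast
 qed
qed

abbreviation "P \<equiv> stable_prod_pos X Y"

lemma P_sel: "codim P = codim X + codim Y" "cells P = {G \<in> common_refinement X Y. G \<subseteq> stable_supp X Y}" "mult P = stable_mult X Y"
 by (simp_all add: stable_prod_pos_def)

lemma adapted_P: "adapted P H"
 unfolding adapted_def
proof (intro conjI ballI arr)
 fix G assume "G \<in> cells P"
 then obtain R W where "R \<in> cells X" "W \<in> cells Y" "G = R \<inter> W" by (auto simp: P_sel common_refinement_def)
 then show "cut_out H G" using cut_out_Int adaptedD(3)[OF HX] adaptedD(3)[OF HY] by blast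
qed

text \<open>The facet is the intersection of the cells carrying \<open>x\<close> in their relative
  interiors. It lies in a transversal pair of facets, which bounds its dimension from above, and its
  directions contain the tangent space at \<open>x\<close>, which bounds it from below.\<close>

lemma stable_supp_facet:
 assumes s: "x \<in> stable_supp X Y" and dim: "dim (tang H x) + codim X + codim Y = CARD('n)"
 obtains R W where "R \<in> cells X" "W \<in> cells Y" "x \<in> R" "x \<in> W" "R \<inter> W \<in> facets P"
proof -
 obtain Q T where t: "(Q, T) \<in> transv x" using stable_supp_transv[OF s] by fast
 then have f: "Q \<in> facets X" "T \<in> facets Y" "x \<in> Q" "x \<in> T" by (auto simp: transv_def)
 obtain R where r: "R \<in> cells X" "x \<in> rel_interior R" by (rule carrier_cell[OF X facet_cell[OF f(1)] f(3)])
 obtain W where p: "W \<in> cells Y" "x \<in> rel_interior W" by (rule carrier_cell[OF Y facet_cell[OF f(2)] f(4)])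
 have x: "x \<in> R" "x \<in> W" using r p rel_interior_subset by blast+
 note cor = adaptedD(3)[OF HX r(1)] and cop = adaptedD(3)[OF HY p(1)]
 have ri: "rel_interior (R \<inter> W) = rel_interior R \<inter> rel_interior W"
  by (rule convex_rel_interior_inter_two[OF cut_out_convex[OF cor] cut_out_convex[OF cop]]) (use r p in blast)
 then have xri: "x \<in> rel_interior (R \<inter> W)" using r p by simp
 have "R \<inter> W \<subseteq> stable_supp X Y" by (rule stable_supp_cell[OF r(1) p(1) xri s])
 then have c: "R \<inter> W \<in> cells P" using r p x by (auto simp: P_sel common_refinement_def)
 have "R \<subseteq> Q" "W \<subseteq> T"
  using gen_sub_cell[OF X HX order_refl r facet_cell[OF f(1)] f(3)]
   gen_sub_cell[OF Y HY order_refl p facet_cell[OF f(2)] f(4)] .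
 then have "dirs (R \<inter> W) \<subseteq> dirs Q \<inter> dirs T" using dirs_mono[of "R \<inter> W" Q] dirs_mono[of "R \<inter> W" T] by blast
 then have "dim (dirs (R \<inter> W)) \<le> dim (dirs Q \<inter> dirs T)" by (rule dim_subset)
 then have "dim (dirs (R \<inter> W)) + codim X + codim Y \<le> CARD('n)" using transv_dim[OF t] by simp
 moreover have "dim (tang H x) \<le> dim (dirs (R \<inter> W))"
  by (intro dim_subset cut_out_tan[OF fin cut_out_Int[OF cor cop]]) (use x in blast)
 ultimately have "dim (dirs (R \<inter> W)) + codim X + codim Y = CARD('n)" using dim by simp
 moreover have "R \<inter> W \<noteq> {}" using x by blast
 ultimately have "R \<inter> W \<in> facets P" using c aff_dim_dirs[of "R \<inter> W"] by (simp add: facets_def P_sel(1))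
 then show thesis using that r p x by blast
qed

lemma polyhedral_P: "polyhedral_complex (cells P)"
proof -
 have "finite (common_refinement X Y)"
 proof -
  have "common_refinement X Y \<subseteq> (\<lambda>(Q, T). Q \<inter> T) ` (cells X \<times> cells Y)" by (auto simp: common_refinement_def)
  then show ?thesis using complexD(1)[OF X] complexD(1)[OF Y] by (meson finite_SigmaI finite_imageI finite_subset)
 qed
 moreover have "rational_polyhedron G \<and> G \<noteq> {}" if "G \<in> common_refinement X Y" for G
  using that rational_polyhedron_Int complexD(2)[OF X] complexD(2)[OF Y] by (auto simp: common_refinement_def)
 \<comment> \<open>A face of an intersection is the intersection of the carriers of one of its
   relative interior points.\<close>
 moreover have faces: "F \<in> common_refinement X Y" if g: "G \<in> common_refinement X Y" and F: "F face_of G" "F \<noteq> {}" for G F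
 proof -
  obtain Q T where s: "Q \<in> cells X" "T \<in> cells Y" "G = Q \<inter> T" using g by (auto simp: common_refinement_def)
  have cvF: "convex F" by (rule face_of_imp_convex[OF F(1)])
  note z = relint_point_mem[OF cvF F(2)]
  let ?z = "relint_point F"
  have zF: "?z \<in> F" using z rel_interior_subset by blast
  then have zs: "?z \<in> Q" "?z \<in> T" using face_of_imp_subset[OF F(1)] s(3) by blast+
  obtain R where r: "R \<in> cells X" "?z \<in> rel_interior R" by (rule carrier_cell[OF X s(1) zs(1)])
  obtain W where p: "W \<in> cells Y" "?z \<in> rel_interior W" by (rule carrier_cell[OF Y s(2) zs(2)])
  have "R \<subseteq> Q" "W \<subseteq> T"
   using gen_sub_cell[OF X HX order_refl r s(1) zs(1)] gen_sub_cell[OF Y HY order_refl p s(2) zs(2)] .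
  then have "R face_of Q" "W face_of T"
   using complexD(6)[OF X r(1) s(1)] complexD(6)[OF Y p(1) s(2)] by (simp_all add: inf.absorb1)
  then have face: "R \<inter> W face_of G" unfolding s(3) by (rule face_of_Int_Int)
  have ri: "rel_interior (R \<inter> W) = rel_interior R \<inter> rel_interior W"
   by (rule convex_rel_interior_inter_two[OF cut_out_convex[OF adaptedD(3)[OF HX r(1)]] cut_out_convex[OF adaptedD(3)[OF HY p(1)]]])
    (use r p in blast)
  have "F = R \<inter> W" by (rule face_of_eq[OF F(1) face]) (use ri r p z in blast)
  then show ?thesis using r p F(2) by (auto simp: common_refinement_def)
 qed
 moreover have "G \<inter> d face_of G \<and> G \<inter> d face_of d" if gd: "G \<in> common_refinement X Y" "d \<in> common_refinement X Y" for G d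
 proof -
  obtain Q T Q' T' where s: "Q \<in> cells X" "T \<in> cells Y" "G = Q \<inter> T" "Q' \<in> cells X" "T' \<in> cells Y" "d = Q' \<inter> T'"
   using gd unfolding common_refinement_def by blast
  have "G \<inter> d = (Q \<inter> Q') \<inter> (T \<inter> T')" using s by blast
  then show ?thesis
   using face_of_Int_Int[OF complexD(5)[OF X s(1,4)] complexD(5)[OF Y s(2,5)]]
    face_of_Int_Int[OF complexD(6)[OF X s(1,4)] complexD(6)[OF Y s(2,5)]] s(3,6) by simp
 qed
 ultimately show ?thesis
  unfolding polyhedral_complex_def P_sel
 proof (intro conjI ballI allI impI)
  fix G F assume h: "G \<in> {G \<in> common_refinement X Y. G \<subseteq> stable_supp X Y}" "F face_of G \<and> F \<noteq> {}"
  have "F \<subseteq> stable_supp X Y" using h face_of_imp_subset[of F G] by blast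
  then show "F \<in> {G \<in> common_refinement X Y. G \<subseteq> stable_supp X Y}" using faces[of G F] h by simp
 qed simp_all
qed

text \<open>At a point of the stable intersection two facets meet transversally, so that by positivity of the
  product of fans there are points of the expected dimension arbitrarily close by.\<close>

lemma pure_P: "pure_complex P"
 unfolding pure_complex_def
proof (intro conjI ballI polyhedral_P)
 fix G assume g: "G \<in> cells P"
 then obtain U0 W0 where r0: "U0 \<in> cells X" "W0 \<in> cells Y" "G = U0 \<inter> W0" "G \<noteq> {}" and sub: "G \<subseteq> stable_supp X Y"
  by (auto simp: P_sel common_refinement_def)
 have co: "cut_out H G" by (rule adaptedD(3)[OF adapted_P g])
 obtain x where x: "x \<in> G" "tang H x = dirs G" by (rule cut_out_generic[OF fin co r0(4)])
 have xr: "x \<in> rel_interior G" by (rule generic_rel_interior[OF fin cut_out_cell[OF co x(1)]]) (use x in simp)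
 obtain Q T where t: "(Q, T) \<in> transv x" using stable_supp_transv[of x] x(1) sub by fast
 then have f: "Q \<in> facets X" "T \<in> facets Y" "x \<in> Q" "x \<in> T" "mult X Q \<noteq> 0" "mult Y T \<noteq> 0"
  and sum: "(msum (dirs Q) (dirs T)) = UNIV" by (auto simp: transv_def)
 have germ_at: "\<exists>r. germ (\<lambda>x. real_of_rat (wgt Z H x)) x r \<noteq> 0 \<and> tang (larr H x) r = dirs J"
  if Z: "pure_complex Z" "adapted Z H" and k: "J \<in> facets Z" "x \<in> J" "mult Z J \<noteq> 0" for Z J
 proof -
  note cok = adaptedD(3)[OF Z(2) facet_cell[OF k(1)]]
  obtain z where z: "z \<in> J" "tang H z = dirs J" using cut_out_generic[OF fin cok] k(2) by blast
  have l: "z - x \<in> link x J" by (rule link_diff_mem[OF fin cok k(2) z(1)])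
  have d: "tang (larr H x) (z - x) = dirs J"
   using mem_link_tan[OF fin cok l] tang_link_diff[of H z x] z(2) by blast
  have "germ (wgt Z H) x (z - x) = mult Z J" by (rule germ_facet[OF Z k(1) l d])
  then have "germ (\<lambda>x. real_of_rat (wgt Z H x)) x (z - x) \<noteq> 0"
   using germ_of_rat[OF fin wgt_cell_const[OF Z(2)], of x "z - x"] k(3) by simp
  then show ?thesis using d by blast
 qed
 obtain r where r: "germ wX x r \<noteq> 0" "tang (larr H x) r = dirs Q" using germ_at[OF X HX f(1,3,5)] by blast
 obtain s where s: "germ wY x s \<noteq> 0" "tang (larr H x) s = dirs T" using germ_at[OF Y HY f(2,4,6)] by blast
 have nonneg: "germ (\<lambda>x. real_of_rat (wgt Z H x)) x q \<ge> 0" if Z: "positive_cycle Z" "adapted Z H" for Z q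
 proof -
  have "wgt Z H y \<ge> 0" for y
  proof -
   have "(\<Sum>Q | Q \<in> facets Z \<and> y \<in> Q. mult Z Q) \<ge> 0"
    by (rule sum_nonneg) (use Z(1) in \<open>auto simp: positive_cycle_def intro: less_imp_le\<close>)
   then show ?thesis by (simp add: wgt_def)
  qed
  moreover obtain y where "\<forall>(u, c)\<in>H. sgn (u \<bullet> y - c) = step_sgn u c x q" using ex_step[OF fin] by blast
  ultimately show ?thesis using germ_step[OF fin pureD(3)[OF wgt_pure[OF Z(2)]], of y x q] by simp
 qed
 \<comment> \<open>The local fans have transversal cells of nonzero weight, so
   \<open>fan_positive\<close> yields a direction with nonzero product weight. The cell entered in
   this direction lies in a facet of \<open>P\<close> that contains \<open>x\<close>, hence all of
   \<open>G\<close>.\<close>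
 obtain z where z: "prod_weight (larr H x) (codim X) (codim Y) (germ wX x) (germ wY x) z > 0"
  using fan_positive[OF bal_weight_germ[OF tX] bal_weight_germ[OF tY] central_larr
   nonneg[OF posX HX] nonneg[OF posY HY] r(1) s(1)] r(2) s(2) sum by auto
 obtain y where y: "near0 (\<lambda>e. x + e *R z \<in> cell H y)" "\<forall>(u, c)\<in>H. sgn (u \<bullet> y - c) = step_sgn u c x z"
  by (rule cell_step[OF fin, of x z])
 have "prodXY y = germ prodXY x z"
  using germ_step[OF fin cell_const_prod_weight[OF fin cwX cwY] y(2)] by simp
 then have nz: "prodXY y \<noteq> 0" using z germ_prod_weight[OF fin cwX cwY, of "codim X" "codim Y" x] by simp
 then have dimy: "dim (tang H y) + codim X + codim Y = CARD('n)" by (simp add: prod_weight_def split: if_splits)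
 obtain U W where rp: "U \<in> cells X" "W \<in> cells Y" "y \<in> U" "y \<in> W" "U \<inter> W \<in> facets P"
  by (rule stable_supp_facet[OF prod_weight_stable_supp[OF nz] dimy])
 have "x \<in> ccell H y" by (rule into_ccell[OF fin y(1)])
 then have xr': "x \<in> U" "x \<in> W"
  using cut_out_ccell[OF adaptedD(3)[OF HX rp(1)] rp(3)] cut_out_ccell[OF adaptedD(3)[OF HY rp(2)] rp(4)] by blast+
 have "G \<subseteq> U" by (rule gen_sub_cell[OF X HX _ r0(1) xr rp(1) xr'(1)]) (use r0 in blast)
 moreover have "G \<subseteq> W" by (rule gen_sub_cell[OF Y HY _ r0(2) xr rp(2) xr'(2)]) (use r0 in blast)
 ultimately show "\<exists>Q\<in>facets P. G \<subseteq> Q" using rp(5) by blast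
qed

text \<open>A point of the expected dimension that lies in no facet of \<open>P\<close> is outside
  the stable support, where the generic degree vanishes as well.\<close>

lemma wgt_P: "real_of_rat (wgt P H x) = prodXY x"
proof (cases "dim (tang H x) + codim X + codim Y = CARD('n)")
 case False
 then show ?thesis by (simp add: wgt_def prod_weight_def P_sel(1) add.assoc)
next
 case dim: True
 then have dim': "dim (tang H x) + codim P = CARD('n)" by (simp add: P_sel(1))
 show ?thesis
 proof (cases "\<exists>G\<in>facets P. x \<in> G")
  case True
  then obtain G where g: "G \<in> facets P" "x \<in> G" by blast
  note gc = facet_cell[OF g(1)]
  have "tang H x = dirs G"
   by (rule subspace_dim_equal[OF sub_tang sub_dirs cut_out_tan[OF fin adaptedD(3)[OF adapted_P gc] g(2)]])
    (use facet_dim[OF pure_P g(1)] dim' in simp)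
  then show ?thesis
   using wgt_facet[OF pure_P adapted_P dim' g] stable_mult_prod_weight[OF _ g(2) _ dim] gc by (simp add: P_sel)
 next
  case False
  then have "{G \<in> facets P. x \<in> G} = {}" by blast
  then have "wgt P H x = 0" unfolding wgt_def by (simp only: sum.empty if_cancel)
  moreover have "prodXY x = 0"
  proof (rule ccontr)
   assume "prodXY x \<noteq> 0"
   then have "x \<in> stable_supp X Y" by (rule prod_weight_stable_supp)
   from stable_supp_facet[OF this dim] False show False by (metis IntI)
  qed
  ultimately show ?thesis by simp
 qed
qed

lemma tropical_P: "tropical_cycle P"
proof -
 have "bal_weight H (codim P) (\<lambda>x. real_of_rat (wgt P H x))"
  unfolding wgt_P P_sel(1) using balanced_prod_weight[OF tX tY] .
 then show ?thesis using balanced_iff_weight[OF pure_P adapted_P] pure_P by (simp add: tropical_cycle_def)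
qed

end

lemma stable_prod_pos_weight:
 assumes "positive_cycle X" "positive_cycle Y" "adapted X H" "adapted Y H"
 shows "tropical_cycle (stable_prod_pos X Y)" "adapted (stable_prod_pos X Y) H"
  "real_of_rat (wgt (stable_prod_pos X Y) H x) =
   prod_weight H (codim X) (codim Y) (\<lambda>x. of_rat (wgt X H x)) (\<lambda>x. of_rat (wgt Y H x)) x"
proof -
 interpret positive_refinement X Y H
  by unfold_locales (use assms in \<open>auto simp: positive_cycle_def tropical_cycle_def\<close>)
 show "tropical_cycle (stable_prod_pos X Y)" "adapted (stable_prod_pos X Y) H"
  "real_of_rat (wgt (stable_prod_pos X Y) H x) =
   prod_weight H (codim X) (codim Y) (\<lambda>x. of_rat (wgt X H x)) (\<lambda>x. of_rat (wgt Y H x)) x"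
  using tropical_P adapted_P wgt_P by auto
qed


subsection \<open>Linear combinations and the bilinear extension\<close>

lemma ex_common_adapted:
 fixes I :: "'i set" and Xs :: "'i => 'n::finite wcomplex"
 assumes "finite I" "\<And>i. i \<in> I ==> pure_complex (Xs i)"
 shows "\<exists>H. arrg H \<and> (\<forall>i\<in>I. adapted (Xs i) H)"
 using assms
proof (induction I rule: finite_induct)
 case empty
 have "arrg ({} :: ((real ^ 'n) \<times> real) set)" by (simp add: arrg_def)
 then show ?case by blast
next
 case (insert i I)
 then obtain H where H: "arrg H" "\<forall>i\<in>I. adapted (Xs i) H" by auto
 obtain G where G: "adapted (Xs i) G" using ex_adapted insert.prems by blast
 have a: "arrg (H \<union> G)" by (rule arrg_Un[OF H(1) adaptedD(1)[OF G]])
 have "\<forall>j\<in>insert i I. adapted (Xs j) (H \<union> G)"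
  using H(2) G adapted_mono[OF _ Un_upper1 a] adapted_mono[OF _ Un_upper2 a] by blast
 then show ?case using a by blast
qed

lemma tropical_weight:
 assumes "tropical_cycle X" "adapted X H"
 shows "bal_weight H (codim X) (\<lambda>x. of_rat (wgt X H x))"
 using balanced_iff_weight[OF tropical_pure[OF assms(1)] assms(2)] assms(1) by (simp add: tropical_cycle_def)

lemma wgt_sum:
 "wgt \<lparr>codim = c, cells = C, mult = (\<lambda>Q. \<Sum>i\<in>I. a i * m i Q)\<rparr> H x =
  (\<Sum>i\<in>I. a i * wgt \<lparr>codim = c, cells = C, mult = m i\<rparr> H x)"
proof -
 define F where "F = facets \<lparr>codim = c, cells = C, mult = \<lambda>_. 0\<rparr>"
 have f: "facets \<lparr>codim = c, cells = C, mult = m\<rparr> = F" for m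
  by (simp add: F_def facets_def)
 show ?thesis
  unfolding wgt_def f by (simp add: sum_distrib_left) (rule impI, rule sum.swap)
qed

text \<open>Combining multiplicities on one complex combines weights pointwise, and
  \<open>\<approx>\<close> is equality of weights once the arrangement is adapted to all complexes
  involved. Both survive further refinement.\<close>

lemma lin_comb_weight:
 fixes W :: "'n::finite wcomplex"
 assumes lc: "lin_comb I a Xs W" and fin: "finite I"
 obtains H0 where "tropical_cycle W" "\<And>i. i \<in> I ==> codim (Xs i) = codim W"
  "arrg H0" "adapted W H0" "\<And>i. i \<in> I ==> adapted (Xs i) H0"
  "\<And>H x. arrg H ==> H0 \<subseteq> H ==> wgt W H x = (\<Sum>i\<in>I. a i * wgt (Xs i) H x)"
proof -
 obtain C m where m: "\<And>i. i \<in> I ==> Xs i \<approx> \<lparr>codim = codim W, cells = C, mult = m i\<rparr>"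
  and W: "W \<approx> \<lparr>codim = codim W, cells = C, mult = (\<lambda>Q. \<Sum>i\<in>I. a i * m i Q)\<rparr>"
  using lc unfolding lin_comb_def by blast
 let ?C = "\<lambda>m. \<lparr>codim = codim W, cells = C, mult = m\<rparr>"
 have tW: "tropical_cycle W" "tropical_cycle (?C (\<lambda>Q. \<Sum>i\<in>I. a i * m i Q))" using W by (simp_all add: cycle_eq_def)
 have tX: "tropical_cycle (Xs i)" if "i \<in> I" for i using m[OF that] by (simp add: cycle_eq_def)
 obtain H1 where H1: "adapted W H1" using ex_adapted tropical_pure tW(1) by blast
 obtain H2 where H2: "adapted (?C (\<lambda>Q. \<Sum>i\<in>I. a i * m i Q)) H2" using ex_adapted tropical_pure tW(2) by blast
 obtain H3 where H3: "arrg H3" "\<forall>i\<in>I. adapted (Xs i) H3" using ex_common_adapted[OF fin, of Xs] tropical_pure[OF tX] by blast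
 let ?H = "H1 \<union> H2 \<union> H3"
 have arr: "arrg ?H" by (intro arrg_Un adaptedD(1)[OF H1] adaptedD(1)[OF H2] H3(1))
 have aC: "adapted (?C m') H" if "?H \<subseteq> H" "arrg H" for H m'
  using adapted_mono[OF H2 _ that(2)] that by (simp add: adapted_def)
 have aW: "adapted W H" if "?H \<subseteq> H" "arrg H" for H using adapted_mono[OF H1 _ that(2)] that by blast
 have aX: "adapted (Xs i) H" if "i \<in> I" "?H \<subseteq> H" "arrg H" for H i
  using adapted_mono[of "Xs i" H3 H] H3(2) that by blast
 show thesis
 proof (rule that[OF tW(1) _ arr])
  fix i assume i: "i \<in> I"
  show "codim (Xs i) = codim W" using m[OF i] cycle_eq_iff[OF aX[OF i order_refl arr] aC[OF order_refl arr]] by auto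
 next
  fix H x assume h: "arrg H" "?H \<subseteq> H"
  have "wgt W H x = (\<Sum>i\<in>I. a i * wgt (?C (m i)) H x)"
   using W cycle_eq_iff[OF aW[OF h(2,1)] aC[OF h(2,1)]] wgt_sum by auto
  also have "\<dots> = (\<Sum>i\<in>I. a i * wgt (Xs i) H x)"
  proof (rule sum.cong[OF refl])
   fix i assume i: "i \<in> I"
   show "a i * wgt (?C (m i)) H x = a i * wgt (Xs i) H x"
    using m[OF i] cycle_eq_iff[OF aX[OF i h(2,1)] aC[OF h(2,1)]] by simp
  qed
  finally show "wgt W H x = (\<Sum>i\<in>I. a i * wgt (Xs i) H x)" .
 next
  show "adapted W ?H" by (rule aW[OF order_refl arr])
  show "adapted (Xs i) ?H" if "i \<in> I" for i by (rule aX[OF that order_refl arr])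
 qed
qed

abbreviation strata :: "((real ^ 'n) \<times> real) set => nat => (real ^ 'n) set"
 where "strata H c \<equiv> {x. dim (tang H x) + c = CARD('n)}"

text \<open>Every rational-valued balanced weight is realized by a cycle. Facets of multiplicity 0
  are kept, so that the cells depend on \<open>H\<close> and \<open>c\<close> alone and weights can
  share one complex.\<close>

lemma cell_complex_strata:
 fixes H :: "((real ^ 'n) \<times> real) set"
 assumes H: "sym_arr H" and b: "bal_weight H c (\<lambda>x. of_rat (f x))"
 shows "tropical_cycle (cell_complex H c (strata H c) f)" "wgt (cell_complex H c (strata H c) f) H = f"
proof -
 have arr: "arrg H" using H by (simp add: sym_arr_def)
 note pw = bal_pure[OF b]
 have f: "cell_const H f" using pureD(3)[OF pw] by (simp add: cell_const_def)
 have z: "f x = 0" if "x \<notin> strata H c" for x using pureD(4)[OF pw, of x] that by auto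
 have "wgt (cell_complex H c (strata H c) f) H x = (if x \<in> strata H c then f x else 0)" for x
  by (rule wgt_cell_complex[OF H _ _ f]) (auto simp: cell_tang)
 then show w: "wgt (cell_complex H c (strata H c) f) H = f" using z by fastforce
 have pc: "pure_complex (cell_complex H c (strata H c) f)" by (rule pure_cell_complex[OF arr]) simp
 show "tropical_cycle (cell_complex H c (strata H c) f)"
  using balanced_iff_weight[OF pc adapted_cell_complex[OF H]] pc b w by (simp add: tropical_cycle_def)
qed

text \<open>The common complex consists of the closed cells of \<open>H\<close> of the right
  codimension and their faces; each \<open>Xs i\<close> is represented on it by its weight.\<close>

lemma lin_combI:
 fixes W :: "'n::finite wcomplex"
 assumes H: "sym_arr H" and W: "tropical_cycle W" "adapted W H"
  and Xs: "\<And>i. i \<in> I ==> tropical_cycle (Xs i)" "\<And>i. i \<in> I ==> adapted (Xs i) H" "\<And>i. i \<in> I ==> codim (Xs i) = codim W"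
  and w: "\<And>x. wgt W H x = (\<Sum>i\<in>I. a i * wgt (Xs i) H x)"
 shows "lin_comb I a Xs W"
 unfolding lin_comb_def
proof (intro exI conjI ballI)
 let ?S = "strata H (codim W)"
 let ?C = "cells (cell_complex H (codim W) ?S (wgt W H))"
 let ?m = "\<lambda>i G. wgt (Xs i) H (relint_point G)"
 fix i assume i: "i \<in> I"
 have b: "bal_weight H (codim W) (\<lambda>x. of_rat (wgt (Xs i) H x))"
  using tropical_weight[OF Xs(1)[OF i] Xs(2)[OF i]] Xs(3)[OF i] by simp
 have "Xs i \<approx> cell_complex H (codim W) ?S (wgt (Xs i) H)"
  unfolding cycle_eq_iff[OF Xs(2)[OF i] adapted_cell_complex[OF H]]
  using cell_complex_strata[OF H b] Xs[OF i] by simp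
 then show "Xs i \<approx> \<lparr>codim = codim W, cells = ?C, mult = ?m i\<rparr>" by (simp add: cell_complex_def)
next
 let ?S = "strata H (codim W)"
 let ?C = "cells (cell_complex H (codim W) ?S (wgt W H))"
 let ?m = "\<lambda>i G. wgt (Xs i) H (relint_point G)"
 have "W \<approx> cell_complex H (codim W) ?S (wgt W H)"
  unfolding cycle_eq_iff[OF W(2) adapted_cell_complex[OF H]]
  using cell_complex_strata[OF H tropical_weight[OF W]] W by simp
 then show "W \<approx> \<lparr>codim = codim W, cells = ?C, mult = (\<lambda>Q. \<Sum>i\<in>I. a i * ?m i Q)\<rparr>" by (simp add: cell_complex_def w)
qed

text \<open>The constant weight on the strata of a given dimension is balanced because these are invariant
  under reflection at each point.\<close>

lemma balanced_strata:
 fixes H :: "((real ^ 'n) \<times> real) set"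
 assumes H: "arrg H"
 shows "bal_weight H c (\<lambda>x. of_bool (x \<in> strata H c))"
 unfolding bal_weight_def pure_weight_def
proof (intro conjI allI impI H)
 show "cell_const H (\<lambda>x. of_bool (x \<in> strata H c) :: real)" by (auto simp: cell_const_def cell_tang)
next
 fix x assume "of_bool (x \<in> strata H c) \<noteq> (0 :: real)"
 then show "dim (tang H x) + c = DIM(real ^ 'n)" by (simp split: if_splits)
next
 fix t :: "real ^ 'n"
 let ?f = "\<lambda>x. of_bool (x \<in> strata H c) :: real"
 have g: "germ ?f t r = of_bool (dim (tang (larr H t) r) + c = CARD('n))" for r
  by (rule germ_eqI) (use near0_tang[OF arrg_finite[OF H], of t r] in \<open>auto elim: eventually_mono\<close>)
 have "tang (larr H t) (- r) = tang (larr H t) r" for r by (simp add: tang_def larr_def)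
 then have sym: "germ ?f t (- r) = germ ?f t r" for r unfolding g by (simp only:)
 let ?R = "{r. prim_mod (tang H t) r \<and> germ ?f t r \<noteq> 0}"
 let ?s = "\<Sum>r\<in>?R. germ ?f t r *R r"
 have "- r \<in> ?R" if "r \<in> ?R" for r
  using that sym[of r] prim_mod_uminus[OF sub_tang[of H t], of r] by simp
 then have "?s = (\<Sum>r\<in>?R. germ ?f t (- r) *R (- r))"
  by (intro sum.reindex_bij_witness[of _ uminus uminus]) auto
 also have "\<dots> = - ?s" by (simp only: sym scaleR_minus_right sum_negf)
 finally have "?s + ?s = 0" by (rule eq_neg_iff_add_eq_0[THEN iffD1])
 then have "2 *R ?s = 0" by (simp only: scaleR_2)
 then have "?s = 0" by (simp only: scaleR_eq_0_iff) simp
 then show "balanced_at H ?f t" unfolding balanced_at_def .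
qed

lemma positive_cell_complex:
 fixes H :: "((real ^ 'n) \<times> real) set"
 assumes H: "sym_arr H" and b: "bal_weight H c (\<lambda>x. of_rat (f x))" and pos: "\<And>x. x \<in> strata H c ==> f x > 0"
 shows "positive_cycle (cell_complex H c (strata H c) f)"
 unfolding positive_cycle_def
proof (intro conjI ballI cell_complex_strata(1)[OF H b])
 have fin: "finite H" using H arrg_finite by (auto simp: sym_arr_def)
 fix Q assume "Q \<in> facets (cell_complex H c (strata H c) f)"
 then have "Q \<in> ccell H ` strata H c" using facets_cell_complex[OF fin, of "strata H c" c f] by simp
 then obtain y where y: "Q = ccell H y" "y \<in> strata H c" by blast
 have "relint_point Q \<in> strata H c" using cell_tang[OF relint_point_ccell[OF fin, of y]] y by simp
 then show "mult (cell_complex H c (strata H c) f) Q > 0" using pos by simp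
qed

text \<open>Adding a large multiple of the constant weight makes any weight positive.\<close>

lemma ex_positive_decomposition:
 fixes X :: "'n::finite wcomplex"
 assumes X: "tropical_cycle X" "adapted X H" and H: "sym_arr H"
 obtains Xs a where "\<And>i. i < (2::nat) ==> positive_cycle (Xs i)" "\<And>i. i < 2 ==> adapted (Xs i) H"
  "\<And>i. i < 2 ==> codim (Xs i) = codim X" "lin_comb {..<2} a Xs X"
proof -
 have arr: "arrg H" and fin: "finite H" using H arrg_finite by (auto simp: sym_arr_def)
 let ?c = "codim X" and ?w = "wgt X H"
 let ?one = "\<lambda>x. of_bool (x \<in> strata H (codim X)) :: rat"
 have "finite (range ?w)"
 proof -
  have "?w x = on_cell ?w (cell H x)" for x using on_cell_cell[OF wgt_cell_const[OF X(2)]] by simp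
  then have "range ?w \<subseteq> on_cell ?w ` ocells H" by (auto simp: ocells_def)
  then show ?thesis using finite_ocells[OF fin] finite_surj by blast
 qed
 then have fin': "finite (range (\<lambda>x. \<bar>?w x\<bar>))" by (simp add: image_image[symmetric, of abs ?w])
 \<comment> \<open>One more than the largest absolute value of the weight, so that the shifted
   weight is positive; the maximum exists because finitely many cells give finitely many
   values.\<close>
 define N where "N = Max (range (\<lambda>x. \<bar>?w x\<bar>)) + 1"
 have N: "- ?w x < N" for x
 proof -
  have "\<bar>?w x\<bar> \<le> Max (range (\<lambda>x. \<bar>?w x\<bar>))" by (rule Max_ge[OF fin']) blast
  then show ?thesis unfolding N_def by linarith
 qed
 have b1: "bal_weight H ?c (\<lambda>x. of_rat (?one x))"
 proof -
  have e: "(\<lambda>x. real_of_rat (?one x)) = (\<lambda>x. of_bool (x \<in> strata H ?c))" by (auto simp: fun_eq_iff)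
  show ?thesis unfolding e by (rule balanced_strata[OF arr])
 qed
 have b0: "bal_weight H ?c (\<lambda>x. of_rat (?w x + N * ?one x))"
 proof -
  let ?f = "\<lambda>i::nat. if i = 0 then (\<lambda>x. real_of_rat (?w x)) else (\<lambda>x. of_rat (?one x))"
  have e: "(\<lambda>x. real_of_rat (?w x + N * ?one x)) = (\<lambda>x. \<Sum>i\<in>{0, 1::nat}. (if i = 0 then 1 else real_of_rat N) * ?f i x)"
   by (auto simp: fun_eq_iff of_rat_add of_rat_mult)
  show ?thesis unfolding e
   by (rule bal_weight_sum[OF arr]) (use b1 tropical_weight[OF X] in auto)
 qed
 define Xs where "Xs i = cell_complex H ?c (strata H ?c) (if i = 0 then \<lambda>x. ?w x + N * ?one x else ?one)" for i :: nat
 define a where "a i = (if i = 0 then 1 else - N)" for i :: nat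
 have pos: "positive_cycle (Xs i)" for i
  unfolding Xs_def
 proof (rule positive_cell_complex[OF H])
  have "0 < ?w x + N" for x using N[of x] by linarith
  then show "0 < (if i = 0 then \<lambda>x. ?w x + N * ?one x else ?one) x" if "x \<in> strata H ?c" for x
   using that by simp
  show "bal_weight H ?c (\<lambda>x. of_rat ((if i = 0 then \<lambda>x. ?w x + N * ?one x else ?one) x))"
  proof (cases "i = 0")
   case True
   show ?thesis unfolding if_P[OF True] by (rule b0)
  next
   case False
   show ?thesis unfolding if_not_P[OF False] by (rule b1)
  qed
 qed
 have ad: "adapted (Xs i) H" for i unfolding Xs_def by (rule adapted_cell_complex[OF H])
 have w0: "wgt (Xs 0) H = (\<lambda>x. ?w x + N * ?one x)" and w1: "wgt (Xs 1) H = ?one"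
  using cell_complex_strata(2)[OF H b0] cell_complex_strata(2)[OF H b1] by (simp_all add: Xs_def)
 have "lin_comb {..<2} a Xs X"
 proof (rule lin_combI[OF H X])
  fix x
  have "{..<2} = {0, 1::nat}" by auto
  then show "?w x = (\<Sum>i<2. a i * wgt (Xs i) H x)" by (simp add: w0 w1[simplified] a_def)
 qed (use pos ad in \<open>auto simp: positive_cycle_def Xs_def\<close>)
 then show thesis using that[of Xs a] pos ad by (simp add: Xs_def)
qed

text \<open>Writing each factor as a combination of two positive cycles on one arrangement gives
  four products adapted to it. The combination of their weights is balanced and is realized by a
  complex.\<close>

lemma ex_stable_prod:
 fixes X Y :: "'n::finite wcomplex"
 assumes X: "tropical_cycle X" and Y: "tropical_cycle Y"
 shows "\<exists>W. is_stable_prod X Y W"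
proof -
 obtain G where G: "adapted X G" using ex_adapted[OF tropical_pure[OF X]] by blast
 obtain G' where G': "adapted Y G'" using ex_adapted[OF tropical_pure[OF Y]] by blast
 obtain H where H: "G \<union> G' \<subseteq> H" "sym_arr H" using ex_sym_arr[OF arrg_Un[OF adaptedD(1)[OF G] adaptedD(1)[OF G']]] by blast
 have arr: "arrg H" using H by (simp add: sym_arr_def)
 have aX: "adapted X H" using adapted_mono[OF G _ arr] H by blast
 have aY: "adapted Y H" using adapted_mono[OF G' _ arr] H by blast
 obtain a Xs where Xs: "\<And>i. i < (2::nat) ==> positive_cycle (Xs i)" "\<And>i. i < 2 ==> adapted (Xs i) H"
  "\<And>i. i < 2 ==> codim (Xs i) = codim X" "lin_comb {..<2} a Xs X" by (rule ex_positive_decomposition[OF X aX H(2)]) (rule that; simp)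
 obtain b Ys where Ys: "\<And>i. i < (2::nat) ==> positive_cycle (Ys i)" "\<And>i. i < 2 ==> adapted (Ys i) H"
  "\<And>i. i < 2 ==> codim (Ys i) = codim Y" "lin_comb {..<2} b Ys Y" by (rule ex_positive_decomposition[OF Y aY H(2)]) (rule that; simp)
 let ?I = "{..<2::nat} \<times> {..<2::nat}" and ?c = "codim X + codim Y"
 define P where "P p = stable_prod_pos (Xs (fst p)) (Ys (snd p))" for p
 define ab where "ab p = a (fst p) * b (snd p)" for p :: "nat \<times> nat"
 define f where "f x = (\<Sum>p\<in>?I. ab p * wgt (P p) H x)" for x
 have P: "tropical_cycle (P p)" "adapted (P p) H" "codim (P p) = ?c" if "p \<in> ?I" for p
  using that stable_prod_pos_weight(1,2)[OF Xs(1) Ys(1) Xs(2) Ys(2)] Xs(3) Ys(3)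
  by (auto simp: P_def stable_prod_pos_def)
 have "bal_weight H ?c (\<lambda>x. \<Sum>p\<in>?I. real_of_rat (ab p) * of_rat (wgt (P p) H x))"
  by (rule bal_weight_sum[OF arr]) (use tropical_weight[OF P(1,2)] P(3) in auto)
 then have b: "bal_weight H ?c (\<lambda>x. of_rat (f x))" by (simp add: f_def of_rat_sum of_rat_mult)
 let ?W = "cell_complex H ?c (strata H ?c) f"
 have "lin_comb ?I ab P ?W"
  by (rule lin_combI[OF H(2) cell_complex_strata(1)[OF H(2) b] adapted_cell_complex[OF H(2)] P(1,2)])
   (use P(3) cell_complex_strata(2)[OF H(2) b] in \<open>auto simp: f_def\<close>)
 then have "lin_comb ?I (\<lambda>(i, j). a i * b j) (\<lambda>(i, j). stable_prod_pos (Xs i) (Ys j)) ?W"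
  by (simp add: P_def[abs_def] ab_def[abs_def] case_prod_unfold)
 then have "is_stable_prod X Y ?W"
  unfolding is_stable_prod_def using Xs(1,4) Ys(1,4) by (intro conjI exI[of _ "2::nat"] exI[of _ a] exI[of _ b] exI[of _ Xs] exI[of _ Ys]) auto
 then show ?thesis by blast
qed

text \<open>Whatever decompositions witness \<open>is_stable_prod\<close>, bilinearity of
  \<open>prod_weight\<close> identifies the weight of \<open>W\<close> in terms of the weights of
  \<open>X\<close> and \<open>Y\<close>. The choice made by \<open>\<odot>\<close> is therefore
  immaterial up to \<open>\<approx>\<close>.\<close>

lemma is_stable_prod_weight:
 fixes X Y W :: "'n::finite wcomplex"
 assumes "is_stable_prod X Y W"
 obtains H0 where "tropical_cycle W" "codim W = codim X + codim Y" "arrg H0"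
  "adapted X H0" "adapted Y H0" "adapted W H0"
  "\<And>H. arrg H ==> H0 \<subseteq> H ==> (\<lambda>x. real_of_rat (wgt W H x)) =
   prod_weight H (codim X) (codim Y) (\<lambda>x. of_rat (wgt X H x)) (\<lambda>x. of_rat (wgt Y H x))"
proof -
 obtain p q a b Xs Ys where cW: "codim W = codim X + codim Y" and
  pX: "\<And>i. i < (p::nat) ==> positive_cycle (Xs i)" and lX: "lin_comb {..<p} a Xs X" and
  pY: "\<And>j. j < (q::nat) ==> positive_cycle (Ys j)" and lY: "lin_comb {..<q} b Ys Y" and
  lW: "lin_comb ({..<p} \<times> {..<q}) (\<lambda>(i, j). a i * b j) (\<lambda>(i, j). stable_prod_pos (Xs i) (Ys j)) W"
  using assms unfolding is_stable_prod_def by blast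
 obtain HX where HX: "\<And>i. i \<in> {..<p} ==> codim (Xs i) = codim X" "arrg HX" "adapted X HX"
  "\<And>i. i \<in> {..<p} ==> adapted (Xs i) HX"
  "\<And>H x. arrg H ==> HX \<subseteq> H ==> wgt X H x = (\<Sum>i<p. a i * wgt (Xs i) H x)"
  by (rule lin_comb_weight[OF lX finite_lessThan]) (rule that; simp)
 obtain HY where HY: "\<And>j. j \<in> {..<q} ==> codim (Ys j) = codim Y" "arrg HY" "adapted Y HY"
  "\<And>j. j \<in> {..<q} ==> adapted (Ys j) HY"
  "\<And>H x. arrg H ==> HY \<subseteq> H ==> wgt Y H x = (\<Sum>j<q. b j * wgt (Ys j) H x)"
  by (rule lin_comb_weight[OF lY finite_lessThan]) (rule that; simp)
 obtain HW where tW: "tropical_cycle W" and HW: "arrg HW" "adapted W HW"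
  "\<And>H x. arrg H ==> HW \<subseteq> H ==> wgt W H x =
   (\<Sum>p\<in>{..<p} \<times> {..<q}. (case p of (i, j) => a i * b j) * wgt (case p of (i, j) => stable_prod_pos (Xs i) (Ys j)) H x)"
  by (rule lin_comb_weight[OF lW finite_cartesian_product[OF finite_lessThan finite_lessThan]]) (rule that; simp)
 let ?H = "HX \<union> HY \<union> HW"
 have arr: "arrg ?H" by (intro arrg_Un HX HY HW)
 show thesis
 proof (rule that[OF tW cW arr])
  show "adapted X ?H" "adapted Y ?H" "adapted W ?H"
   using adapted_mono[OF HX(3) _ arr] adapted_mono[OF HY(3) _ arr] adapted_mono[OF HW(2) _ arr] by blast+
  fix H assume h: "arrg H" "?H \<subseteq> H"
  have aXs: "adapted (Xs i) H" if "i < p" for i using adapted_mono[OF HX(4) _ h(1)] that h by blast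
  have aYs: "adapted (Ys j) H" if "j < q" for j using adapted_mono[OF HY(4) _ h(1)] that h by blast
  let ?x = "\<lambda>i x. real_of_rat (wgt (Xs i) H x)" and ?y = "\<lambda>j x. real_of_rat (wgt (Ys j) H x)"
  have bX: "bal_weight H (codim X) (?x i)" if "i \<in> {..<p}" for i
   using tropical_weight[OF _ aXs, of i] pX[of i] HX(1)[OF that] that by (simp add: positive_cycle_def)
  have bY: "bal_weight H (codim Y) (?y j)" if "j \<in> {..<q}" for j
   using tropical_weight[OF _ aYs, of j] pY[of j] HY(1)[OF that] that by (simp add: positive_cycle_def)
  have wX: "real_of_rat (wgt X H x) = (\<Sum>i<p. of_rat (a i) * ?x i x)" for x
   using HX(5)[OF h(1)] h(2) by (simp add: of_rat_sum of_rat_mult)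
  have wY: "real_of_rat (wgt Y H x) = (\<Sum>j<q. of_rat (b j) * ?y j x)" for x
   using HY(5)[OF h(1)] h(2) by (simp add: of_rat_sum of_rat_mult)
  show "(\<lambda>x. real_of_rat (wgt W H x)) =
   prod_weight H (codim X) (codim Y) (\<lambda>x. of_rat (wgt X H x)) (\<lambda>x. of_rat (wgt Y H x))"
  proof
   fix x
   have "real_of_rat (wgt W H x) =
    (\<Sum>(i, j)\<in>{..<p} \<times> {..<q}. of_rat (a i) * of_rat (b j) * of_rat (wgt (stable_prod_pos (Xs i) (Ys j)) H x))"
    using HW(3)[OF h(1)] h(2) by (simp add: of_rat_sum of_rat_mult case_prod_unfold)
   also have "\<dots> = (\<Sum>(i, j)\<in>{..<p} \<times> {..<q}. of_rat (a i) * of_rat (b j) * prod_weight H (codim X) (codim Y) (?x i) (?y j) x)"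
   proof (rule sum.cong[OF refl], clarify)
    fix i j assume ij: "i < p" "j < q"
    show "of_rat (a i) * of_rat (b j) * of_rat (wgt (stable_prod_pos (Xs i) (Ys j)) H x) =
     of_rat (a i) * of_rat (b j) * prod_weight H (codim X) (codim Y) (?x i) (?y j) x"
     using stable_prod_pos_weight(3)[OF pX[OF ij(1)] pY[OF ij(2)] aXs[OF ij(1)] aYs[OF ij(2)]] HX(1) HY(1) ij by simp
   qed
   also have "\<dots> = prod_weight H (codim X) (codim Y) (\<lambda>x. \<Sum>i<p. of_rat (a i) * ?x i x) (\<lambda>x. \<Sum>j<q. of_rat (b j) * ?y j x) x"
    by (rule prod_weight_bilinear[symmetric, OF h(1) _ _ bX bY]) auto
   finally show "real_of_rat (wgt W H x) =
    prod_weight H (codim X) (codim Y) (\<lambda>x. of_rat (wgt X H x)) (\<lambda>x. of_rat (wgt Y H x)) x"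
    by (simp only: wX wY)
  qed
 qed
qed

lemma stable_prod:
 assumes "tropical_cycle X" "tropical_cycle Y"
 shows "is_stable_prod X Y (X \<odot> Y)"
 unfolding stable_prod_def by (rule someI_ex[OF ex_stable_prod[OF assms]])

theorem theorem2p14:
  fixes X Y Z :: "(real ^ 'n) weighted_complex"
  assumes "tropical_cycle X" and "tropical_cycle Y" and "tropical_cycle Z"
  shows "(X \<odot> Y) \<odot> Z \<approx> X \<odot> (Y \<odot> Z)"
proof -
 obtain H1 where 1: "tropical_cycle (X \<odot> Y)" "codim (X \<odot> Y) = codim X + codim Y" "arrg H1"
  "adapted X H1" "adapted Y H1"
  "\<And>H. arrg H ==> H1 \<subseteq> H ==> (\<lambda>x. real_of_rat (wgt (X \<odot> Y) H x)) =
   prod_weight H (codim X) (codim Y) (\<lambda>x. of_rat (wgt X H x)) (\<lambda>x. of_rat (wgt Y H x))"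
  by (rule is_stable_prod_weight[OF stable_prod[OF assms(1,2)]]) (rule that; simp)
 obtain H2 where 2: "tropical_cycle (Y \<odot> Z)" "codim (Y \<odot> Z) = codim Y + codim Z" "arrg H2"
  "adapted Z H2"
  "\<And>H. arrg H ==> H2 \<subseteq> H ==> (\<lambda>x. real_of_rat (wgt (Y \<odot> Z) H x)) =
   prod_weight H (codim Y) (codim Z) (\<lambda>x. of_rat (wgt Y H x)) (\<lambda>x. of_rat (wgt Z H x))"
  by (rule is_stable_prod_weight[OF stable_prod[OF assms(2,3)]]) (rule that; simp)
 let ?L = "(X \<odot> Y) \<odot> Z" and ?R = "X \<odot> (Y \<odot> Z)"
 obtain H3 where 3: "tropical_cycle ?L" "codim ?L = codim (X \<odot> Y) + codim Z" "arrg H3"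
  "adapted ?L H3"
  "\<And>H. arrg H ==> H3 \<subseteq> H ==> (\<lambda>x. real_of_rat (wgt ?L H x)) =
   prod_weight H (codim (X \<odot> Y)) (codim Z) (\<lambda>x. of_rat (wgt (X \<odot> Y) H x)) (\<lambda>x. of_rat (wgt Z H x))"
  by (rule is_stable_prod_weight[OF stable_prod[OF 1(1) assms(3)]]) (rule that; simp)
 obtain H4 where 4: "tropical_cycle ?R" "codim ?R = codim X + codim (Y \<odot> Z)" "arrg H4"
  "adapted ?R H4"
  "\<And>H. arrg H ==> H4 \<subseteq> H ==> (\<lambda>x. real_of_rat (wgt ?R H x)) =
   prod_weight H (codim X) (codim (Y \<odot> Z)) (\<lambda>x. of_rat (wgt X H x)) (\<lambda>x. of_rat (wgt (Y \<odot> Z) H x))"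
  by (rule is_stable_prod_weight[OF stable_prod[OF assms(1) 2(1)]]) (rule that; simp)
 \<comment> \<open>One arrangement for all four products: each weight formula holds on every
   arrangement containing the one supplied with it, and adaptedness is inherited.\<close>
 define H where "H = H1 \<union> H2 \<union> H3 \<union> H4"
 have arr: "arrg H" unfolding H_def by (intro arrg_Un 1 2 3 4)
 have sub: "H1 \<subseteq> H" "H2 \<subseteq> H" "H3 \<subseteq> H" "H4 \<subseteq> H" by (auto simp: H_def)
 note b = tropical_weight[OF assms(1) adapted_mono[OF 1(4) sub(1) arr]]
  tropical_weight[OF assms(2) adapted_mono[OF 1(5) sub(1) arr]]
  tropical_weight[OF assms(3) adapted_mono[OF 2(4) sub(2) arr]]
 have "(\<lambda>x. real_of_rat (wgt ?L H x)) = (\<lambda>x. real_of_rat (wgt ?R H x))"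
  unfolding 3(5)[OF arr sub(3)] 4(5)[OF arr sub(4)] 1(6)[OF arr sub(1)] 2(5)[OF arr sub(2)] 1(2) 2(2)
  by (rule prod_weight_assoc[OF b])
 then have "wgt ?L H = wgt ?R H" by (simp add: fun_eq_iff)
 moreover have "codim ?L = codim ?R" using 1(2) 2(2) 3(2) 4(2) by simp
 ultimately show ?thesis
  unfolding cycle_eq_iff[OF adapted_mono[OF 3(4) sub(3) arr] adapted_mono[OF 4(4) sub(4) arr]]
  using 3(1) 4(1) by blast
qed

end
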